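(* Suppose that $1\le p,q,r_1,r_2\le\infty$ satisfy $$q\le p',\qquad \max\{r_1,r_2,r_1',r_2'\}\le p .$$ Let $a\in W(\mathcal{F}L^p,L^q)(\mathbb{R}^{2d})$. Then for every $\tau\in(0,1)$ the $\tau$-pseudodifferential operator $\operatorname{Op}_\tau(a)$ is a bounded operator on $M^{r_1,r_2}(\mathbb{R}^d)$. Moreover, there exists a constant $C>0$ independent of $\tau$ (and of $a$ and $f$) such that $$\|\operatorname{Op}_\tau(a)f\|_{M^{r_1,r_2}}\le C\,\alpha_{(r_1,r_2)}(\tau)\,\|a\|_{W(\mathcal{F}L^p,L^q)}\,\|f\|_{M^{r_1,r_2}},\qquad \tau\in(0,1),\ f\in M^{r_1,r_2}(\mathbb{R}^d),$$ where $$\alpha_{(r_1,r_2)}(\tau)=\frac{1}{\tau^{d\left(\frac1{r_1'}+\frac1{r_2}\right)}(1-\tau)^{d\left(\frac1{r_1}+\frac1{r_2'}\right)}},\qquad \tau\in(0,1).$$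
   Context: $p'$ denotes the conjugate exponent of $p\in[1,\infty]$: $1/p+1/p'=1$. $\langle\cdot,\cdot\rangle$ is the $L^2$ inner product or the duality pairing between $\mathcal{S}'$ and $\mathcal{S}$ (antilinear in the second argument), extended where possible to dual pairs of function spaces. Short-time Fourier transform on $\mathbb{R}^n$ ($n=d$ or $2d$): for a nonzero $g\in\mathcal{S}(\mathbb{R}^n)$ and $f\in\mathcal{S}'(\mathbb{R}^n)$, $V_gf(x,\xi)=\langle f,M_\xi T_xg\rangle=\int_{\mathbb{R}^n}f(t)\overline{g(t-x)}e^{-2\pi i t\xi}\,dt$, where $T_xg(t)=g(t-x)$, $M_\xi g(t)=e^{2\pi i\xi t}g(t)$, $x,\xi\in\mathbb{R}^n$. Modulation space $M^{p,q}(\mathbb{R}^n)$: all $f\in\mathcal{S}'(\mathbb{R}^n)$ with $\|f\|_{M^{p,q}}=\big(\int(\int|V_gf(x,\xi)|^p\,dx)^{q/p}d\xi\big)^{1/q}<\infty$. Wiener amalgam space $W(\mathcal{F}L^p,L^q)(\mathbb{R}^n)$: all $f\in\mathcal{S}'(\mathbb{R}^n)$ with $\|f\|_{W(\mathcal{F}L^p,L^q)}=\big(\int(\int|V_gf(x,\xi)|^p\,d\xi)^{q/p}dx\big)^{1/q}<\infty$. Usual sup modifications if $p$ or $q$ is $\infty$; a window $g$ is fixed, and different windows give equivalent norms. For $\tau\in[0,1]$ the (cross-)$\tau$-Wigner distribution is $W_\tau(f,g)(x,\xi)=\int_{\mathbb{R}^d}e^{-2\pi it\xi}f(x+\tau t)\overline{g(x-(1-\tau)t)}\,dt$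 (extended to tempered distributions in the usual way). For $a\in\mathcal{S}'(\mathbb{R}^{2d})$ the $\tau$-pseudodifferential operator with symbol $a$ is defined by $\langle\operatorname{Op}_\tau(a)f,g\rangle=\langle a,W_\tau(g,f)\rangle$, $f,g\in\mathcal{S}(\mathbb{R}^d)$; formally $\operatorname{Op}_\tau(a)f(x)=\iint e^{2\pi i(x-y)\xi}a((1-\tau)x+\tau y,\xi)f(y)\,dy\,d\xi$. The same duality formula defines $\operatorname{Op}_\tau(a)f$ for $f$ in a modulation space $M^{r_1,r_2}(\mathbb{R}^d)$, tested against $g\in M^{r_1',r_2'}(\mathbb{R}^d)$. *)

theory Defs
  imports "HOL-Analysis.Analysis" "HOL-Probability.Essential_Supremum"
begin

section \<open>Schwartz functions and tempered distributions\<close>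

text \<open>The iterated partial derivative of \<open>f\<close> along the directions in the list, the head
  being applied last.\<close>

fun iter_deriv :: "'a::euclidean_space list \<Rightarrow> ('a \<Rightarrow> complex) \<Rightarrow> 'a \<Rightarrow> complex" where
  "iter_deriv [] f = f"
| "iter_deriv (b # bs) f = (\<lambda>x. frechet_derivative (iter_deriv bs f) (at x) b)"

definition schwartz :: "('a::euclidean_space \<Rightarrow> complex) \<Rightarrow> bool" where
  "schwartz f \<longleftrightarrow> (\<forall>bs. set bs \<subseteq> Basis \<longrightarrow>
     iter_deriv bs f differentiable_on UNIV \<and>
     (\<forall>k. bounded (range (\<lambda>x. norm x ^ k *\<^sub>R iter_deriv bs f x))))"

definition schwartz_seminorm ::
    "nat \<Rightarrow> 'a::euclidean_space list \<Rightarrow> ('a \<Rightarrow> complex) \<Rightarrow> real" where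
  "schwartz_seminorm k bs f = (SUP x. norm x ^ k * norm (iter_deriv bs f x))"

text \<open>A tempered distribution \<open>u\<close> is represented by the map \<open>\<phi> \<mapsto> \<langle>u, \<phi>\<rangle>\<close>, which is
  \<^emph>\<open>antilinear\<close> because the pairing is antilinear in its second argument.  Only the values on
  Schwartz functions matter: \<open>u\<close> and \<open>v\<close> are the same distribution iff they agree there.\<close>

type_synonym 'a distribution = "('a \<Rightarrow> complex) \<Rightarrow> complex"

definition tempered :: "'a::euclidean_space distribution \<Rightarrow> bool" where
  "tempered u \<longleftrightarrow>
     (\<forall>\<phi> \<psi>. schwartz \<phi> \<longrightarrow> schwartz \<psi> \<longrightarrow> u (\<lambda>x. \<phi> x + \<psi> x) = u \<phi> + u \<psi>) \<and>
     (\<forall>c \<phi>. schwartz \<phi> \<longrightarrow> u (\<lambda>x. c * \<phi> x) = cnj c * u \<phi>) \<and>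
     (\<exists>C N. \<forall>\<phi>. schwartz \<phi> \<longrightarrow>
        norm (u \<phi>) \<le> C * (\<Sum>k\<le>N. \<Sum>bs | set bs \<subseteq> Basis \<and> length bs \<le> N. schwartz_seminorm k bs \<phi>))"

definition dist_of_fun :: "('a::euclidean_space \<Rightarrow> complex) \<Rightarrow> 'a distribution" where
  "dist_of_fun f = (\<lambda>\<phi>. \<integral>x. f x * cnj (\<phi> x) \<partial>lborel)"


section \<open>Modulation and Wiener amalgam spaces\<close>

text \<open>\<open>V\<^sub>g u (x, \<xi>) = \<langle>u, M\<^sub>\<xi> T\<^sub>x g\<rangle>\<close>\<close>

definition stft ::
    "('a::euclidean_space \<Rightarrow> complex) \<Rightarrow> 'a distribution \<Rightarrow> 'a \<Rightarrow> 'a \<Rightarrow> complex" where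
  "stft g u x \<xi> = u (\<lambda>t. cis (2 * pi * (\<xi> \<bullet> t)) * g (t - x))"

definition ennreal_powr :: "ennreal \<Rightarrow> real \<Rightarrow> ennreal" where
  "ennreal_powr x s = (if x = \<infinity> then \<infinity> else ennreal (enn2real x powr s))"

definition Lp_norm :: "ennreal \<Rightarrow> ('a::euclidean_space \<Rightarrow> ennreal) \<Rightarrow> ennreal" where
  "Lp_norm p h =
     (if p = \<infinity> then esssup lborel h
      else ennreal_powr (\<integral>\<^sup>+x. ennreal_powr (h x) (enn2real p) \<partial>lborel) (1 / enn2real p))"

definition modulation_norm ::
    "('a::euclidean_space \<Rightarrow> complex) \<Rightarrow> ennreal \<Rightarrow> ennreal \<Rightarrow> 'a distribution \<Rightarrow> ennreal" where
  "modulation_norm g p q u = Lp_norm q (\<lambda>\<xi>. Lp_norm p (\<lambda>x. ennreal (norm (stft g u x \<xi>))))"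

definition modulation_space ::
    "('a::euclidean_space \<Rightarrow> complex) \<Rightarrow> ennreal \<Rightarrow> ennreal \<Rightarrow> 'a distribution set" where
  "modulation_space g p q = {u. tempered u \<and> modulation_norm g p q u < \<infinity>}"

text \<open>\<open>W(\<F>L\<^sup>p, L\<^sup>q)\<close>: the order of integration is exchanged.\<close>

definition amalgam_norm ::
    "('a::euclidean_space \<Rightarrow> complex) \<Rightarrow> ennreal \<Rightarrow> ennreal \<Rightarrow> 'a distribution \<Rightarrow> ennreal" where
  "amalgam_norm g p q u = Lp_norm q (\<lambda>x. Lp_norm p (\<lambda>\<xi>. ennreal (norm (stft g u x \<xi>))))"

definition amalgam_space ::
    "('a::euclidean_space \<Rightarrow> complex) \<Rightarrow> ennreal \<Rightarrow> ennreal \<Rightarrow> 'a distribution set" where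
  "amalgam_space g p q = {u. tempered u \<and> amalgam_norm g p q u < \<infinity>}"

text \<open>Since \<open>inverse 0 = \<infinity>\<close> and \<open>inverse \<infinity> = 0\<close> in \<open>ennreal\<close>, this also covers the
  endpoints \<open>1' = \<infinity>\<close> and \<open>\<infinity>' = 1\<close>.\<close>

definition conj_exp :: "ennreal \<Rightarrow> ennreal" where
  "conj_exp p = inverse (1 - inverse p)"

lemma inverse_add_inverse_conj_exp:
  assumes "1 \<le> p"
  shows "inverse p + inverse (conj_exp p) = 1"
proof (cases p)
  case (real r)
  then have r: "1 \<le> r" using assms by simp
  have p: "inverse p = ennreal (inverse r)" using real r by (simp add: inverse_ennreal)
  have m: "1 - inverse p = ennreal (1 - inverse r)"
    unfolding p ennreal_1[symmetric] using r by (intro ennreal_minus) simp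
  have "inverse (conj_exp p) = ennreal (1 - inverse r)"
  proof (cases "r = 1")
    case True
    then show ?thesis unfolding conj_exp_def m by simp
  next
    case False
    with r have "inverse r < 1" by (simp add: inverse_less_1_iff)
    then show ?thesis unfolding conj_exp_def m by (simp add: inverse_ennreal)
  qed
  moreover have "inverse r \<le> 1" using r by (simp add: inverse_le_1_iff)
  ultimately show ?thesis
    unfolding p using r by (simp add: ennreal_plus[symmetric] del: ennreal_plus)
next
  case top
  then show ?thesis by (simp add: conj_exp_def)
qed


section \<open>The duality pairing between dual pairs of function spaces\<close>

text \<open>The pairing of \<open>\<S>'\<close> and \<open>\<S>\<close> is extended to pairs of distributions, such as
  \<open>M\<^sup>p\<^sup>,\<^sup>q\<close> and \<open>M\<^sup>p\<^sup>'\<^sup>,\<^sup>q\<^sup>'\<close>, or \<open>W(\<F>L\<^sup>p, L\<^sup>q)\<close> and \<open>W(\<F>L\<^sup>p\<^sup>', L\<^sup>q\<^sup>')\<close>, in the usual way: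
  \<open>\<langle>u, v\<rangle> = \<integral>\<integral> V\<^sub>\<phi> u (x, \<xi>) cnj (V\<^sub>\<phi> v (x, \<xi>)) dx d\<xi>\<close> with \<open>\<parallel>\<phi>\<parallel>\<^sub>2 = 1\<close>, whenever the integral
  converges absolutely.\<close>

definition gauss :: "'a::euclidean_space \<Rightarrow> complex" where
  "gauss x = of_real (2 powr (real DIM('a) / 4) * exp (- pi * (norm x)\<^sup>2))"

definition has_pairing ::
    "'a::euclidean_space distribution \<Rightarrow> 'a distribution \<Rightarrow> bool" where
  "has_pairing u v \<longleftrightarrow>
     integrable lborel (\<lambda>(x, \<xi>). stft gauss u x \<xi> * cnj (stft gauss v x \<xi>))"

definition pairing ::
    "'a::euclidean_space distribution \<Rightarrow> 'a distribution \<Rightarrow> complex" where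
  "pairing u v = (\<integral>(x, \<xi>). stft gauss u x \<xi> * cnj (stft gauss v x \<xi>) \<partial>lborel)"


section \<open>Wigner distributions and pseudodifferential operators\<close>

definition wigner ::
    "real \<Rightarrow> ('a::euclidean_space \<Rightarrow> complex) \<Rightarrow> ('a \<Rightarrow> complex) \<Rightarrow> 'a \<times> 'a \<Rightarrow> complex" where
  "wigner \<tau> f g = (\<lambda>(x, \<xi>).
     \<integral>t. cis (- 2 * pi * (t \<bullet> \<xi>)) * f (x + \<tau> *\<^sub>R t) * cnj (g (x - (1 - \<tau>) *\<^sub>R t)) \<partial>lborel)"

text \<open>For functions, substituting \<open>u = x + \<tau>t\<close>, \<open>v = x - (1 - \<tau>)t\<close> gives
  \<open>\<langle>W\<^sub>\<tau>(f, g), \<Psi>\<rangle> = \<integral>\<integral> f(u) cnj (g(v)) cnj (\<Theta>(u, v)) dv du\<close> with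
  \<open>\<Theta>(u, v) = \<integral> e\<^bsup>2\<pi>i(u - v)\<xi>\<^esup> \<Psi>((1 - \<tau>)u + \<tau>v, \<xi>) d\<xi>\<close>.  So \<open>W\<^sub>\<tau>(f, g)\<close> acts on \<open>\<Psi>\<close> as the tensor
  product \<open>f \<otimes> cnj g\<close> acts on \<open>\<Theta>\<close>, that is, as \<open>u \<mapsto> \<langle>g, cnj (\<Theta>(u, \<cdot>))\<rangle>\<close> followed by \<open>f\<close>.\<close>

definition wigner_kernel ::
    "real \<Rightarrow> ('a::euclidean_space \<times> 'a \<Rightarrow> complex) \<Rightarrow> 'a \<Rightarrow> 'a \<Rightarrow> complex" where
  "wigner_kernel \<tau> \<Psi> u v =
     (\<integral>\<xi>. cis (2 * pi * ((u - v) \<bullet> \<xi>)) * \<Psi> ((1 - \<tau>) *\<^sub>R u + \<tau> *\<^sub>R v, \<xi>) \<partial>lborel)"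

definition wigner_dist ::
    "real \<Rightarrow> 'a::euclidean_space distribution \<Rightarrow> 'a distribution \<Rightarrow> ('a \<times> 'a) distribution" where
  "wigner_dist \<tau> f g = (\<lambda>\<Psi>. f (\<lambda>u. g (\<lambda>v. cnj (wigner_kernel \<tau> \<Psi> u v))))"

text \<open>For Schwartz \<open>g\<close>: \<open>\<langle>Op\<^sub>\<tau>(a) f, g\<rangle> = \<langle>a, W\<^sub>\<tau>(g, f)\<rangle>\<close>, with the extended pairing on the right.\<close>

definition op_tau ::
    "real \<Rightarrow> ('a::euclidean_space \<times> 'a) distribution \<Rightarrow> 'a distribution \<Rightarrow> 'a distribution" where
  "op_tau \<tau> a f = (\<lambda>g. pairing a (wigner_dist \<tau> (dist_of_fun g) f))"

definition alpha :: "nat \<Rightarrow> ennreal \<Rightarrow> ennreal \<Rightarrow> real \<Rightarrow> real" where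
  "alpha d r1 r2 \<tau> =
     1 / (\<tau> powr (real d * (enn2real (inverse (conj_exp r1)) + enn2real (inverse r2)))
        * (1 - \<tau>) powr (real d * (enn2real (inverse r1) + enn2real (inverse (conj_exp r2)))))"

end

theory Submission
  imports Defs "HOL-Probability.Probability"
begin

text \<open>Write \<open>V u\<close> for the short-time Fourier transform of \<open>u\<close> with Gaussian window.  Expanding the kernel of
  \<open>W\<^sub>\<tau>(g, f)\<close> into time-frequency shifts by Fourier inversion shows that \<open>V (W\<^sub>\<tau>(g, f))\<close> at \<open>w\<close> is a
  superposition of the products \<open>V g z * cnj (V f y)\<close>, with weights that decay rapidly, uniformly in
  \<open>\<tau>\<close>, in the distance of \<open>w\<close> from a point \<open>M\<^sub>\<tau>(z, y)\<close> depending linearly on \<open>(z, y)\<close>.  Pairing with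
  \<open>a\<close> gives \<open>\<bar>\<langle>Op\<^sub>\<tau>(a) f, g\<rangle>\<bar> \<le> \<integral>\<integral> \<bar>V g z\<bar> B (M\<^sub>\<tau>(z, y)) \<bar>V f y\<bar> dy dz\<close>, where \<open>B\<close> is \<open>\<bar>V a\<bar>\<close> smeared out
  by a rapidly decaying kernel; Young's inequality bounds \<open>B\<close> in \<open>L\<^sup>p\<^sup>'(L\<^sup>p)\<close> because \<open>q \<le> p'\<close>.

  In each of the two blocks of variables \<open>B (M\<^sub>\<tau>(z, y))\<close> has the form \<open>b ((1 - \<tau>) z + \<tau> y, y - z)\<close>.  Hoelder's
  inequality with four factors bounds the integral operator with this kernel on \<open>L\<^sup>r\<close> for
  \<open>max {r, r'} \<le> p\<close>, and the Jacobians of the substitutions are the powers of \<open>\<tau>\<close> and \<open>1 - \<tau>\<close> in the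
  statement.  Minkowski's inequality combines the two blocks.\<close>

text \<open>A distribution is known only through its values on Schwartz functions, so the expansion
  of the Wigner kernel has to be carried through \<open>f\<close> and \<open>g\<close> as
  functionals. This requires exchanging a tempered distribution with an integral of Schwartz
  functions depending on a parameter; the first half of the development supplies that exchange. The
  Gaussian window is chosen because the Wigner kernel of a shifted Gaussian is a time-frequency
  shift of a Gaussian in linear coordinates whose determinant has absolute value 1 for every \<tau>,
  so no constant depends on \<tau> up to that point. The dependence on \<tau> comes from holding one
  variable fixed in \<open>(1 - \<tau>) z + \<tau> y\<close>. The position block yields
  \<open>\<tau>\<close> to the power \<open>-d/r1'\<close> and \<open>1 - \<tau>\<close> to the
  power \<open>-d/r1\<close>; in the frequency block \<tau> and \<open>1 - \<tau>\<close> trade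
  places, with \<open>r2\<close> for \<open>r1\<close>, and the product is \<open>alpha\<close>. The
  hypothesis on \<open>r1\<close> and \<open>r2\<close> forces \<open>p \<ge> 2\<close>, hence
  \<open>p' \<le> p\<close>, the direction in which Minkowski's inequality exchanges the norms of
  the two blocks.\<close>

abbreviation borel_fun :: "('a::topological_space \<Rightarrow> 'b::topological_space) \<Rightarrow> bool" where
  "borel_fun f \<equiv> f \<in> borel_measurable borel"

section \<open>Families of Schwartz functions with a parameter of polynomial growth\<close>

lemma power_one_plus_le:
  fixes s :: real
  assumes "0 \<le> s"
  shows "(1 + s) ^ k \<le> 2 ^ k * (1 + s ^ k)"
proof -
  have "(1 + s) ^ k \<le> (2 * max 1 s) ^ k" using assms by (intro power_mono) auto
  also have "\<dots> = 2 ^ k * (max 1 s) ^ k" by (simp add: power_mult_distrib)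
  also have "(max 1 s) ^ k \<le> 1 + s ^ k" using assms by (cases "s \<le> 1") (auto simp: max_def)
  finally show ?thesis by simp
qed

lemma one_plus_norm_add_le:
  fixes x y :: "'a::real_normed_vector"
  shows "1 + norm (x + y) \<le> (1 + norm x) * (1 + norm y)"
proof -
  have "norm (x + y) \<le> norm x + norm y" by (rule norm_triangle_ineq)
  moreover have "0 \<le> norm x * norm y" by simp
  moreover have "(1 + norm x) * (1 + norm y) = 1 + norm x + norm y + norm x * norm y"
    by (simp add: algebra_simps)
  ultimately show ?thesis by linarith
qed

lemma poly_bound_mono:
  fixes s :: real
  assumes "a \<le> C * (1 + s) ^ m" "C \<le> C'" "0 \<le> C'" "m \<le> m'" "0 \<le> s"
  shows "a \<le> C' * (1 + s) ^ m'"
proof -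
  have "C * (1 + s) ^ m \<le> C' * (1 + s) ^ m" using assms by (intro mult_right_mono) auto
  also have "\<dots> \<le> C' * (1 + s) ^ m'" using assms by (intro mult_left_mono power_increasing) auto
  finally show ?thesis using assms(1) by simp
qed

lemma iter_deriv_append: "iter_deriv (bs @ cs) f = iter_deriv bs (iter_deriv cs f)"
  by (induction bs) auto

definition poly_bounded :: "('z::real_normed_vector \<Rightarrow> 'b::real_normed_vector) \<Rightarrow> bool" where
  "poly_bounded c \<longleftrightarrow> continuous_on UNIV c \<and> (\<exists>C m. \<forall>z. norm (c z) \<le> C * (1 + norm z) ^ m)"

text \<open>The parameter \<open>z\<close> ranges over phase space or over \<tau>, and the bounds
  may grow polynomially in it, which is what a rapidly decreasing weight can absorb under an
  integral. Joint continuity supplies measurability in \<open>z\<close> and the local uniformity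
  behind continuity of \<open>u (K z)\<close>.\<close>

definition rapid_family :: "('z::euclidean_space \<Rightarrow> 'a::euclidean_space \<Rightarrow> complex) \<Rightarrow> bool" where
  "rapid_family K \<longleftrightarrow> (\<forall>z t. K z differentiable (at t)) \<and> continuous_on UNIV (\<lambda>(z, t). K z t) \<and>
     (\<forall>k. \<exists>C m. \<forall>z t. norm t ^ k * norm (K z t) \<le> C * (1 + norm z) ^ m)"

text \<open>Derivatives are taken in \<open>t\<close> only; in the parameter nothing beyond
  continuity is asked.\<close>

definition schwartz_family :: "('z::euclidean_space \<Rightarrow> 'a::euclidean_space \<Rightarrow> complex) \<Rightarrow> bool" where
  "schwartz_family K \<longleftrightarrow> (\<forall>bs. set bs \<subseteq> Basis \<longrightarrow> rapid_family (\<lambda>z. iter_deriv bs (K z)))"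

lemma rapid_family_add:
  assumes "rapid_family K" "rapid_family H"
  shows "rapid_family (\<lambda>z t. K z t + H z t)"
  unfolding rapid_family_def
proof (intro conjI allI)
  show "(\<lambda>t. K z t + H z t) differentiable at t" for z t
    using assms by (intro differentiable_add) (auto simp: rapid_family_def)
  show "continuous_on UNIV (\<lambda>(z, t). K z t + H z t)"
    using assms by (auto simp: rapid_family_def split_beta intro!: continuous_on_add)
  fix k
  obtain C m where 1: "\<And>z t. norm t ^ k * norm (K z t) \<le> C * (1 + norm z) ^ m"
    using assms(1) unfolding rapid_family_def by meson
  obtain D n where 2: "\<And>z t. norm t ^ k * norm (H z t) \<le> D * (1 + norm z) ^ n"
    using assms(2) unfolding rapid_family_def by meson
  show "\<exists>C m. \<forall>z t. norm t ^ k * norm (K z t + H z t) \<le> C * (1 + norm z) ^ m"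
  proof (intro exI allI)
    fix z t
    have "norm t ^ k * norm (K z t + H z t) \<le> norm t ^ k * norm (K z t) + norm t ^ k * norm (H z t)"
      by (metis norm_triangle_ineq distrib_left mult_left_mono norm_ge_zero zero_le_power)
    also have "\<dots> \<le> \<bar>C\<bar> * (1 + norm z) ^ (m + n) + \<bar>D\<bar> * (1 + norm z) ^ (m + n)"
      by (intro add_mono poly_bound_mono[OF 1] poly_bound_mono[OF 2]) auto
    finally show "norm t ^ k * norm (K z t + H z t) \<le> (\<bar>C\<bar> + \<bar>D\<bar>) * (1 + norm z) ^ (m + n)"
      by (simp add: distrib_right)
  qed
qed

lemma rapid_family_scale:
  assumes "poly_bounded c" "rapid_family K"
  shows "rapid_family (\<lambda>z t. c z * K z t)"
  unfolding rapid_family_def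
proof (intro conjI allI)
  show "(\<lambda>t. c z * K z t) differentiable at t" for z t
    using assms by (intro differentiable_mult) (auto simp: rapid_family_def)
  have "continuous_on UNIV (\<lambda>x. c (fst x))"
    using assms(1) unfolding poly_bounded_def
    by (intro continuous_on_compose2[of UNIV c UNIV fst]) (auto intro: continuous_intros)
  then show "continuous_on UNIV (\<lambda>(z, t). c z * K z t)"
    using assms by (auto simp: rapid_family_def split_beta intro!: continuous_on_mult)
  fix k
  obtain C m where 1: "\<And>z t. norm t ^ k * norm (K z t) \<le> C * (1 + norm z) ^ m"
    using assms(2) unfolding rapid_family_def by meson
  obtain D n where 2: "\<And>z. norm (c z) \<le> D * (1 + norm z) ^ n"
    using assms(1) unfolding poly_bounded_def by meson
  show "\<exists>C m. \<forall>z t. norm t ^ k * norm (c z * K z t) \<le> C * (1 + norm z) ^ m"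
  proof (intro exI allI)
    fix z t
    have "norm t ^ k * norm (c z * K z t) = norm (c z) * (norm t ^ k * norm (K z t))"
      by (simp add: norm_mult)
    also have "\<dots> \<le> (D * (1 + norm z) ^ n) * (C * (1 + norm z) ^ m)"
      by (intro mult_mono 1 2 order_trans[OF norm_ge_zero 2]) auto
    finally show "norm t ^ k * norm (c z * K z t) \<le> (D * C) * (1 + norm z) ^ (n + m)"
      by (simp add: power_add mult_ac)
  qed
qed

text \<open>The module generated by \<open>G\<close> over functions of the parameter. Coefficients
  depend on \<open>z\<close> but not on \<open>t\<close>, so a derivative in \<open>t\<close> passes
  them by, and the frequencies produced by differentiating a modulation stay inside the
  span.\<close>

inductive family_span ::
    "(('z::euclidean_space \<Rightarrow> 'a::euclidean_space \<Rightarrow> complex) \<Rightarrow> bool) \<Rightarrow> ('z \<Rightarrow> 'a \<Rightarrow> complex) \<Rightarrow> bool"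
  for G where
  base: "G K \<Longrightarrow> family_span G K"
| add: "family_span G K \<Longrightarrow> family_span G H \<Longrightarrow> family_span G (\<lambda>z t. K z t + H z t)"
| scale: "poly_bounded c \<Longrightarrow> family_span G K \<Longrightarrow> family_span G (\<lambda>z t. c z * K z t)"

lemma poly_bounded_const [simp]: "poly_bounded (\<lambda>_. c)"
proof -
  have "\<forall>z::'a. norm c \<le> norm c * (1 + norm z) ^ 0" by simp
  then show ?thesis unfolding poly_bounded_def by (metis continuous_on_const)
qed

lemma family_span_sum:
  assumes "finite A" "A \<noteq> {}" "\<And>i. i \<in> A \<Longrightarrow> family_span G (K i)"
  shows "family_span G (\<lambda>z t. \<Sum>i\<in>A. K i z t)"
  using assms by (induction A rule: finite_ne_induct) (auto intro: family_span.add)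

lemma rapid_family_span:
  assumes "family_span G K" "\<And>K. G K \<Longrightarrow> rapid_family K"
  shows "rapid_family K"
  using assms by induction (auto intro: rapid_family_add rapid_family_scale)

lemma family_span_deriv:
  assumes "family_span G K" "\<And>K. G K \<Longrightarrow> rapid_family K" "b \<in> Basis"
    and "\<And>K. G K \<Longrightarrow> family_span G (\<lambda>z t. frechet_derivative (K z) (at t) b)"
  shows "family_span G (\<lambda>z t. frechet_derivative (K z) (at t) b)"
  using assms(1)
proof induction
  case (base K)
  then show ?case using assms(4) by blast
next
  case (add K H)
  have d: "(K z has_derivative frechet_derivative (K z) (at t)) (at t)"
    "(H z has_derivative frechet_derivative (H z) (at t)) (at t)" for z t
    using add.hyps(1,2)[THEN rapid_family_span, OF assms(2)]
    by (auto simp: rapid_family_def frechet_derivative_works)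
  have "frechet_derivative (\<lambda>t. K z t + H z t) (at t) b
     = frechet_derivative (K z) (at t) b + frechet_derivative (H z) (at t) b" for z t
    by (subst frechet_derivative_at[OF has_derivative_add[OF d], symmetric]) simp
  then show ?case using family_span.add[OF add.IH] by simp
next
  case (scale c K)
  have d: "(K z has_derivative frechet_derivative (K z) (at t)) (at t)" for z t
    using scale.hyps(2)[THEN rapid_family_span, OF assms(2)]
    by (auto simp: rapid_family_def frechet_derivative_works)
  have "frechet_derivative (\<lambda>t. c z * K z t) (at t) b = c z * frechet_derivative (K z) (at t) b" for z t
    by (subst frechet_derivative_at[OF has_derivative_mult_right[OF d], symmetric]) simp
  then show ?case using family_span.scale[OF scale.hyps(1) scale.IH] by simp
qed

text \<open>A coinduction principle: the span of a class of families which is closed under partial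
  derivatives consists of families of Schwartz functions.\<close>

lemma schwartz_family_span:
  assumes "\<And>K. G K \<Longrightarrow> rapid_family K"
    and "\<And>K b. G K \<Longrightarrow> b \<in> Basis \<Longrightarrow> family_span G (\<lambda>z t. frechet_derivative (K z) (at t) b)"
    and "family_span G K"
  shows "schwartz_family K"
proof -
  have "family_span G (\<lambda>z. iter_deriv bs (K z))" if "set bs \<subseteq> Basis" for bs
    using that
  proof (induction bs)
    case Nil
    then show ?case using assms(3) by simp
  next
    case (Cons b bs)
    then have "family_span G (\<lambda>z. iter_deriv bs (K z))" "b \<in> Basis" by auto
    show ?case unfolding iter_deriv.simps
    proof (rule family_span_deriv)
      show "family_span G (\<lambda>z. iter_deriv bs (K z))" "b \<in> Basis" by fact+
    qed (fact assms(1), rule assms(2)[OF _ \<open>b \<in> Basis\<close>])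
  qed
  then show ?thesis
    unfolding schwartz_family_def using rapid_family_span assms(1) by blast
qed

lemma schwartz_family_deriv:
  assumes "schwartz_family K" "set cs \<subseteq> Basis"
  shows "schwartz_family (\<lambda>z. iter_deriv cs (K z))"
  using assms unfolding schwartz_family_def by (simp flip: iter_deriv_append)

text \<open>The coinduction principle is applied to the class of all Schwartz families itself, which
  contains its own derivatives.\<close>

lemma schwartz_family_closed:
  assumes "family_span schwartz_family K"
  shows "schwartz_family K"
proof (rule schwartz_family_span[OF _ _ assms])
  fix K :: "'a \<Rightarrow> 'b \<Rightarrow> complex" and b :: 'b
  assume K: "schwartz_family K"
  then show "rapid_family K"
    using K[unfolded schwartz_family_def, rule_format, of "[]"] by simp
  assume "b \<in> Basis"
  then show "family_span schwartz_family (\<lambda>z t. frechet_derivative (K z) (at t) b)"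
    using schwartz_family_deriv[OF K, of "[b]"] by (auto intro: family_span.base)
qed

lemma schwartz_family_add:
  "schwartz_family K \<Longrightarrow> schwartz_family H \<Longrightarrow> schwartz_family (\<lambda>z t. K z t + H z t)"
  by (rule schwartz_family_closed[OF family_span.add[OF family_span.base family_span.base]])

lemma schwartz_family_scale:
  "poly_bounded c \<Longrightarrow> schwartz_family K \<Longrightarrow> schwartz_family (\<lambda>z t. c z * K z t)"
  by (rule schwartz_family_closed[OF family_span.scale[OF _ family_span.base]])

lemma rapid_family_reindex:
  fixes h :: "'y::euclidean_space \<Rightarrow> 'z::euclidean_space"
  assumes "poly_bounded h" "rapid_family K"
  shows "rapid_family (\<lambda>y. K (h y))"
  unfolding rapid_family_def
proof (intro conjI allI)
  show "K (h y) differentiable at t" for y t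
    using assms by (auto simp: rapid_family_def)
  have ch: "continuous_on UNIV h" and cK: "continuous_on UNIV (\<lambda>(z, t). K z t)"
    using assms by (auto simp: poly_bounded_def rapid_family_def)
  have "continuous_on UNIV (\<lambda>x::'y \<times> 'a. (h (fst x), snd x))"
    by (intro continuous_on_Pair continuous_on_compose2[OF ch] continuous_on_fst continuous_on_snd continuous_on_id) auto
  from continuous_on_compose2[OF cK this] show "continuous_on UNIV (\<lambda>(y, t). K (h y) t)"
    by (simp add: split_beta)
  fix k
  obtain C m where 1: "\<And>z t. norm t ^ k * norm (K z t) \<le> C * (1 + norm z) ^ m"
    using assms(2) unfolding rapid_family_def by meson
  obtain D n where 2: "\<And>z. norm (h z) \<le> D * (1 + norm z) ^ n"
    using assms(1) unfolding poly_bounded_def by meson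
  show "\<exists>C m. \<forall>y t. norm t ^ k * norm (K (h y) t) \<le> C * (1 + norm y) ^ m"
  proof (intro exI allI)
    fix y t
    have "1 + norm (h y) \<le> 1 + \<bar>D\<bar> * (1 + norm y) ^ n"
      using poly_bound_mono[OF 2[of y], of "\<bar>D\<bar>" n] by auto
    also have "\<dots> \<le> (1 + \<bar>D\<bar>) * (1 + norm y) ^ n"
      by (simp add: distrib_right)
    finally have h: "(1 + norm (h y)) ^ m \<le> ((1 + \<bar>D\<bar>) * (1 + norm y) ^ n) ^ m"
      by (intro power_mono) auto
    have "norm t ^ k * norm (K (h y) t) \<le> \<bar>C\<bar> * (1 + norm (h y)) ^ m"
      by (rule poly_bound_mono[OF 1]) auto
    also have "\<dots> \<le> \<bar>C\<bar> * ((1 + \<bar>D\<bar>) * (1 + norm y) ^ n) ^ m"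
      using h by (intro mult_left_mono) auto
    finally show "norm t ^ k * norm (K (h y) t) \<le> (\<bar>C\<bar> * (1 + \<bar>D\<bar>) ^ m) * (1 + norm y) ^ (n * m)"
      by (simp add: power_mult_distrib power_mult mult.assoc)
  qed
qed

lemma schwartz_family_reindex:
  fixes h :: "'y::euclidean_space \<Rightarrow> 'z::euclidean_space"
  assumes "poly_bounded h" "schwartz_family K"
  shows "schwartz_family (\<lambda>y. K (h y))"
  using assms rapid_family_reindex[of h "\<lambda>z. iter_deriv bs (K z)" for bs]
  unfolding schwartz_family_def by blast

text \<open>Constant families embed single functions, so that the closure properties of families
  transfer to Schwartz functions. The parameter space is arbitrary and is later fixed as
  \<open>real\<close>.\<close>

lemma schwartz_iff_family:
  fixes f :: "'a::euclidean_space \<Rightarrow> complex"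
  shows "schwartz f \<longleftrightarrow> schwartz_family (\<lambda>_::'z::euclidean_space. f)"
proof -
  have "(iter_deriv bs f differentiable_on UNIV \<and> (\<forall>k. bounded (range (\<lambda>x. norm x ^ k *\<^sub>R iter_deriv bs f x))))
     \<longleftrightarrow> rapid_family (\<lambda>_::'z. iter_deriv bs f)" (is "?l \<longleftrightarrow> ?r") for bs
  proof
    assume l: ?l
    then have "continuous_on UNIV (iter_deriv bs f)" by (simp add: differentiable_imp_continuous_on)
    from continuous_on_compose2[OF this continuous_on_snd[OF continuous_on_id]]
    have "continuous_on UNIV (\<lambda>x::'z\<times>'a. iter_deriv bs f (snd x))" by simp
    moreover have "\<exists>C m. \<forall>(z::'z) t. norm t ^ k * norm (iter_deriv bs f t) \<le> C * (1 + norm z) ^ m" for k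
    proof -
      obtain C where "\<And>x. norm (norm x ^ k *\<^sub>R iter_deriv bs f x) \<le> C"
        using l unfolding bounded_iff by blast
      then have "\<forall>(z::'z) t. norm t ^ k * norm (iter_deriv bs f t) \<le> C * (1 + norm z) ^ 0" by simp
      then show ?thesis by blast
    qed
    ultimately show ?r using l by (auto simp: rapid_family_def differentiable_on_def split_beta)
  next
    assume r: ?r
    then have "bounded (range (\<lambda>x. norm x ^ k *\<^sub>R iter_deriv bs f x))" for k
    proof -
      obtain C m where "\<And>(z::'z) t. norm t ^ k * norm (iter_deriv bs f t) \<le> C * (1 + norm z) ^ m"
        using r unfolding rapid_family_def by meson
      from this[of _ 0] show ?thesis unfolding bounded_iff by (auto intro!: exI[of _ C])
    qed
    then show ?l using r by (auto simp: rapid_family_def differentiable_on_def)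
  qed
  then show ?thesis unfolding schwartz_def schwartz_family_def by blast
qed

lemma schwartz_familyD: "schwartz_family K \<Longrightarrow> schwartz (K z)"
  unfolding schwartz_iff_family[where 'z = real]
  by (rule schwartz_family_reindex[OF poly_bounded_const])

lemma schwartz_add: "schwartz f \<Longrightarrow> schwartz g \<Longrightarrow> schwartz (\<lambda>x. f x + g x)"
  unfolding schwartz_iff_family[where 'z = real] by (rule schwartz_family_add)

lemma schwartz_scale: "schwartz f \<Longrightarrow> schwartz (\<lambda>x. c * f x)"
  unfolding schwartz_iff_family[where 'z = real] by (rule schwartz_family_scale[OF poly_bounded_const])

lemma schwartz_diff:
  assumes "schwartz f" "schwartz g"
  shows "schwartz (\<lambda>x. f x - g x)"
  using schwartz_add[OF assms(1) schwartz_scale[OF assms(2), of "-1"]] by simp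

lemma schwartz_iter_deriv: "schwartz f \<Longrightarrow> set bs \<subseteq> Basis \<Longrightarrow> schwartz (iter_deriv bs f)"
  unfolding schwartz_iff_family[where 'z = real] by (rule schwartz_family_deriv)

lemma schwartz_has_derivative:
  assumes "schwartz f"
  shows "(f has_derivative (\<lambda>h. \<Sum>b\<in>Basis. (h \<bullet> b) *\<^sub>R iter_deriv [b] f x)) (at x)"
proof -
  have "f differentiable (at x)"
    using assms unfolding schwartz_def
    by (metis UNIV_I differentiable_on_eq_differentiable_at empty_set empty_subsetI iter_deriv.simps(1) open_UNIV)
  then have d: "(f has_derivative frechet_derivative f (at x)) (at x)"
    by (simp add: frechet_derivative_works)
  then have l: "linear (frechet_derivative f (at x))" by (rule has_derivative_linear)
  have "frechet_derivative f (at x) = (\<lambda>h. \<Sum>b\<in>Basis. (h \<bullet> b) *\<^sub>R frechet_derivative f (at x) b)"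
  proof
    fix h :: 'a
    have "frechet_derivative f (at x) h = frechet_derivative f (at x) (\<Sum>b\<in>Basis. (h \<bullet> b) *\<^sub>R b)"
      by (simp add: euclidean_representation)
    then show "frechet_derivative f (at x) h = (\<Sum>b\<in>Basis. (h \<bullet> b) *\<^sub>R frechet_derivative f (at x) b)"
      by (simp only: linear_sum[OF l] linear_cmul[OF l])
  qed
  with d show ?thesis by simp
qed

text \<open>The weight \<open>norm t ^ k\<close> gives no control near the origin; adding the bounds
  for the exponents 0 and \<open>k\<close> yields the full weight with one pair of
  constants.\<close>

lemma schwartz_family_bound:
  assumes "schwartz_family K" "set bs \<subseteq> Basis"
  obtains C m where "0 \<le> C"
    "\<And>z t. (1 + norm t) ^ k * norm (iter_deriv bs (K z) t) \<le> C * (1 + norm z) ^ m"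
proof -
  have r: "\<forall>k. \<exists>C m. \<forall>z t. norm t ^ k * norm (iter_deriv bs (K z) t) \<le> C * (1 + norm z) ^ m"
    using assms unfolding schwartz_family_def rapid_family_def by blast
  obtain C m where 1: "\<And>z t. norm t ^ 0 * norm (iter_deriv bs (K z) t) \<le> C * (1 + norm z) ^ m"
    using r by meson
  obtain D n where 2: "\<And>z t. norm t ^ k * norm (iter_deriv bs (K z) t) \<le> D * (1 + norm z) ^ n"
    using r by meson
  show ?thesis
  proof (rule that)
    show "0 \<le> 2 ^ k * (\<bar>C\<bar> + \<bar>D\<bar>)" by simp
    fix z t
    have "(1 + norm t) ^ k * norm (iter_deriv bs (K z) t)
        \<le> 2 ^ k * (1 + norm t ^ k) * norm (iter_deriv bs (K z) t)"
      by (intro mult_right_mono power_one_plus_le) auto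
    also have "\<dots> = 2 ^ k * (norm t ^ 0 * norm (iter_deriv bs (K z) t) + norm t ^ k * norm (iter_deriv bs (K z) t))"
      by (simp add: algebra_simps)
    also have "\<dots> \<le> 2 ^ k * (\<bar>C\<bar> * (1 + norm z) ^ (m + n) + \<bar>D\<bar> * (1 + norm z) ^ (m + n))"
      by (intro mult_left_mono add_mono poly_bound_mono[OF 1] poly_bound_mono[OF 2]) auto
    finally show "(1 + norm t) ^ k * norm (iter_deriv bs (K z) t)
        \<le> 2 ^ k * (\<bar>C\<bar> + \<bar>D\<bar>) * (1 + norm z) ^ (m + n)" by (simp add: algebra_simps)
  qed
qed

lemma schwartz_bound:
  assumes "schwartz f"
  obtains C where "0 \<le> C" "\<And>t. (1 + norm t) ^ k * norm (f t) \<le> C"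
proof -
  obtain C m where "0 \<le> C" "\<And>(z::real) t. (1 + norm t) ^ k * norm (iter_deriv [] f t) \<le> C * (1 + norm z) ^ m"
    using schwartz_family_bound[of "\<lambda>_::real. f" "[]"] assms schwartz_iff_family by (metis empty_set empty_subsetI)
  from this(1) this(2)[of _ 0] show ?thesis using that by simp
qed

lemma schwartz_continuous: "schwartz f \<Longrightarrow> continuous_on A f"
  by (meson continuous_at_imp_continuous_on has_derivative_continuous schwartz_has_derivative)

lemma schwartz_measurable [measurable_dest]: "schwartz f \<Longrightarrow> borel_fun f"
  by (simp add: borel_measurable_continuous_onI schwartz_continuous)

subsection \<open>Time-frequency shifts, Gaussians and linear substitutions\<close>

definition tf_shift :: "('a::euclidean_space \<Rightarrow> complex) \<Rightarrow> 'a \<times> 'a \<Rightarrow> 'a \<Rightarrow> complex" where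
  "tf_shift g w t = cis (2 * pi * (snd w \<bullet> t)) * g (t - fst w)"

lemma stft_eq: "stft g u x \<xi> = u (tf_shift g (x, \<xi>))"
  by (simp add: stft_def tf_shift_def[abs_def])

lemma norm_tf_shift: "norm (tf_shift g w t) = norm (g (t - fst w))"
  by (simp add: tf_shift_def norm_mult)

lemma tf_shift_has_derivative:
  assumes "schwartz g"
  shows "(tf_shift g w has_derivative (\<lambda>h. \<Sum>b\<in>Basis. (h \<bullet> b) *\<^sub>R
     (2 * pi * \<i> * (snd w \<bullet> b) * tf_shift g w t + tf_shift (iter_deriv [b] g) w t))) (at t)"
proof -
  have "((\<lambda>t. cis (2 * pi * (snd w \<bullet> t)) * g (t - fst w)) has_derivative
    (\<lambda>h. cis (2 * pi * (snd w \<bullet> t)) * (\<Sum>b\<in>Basis. ((h - 0) \<bullet> b) *\<^sub>R iter_deriv [b] g (t - fst w))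
     + ((2 * pi * (snd w \<bullet> h)) *\<^sub>R (\<i> * cis (2 * pi * (snd w \<bullet> t)))) * g (t - fst w))) (at t)"
    by (intro has_derivative_mult has_derivative_cis has_derivative_compose[OF _ schwartz_has_derivative[OF assms]]
        derivative_intros)
  moreover have "cis (2 * pi * (snd w \<bullet> t)) * (\<Sum>b\<in>Basis. ((h - 0) \<bullet> b) *\<^sub>R iter_deriv [b] g (t - fst w))
     + ((2 * pi * (snd w \<bullet> h)) *\<^sub>R (\<i> * cis (2 * pi * (snd w \<bullet> t)))) * g (t - fst w)
     = (\<Sum>b\<in>Basis. (h \<bullet> b) *\<^sub>R (2 * pi * \<i> * (snd w \<bullet> b) * tf_shift g w t + tf_shift (iter_deriv [b] g) w t))"
    (is "?l1 + ?l2 = ?r") for h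
  proof -
    have i: "complex_of_real (snd w \<bullet> h) = (\<Sum>b\<in>Basis. of_real (h \<bullet> b) * of_real (snd w \<bullet> b))"
      by (subst euclidean_inner) (simp add: mult_ac)
    have "?l2 = (2 * pi * \<i> * tf_shift g w t) * complex_of_real (snd w \<bullet> h)"
      by (simp add: tf_shift_def scaleR_conv_of_real mult_ac)
    then have "?l1 + ?l2 = (\<Sum>b\<in>Basis. cis (2 * pi * (snd w \<bullet> t)) * ((h \<bullet> b) *\<^sub>R iter_deriv [b] g (t - fst w))
       + (2 * pi * \<i> * tf_shift g w t) * (of_real (h \<bullet> b) * of_real (snd w \<bullet> b)))"
      unfolding i by (simp only: sum.distrib sum_distrib_left diff_zero)
    also have "\<dots> = ?r"
      by (intro sum.cong refl) (simp add: tf_shift_def scaleR_conv_of_real algebra_simps)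
    finally show ?thesis .
  qed
  ultimately show ?thesis unfolding tf_shift_def[abs_def] by simp
qed

lemma poly_bounded_inner:
  fixes b :: "'a::euclidean_space"
  shows "poly_bounded (\<lambda>w::'b::real_normed_vector \<times> 'a. complex_of_real (snd w \<bullet> b))"
proof -
  have "continuous_on UNIV (\<lambda>w::'b \<times> 'a. complex_of_real (snd w \<bullet> b))"
    by (rule continuous_on_of_real[OF continuous_on_inner[OF continuous_on_snd[OF continuous_on_id] continuous_on_const]])
  moreover have "norm (complex_of_real (snd w \<bullet> b)) \<le> norm b * (1 + norm w) ^ 1" for w :: "'b \<times> 'a"
  proof -
    have "\<bar>snd w \<bullet> b\<bar> \<le> norm (snd w) * norm b" by (rule Cauchy_Schwarz_ineq2)
    also have "\<dots> \<le> (1 + norm w) * norm b" using norm_snd_le[of "snd w" "fst w"]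
      by (intro mult_right_mono) auto
    finally show ?thesis by (simp add: mult_ac)
  qed
  ultimately show ?thesis unfolding poly_bounded_def by blast
qed

text \<open>Differentiating \<open>tf_shift g w\<close> gives a multiple of the same shift, with a
  coordinate of the frequency as factor, plus the shift of a derivative of \<open>g\<close>. The
  class of all shifts of Schwartz functions thus has its derivatives in its span. Decay is uniform
  up to polynomial factors in \<open>w\<close> because \<open>1 + norm t\<close> is at most
  \<open>(1 + norm (t - x)) * (1 + norm x)\<close>.\<close>

lemma schwartz_family_tf_shift:
  assumes "schwartz g"
  shows "schwartz_family (tf_shift g)"
proof (rule schwartz_family_span[of "\<lambda>K. \<exists>g. schwartz g \<and> K = tf_shift g"])
  let ?G = "\<lambda>K. \<exists>g::'a \<Rightarrow> complex. schwartz g \<and> K = tf_shift g"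
  fix K :: "'a \<times> 'a \<Rightarrow> 'a \<Rightarrow> complex" assume "?G K"
  then obtain g where g: "schwartz g" and K: "K = tf_shift g" by blast
  show "rapid_family K" unfolding rapid_family_def
  proof (intro conjI allI)
    show "K z differentiable at t" for z t
      using tf_shift_has_derivative[OF g] unfolding K differentiable_def by blast
    have "continuous_on UNIV (\<lambda>x::('a\<times>'a)\<times>'a. g (snd x - fst (fst x)))"
      by (intro continuous_on_compose2[OF schwartz_continuous[OF g, of UNIV]] continuous_intros) auto
    then show "continuous_on UNIV (\<lambda>(z, t). K z t)"
      unfolding K tf_shift_def split_beta by (intro continuous_intros)
    fix k
    obtain C where C: "0 \<le> C" "\<And>t. (1 + norm t) ^ k * norm (g t) \<le> C" by (rule schwartz_bound[OF g, where k = k]) blast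
    have "norm t ^ k * norm (K w t) \<le> C * (1 + norm w) ^ k" for w t
    proof -
      have "norm t \<le> 1 + norm ((t - fst w) + fst w)" by simp
      also have "\<dots> \<le> (1 + norm (t - fst w)) * (1 + norm (fst w))" by (rule one_plus_norm_add_le)
      also have "\<dots> \<le> (1 + norm (t - fst w)) * (1 + norm w)"
        using norm_fst_le[of "fst w" "snd w"] by (intro mult_left_mono) auto
      finally have "norm t ^ k \<le> ((1 + norm (t - fst w)) * (1 + norm w)) ^ k"
        by (intro power_mono) auto
      then have "norm t ^ k * norm (K w t) \<le> ((1 + norm (t - fst w)) * (1 + norm w)) ^ k * norm (g (t - fst w))"
        unfolding K norm_tf_shift by (intro mult_right_mono) auto
      also have "\<dots> = ((1 + norm (t - fst w)) ^ k * norm (g (t - fst w))) * (1 + norm w) ^ k"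
        by (simp add: power_mult_distrib mult_ac)
      also have "\<dots> \<le> C * (1 + norm w) ^ k" by (intro mult_right_mono C) auto
      finally show ?thesis .
    qed
    then show "\<exists>C m. \<forall>z t. norm t ^ k * norm (K z t) \<le> C * (1 + norm z) ^ m" by blast
  qed
  fix b :: 'a assume b: "b \<in> Basis"
  have der: "frechet_derivative (K w) (at t) b = (2 * pi * \<i> * (snd w \<bullet> b)) * tf_shift g w t + tf_shift (iter_deriv [b] g) w t" for w t
  proof -
    have "(\<Sum>c\<in>Basis. (b \<bullet> c) *\<^sub>R (2 * pi * \<i> * (snd w \<bullet> c) * tf_shift g w t + tf_shift (iter_deriv [c] g) w t))
      = (\<Sum>c\<in>Basis. if c = b then (2 * pi * \<i> * (snd w \<bullet> c) * tf_shift g w t + tf_shift (iter_deriv [c] g) w t) else 0)"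
      using b by (intro sum.cong) (auto simp: inner_Basis)
    also have "\<dots> = (2 * pi * \<i> * (snd w \<bullet> b)) * tf_shift g w t + tf_shift (iter_deriv [b] g) w t"
      using b by simp
    finally show ?thesis unfolding K frechet_derivative_at[OF tf_shift_has_derivative[OF g], symmetric] .
  qed
  have "poly_bounded (\<lambda>w::'a\<times>'a. 2 * pi * \<i> * (snd w \<bullet> b))"
  proof -
    have "continuous_on UNIV (\<lambda>w::'a\<times>'a. 2 * pi * \<i> * (snd w \<bullet> b))" by (intro continuous_intros)
    moreover obtain C m where "\<And>w::'a\<times>'a. norm (complex_of_real (snd w \<bullet> b)) \<le> C * (1 + norm w) ^ m"
      using poly_bounded_inner[of b, where 'b='a] unfolding poly_bounded_def by blast
    then have "norm (2 * pi * \<i> * (snd w \<bullet> b)) \<le> (2 * pi * C) * (1 + norm w) ^ m" for w :: "'a\<times>'a"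
      by (simp add: norm_mult)
    ultimately show ?thesis unfolding poly_bounded_def by blast
  qed
  moreover have "schwartz (iter_deriv [b] g)" using schwartz_iter_deriv[OF g, of "[b]"] b by simp
  ultimately have "family_span ?G (\<lambda>w t. (2 * pi * \<i> * (snd w \<bullet> b)) * tf_shift g w t + tf_shift (iter_deriv [b] g) w t)"
    using g by (intro family_span.add[OF family_span.scale[OF _ family_span.base] family_span.base]) blast+
  then show "family_span ?G (\<lambda>z t. frechet_derivative (K z) (at t) b)" by (simp only: der)
next
  show "family_span (\<lambda>K. \<exists>g::'a \<Rightarrow> complex. schwartz g \<and> K = tf_shift g) (tf_shift g)"
    using assms by (intro family_span.base) blast
qed

lemma schwartz_tf_shift: "schwartz g \<Longrightarrow> schwartz (tf_shift g w)"
  by (rule schwartz_familyD[OF schwartz_family_tf_shift])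

text \<open>By the chain rule a derivative of \<open>f (L z t)\<close> is a combination of functions
  of the same form with coefficients \<open>L z b \<bullet> c\<close> depending on \<open>z\<close>
  alone. The upper bound on \<open>L z\<close> controls these coefficients, the lower one transfers
  decay from \<open>L z t\<close> to \<open>t\<close>. The parameter in the application is
  \<tau>.\<close>

lemma schwartz_family_compose_linear:
  fixes L :: "'z::euclidean_space \<Rightarrow> 'a::euclidean_space \<Rightarrow> 'b::euclidean_space"
  assumes f: "schwartz f" and lin: "\<And>z. linear (L z)"
    and cont: "continuous_on UNIV (\<lambda>(z, t). L z t)"
    and up: "\<And>z t. norm (L z t) \<le> C * (1 + norm z) ^ m * norm t"
    and low: "\<And>z t. norm t \<le> D * (1 + norm z) ^ n * norm (L z t)"
  shows "schwartz_family (\<lambda>z t. f (L z t))"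
proof (rule schwartz_family_span[of "\<lambda>K. \<exists>f. schwartz f \<and> K = (\<lambda>z t. f (L z t))"])
  let ?G = "\<lambda>K. \<exists>f. schwartz f \<and> K = (\<lambda>z t. f (L z t))"
  have der: "((\<lambda>t. f (L z t)) has_derivative (\<lambda>h. \<Sum>c\<in>Basis. (L z h \<bullet> c) *\<^sub>R iter_deriv [c] f (L z t))) (at t)"
    if "schwartz f" for f z t
    using has_derivative_compose[OF linear_imp_has_derivative[OF lin] schwartz_has_derivative[OF that]] .
  fix K :: "'z \<Rightarrow> 'a \<Rightarrow> complex" assume "?G K"
  then obtain f where f: "schwartz f" and K: "K = (\<lambda>z t. f (L z t))" by blast
  show "rapid_family K" unfolding rapid_family_def
  proof (intro conjI allI)
    show "K z differentiable at t" for z t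
      using der[OF f] unfolding K differentiable_def by blast
    show "continuous_on UNIV (\<lambda>(z, t). K z t)"
      unfolding K split_beta using cont
      by (intro continuous_on_compose2[OF schwartz_continuous[OF f, of UNIV]]) (auto simp: split_beta)
    fix k
    obtain B where B: "0 \<le> B" "\<And>t. (1 + norm t) ^ k * norm (f t) \<le> B" by (rule schwartz_bound[OF f, where k = k]) blast
    have "norm t ^ k * norm (K z t) \<le> (\<bar>D\<bar> ^ k * B) * (1 + norm z) ^ (n * k)" for z t
    proof -
      have "norm t \<le> \<bar>D\<bar> * (1 + norm z) ^ n * (1 + norm (L z t))"
        by (rule order_trans[OF low]) (auto intro!: mult_mono)
      then have "norm t ^ k \<le> (\<bar>D\<bar> * (1 + norm z) ^ n * (1 + norm (L z t))) ^ k"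
        by (intro power_mono) auto
      then have "norm t ^ k * norm (K z t) \<le> (\<bar>D\<bar> * (1 + norm z) ^ n * (1 + norm (L z t))) ^ k * norm (f (L z t))"
        unfolding K by (intro mult_right_mono) auto
      also have "\<dots> = (\<bar>D\<bar> ^ k * (1 + norm z) ^ (n * k)) * ((1 + norm (L z t)) ^ k * norm (f (L z t)))"
        unfolding power_mult_distrib power_mult by (simp only: mult_ac)
      also have "\<dots> \<le> (\<bar>D\<bar> ^ k * (1 + norm z) ^ (n * k)) * B" by (intro mult_left_mono B) auto
      finally show ?thesis by (simp add: mult_ac)
    qed
    then show "\<exists>C m. \<forall>z t. norm t ^ k * norm (K z t) \<le> C * (1 + norm z) ^ m" by blast
  qed
  fix b :: 'a assume b: "b \<in> Basis"
  have "frechet_derivative (K z) (at t) b = (\<Sum>c\<in>Basis. of_real (L z b \<bullet> c) * iter_deriv [c] f (L z t))" for z t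
    unfolding K frechet_derivative_at[OF der[OF f], symmetric] by (simp add: scaleR_conv_of_real)
  moreover have "family_span ?G (\<lambda>z t. of_real (L z b \<bullet> c) * iter_deriv [c] f (L z t))" if c: "c \<in> Basis" for c
  proof -
    have "continuous_on UNIV (\<lambda>z. L z b)"
      using continuous_on_compose2[OF cont continuous_on_Pair[OF continuous_on_id continuous_on_const[of UNIV b]]]
      by simp
    then have "continuous_on UNIV (\<lambda>z. complex_of_real (L z b \<bullet> c))" by (intro continuous_intros)
    moreover have "norm (complex_of_real (L z b \<bullet> c)) \<le> (C * norm b) * (1 + norm z) ^ m" for z
      using Basis_le_norm[OF c, of "L z b"] up[of z b] by (auto simp: mult_ac)
    ultimately have "poly_bounded (\<lambda>z. complex_of_real (L z b \<bullet> c))" unfolding poly_bounded_def by blast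
    moreover have "schwartz (iter_deriv [c] f)" using schwartz_iter_deriv[OF f, of "[c]"] c by simp
    ultimately show ?thesis by (intro family_span.scale family_span.base) auto
  qed
  ultimately show "family_span ?G (\<lambda>z t. frechet_derivative (K z) (at t) b)"
    by (simp add: family_span_sum)
next
  show "family_span (\<lambda>K. \<exists>f. schwartz f \<and> K = (\<lambda>z t. f (L z t))) (\<lambda>z t. f (L z t))"
    using f by (intro family_span.base) blast
qed

text \<open>Polynomials times the Gaussian. Sums and multiples are built in, so that a derivative of
  a member is again a single member.\<close>

inductive hermite_class :: "('a::euclidean_space \<Rightarrow> complex) \<Rightarrow> bool" where
  "hermite_class gauss"
| "hermite_class f \<Longrightarrow> hermite_class (\<lambda>x. of_real (x \<bullet> b) * f x)"
| "hermite_class f \<Longrightarrow> hermite_class (\<lambda>x. c * f x)"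
| "hermite_class f \<Longrightarrow> hermite_class g \<Longrightarrow> hermite_class (\<lambda>x. f x + g x)"

lemma gauss_has_derivative:
  fixes x :: "'a::euclidean_space"
  shows "(gauss has_derivative (\<lambda>h. (-2 * pi) * (of_real (x \<bullet> h) * gauss x))) (at x)"
proof -
  have i: "((\<lambda>x::'a. x \<bullet> x) has_derivative (\<lambda>h. x \<bullet> h + h \<bullet> x)) (at x)"
    by (rule has_derivative_inner[OF has_derivative_ident has_derivative_ident])
  have "((\<lambda>x::'a. exp (- pi * (x \<bullet> x))) has_derivative (\<lambda>h. (- 2 * pi) * ((x \<bullet> h) * exp (- pi * (x \<bullet> x))))) (at x)"
    by (rule has_derivative_eq_rhs[OF has_derivative_exp[OF has_derivative_mult_right[OF i]]])
       (simp add: fun_eq_iff inner_commute algebra_simps)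
  from has_derivative_of_real[OF has_derivative_mult_right[OF this, of "2 powr (real DIM('a) / 4)"], where 'a = complex]
  show ?thesis unfolding gauss_def[abs_def] power2_norm_eq_inner by (simp add: mult_ac)
qed

lemma hermite_class_deriv:
  assumes "hermite_class f"
  shows "\<exists>f'. (\<forall>x. (f has_derivative f' x) (at x)) \<and> (\<forall>h. hermite_class (\<lambda>x. f' x h))"
  using assms
proof induction
  case 1
  have "hermite_class (\<lambda>x::'a. (- 2 * pi) * (of_real (x \<bullet> h) * gauss x))" for h
    by (intro hermite_class.intros(3) hermite_class.intros(2) hermite_class.intros(1))
  with gauss_has_derivative show ?case
    by (intro exI[of _ "\<lambda>x h. (- 2 * pi) * (of_real (x \<bullet> h) * gauss x)"] conjI allI)
next
  case (2 f b)
  then obtain f' where f': "\<And>x. (f has_derivative f' x) (at x)" "\<And>h. hermite_class (\<lambda>x. f' x h)" by blast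
  have "((\<lambda>x. of_real (x \<bullet> b) * f x) has_derivative (\<lambda>h. of_real (x \<bullet> b) * f' x h + of_real (h \<bullet> b) * f x)) (at x)" for x
    using has_derivative_mult[OF has_derivative_of_real[OF has_derivative_inner_left[OF has_derivative_ident]] f'(1)] .
  moreover have "hermite_class (\<lambda>x. of_real (x \<bullet> b) * f' x h + of_real (h \<bullet> b) * f x)" for h
    by (intro hermite_class.intros(4) hermite_class.intros(2) f' hermite_class.intros(3) 2)
  ultimately show ?case
    by (intro exI[of _ "\<lambda>x h. of_real (x \<bullet> b) * f' x h + of_real (h \<bullet> b) * f x"] conjI allI)
next
  case (3 f c)
  then obtain f' where f': "\<And>x. (f has_derivative f' x) (at x)" "\<And>h. hermite_class (\<lambda>x. f' x h)" by blast
  have "((\<lambda>x. c * f x) has_derivative (\<lambda>h. c * f' x h)) (at x)" for x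
    by (rule has_derivative_mult_right[OF f'(1)])
  moreover have "hermite_class (\<lambda>x. c * f' x h)" for h
    by (intro hermite_class.intros(3) f')
  ultimately show ?case by (intro exI[of _ "\<lambda>x h. c * f' x h"] conjI allI)
next
  case (4 f g)
  then obtain f' g' where f': "\<And>x. (f has_derivative f' x) (at x)" "\<And>h. hermite_class (\<lambda>x. f' x h)"
    "\<And>x. (g has_derivative g' x) (at x)" "\<And>h. hermite_class (\<lambda>x. g' x h)" by blast
  have "((\<lambda>x. f x + g x) has_derivative (\<lambda>h. f' x h + g' x h)) (at x)" for x
    by (intro has_derivative_add f')
  moreover have "hermite_class (\<lambda>x. f' x h + g' x h)" for h
    by (intro hermite_class.intros(4) f')
  ultimately show ?case by (intro exI[of _ "\<lambda>x h. f' x h + g' x h"] conjI allI)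
qed

lemma hermite_class_bound:
  assumes "hermite_class (f :: 'a::euclidean_space \<Rightarrow> complex)"
  shows "\<exists>C m. 0 \<le> C \<and> (\<forall>x. norm (f x) \<le> C * (1 + norm x) ^ m * exp (- pi * (norm x)\<^sup>2))"
  using assms
proof induction
  case 1
  then show ?case
    by (intro exI[of _ "2 powr (real DIM('a) / 4)"] exI[of _ 0]) (auto simp: gauss_def norm_mult)
next
  case (2 f b)
  then obtain C m where C: "0 \<le> C" "\<And>x. norm (f x) \<le> C * (1 + norm x) ^ m * exp (- pi * (norm x)\<^sup>2)" by blast
  show ?case
  proof (intro exI conjI allI)
    fix x :: 'a
    have "\<bar>x \<bullet> b\<bar> \<le> norm b * (1 + norm x)" using Cauchy_Schwarz_ineq2[of x b]
      by (simp add: algebra_simps add_increasing)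
    then have "\<bar>x \<bullet> b\<bar> * norm (f x) \<le> (norm b * (1 + norm x)) * (C * (1 + norm x) ^ m * exp (- pi * (norm x)\<^sup>2))"
      by (intro mult_mono C) auto
    then show "norm (of_real (x \<bullet> b) * f x) \<le> (norm b * C) * (1 + norm x) ^ (Suc m) * exp (- pi * (norm x)\<^sup>2)"
      by (simp add: norm_mult mult_ac)
  qed (use C in auto)
next
  case (3 f c)
  then obtain C m where C: "0 \<le> C" "\<And>x. norm (f x) \<le> C * (1 + norm x) ^ m * exp (- pi * (norm x)\<^sup>2)" by blast
  show ?case
  proof (intro exI conjI allI)
    fix x :: 'a
    have "norm c * norm (f x) \<le> norm c * (C * (1 + norm x) ^ m * exp (- pi * (norm x)\<^sup>2))"
      by (intro mult_left_mono C) auto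
    then show "norm (c * f x) \<le> (norm c * C) * (1 + norm x) ^ m * exp (- pi * (norm x)\<^sup>2)"
      by (simp add: norm_mult mult_ac)
  qed (use C in auto)
next
  case (4 f g)
  then obtain C m D n where C: "0 \<le> C" "\<And>x. norm (f x) \<le> C * (1 + norm x) ^ m * exp (- pi * (norm x)\<^sup>2)"
    and D: "0 \<le> D" "\<And>x. norm (g x) \<le> D * (1 + norm x) ^ n * exp (- pi * (norm x)\<^sup>2)" by blast
  show ?case
  proof (intro exI conjI allI)
    fix x :: 'a
    have "norm (f x + g x) \<le> C * (1 + norm x) ^ m * exp (- pi * (norm x)\<^sup>2) + D * (1 + norm x) ^ n * exp (- pi * (norm x)\<^sup>2)"
      by (rule order_trans[OF norm_triangle_ineq add_mono[OF C(2) D(2)]])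
    also have "\<dots> \<le> C * (1 + norm x) ^ (m + n) * exp (- pi * (norm x)\<^sup>2) + D * (1 + norm x) ^ (m + n) * exp (- pi * (norm x)\<^sup>2)"
      using C(1) D(1) by (intro add_mono mult_right_mono mult_left_mono power_increasing) auto
    finally show "norm (f x + g x) \<le> (C + D) * (1 + norm x) ^ (m + n) * exp (- pi * (norm x)\<^sup>2)"
      by (simp add: algebra_simps)
  qed (use C D in auto)
qed

lemma power_times_gaussian_le:
  fixes s :: real
  assumes "0 \<le> s"
  shows "(1 + s) ^ m * exp (- pi * s\<^sup>2) \<le> exp ((real m)\<^sup>2)"
proof -
  have "(1 + s) ^ m \<le> exp s ^ m" using assms exp_ge_add_one_self by (intro power_mono) auto
  also have "\<dots> = exp (m * s)" by (simp add: exp_of_nat_mult)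
  finally have "(1 + s) ^ m * exp (- pi * s\<^sup>2) \<le> exp (m * s) * exp (- pi * s\<^sup>2)"
    by (intro mult_right_mono) auto
  also have "\<dots> = exp (m * s - pi * s\<^sup>2)" by (simp add: exp_add[symmetric])
  also have "m * s - pi * s\<^sup>2 \<le> (real m)\<^sup>2"
  proof -
    have "0 \<le> (real m - s / 2)\<^sup>2" by simp
    then have "m * s \<le> (real m)\<^sup>2 + s\<^sup>2 / 4" by (simp add: power2_eq_square algebra_simps)
    moreover have "1 * s\<^sup>2 \<le> pi * s\<^sup>2" using pi_gt3 by (intro mult_right_mono) auto
    moreover have "0 \<le> s\<^sup>2" by simp
    ultimately show ?thesis by argo
  qed
  then have "exp (m * s - pi * s\<^sup>2) \<le> exp ((real m)\<^sup>2)" by simp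
  finally show ?thesis .
qed

lemma schwartz_gauss: "schwartz (gauss :: 'a::euclidean_space \<Rightarrow> complex)"
  unfolding schwartz_iff_family[where 'z = real]
proof (rule schwartz_family_span[of "\<lambda>K. \<exists>f. hermite_class f \<and> K = (\<lambda>_. f)"])
  let ?G = "\<lambda>K. \<exists>f. hermite_class f \<and> K = (\<lambda>_. f)"
  fix K :: "real \<Rightarrow> 'a \<Rightarrow> complex" assume "?G K"
  then obtain f where f: "hermite_class f" and K: "K = (\<lambda>_. f)" by blast
  then obtain f' where f': "\<And>x. (f has_derivative f' x) (at x)" "\<And>h. hermite_class (\<lambda>x. f' x h)"
    using hermite_class_deriv by blast
  show "rapid_family K" unfolding rapid_family_def
  proof (intro conjI allI)
    show "K z differentiable at t" for z t
      using f' unfolding K differentiable_def by blast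
    have "continuous_on UNIV f" using f'(1) has_derivative_continuous continuous_at_imp_continuous_on by blast
    then show "continuous_on UNIV (\<lambda>(z, t). K z t)"
      unfolding K split_beta by (rule continuous_on_compose2) (auto intro: continuous_intros)
    fix k
    obtain C m where C: "0 \<le> C" "\<And>x. norm (f x) \<le> C * (1 + norm x) ^ m * exp (- pi * (norm x)\<^sup>2)"
      using hermite_class_bound[OF f] by blast
    have "norm t ^ k * norm (f t) \<le> (C * exp ((real (k + m))\<^sup>2)) * (1 + norm z) ^ 0" for z::real and t
    proof -
      have "norm t ^ k * norm (f t) \<le> (1 + norm t) ^ k * (C * (1 + norm t) ^ m * exp (- pi * (norm t)\<^sup>2))"
        using C by (intro mult_mono power_mono) auto
      also have "\<dots> = C * ((1 + norm t) ^ (k + m) * exp (- pi * (norm t)\<^sup>2))" by (simp add: power_add mult_ac)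
      also have "\<dots> \<le> C * exp ((real (k + m))\<^sup>2)" using C by (intro mult_left_mono power_times_gaussian_le) auto
      finally show ?thesis by simp
    qed
    then show "\<exists>C m. \<forall>z t. norm t ^ k * norm (K z t) \<le> C * (1 + norm z) ^ m" unfolding K by blast
  qed
  fix b :: 'a
  have "frechet_derivative (K z) (at t) b = f' t b" for z t
    unfolding K frechet_derivative_at[OF f'(1), symmetric] ..
  then show "family_span ?G (\<lambda>z t. frechet_derivative (K z) (at t) b)"
    using f'(2) by (auto intro!: family_span.base)
next
  show "family_span (\<lambda>K. \<exists>f. hermite_class f \<and> K = (\<lambda>_. f)) (\<lambda>_::real. gauss :: 'a \<Rightarrow> complex)"
    using hermite_class.intros(1) by (intro family_span.base) blast
qed

subsection \<open>Integration of families of Schwartz functions\<close>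

text \<open>Lebesgue measure on a Euclidean space is the image of a product of one-dimensional
  measures. The two uses are an integrable majorant for \<open>decay\<close> and the Fourier
  transform of a Gaussian.\<close>

lemma integrable_prod_Basis:
  fixes f :: "'a::euclidean_space \<Rightarrow> real \<Rightarrow> complex"
  assumes "\<And>b. b \<in> Basis \<Longrightarrow> integrable lborel (f b)"
  shows "integrable lborel (\<lambda>z::'a. \<Prod>b\<in>Basis. f b (z \<bullet> b))"
    and "(\<integral>z. (\<Prod>b\<in>Basis. f b (z \<bullet> b)) \<partial>(lborel :: 'a measure)) = (\<Prod>b\<in>Basis. \<integral>s. f b s \<partial>lborel)"
proof -
  interpret product_sigma_finite "\<lambda>_::'a. lborel :: real measure" ..
  have m: "borel_fun (\<lambda>z::'a. \<Prod>b\<in>Basis. f b (z \<bullet> b))"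
    using assms by (intro borel_measurable_prod measurable_compose[OF borel_measurable_inner[OF measurable_ident_sets borel_measurable_const]]) auto
  have e: "(\<Prod>b\<in>Basis. f b ((\<Sum>c\<in>Basis. x c *\<^sub>R c) \<bullet> b)) = (\<Prod>b\<in>Basis. f b (x b))" for x :: "'a \<Rightarrow> real"
    by (intro prod.cong refl) simp
  have s: "(\<lambda>f. \<Sum>b\<in>Basis. f b *\<^sub>R b) \<in> measurable (\<Pi>\<^sub>M b\<in>Basis. lborel) (borel :: 'a measure)"
    by measurable
  show "integrable lborel (\<lambda>z::'a. \<Prod>b\<in>Basis. f b (z \<bullet> b))"
    unfolding lborel_eq[where 'a='a]
    by (subst integrable_distr_eq[OF s m]) (simp add: e product_integrable_prod assms)
  show "(\<integral>z. (\<Prod>b\<in>Basis. f b (z \<bullet> b)) \<partial>(lborel :: 'a measure)) = (\<Prod>b\<in>Basis. \<integral>s. f b s \<partial>lborel)"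
    unfolding lborel_eq[where 'a='a]
    by (subst integral_distr[OF s m]) (simp add: e product_integral_prod assms)
qed

text \<open>The exponent is chosen so that the product of
  \<open>inverse (1 + (z \<bullet> b)\<^sup>2)\<close> over the coordinates, which is integrable, is
  a majorant: each \<open>1 + (z \<bullet> b)\<^sup>2\<close> is at most
  \<open>(1 + norm z)\<^sup>2\<close>.\<close>

definition decay :: "'a::euclidean_space \<Rightarrow> real" where
  "decay z = inverse ((1 + norm z) ^ (2 * DIM('a)))"

lemma
  fixes z :: "'a::euclidean_space" and A :: "'a set"
  shows decay_pos [simp]: "0 < decay z" "0 \<le> decay z"
  and decay_le_1: "decay z \<le> 1"
  and decay_continuous: "continuous_on A decay"
proof -
  have p: "0 < 1 + norm z" for z :: 'a using norm_ge_zero[of z] by linarith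
  then have n: "1 + norm z \<noteq> 0" for z :: 'a by (rule less_imp_neq[OF _ , symmetric])
  show "0 < decay z" unfolding decay_def using p[of z] by simp
  then show "0 \<le> decay z" by simp
  have "1 \<le> (1 + norm z) ^ (2 * DIM('a))" by (intro one_le_power) simp
  then show "decay z \<le> 1" unfolding decay_def by (rule inverse_le_1_iff[THEN iffD2, OF disjI2])
  show "continuous_on A decay" unfolding decay_def
    by (intro continuous_on_inverse continuous_on_power continuous_on_add continuous_on_const continuous_on_norm
        continuous_on_id) (use n in simp)
qed

lemma decay_cancel: "(1 + norm z) ^ (2 * DIM('a)) * decay z = 1" for z :: "'a::euclidean_space"
proof -
  have "1 + norm z \<noteq> 0" using norm_ge_zero[of z] by linarith
  then show ?thesis by (simp add: decay_def)
qed

lemma decay_measurable [measurable]: "borel_fun decay"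
  by (rule borel_measurable_continuous_onI[OF decay_continuous])

lemma integrable_decay: "integrable lborel (decay :: 'a::euclidean_space \<Rightarrow> real)"
proof (rule Bochner_Integration.integrable_bound)
  have "integrable lborel (\<lambda>s::real. inverse (1 + s\<^sup>2))"
    using integrable_inverse_1_plus_square by (simp add: set_integrable_def)
  then have "integrable lborel (\<lambda>s::real. complex_of_real (inverse (1 + s\<^sup>2)))" by (rule integrable_of_real)
  then show "integrable lborel (\<lambda>z::'a. \<Prod>b\<in>Basis. complex_of_real (inverse (1 + (z \<bullet> b)\<^sup>2)))"
    by (rule integrable_prod_Basis(1)[where f = "\<lambda>_ s. complex_of_real (inverse (1 + s\<^sup>2))"])
  have "decay z \<le> norm (\<Prod>b\<in>Basis. complex_of_real (inverse (1 + (z \<bullet> b)\<^sup>2)))" for z :: 'a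
  proof -
    have p: "0 < 1 + (z \<bullet> b)\<^sup>2" for b using zero_le_power2[of "z \<bullet> b"] by linarith
    have "1 + (z \<bullet> b)\<^sup>2 \<le> (1 + norm z)\<^sup>2" if "b \<in> Basis" for b
    proof -
      have "(z \<bullet> b)\<^sup>2 \<le> (norm z)\<^sup>2" using Basis_le_norm[OF that, of z] by (simp add: abs_le_square_iff[symmetric])
      moreover have "(1 + norm z)\<^sup>2 = 1 + (norm z)\<^sup>2 + 2 * norm z" by (simp add: power2_eq_square algebra_simps)
      ultimately show ?thesis using norm_ge_zero[of z] by linarith
    qed
    then have "(\<Prod>b\<in>(Basis::'a set). 1 + (z \<bullet> b)\<^sup>2) \<le> (\<Prod>b\<in>(Basis::'a set). (1 + norm z)\<^sup>2)"
      using p by (intro prod_mono) (auto intro: less_imp_le)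
    also have "\<dots> = (1 + norm z) ^ (2 * DIM('a))" by (simp add: power_mult)
    finally have "decay z \<le> inverse (\<Prod>b\<in>(Basis::'a set). 1 + (z \<bullet> b)\<^sup>2)"
      unfolding decay_def using p by (intro le_imp_inverse_le prod_pos) auto
    also have "\<dots> = norm (\<Prod>b\<in>Basis. complex_of_real (inverse (1 + (z \<bullet> b)\<^sup>2)))"
    proof -
      have "norm (complex_of_real (inverse (1 + (z \<bullet> b)\<^sup>2))) = inverse (1 + (z \<bullet> b)\<^sup>2)" for b
        using p[of b] unfolding norm_of_real by simp
      then show ?thesis unfolding prod_norm[symmetric] by (simp only: prod_inversef[symmetric] o_def)
    qed
    finally show ?thesis .
  qed
  then show "AE z::'a in lborel. norm (decay z) \<le> norm (\<Prod>b\<in>Basis. complex_of_real (inverse (1 + (z \<bullet> b)\<^sup>2)))"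
    by (intro AE_I2) (simp only: real_norm_def abs_of_nonneg decay_pos)
qed simp

text \<open>Dominated convergence along an arbitrary sequence of increments. The mean value
  inequality on the unit ball around \<open>t0\<close> bounds the increment of \<open>k z\<close> by
  \<open>W z * norm h\<close>, so the normalised remainder is at most \<open>2 * W z\<close>; it
  tends to 0 pointwise by differentiability.\<close>

lemma has_derivative_integral:
  fixes k :: "'z::euclidean_space \<Rightarrow> 'a::euclidean_space \<Rightarrow> complex"
  assumes int: "\<And>t. integrable M (\<lambda>z. k z t)"
    and der: "\<And>z t. (k z has_derivative k' z t) (at t)"
    and bd: "\<And>z t h. dist t t0 < 1 \<Longrightarrow> norm (k' z t h) \<le> W z * norm h"
    and W: "integrable M W"
    and meas: "\<And>h. (\<lambda>z. k' z t0 h) \<in> borel_measurable M"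
  shows "((\<lambda>t. \<integral>z. k z t \<partial>M) has_derivative (\<lambda>h. \<integral>z. k' z t0 h \<partial>M)) (at t0)"
proof -
  have bl: "bounded_linear (k' z t)" for z t using der has_derivative_bounded_linear by blast
  have Wh: "integrable M (\<lambda>z. W z * norm h)" for h :: 'a
    by (rule integrable_mult_left[OF W])
  have int': "integrable M (\<lambda>z. k' z t0 h)" for h
    by (rule Bochner_Integration.integrable_bound[OF Wh meas]) (auto intro!: AE_I2 order_trans[OF bd abs_ge_self])
  have lin: "bounded_linear (\<lambda>h. \<integral>z. k' z t0 h \<partial>M)"
  proof (rule bounded_linear_intro)
    show "(\<integral>z. k' z t0 (x + y) \<partial>M) = (\<integral>z. k' z t0 x \<partial>M) + (\<integral>z. k' z t0 y \<partial>M)" for x y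
      by (simp add: linear_simps[OF bl] Bochner_Integration.integral_add[OF int' int'])
    show "(\<integral>z. k' z t0 (r *\<^sub>R x) \<partial>M) = r *\<^sub>R (\<integral>z. k' z t0 x \<partial>M)" for r x
      by (simp add: linear_simps[OF bl])
    show "norm (\<integral>z. k' z t0 x \<partial>M) \<le> norm x * (\<integral>z. W z \<partial>M)" for x
    proof -
      have "norm (\<integral>z. k' z t0 x \<partial>M) \<le> (\<integral>z. W z * norm x \<partial>M)"
        by (intro Bochner_Integration.integral_norm_bound_integral int' Wh) (simp add: bd)
      then show ?thesis by (simp add: mult.commute)
    qed
  qed
  have lip: "norm (k z (t0 + h) - k z t0) \<le> W z * norm h" if "norm h < 1" for z h
  proof -
    note h = that
    have "norm (k z (t0 + h) - k z t0) \<le> W z * norm (t0 + h - t0)"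
    proof (rule differentiable_bound[of "ball t0 1"])
      show "(k z has_derivative k' z x) (at x within ball t0 1)" for x
        using der by (rule has_derivative_at_withinI)
      show "onorm (k' z x) \<le> W z" if "x \<in> ball t0 1" for x
        using bd[of x] that by (intro onorm_le) (simp add: dist_commute)
    qed (use h in \<open>auto simp: dist_norm\<close>)
    then show ?thesis by simp
  qed
  have "((\<lambda>h. norm ((\<integral>z. k z (t0 + h) \<partial>M) - (\<integral>z. k z t0 \<partial>M) - (\<integral>z. k' z t0 h \<partial>M)) / norm h) \<longlongrightarrow> 0) (at 0)"
    unfolding tendsto_at_iff_sequentially
  proof (intro allI impI)
    fix X :: "nat \<Rightarrow> 'a" assume X: "\<forall>i. X i \<in> UNIV - {0}" "X \<longlonglongrightarrow> 0"
    then have nz: "X i \<noteq> 0" for i by auto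
    \<comment> \<open>The bound on \<open>k'\<close> holds within distance 1 of \<open>t0\<close>
      only. The sequence is shifted by \<open>N\<close> to stay there, and
      \<open>LIMSEQ_offset\<close> undoes the shift at the end.\<close>
    obtain N where N: "\<And>n. n \<ge> N \<Longrightarrow> norm (X n) < 1"
      using LIMSEQ_D[OF X(2), of 1] by auto
    define s where "s n z = (k z (t0 + X (n + N)) - k z t0 - k' z t0 (X (n + N))) /\<^sub>R norm (X (n + N))" for n z
    have si: "integrable M (s n)" for n
      unfolding s_def by (intro Bochner_Integration.integrable_scaleR_right Bochner_Integration.integrable_diff int int')
    have X': "(\<lambda>n. X (n + N)) \<longlonglongrightarrow> 0" by (rule LIMSEQ_ignore_initial_segment[OF X(2)])
    have s0: "(\<lambda>n. s n z) \<longlonglongrightarrow> 0" for z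
    proof -
      have "((\<lambda>y. (k z y - k z t0 - k' z t0 (y - t0)) /\<^sub>R norm (y - t0)) \<longlongrightarrow> 0) (at t0)"
        using der[of z t0] unfolding has_derivative_at_within by blast
      moreover have "filterlim (\<lambda>n. t0 + X (n + N)) (at t0) sequentially"
        using nz tendsto_add[OF tendsto_const[of t0] X'] by (simp add: filterlim_at)
      ultimately have "((\<lambda>n. (k z (t0 + X (n + N)) - k z t0 - k' z t0 (t0 + X (n + N) - t0)) /\<^sub>R norm (t0 + X (n + N) - t0)) \<longlongrightarrow> 0) sequentially"
        by (rule filterlim_compose)
      then show ?thesis by (simp add: s_def)
    qed
    have sb: "norm (s n z) \<le> 2 * W z" for n z
    proof -
      have n1: "norm (X (n + N)) < 1" using N by simp
      have "norm (k z (t0 + X (n + N)) - k z t0 - k' z t0 (X (n + N))) \<le> W z * norm (X (n + N)) + W z * norm (X (n + N))"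
        by (rule order_trans[OF norm_triangle_ineq4 add_mono[OF lip[OF n1] bd]]) simp
      moreover have "norm (s n z) = norm (k z (t0 + X (n + N)) - k z t0 - k' z t0 (X (n + N))) / norm (X (n + N))"
        by (simp add: s_def divide_inverse mult.commute)
      ultimately show ?thesis using nz[of "n + N"] by (simp add: divide_le_eq)
    qed
    have "(\<lambda>n. \<integral>z. s n z \<partial>M) \<longlonglongrightarrow> (\<integral>z. 0 \<partial>M)"
    proof (rule integral_dominated_convergence[where w = "\<lambda>z. 2 * W z"])
      show "(\<lambda>z. 0) \<in> borel_measurable M" "\<And>i. s i \<in> borel_measurable M" "integrable M (\<lambda>z. 2 * W z)"
        using si W by auto
    qed (use s0 sb in auto)
    then have "(\<lambda>n. norm (\<integral>z. s n z \<partial>M)) \<longlonglongrightarrow> 0" by (simp add: tendsto_norm_zero)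
    moreover have "norm (\<integral>z. s n z \<partial>M) = norm ((\<integral>z. k z (t0 + X (n + N)) \<partial>M) - (\<integral>z. k z t0 \<partial>M) - (\<integral>z. k' z t0 (X (n + N)) \<partial>M)) / norm (X (n + N))" for n
    proof -
      have "(\<integral>z. s n z \<partial>M) = ((\<integral>z. k z (t0 + X (n + N)) \<partial>M) - (\<integral>z. k z t0 \<partial>M) - (\<integral>z. k' z t0 (X (n + N)) \<partial>M)) /\<^sub>R norm (X (n + N))"
        unfolding s_def Bochner_Integration.integral_scaleR_right
        by (subst Bochner_Integration.integral_diff[OF Bochner_Integration.integrable_diff[OF int int] int'],
            subst Bochner_Integration.integral_diff[OF int int]) simp
      then show ?thesis by (simp add: divide_inverse mult.commute)
    qed
    ultimately have "(\<lambda>n. norm ((\<integral>z. k z (t0 + X (n + N)) \<partial>M) - (\<integral>z. k z t0 \<partial>M) - (\<integral>z. k' z t0 (X (n + N)) \<partial>M)) / norm (X (n + N))) \<longlonglongrightarrow> 0"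
      by simp
    then show "((\<lambda>h. norm ((\<integral>z. k z (t0 + h) \<partial>M) - (\<integral>z. k z t0 \<partial>M) - (\<integral>z. k' z t0 h \<partial>M)) / norm h) \<circ> X) \<longlonglongrightarrow> 0"
      unfolding o_def by (rule LIMSEQ_offset)
  qed
  with lin show ?thesis unfolding has_derivative_at by blast
qed

text \<open>Measurability rather than continuity: the weight must stay in the class after
  restriction to a Borel set, on which the partition argument of \<open>tempered_integral\<close>
  rests.\<close>

definition rapidly_decreasing :: "('z::euclidean_space \<Rightarrow> complex) \<Rightarrow> bool" where
  "rapidly_decreasing F \<longleftrightarrow> borel_fun F \<and> (\<forall>k. \<exists>C. \<forall>z. (1 + norm z) ^ k * norm (F z) \<le> C)"

lemma rapidly_decreasing_measurable [measurable_dest]: "rapidly_decreasing F \<Longrightarrow> borel_fun F"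
  by (simp add: rapidly_decreasing_def)

lemma rapidly_decreasing_mono:
  assumes "rapidly_decreasing F" "borel_fun G" "\<And>z. norm (G z) \<le> norm (F z)"
  shows "rapidly_decreasing G"
  unfolding rapidly_decreasing_def
proof (intro conjI allI)
  fix k
  obtain C where C: "\<And>z. (1 + norm z) ^ k * norm (F z) \<le> C" using assms(1) unfolding rapidly_decreasing_def by meson
  have "(1 + norm z) ^ k * norm (G z) \<le> C" for z
    by (rule order_trans[OF mult_left_mono[OF assms(3)] C]) auto
  then show "\<exists>C. \<forall>z. (1 + norm z) ^ k * norm (G z) \<le> C" by blast
qed fact

lemma rapidly_decreasing_bound:
  fixes F :: "'z::euclidean_space \<Rightarrow> complex"
  assumes "rapidly_decreasing F"
  obtains C where "0 \<le> C" "\<And>z. (1 + norm z) ^ k * norm (F z) \<le> C * decay z"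
proof -
  obtain C where C: "\<And>z. (1 + norm z) ^ (k + 2 * DIM('z)) * norm (F z) \<le> C"
    using assms unfolding rapidly_decreasing_def by meson
  show ?thesis
  proof (rule that[of "\<bar>C\<bar>"])
    fix z
    have "(1 + norm z) ^ (k + 2 * DIM('z)) * norm (F z) * decay z
        = (1 + norm z) ^ k * norm (F z) * ((1 + norm z) ^ (2 * DIM('z)) * decay z)"
      by (simp add: power_add)
    then have "(1 + norm z) ^ k * norm (F z) = (1 + norm z) ^ (k + 2 * DIM('z)) * norm (F z) * decay z"
      unfolding decay_cancel by (simp only: mult_1_right)
    also have "\<dots> \<le> \<bar>C\<bar> * decay z" using C[of z] by (intro mult_right_mono) auto
    finally show "(1 + norm z) ^ k * norm (F z) \<le> \<bar>C\<bar> * decay z" .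
  qed simp
qed

lemma rapidly_decreasing_integrable:
  fixes F :: "'a::euclidean_space \<Rightarrow> complex"
  assumes "rapidly_decreasing F" "borel_fun G" "\<And>z. norm (G z) \<le> B * (1 + norm z) ^ m"
  shows "integrable lborel (\<lambda>z. F z * G z)"
proof -
  obtain C where C: "0 \<le> C" "\<And>z. (1 + norm z) ^ m * norm (F z) \<le> C * decay z"
    by (rule rapidly_decreasing_bound[OF assms(1), where k = m]) blast
  have "norm (F z * G z) \<le> \<bar>B\<bar> * (C * decay z)" for z
  proof -
    have "norm (F z * G z) \<le> norm (F z) * (\<bar>B\<bar> * (1 + norm z) ^ m)" unfolding norm_mult
      by (intro mult_left_mono order_trans[OF assms(3)] mult_right_mono) auto
    also have "\<dots> = \<bar>B\<bar> * ((1 + norm z) ^ m * norm (F z))" by simp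
    also have "\<dots> \<le> \<bar>B\<bar> * (C * decay z)" by (intro mult_left_mono C) auto
    finally show ?thesis .
  qed
  then have "norm (F z * G z) \<le> norm (\<bar>B\<bar> * (C * decay z))" for z
    by (metis abs_ge_self order_trans real_norm_def)
  moreover have "integrable lborel (\<lambda>z::'a. \<bar>B\<bar> * (C * decay z))"
    by (rule integrable_mult_right[OF integrable_mult_right[OF integrable_decay]])
  moreover have "(\<lambda>z. F z * G z) \<in> borel_measurable lborel"
    using borel_measurable_times[OF rapidly_decreasing_measurable[OF assms(1)] assms(2)] by simp
  ultimately show ?thesis
    using Bochner_Integration.integrable_bound[of lborel "\<lambda>z. \<bar>B\<bar> * (C * decay z)" "\<lambda>z. F z * G z"] by blast
qed

lemma schwartz_family_measurable:
  assumes "schwartz_family K" "set bs \<subseteq> Basis"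
  shows "borel_fun (\<lambda>(z, t). iter_deriv bs (K z) t)"
    and "borel_fun (\<lambda>z. iter_deriv bs (K z) t)"
proof -
  have c: "continuous_on UNIV (\<lambda>(z, t). iter_deriv bs (K z) t)"
    using assms unfolding schwartz_family_def rapid_family_def by blast
  then show "borel_fun (\<lambda>(z, t). iter_deriv bs (K z) t)"
    by (rule borel_measurable_continuous_onI)
  have "continuous_on UNIV (\<lambda>z. (z, t))" by (intro continuous_on_Pair continuous_on_id continuous_on_const)
  from continuous_on_compose2[OF c this] show "borel_fun (\<lambda>z. iter_deriv bs (K z) t)"
    by (intro borel_measurable_continuous_onI) auto
qed

lemma schwartz_family_integrable:
  assumes "schwartz_family K" "rapidly_decreasing F" "set bs \<subseteq> Basis"
  shows "integrable lborel (\<lambda>z. F z * iter_deriv bs (K z) t)"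
proof -
  obtain C m where "\<And>z t. (1 + norm t) ^ 0 * norm (iter_deriv bs (K z) t) \<le> C * (1 + norm z) ^ m"
    by (rule schwartz_family_bound[OF assms(1,3), where k = 0]) blast
  then show ?thesis
    by (intro rapidly_decreasing_integrable[OF assms(2) schwartz_family_measurable(2)[OF assms(1,3)]]) auto
qed

lemma schwartz_family_integral_has_derivative:
  assumes K: "schwartz_family K" and F: "rapidly_decreasing F"
  shows "((\<lambda>t. \<integral>z. F z * K z t \<partial>lborel) has_derivative
    (\<lambda>h. \<integral>z. F z * (\<Sum>b\<in>Basis. (h \<bullet> b) *\<^sub>R iter_deriv [b] (K z) t) \<partial>lborel)) (at t)"
proof -
  have "\<exists>C m. \<forall>z t. norm (iter_deriv [b] (K z) t) \<le> C * (1 + norm z) ^ m" if "b \<in> Basis" for b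
  proof -
    have "set [b] \<subseteq> Basis" using that by simp
    then obtain C m where "\<And>z t. (1 + norm t) ^ 0 * norm (iter_deriv [b] (K z) t) \<le> C * (1 + norm z) ^ m"
      by (rule schwartz_family_bound[OF K, where k = 0]) blast
    then have "\<forall>z t. norm (iter_deriv [b] (K z) t) \<le> C * (1 + norm z) ^ m" by simp
    then show ?thesis by blast
  qed
  then obtain C m where C: "\<And>b z t. b \<in> Basis \<Longrightarrow> norm (iter_deriv [b] (K z) t) \<le> C b * (1 + norm z) ^ m b"
    by metis
  define W where "W z = (\<Sum>b\<in>Basis. norm (F z) * (C b * (1 + norm z) ^ m b))" for z
  show ?thesis
  proof (rule has_derivative_integral)
    show "integrable lborel (\<lambda>z. F z * K z t)" for t
      using schwartz_family_integrable[OF K F, of "[]"] by simp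
    show "((\<lambda>t. F z * K z t) has_derivative (\<lambda>h. F z * (\<Sum>b\<in>Basis. (h \<bullet> b) *\<^sub>R iter_deriv [b] (K z) t))) (at t)" for z t
      by (intro has_derivative_mult_right schwartz_has_derivative schwartz_familyD[OF K])
    show "norm (F z * (\<Sum>b\<in>Basis. (h \<bullet> b) *\<^sub>R iter_deriv [b] (K z) t)) \<le> W z * norm h" for z t h
    proof -
      have "norm (\<Sum>b\<in>Basis. (h \<bullet> b) *\<^sub>R iter_deriv [b] (K z) t) \<le> (\<Sum>b\<in>Basis. norm h * (C b * (1 + norm z) ^ m b))"
      proof (rule order_trans[OF norm_sum sum_mono])
        fix b :: 'b assume "b \<in> Basis"
        then show "norm ((h \<bullet> b) *\<^sub>R iter_deriv [b] (K z) t) \<le> norm h * (C b * (1 + norm z) ^ m b)"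
          unfolding norm_scaleR by (intro mult_mono C Basis_le_norm) auto
      qed
      then have "norm (F z) * norm (\<Sum>b\<in>Basis. (h \<bullet> b) *\<^sub>R iter_deriv [b] (K z) t)
        \<le> norm (F z) * (\<Sum>b\<in>Basis. norm h * (C b * (1 + norm z) ^ m b))"
        by (intro mult_left_mono) auto
      also have "\<dots> = W z * norm h" unfolding W_def sum_distrib_left sum_distrib_right
        by (intro sum.cong refl) simp
      finally show ?thesis by (simp add: norm_mult)
    qed
    have 1: "integrable lborel (\<lambda>z. norm (F z * complex_of_real (C b * (1 + norm z) ^ m b)))" for b
    proof (intro integrable_norm rapidly_decreasing_integrable[OF F, of _ "\<bar>C b\<bar>" "m b"])
      show "norm (complex_of_real (C b * (1 + norm z) ^ m b)) \<le> \<bar>C b\<bar> * (1 + norm z) ^ m b" for z :: 'a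
        unfolding norm_of_real abs_mult by simp
    qed simp
    have 2: "norm (F z * complex_of_real (C b * (1 + norm z) ^ m b)) = norm (F z) * (C b * (1 + norm z) ^ m b)"
      if "b \<in> Basis" for b z
      using order_trans[OF norm_ge_zero C[OF that, of z]] by (simp only: norm_mult norm_of_real abs_of_nonneg)
    show "integrable lborel W" unfolding W_def
    proof (rule Bochner_Integration.integrable_sum)
      fix b :: 'b assume b: "b \<in> Basis"
      show "integrable lborel (\<lambda>z. norm (F z) * (C b * (1 + norm z) ^ m b))"
        using 1[of b] unfolding 2[OF b] .
    qed
    show "(\<lambda>z. F z * (\<Sum>b\<in>Basis. (h \<bullet> b) *\<^sub>R iter_deriv [b] (K z) t)) \<in> borel_measurable lborel" for h
      using F schwartz_family_measurable(2)[OF K, of "[b]" t for b]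
      by (intro borel_measurable_times borel_measurable_sum borel_measurable_scaleR) auto
  qed
qed

lemma iter_deriv_integral:
  assumes K: "schwartz_family K" and F: "rapidly_decreasing F" and "set bs \<subseteq> Basis"
  shows "iter_deriv bs (\<lambda>t. \<integral>z. F z * K z t \<partial>lborel) = (\<lambda>t. \<integral>z. F z * iter_deriv bs (K z) t \<partial>lborel)"
  using assms(3)
proof (induction bs)
  case (Cons b bs)
  have K': "schwartz_family (\<lambda>z. iter_deriv bs (K z))" using Cons schwartz_family_deriv[OF K] by auto
  have "(\<Sum>c\<in>Basis. (b \<bullet> c) *\<^sub>R iter_deriv [c] (iter_deriv bs (K z)) t) = iter_deriv (b # bs) (K z) t" for z t
  proof -
    have "(\<Sum>c\<in>Basis. (b \<bullet> c) *\<^sub>R iter_deriv [c] (iter_deriv bs (K z)) t)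
      = (\<Sum>c\<in>Basis. if c = b then iter_deriv [c] (iter_deriv bs (K z)) t else 0)"
      using Cons.prems by (intro sum.cong) (auto simp: inner_Basis)
    then show ?thesis using Cons.prems by simp
  qed
  then have "frechet_derivative (\<lambda>t. \<integral>z. F z * iter_deriv bs (K z) t \<partial>lborel) (at t) b
     = (\<integral>z. F z * iter_deriv (b # bs) (K z) t \<partial>lborel)" for t
    by (subst frechet_derivative_at[OF schwartz_family_integral_has_derivative[OF K' F], symmetric]) simp
  then show ?case using Cons by simp
qed simp

lemma integral_norm_bound_family:
  assumes "schwartz_family K" "rapidly_decreasing F" "set bs \<subseteq> Basis"
    and "integrable lborel B" "\<And>z. c * norm (F z * iter_deriv bs (K z) t) \<le> B z" "0 \<le> c"
  shows "c * norm (\<integral>z. F z * iter_deriv bs (K z) t \<partial>lborel) \<le> (\<integral>z. B z \<partial>lborel)"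
proof -
  have "c * norm (\<integral>z. F z * iter_deriv bs (K z) t \<partial>lborel) = norm (\<integral>z. c *\<^sub>R (F z * iter_deriv bs (K z) t) \<partial>lborel)"
    using assms(6) by simp
  also have "\<dots> \<le> (\<integral>z. B z \<partial>lborel)"
    using assms by (intro Bochner_Integration.integral_norm_bound_integral Bochner_Integration.integrable_scaleR_right
      schwartz_family_integrable) auto
  finally show ?thesis .
qed

text \<open>For each derivative and each power of \<open>t\<close> the family grows in
  \<open>z\<close> like some power \<open>m\<close>, and rapid decrease of the weight is invoked
  with that \<open>m\<close>. The lemma recurs as a way of proving that a function is Schwartz: it
  is written as a superposition of shifted Gaussians.\<close>

lemma schwartz_integral:
  assumes K: "schwartz_family K" and F: "rapidly_decreasing F"
  shows "schwartz (\<lambda>t. \<integral>z. F z * K z t \<partial>lborel)"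
  unfolding schwartz_def
proof (intro allI impI conjI)
  fix bs :: "'b list" assume bs: "set bs \<subseteq> Basis"
  note eq = iter_deriv_integral[OF K F bs]
  have K': "schwartz_family (\<lambda>z. iter_deriv bs (K z))" using schwartz_family_deriv[OF K bs] .
  show "iter_deriv bs (\<lambda>t. \<integral>z. F z * K z t \<partial>lborel) differentiable_on UNIV"
    unfolding eq differentiable_on_def differentiable_def
    using schwartz_family_integral_has_derivative[OF K' F] by blast
  fix k
  obtain C m where C: "0 \<le> C" "\<And>z t. (1 + norm t) ^ k * norm (iter_deriv bs (K z) t) \<le> C * (1 + norm z) ^ m"
    by (rule schwartz_family_bound[OF K bs, where k = k]) blast
  obtain D where D: "0 \<le> D" "\<And>z. (1 + norm z) ^ m * norm (F z) \<le> D * decay z"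
    by (rule rapidly_decreasing_bound[OF F, where k = m]) blast
  have "norm t ^ k * norm (\<integral>z. F z * iter_deriv bs (K z) t \<partial>lborel) \<le> (\<integral>z. C * (D * decay (z::'a)) \<partial>lborel)" for t
  proof (rule integral_norm_bound_family[OF K F bs])
    fix z
    have "norm t ^ k * norm (F z * iter_deriv bs (K z) t) = norm (F z) * (norm t ^ k * norm (iter_deriv bs (K z) t))"
      by (simp add: norm_mult)
    also have "\<dots> \<le> norm (F z) * (C * (1 + norm z) ^ m)"
    proof (intro mult_left_mono)
      have "norm t ^ k * norm (iter_deriv bs (K z) t) \<le> (1 + norm t) ^ k * norm (iter_deriv bs (K z) t)"
        by (intro mult_right_mono power_mono) auto
      then show "norm t ^ k * norm (iter_deriv bs (K z) t) \<le> C * (1 + norm z) ^ m"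
        using C(2)[of t z] by linarith
    qed simp
    also have "\<dots> = C * ((1 + norm z) ^ m * norm (F z))" by simp
    also have "\<dots> \<le> C * (D * decay z)" by (intro mult_left_mono C D)
    finally show "norm t ^ k * norm (F z * iter_deriv bs (K z) t) \<le> C * (D * decay z)" .
  qed (use integrable_mult_right[OF integrable_mult_right[OF integrable_decay]] in auto)
  then show "bounded (range (\<lambda>x. norm x ^ k *\<^sub>R iter_deriv bs (\<lambda>t. \<integral>z. F z * K z t \<partial>lborel) x))"
    unfolding eq bounded_iff by auto
qed

subsection \<open>Tempered distributions\<close>

lemma iter_deriv_add:
  assumes "schwartz f" "schwartz g" "set bs \<subseteq> Basis"
  shows "iter_deriv bs (\<lambda>x. f x + g x) = (\<lambda>x. iter_deriv bs f x + iter_deriv bs g x)"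
  using assms(3)
proof (induction bs)
  case (Cons b bs)
  have "(iter_deriv bs f has_derivative frechet_derivative (iter_deriv bs f) (at x)) (at x)"
    "(iter_deriv bs g has_derivative frechet_derivative (iter_deriv bs g) (at x)) (at x)" for x
    using Cons.prems assms(1,2)
    by (auto simp: schwartz_def differentiable_on_def frechet_derivative_works)
  then have "frechet_derivative (\<lambda>x. iter_deriv bs f x + iter_deriv bs g x) (at x) b
    = frechet_derivative (iter_deriv bs f) (at x) b + frechet_derivative (iter_deriv bs g) (at x) b" for x
    by (subst frechet_derivative_at[OF has_derivative_add, symmetric]) auto
  then show ?case using Cons by simp
qed simp

lemma iter_deriv_scale:
  assumes "schwartz f" "set bs \<subseteq> Basis"
  shows "iter_deriv bs (\<lambda>x. c * f x) = (\<lambda>x. c * iter_deriv bs f x)"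
  using assms(2)
proof (induction bs)
  case (Cons b bs)
  have "(iter_deriv bs f has_derivative frechet_derivative (iter_deriv bs f) (at x)) (at x)" for x
    using Cons.prems assms(1) by (auto simp: schwartz_def differentiable_on_def frechet_derivative_works)
  then have "frechet_derivative (\<lambda>x. c * iter_deriv bs f x) (at x) b
    = c * frechet_derivative (iter_deriv bs f) (at x) b" for x
    by (subst frechet_derivative_at[OF has_derivative_mult_right, symmetric]) auto
  then show ?case using Cons by simp
qed simp

lemma iter_deriv_diff:
  assumes "schwartz f" "schwartz g" "set bs \<subseteq> Basis"
  shows "iter_deriv bs (\<lambda>x. f x - g x) = (\<lambda>x. iter_deriv bs f x - iter_deriv bs g x)"
  using iter_deriv_add[OF assms(1) schwartz_scale[OF assms(2), of "-1"] assms(3)]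
    iter_deriv_scale[OF assms(2,3), of "-1"] by simp

definition schwartz_norm :: "nat \<Rightarrow> ('a::euclidean_space \<Rightarrow> complex) \<Rightarrow> real" where
  "schwartz_norm N \<phi> = (\<Sum>k\<le>N. \<Sum>bs | set bs \<subseteq> Basis \<and> length bs \<le> N. schwartz_seminorm k bs \<phi>)"

lemma finite_multiindices: "finite {bs. set bs \<subseteq> (Basis :: 'a::euclidean_space set) \<and> length bs \<le> N}"
  by (rule finite_lists_length_le) simp

lemma schwartz_seminorm_upper:
  assumes "schwartz \<phi>" "set bs \<subseteq> Basis"
  shows "norm x ^ k * norm (iter_deriv bs \<phi> x) \<le> schwartz_seminorm k bs \<phi>"
proof -
  have "bounded (range (\<lambda>x. norm x ^ k *\<^sub>R iter_deriv bs \<phi> x))"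
    using assms unfolding schwartz_def by blast
  then obtain B where "\<And>x. norm (norm x ^ k *\<^sub>R iter_deriv bs \<phi> x) \<le> B" unfolding bounded_iff by blast
  then have "bdd_above (range (\<lambda>x. norm x ^ k * norm (iter_deriv bs \<phi> x)))" by (intro bdd_aboveI[of _ B]) auto
  then show ?thesis unfolding schwartz_seminorm_def by (intro cSUP_upper) auto
qed

lemma schwartz_seminorm_nonneg:
  assumes "schwartz \<phi>" "set bs \<subseteq> Basis"
  shows "0 \<le> schwartz_seminorm k bs \<phi>"
  using order_trans[OF _ schwartz_seminorm_upper[OF assms, of 0 k]] by simp

lemma schwartz_norm_upper:
  fixes \<phi> :: "'a::euclidean_space \<Rightarrow> complex"
  assumes \<phi>: "schwartz \<phi>" and bs: "set bs \<subseteq> Basis" "length bs \<le> N" and k: "k \<le> N"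
  shows "norm x ^ k * norm (iter_deriv bs \<phi> x) \<le> schwartz_norm N \<phi>"
proof -
  let ?I = "{bs. set bs \<subseteq> (Basis :: 'a set) \<and> length bs \<le> N}"
  have "norm x ^ k * norm (iter_deriv bs \<phi> x) \<le> schwartz_seminorm k bs \<phi>"
    by (rule schwartz_seminorm_upper[OF \<phi> bs(1)])
  also have "\<dots> \<le> (\<Sum>bs\<in>?I. schwartz_seminorm k bs \<phi>)"
    using bs finite_multiindices by (intro member_le_sum) (auto intro: schwartz_seminorm_nonneg[OF \<phi>])
  also have "\<dots> \<le> schwartz_norm N \<phi>"
    unfolding schwartz_norm_def using k
    by (intro member_le_sum[of k _ "\<lambda>k. \<Sum>bs\<in>?I. schwartz_seminorm k bs \<phi>"])
       (auto intro!: sum_nonneg schwartz_seminorm_nonneg[OF \<phi>])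
  finally show ?thesis .
qed

lemma schwartz_norm_nonneg: "schwartz \<phi> \<Longrightarrow> 0 \<le> schwartz_norm N \<phi>"
  unfolding schwartz_norm_def by (intro sum_nonneg) (auto intro: schwartz_seminorm_nonneg)

lemma schwartz_norm_le:
  fixes \<phi> :: "'a::euclidean_space \<Rightarrow> complex"
  assumes "\<And>k bs x. k \<le> N \<Longrightarrow> set bs \<subseteq> Basis \<Longrightarrow> length bs \<le> N \<Longrightarrow> norm x ^ k * norm (iter_deriv bs \<phi> x) \<le> B"
  shows "schwartz_norm N \<phi> \<le> real (Suc N) * real (card {bs. set bs \<subseteq> (Basis :: 'a set) \<and> length bs \<le> N}) * B"
proof -
  have "schwartz_norm N \<phi> \<le> (\<Sum>k\<le>N. \<Sum>bs | set bs \<subseteq> (Basis :: 'a set) \<and> length bs \<le> N. B)"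
    unfolding schwartz_norm_def schwartz_seminorm_def
    by (intro sum_mono cSUP_least) (auto intro: assms)
  then show ?thesis by (simp add: mult.assoc)
qed

lemma
  assumes "tempered u" "schwartz \<phi>"
  shows tempered_add: "schwartz \<psi> \<Longrightarrow> u (\<lambda>x. \<phi> x + \<psi> x) = u \<phi> + u \<psi>"
    and tempered_scale: "u (\<lambda>x. c * \<phi> x) = cnj c * u \<phi>"
    and tempered_diff: "schwartz \<psi> \<Longrightarrow> u (\<lambda>x. \<phi> x - \<psi> x) = u \<phi> - u \<psi>"
proof -
  have a: "u (\<lambda>x. \<phi> x + \<psi> x) = u \<phi> + u \<psi>" if "schwartz \<phi>" "schwartz \<psi>" for \<phi> \<psi>
    using assms that unfolding tempered_def by blast
  have s: "u (\<lambda>x. c * \<phi> x) = cnj c * u \<phi>" if "schwartz \<phi>" for \<phi> c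
    using assms that unfolding tempered_def by blast
  show "u (\<lambda>x. c * \<phi> x) = cnj c * u \<phi>" "schwartz \<psi> \<Longrightarrow> u (\<lambda>x. \<phi> x + \<psi> x) = u \<phi> + u \<psi>"
    using a s assms by auto
  show "u (\<lambda>x. \<phi> x - \<psi> x) = u \<phi> - u \<psi>" if "schwartz \<psi>"
    using a[OF assms(2) schwartz_scale[OF that, of "-1"]] s[OF that, of "-1"] by simp
qed

lemma tempered_norm_bound:
  assumes "tempered u"
  obtains C N where "0 \<le> C" "\<And>\<phi>. schwartz \<phi> \<Longrightarrow> norm (u \<phi>) \<le> C * schwartz_norm N \<phi>"
proof -
  obtain C N where C: "\<And>\<phi>. schwartz \<phi> \<Longrightarrow> norm (u \<phi>) \<le> C * schwartz_norm N \<phi>"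
    using assms unfolding tempered_def schwartz_norm_def by blast
  have "norm (u \<phi>) \<le> \<bar>C\<bar> * schwartz_norm N \<phi>" if "schwartz \<phi>" for \<phi>
    using C[OF that] schwartz_norm_nonneg[OF that, of N]
    by (meson abs_ge_self mult_right_mono order_trans)
  then show ?thesis using that[of "\<bar>C\<bar>" N] by simp
qed

text \<open>The seminorms in the definition of \<open>tempered\<close> are finite in number, so a
  common bound \<open>B\<close> for the functions under the suprema suffices, at the price of a
  factor counting the seminorms.\<close>

lemma tempered_bound:
  assumes "tempered (u :: 'a::euclidean_space distribution)"
  obtains C N where "0 \<le> C"
    "\<And>\<phi> B. schwartz \<phi> \<Longrightarrow> (\<And>k bs x. k \<le> N \<Longrightarrow> set bs \<subseteq> Basis \<Longrightarrow> length bs \<le> N \<Longrightarrow>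
       norm x ^ k * norm (iter_deriv bs \<phi> x) \<le> B) \<Longrightarrow> norm (u \<phi>) \<le> C * B"
proof -
  obtain C N where C: "0 \<le> C" "\<And>\<phi>. schwartz \<phi> \<Longrightarrow> norm (u \<phi>) \<le> C * schwartz_norm N \<phi>"
    by (rule tempered_norm_bound[OF assms]) blast
  show ?thesis
  proof (rule that[of "C * (real (Suc N) * real (card {bs. set bs \<subseteq> (Basis :: 'a set) \<and> length bs \<le> N}))" N])
    fix \<phi> :: "'a \<Rightarrow> complex" and B
    assume 1: "schwartz \<phi>" and 2: "\<And>k bs x. k \<le> N \<Longrightarrow> set bs \<subseteq> Basis \<Longrightarrow> length bs \<le> N \<Longrightarrow>
       norm x ^ k * norm (iter_deriv bs \<phi> x) \<le> B"
    have "norm (u \<phi>) \<le> C * schwartz_norm N \<phi>" by (rule C(2)[OF 1])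
    also have "\<dots> \<le> C * (real (Suc N) * real (card {bs. set bs \<subseteq> (Basis :: 'a set) \<and> length bs \<le> N}) * B)"
      by (intro mult_left_mono schwartz_norm_le 2 C(1))
    finally show "norm (u \<phi>) \<le> C * (real (Suc N) * real (card {bs. set bs \<subseteq> (Basis :: 'a set) \<and> length bs \<le> N})) * B"
      by (simp only: mult.assoc)
  qed (use C(1) in auto)
qed

lemma schwartz_family_uniform_bound:
  fixes K :: "'z::euclidean_space \<Rightarrow> 'a::euclidean_space \<Rightarrow> complex"
  assumes "schwartz_family K"
  obtains C m where "0 \<le> C" "\<And>k bs z t. k \<le> N \<Longrightarrow> set bs \<subseteq> Basis \<Longrightarrow> length bs \<le> N \<Longrightarrow>
     norm t ^ k * norm (iter_deriv bs (K z) t) \<le> C * (1 + norm z) ^ m"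
proof -
  let ?I = "{bs. set bs \<subseteq> (Basis :: 'a set) \<and> length bs \<le> N}"
  have "\<exists>C m. 0 \<le> C \<and> (\<forall>z t. (1 + norm t) ^ N * norm (iter_deriv bs (K z) t) \<le> C * (1 + norm z) ^ m)"
    if "set bs \<subseteq> Basis" for bs
    by (rule schwartz_family_bound[OF assms that, where k = N]) blast
  then obtain C m where C: "\<And>bs. set bs \<subseteq> Basis \<Longrightarrow> 0 \<le> C bs"
    "\<And>bs z t. set bs \<subseteq> Basis \<Longrightarrow> (1 + norm t) ^ N * norm (iter_deriv bs (K z) t) \<le> C bs * (1 + norm z) ^ m bs"
    by metis
  show ?thesis
  proof (rule that[of "\<Sum>bs\<in>?I. C bs" "\<Sum>bs\<in>?I. m bs"])
    show "0 \<le> (\<Sum>bs\<in>?I. C bs)" by (intro sum_nonneg C) auto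
    fix k bs and z :: 'z and t :: 'a assume *: "k \<le> N" "set bs \<subseteq> (Basis::'a set)" "length bs \<le> N"
    have "norm t ^ k \<le> (1 + norm t) ^ k" by (intro power_mono) auto
    also have "\<dots> \<le> (1 + norm t) ^ N" using * by (intro power_increasing) auto
    finally have "norm t ^ k * norm (iter_deriv bs (K z) t) \<le> (1 + norm t) ^ N * norm (iter_deriv bs (K z) t)"
      by (intro mult_right_mono) auto
    also have "\<dots> \<le> C bs * (1 + norm z) ^ m bs" by (rule C(2)[OF *(2)])
    finally show "norm t ^ k * norm (iter_deriv bs (K z) t) \<le> (\<Sum>bs\<in>?I. C bs) * (1 + norm z) ^ (\<Sum>bs\<in>?I. m bs)"
    proof (rule poly_bound_mono)
      show "C bs \<le> (\<Sum>bs\<in>?I. C bs)" using * finite_multiindices C(1) by (intro member_le_sum) auto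
      show "m bs \<le> (\<Sum>bs\<in>?I. m bs)" using * finite_multiindices by (intro member_le_sum) auto
      show "0 \<le> (\<Sum>bs\<in>?I. C bs)" by (intro sum_nonneg C) auto
    qed simp
  qed
qed

text \<open>One spare power of \<open>t\<close> makes the difference small outside a ball, uniformly
  for \<open>z\<close> within distance 1 of \<open>z0\<close>; inside the ball uniform continuity on
  a compact set applies.\<close>

lemma schwartz_family_continuous:
  fixes K :: "'z::euclidean_space \<Rightarrow> 'a::euclidean_space \<Rightarrow> complex"
  assumes K: "schwartz_family K" and bs: "set bs \<subseteq> Basis" and e: "0 < e"
  shows "\<forall>\<^sub>F z in nhds z0. \<forall>t. norm t ^ k * norm (iter_deriv bs (K z) t - iter_deriv bs (K z0) t) \<le> e"
proof -
  obtain C m where C: "0 \<le> C" "\<And>z t. (1 + norm t) ^ Suc k * norm (iter_deriv bs (K z) t) \<le> C * (1 + norm z) ^ m"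
    by (rule schwartz_family_bound[OF K bs, where k = "Suc k"]) blast
  define D where "D = 2 * (C * (2 + norm z0) ^ m)"
  \<comment> \<open>For \<open>norm t > R\<close> this gives \<open>D \<le> norm t * e\<close>, so
    that the spare factor \<open>norm t\<close> can be cancelled. The added 1 keeps \<open>R\<close>
    away from 0 for the later division by \<open>R ^ k\<close>.\<close>
  define R where "R = D / e + 1"
  have D0: "0 \<le> D" using C(1) by (simp add: D_def)
  have R: "1 \<le> R" using D0 e by (simp add: R_def)
  have far: "norm t ^ k * norm (iter_deriv bs (K z) t - iter_deriv bs (K z0) t) \<le> e"
    if z: "dist z z0 < 1" and t: "R < norm t" for z t
  proof -
    have b: "(1 + norm t) ^ Suc k * norm (iter_deriv bs (K y) t) \<le> C * (2 + norm z0) ^ m" if "norm y \<le> 1 + norm z0" for y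
    proof -
      have "C * (1 + norm y) ^ m \<le> C * (2 + norm z0) ^ m" using C(1) that by (intro mult_left_mono power_mono) auto
      then show ?thesis using C(2)[of t y] by linarith
    qed
    have nz: "norm z \<le> 1 + norm z0"
      using z norm_triangle_ineq[of "z - z0" z0] by (simp add: dist_norm)
    have "norm t * (norm t ^ k * norm (iter_deriv bs (K z) t - iter_deriv bs (K z0) t))
       \<le> (1 + norm t) ^ Suc k * (norm (iter_deriv bs (K z) t) + norm (iter_deriv bs (K z0) t))"
      unfolding power_Suc mult.assoc[symmetric]
      by (intro mult_mono power_mono norm_triangle_ineq4 mult_nonneg_nonneg zero_le_power) auto
    also have "\<dots> \<le> D" unfolding D_def distrib_left using b[OF nz] b[of z0] by simp
    finally have "norm t * (norm t ^ k * norm (iter_deriv bs (K z) t - iter_deriv bs (K z0) t)) \<le> D" .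
    moreover have "D \<le> norm t * e"
    proof -
      have "D / e \<le> norm t" using t unfolding R_def by linarith
      then show ?thesis using e by (simp add: divide_le_eq)
    qed
    ultimately have "norm t * (norm t ^ k * norm (iter_deriv bs (K z) t - iter_deriv bs (K z0) t)) \<le> norm t * e" by linarith
    moreover have "0 < norm t" using t R by linarith
    ultimately show ?thesis by (rule mult_left_le_imp_le)
  qed
  have c: "continuous_on UNIV (\<lambda>(z, t). iter_deriv bs (K z) t)"
    using K bs unfolding schwartz_family_def rapid_family_def by blast
  have uc: "uniformly_continuous_on (cball z0 1 \<times> cball 0 R) (\<lambda>(z, t). iter_deriv bs (K z) t)"
    by (intro compact_uniformly_continuous continuous_on_subset[OF c] compact_Times) auto
  have e': "0 < e / R ^ k" using e R by simp
  let ?S = "cball z0 1 \<times> cball 0 R" and ?f = "\<lambda>(z, t). iter_deriv bs (K z) t"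
  have "\<exists>d>0. \<forall>x\<in>?S. \<forall>x'\<in>?S. dist x' x < d \<longrightarrow> dist (?f x') (?f x) < e / R ^ k"
    using uc[unfolded uniformly_continuous_on_def] e' by simp
  then obtain d where d: "0 < d" "\<forall>x\<in>?S. \<forall>x'\<in>?S. dist x' x < d \<longrightarrow> dist (?f x') (?f x) < e / R ^ k"
    by (elim exE conjE)
  have "norm t ^ k * norm (iter_deriv bs (K z) t - iter_deriv bs (K z0) t) \<le> e" if "dist z z0 < min 1 d" for z t
  proof (cases "norm t \<le> R")
    case True
    have "dist (?f (z, t)) (?f (z0, t)) < e / R ^ k"
      using that True by (intro d(2)[rule_format]) (auto simp: dist_Pair_Pair dist_commute)
    then have 1: "norm (iter_deriv bs (K z) t - iter_deriv bs (K z0) t) \<le> e / R ^ k" by (simp add: dist_norm)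
    have "norm t ^ k * norm (iter_deriv bs (K z) t - iter_deriv bs (K z0) t) \<le> R ^ k * (e / R ^ k)"
      using True R by (intro mult_mono 1 power_mono) auto
    then show ?thesis using R by simp
  next
    case False
    then show ?thesis using far that by auto
  qed
  then show ?thesis
    unfolding eventually_nhds_metric using d(1) by (intro exI[of _ "min 1 d"]) auto
qed

lemma schwartz_family_continuous_uniform:
  fixes K :: "'z::euclidean_space \<Rightarrow> 'a::euclidean_space \<Rightarrow> complex"
  assumes K: "schwartz_family K" and e: "0 < e"
  shows "\<forall>\<^sub>F z in nhds z0. \<forall>k bs t. k \<le> N \<longrightarrow> set bs \<subseteq> Basis \<longrightarrow> length bs \<le> N \<longrightarrow>
     norm t ^ k * norm (iter_deriv bs (\<lambda>t. K z t - K z0 t) t) \<le> e"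
proof -
  let ?I = "{bs. set bs \<subseteq> (Basis :: 'a set) \<and> length bs \<le> N}"
  have "\<forall>\<^sub>F z in nhds z0. \<forall>p\<in>{..N} \<times> ?I. \<forall>t. norm t ^ fst p * norm (iter_deriv (snd p) (K z) t - iter_deriv (snd p) (K z0) t) \<le> e"
  proof (rule eventually_ball_finite)
    show "finite ({..N} \<times> ?I)" using finite_multiindices by auto
    show "\<forall>p\<in>{..N} \<times> ?I. \<forall>\<^sub>F z in nhds z0. \<forall>t. norm t ^ fst p * norm (iter_deriv (snd p) (K z) t - iter_deriv (snd p) (K z0) t) \<le> e"
      using schwartz_family_continuous[OF K _ e] by auto
  qed
  then show ?thesis
  proof (rule eventually_mono, intro allI impI)
    fix z :: 'z and k and bs :: "'a list" and t :: 'a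
    assume *: "\<forall>p\<in>{..N} \<times> ?I. \<forall>t. norm t ^ fst p * norm (iter_deriv (snd p) (K z) t - iter_deriv (snd p) (K z0) t) \<le> e"
      "k \<le> N" "set bs \<subseteq> Basis" "length bs \<le> N"
    then have "(k, bs) \<in> {..N} \<times> ?I" by auto
    with *(1) have "\<forall>t. norm t ^ k * norm (iter_deriv bs (K z) t - iter_deriv bs (K z0) t) \<le> e" by fastforce
    then show "norm t ^ k * norm (iter_deriv bs (\<lambda>t. K z t - K z0 t) t) \<le> e"
      using * schwartz_familyD[OF K] by (subst iter_deriv_diff) auto
  qed
qed

lemma tempered_family_poly_bounded:
  assumes u: "tempered u" and K: "schwartz_family K"
  shows "poly_bounded (\<lambda>z. u (K z))"
proof -
  obtain C N where C: "0 \<le> C"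
    "\<And>\<phi> B. schwartz \<phi> \<Longrightarrow> (\<And>k bs x. k \<le> N \<Longrightarrow> set bs \<subseteq> Basis \<Longrightarrow> length bs \<le> N \<Longrightarrow>
       norm x ^ k * norm (iter_deriv bs \<phi> x) \<le> B) \<Longrightarrow> norm (u \<phi>) \<le> C * B"
    by (rule tempered_bound[OF u]) blast
  obtain D m where D: "0 \<le> D" "\<And>k bs z t. k \<le> N \<Longrightarrow> set bs \<subseteq> Basis \<Longrightarrow> length bs \<le> N \<Longrightarrow>
     norm t ^ k * norm (iter_deriv bs (K z) t) \<le> D * (1 + norm z) ^ m"
    by (rule schwartz_family_uniform_bound[OF K]) blast
  have "norm (u (K z)) \<le> (C * D) * (1 + norm z) ^ m" for z
    using C(2)[OF schwartz_familyD[OF K] D(2)] by (simp add: mult.assoc)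
  moreover have "continuous_on UNIV (\<lambda>z. u (K z))"
  proof (rule continuous_at_imp_continuous_on, intro ballI)
    fix z0
    show "isCont (\<lambda>z. u (K z)) z0"
      unfolding continuous_at_eps_delta
    proof (intro allI impI)
      fix e :: real assume e: "0 < e"
      \<comment> \<open>\<open>C\<close> may be 0, hence the denominator \<open>C + 1\<close>; the
        half turns the weak inequality of the estimate into a strict one.\<close>
      define e' where "e' = (e / 2) / (C + 1)"
      have e': "0 < e'" using e C(1) by (simp add: e'_def)
      obtain d where d: "0 < d" "\<forall>z. dist z z0 < d \<longrightarrow> (\<forall>k bs t. k \<le> N \<longrightarrow> set bs \<subseteq> Basis \<longrightarrow> length bs \<le> N \<longrightarrow>
          norm t ^ k * norm (iter_deriv bs (\<lambda>t. K z t - K z0 t) t) \<le> e')"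
        using schwartz_family_continuous_uniform[OF K e', of N z0] unfolding eventually_nhds_metric by (elim exE conjE)
      have "dist (u (K z)) (u (K z0)) < e" if "dist z z0 < d" for z
      proof -
        have "norm (u (\<lambda>t. K z t - K z0 t)) \<le> C * e'"
          by (rule C(2)[OF schwartz_diff[OF schwartz_familyD[OF K] schwartz_familyD[OF K]] d(2)[rule_format, OF that]])
        also have "\<dots> \<le> (C + 1) * e'" using e' by simp
        also have "\<dots> = e / 2" using C(1) unfolding e'_def
          by (metis add_nonneg_eq_0_iff nonzero_mult_div_cancel_left times_divide_eq_right zero_le_one zero_neq_one)
        also have "\<dots> < e" using e by simp
        finally show ?thesis using tempered_diff[OF u schwartz_familyD[OF K] schwartz_familyD[OF K]] by (simp add: dist_norm)
      qed
      then show "\<exists>d>0. \<forall>x'. dist x' z0 < d \<longrightarrow> dist (u (K x')) (u (K z0)) < e" using d(1) by blast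
    qed
  qed
  ultimately show ?thesis unfolding poly_bounded_def by blast
qed

lemma poly_bounded_measurable: "poly_bounded c \<Longrightarrow> borel_fun c"
  by (simp add: poly_bounded_def borel_measurable_continuous_onI)

lemma rapidly_decreasing_integrable_mult:
  fixes F :: "'a::euclidean_space \<Rightarrow> complex"
  assumes "rapidly_decreasing F" "poly_bounded G"
  shows "integrable lborel (\<lambda>z. F z * G z)"
proof -
  obtain C m where "\<And>z. norm (G z) \<le> C * (1 + norm z) ^ m" using assms(2) unfolding poly_bounded_def by blast
  then show ?thesis by (rule rapidly_decreasing_integrable[OF assms(1) poly_bounded_measurable[OF assms(2)]])
qed

lemma rapidly_decreasing_integrable': "rapidly_decreasing F \<Longrightarrow> integrable lborel F"
  using rapidly_decreasing_integrable_mult[of F "\<lambda>_. 1"] by simp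

lemma borel_measurable_cnj [measurable]:
  "F \<in> borel_measurable M \<Longrightarrow> (\<lambda>z. cnj (F z)) \<in> borel_measurable M"
  by (rule measurable_compose[OF _ borel_measurable_continuous_onI[OF continuous_on_cnj[OF continuous_on_id]]])

lemma rapidly_decreasing_cnj: "rapidly_decreasing F \<Longrightarrow> rapidly_decreasing (\<lambda>z. cnj (F z))"
  by (rule rapidly_decreasing_mono) (auto intro: borel_measurable_cnj dest: rapidly_decreasing_measurable)

lemma rapidly_decreasing_restrict:
  assumes "rapidly_decreasing F" "S \<in> sets borel"
  shows "rapidly_decreasing (\<lambda>z. if z \<in> S then F z else 0)"
proof (rule rapidly_decreasing_mono[OF assms(1)])
  have [measurable]: "borel_fun F" using assms(1) by (rule rapidly_decreasing_measurable)
  note assms(2)[measurable]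
  show "borel_fun (\<lambda>z. if z \<in> S then F z else 0)" by measurable
qed auto

lemma rapidly_decreasing_split:
  fixes F :: "'z::euclidean_space \<Rightarrow> complex"
  assumes F: "rapidly_decreasing F" and S: "S \<in> sets borel"
  shows "(\<integral>z. norm (F z) \<partial>lborel)
     = (\<integral>z. norm (if z \<in> S then F z else 0) \<partial>lborel) + (\<integral>z. norm (if z \<in> - S then F z else 0) \<partial>lborel)"
proof -
  have "- S \<in> sets borel" using S by auto
  then have "(\<integral>z. norm (if z \<in> S then F z else 0) \<partial>lborel) + (\<integral>z. norm (if z \<in> - S then F z else 0) \<partial>lborel)
    = (\<integral>z. norm (if z \<in> S then F z else 0) + norm (if z \<in> - S then F z else 0) \<partial>lborel)"
    by (intro Bochner_Integration.integral_add[symmetric] integrable_norm rapidly_decreasing_integrable'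
        rapidly_decreasing_restrict F S)
  also have "\<dots> = (\<integral>z. norm (F z) \<partial>lborel)" by (intro Bochner_Integration.integral_cong) auto
  finally show ?thesis by simp
qed

text \<open>The defect in the interchange of \<open>u\<close> with the integral is additive in \<open>F\<close>, small if \<open>F\<close> lives on
  a small set where \<open>K\<close> varies little, and small if \<open>F\<close> lives far out; a finite partition of a
  large ball then shows that it vanishes.\<close>

lemma tempered_integral:
  fixes K :: "'z::euclidean_space \<Rightarrow> 'a::euclidean_space \<Rightarrow> complex"
  assumes u: "tempered u" and K: "schwartz_family K" and F: "rapidly_decreasing F"
  shows "u (\<lambda>t. \<integral>z. F z * K z t \<partial>lborel) = (\<integral>z. cnj (F z) * u (K z) \<partial>lborel)"
proof -
  define D where "D F = u (\<lambda>t. \<integral>z. F z * K z t \<partial>lborel) - (\<integral>z. cnj (F z) * u (K z) \<partial>lborel)" for F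
  obtain C N where C: "0 \<le> C"
    "\<And>\<phi> B. schwartz \<phi> \<Longrightarrow> (\<And>k bs x. k \<le> N \<Longrightarrow> set bs \<subseteq> Basis \<Longrightarrow> length bs \<le> N \<Longrightarrow>
       norm x ^ k * norm (iter_deriv bs \<phi> x) \<le> B) \<Longrightarrow> norm (u \<phi>) \<le> C * B"
    by (rule tempered_bound[OF u]) blast
  have upb: "poly_bounded (\<lambda>z. u (K z))" by (rule tempered_family_poly_bounded[OF u K])
  have Kint: "integrable lborel (\<lambda>z. F z * K z t)" if "rapidly_decreasing F" for F t
    using schwartz_family_integrable[OF K that, of "[]"] by simp
  have uint: "integrable lborel (\<lambda>z. cnj (F z) * u (K z))" if "rapidly_decreasing F" for F
    by (rule rapidly_decreasing_integrable_mult[OF rapidly_decreasing_cnj[OF that] upb])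

  have D_add: "D F = D (\<lambda>z. if z \<in> S then F z else 0) + D (\<lambda>z. if z \<in> - S then F z else 0)"
    if F: "rapidly_decreasing F" and S: "S \<in> sets borel" for F S
  proof -
    let ?F1 = "\<lambda>z. if z \<in> S then F z else 0" and ?F2 = "\<lambda>z. if z \<in> - S then F z else 0"
    have S': "- S \<in> sets borel" using S by auto
    note r = rapidly_decreasing_restrict[OF F S] rapidly_decreasing_restrict[OF F S']
    have "(\<integral>z. F z * K z t \<partial>lborel) = (\<integral>z. ?F1 z * K z t + ?F2 z * K z t \<partial>lborel)" for t
      by (intro Bochner_Integration.integral_cong) auto
    then have "(\<lambda>t. \<integral>z. F z * K z t \<partial>lborel) = (\<lambda>t. (\<integral>z. ?F1 z * K z t \<partial>lborel) + (\<integral>z. ?F2 z * K z t \<partial>lborel))"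
      by (simp only: Bochner_Integration.integral_add[OF Kint[OF r(1)] Kint[OF r(2)]])
    then have 1: "u (\<lambda>t. \<integral>z. F z * K z t \<partial>lborel) = u (\<lambda>t. \<integral>z. ?F1 z * K z t \<partial>lborel) + u (\<lambda>t. \<integral>z. ?F2 z * K z t \<partial>lborel)"
      using tempered_add[OF u schwartz_integral[OF K r(1)] schwartz_integral[OF K r(2)]] by simp
    have "(\<integral>z. cnj (F z) * u (K z) \<partial>lborel) = (\<integral>z. cnj (?F1 z) * u (K z) + cnj (?F2 z) * u (K z) \<partial>lborel)"
      by (intro Bochner_Integration.integral_cong) auto
    also have "\<dots> = (\<integral>z. cnj (?F1 z) * u (K z) \<partial>lborel) + (\<integral>z. cnj (?F2 z) * u (K z) \<partial>lborel)"
      by (rule Bochner_Integration.integral_add[OF uint[OF r(1)] uint[OF r(2)]])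
    finally show ?thesis using 1 unfolding D_def by simp
  qed

  \<comment> \<open>With \<open>K c\<close> in place of \<open>K z\<close> the exchange is exact by
    antilinearity, since the integral is then a multiple of one fixed function. The defect is that
    of the family \<open>K z - K c\<close>, whose seminorms are at most \<open>e\<close> where
    \<open>F\<close> lives; each of the two terms of the defect contributes
    \<open>C * e\<close>.\<close>
  have D_small: "norm (D F) \<le> 2 * C * e * (\<integral>z. norm (F z) \<partial>lborel)"
    if F: "rapidly_decreasing F" and S: "\<And>z. z \<notin> S \<Longrightarrow> F z = 0"
      and e: "\<And>z k bs t. z \<in> S \<Longrightarrow> k \<le> N \<Longrightarrow> set bs \<subseteq> Basis \<Longrightarrow> length bs \<le> N \<Longrightarrow>
         norm t ^ k * norm (iter_deriv bs (\<lambda>t. K z t - K c t) t) \<le> e" for F S c e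
  proof -
    let ?H = "\<lambda>z t. K z t - K c t"
    have Kc: "schwartz_family (\<lambda>_::'z. K c)" using schwartz_familyD[OF K] by (simp flip: schwartz_iff_family)
    have H: "schwartz_family ?H"
      using schwartz_family_add[OF K schwartz_family_scale[OF poly_bounded_const Kc, of "-1"]] by simp
    have Fi: "integrable lborel F" by (rule rapidly_decreasing_integrable'[OF F])
    have Fn: "integrable lborel (\<lambda>z. norm (F z) * e)" by (intro integrable_mult_left integrable_norm Fi)
    have Hint: "integrable lborel (\<lambda>z. F z * ?H z t)" for t
      using schwartz_family_integrable[OF H F, of "[]"] by simp
    let ?c = "\<integral>z. F z \<partial>lborel"
    have "(\<integral>z. F z * K z t \<partial>lborel) = (\<integral>z. F z * K c t + F z * ?H z t \<partial>lborel)" for t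
      by (intro Bochner_Integration.integral_cong) (auto simp: algebra_simps)
    then have "(\<lambda>t. \<integral>z. F z * K z t \<partial>lborel) = (\<lambda>t. ?c * K c t + (\<integral>z. F z * ?H z t \<partial>lborel))"
      using Hint Fi by (simp only: Bochner_Integration.integral_add integrable_mult_left integral_mult_left_zero)
    then have u1: "u (\<lambda>t. \<integral>z. F z * K z t \<partial>lborel) = cnj ?c * u (K c) + u (\<lambda>t. \<integral>z. F z * ?H z t \<partial>lborel)"
      using tempered_add[OF u schwartz_scale[OF schwartz_familyD[OF K]] schwartz_integral[OF H F]]
        tempered_scale[OF u schwartz_familyD[OF K]] by simp
    have "norm (u (\<lambda>t. \<integral>z. F z * ?H z t \<partial>lborel)) \<le> C * (\<integral>z. norm (F z) * e \<partial>lborel)"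
    proof (rule C(2)[OF schwartz_integral[OF H F]])
      fix k bs and x :: 'a assume k: "k \<le> N" "set bs \<subseteq> (Basis :: 'a set)" "length bs \<le> N"
      show "norm x ^ k * norm (iter_deriv bs (\<lambda>t. \<integral>z. F z * ?H z t \<partial>lborel) x) \<le> (\<integral>z. norm (F z) * e \<partial>lborel)"
        unfolding iter_deriv_integral[OF H F k(2)]
      proof (rule integral_norm_bound_family[OF H F k(2) Fn])
        fix z
        show "norm x ^ k * norm (F z * iter_deriv bs (?H z) x) \<le> norm (F z) * e"
        proof (cases "z \<in> S")
          case True
          then have "norm (F z) * (norm x ^ k * norm (iter_deriv bs (?H z) x)) \<le> norm (F z) * e"
            using e[OF True k] by (intro mult_left_mono) auto
          then show ?thesis by (simp add: norm_mult mult.left_commute)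
        qed (use S in simp)
      qed simp
    qed
    then have b1: "norm (u (\<lambda>t. \<integral>z. F z * ?H z t \<partial>lborel)) \<le> C * e * (\<integral>z. norm (F z) \<partial>lborel)"
      by (simp add: mult_ac)
    have uH: "u (?H z) = u (K z) - u (K c)" for z
      by (rule tempered_diff[OF u schwartz_familyD[OF K] schwartz_familyD[OF K]])
    have uHi: "integrable lborel (\<lambda>z. cnj (F z) * u (?H z))"
      by (rule rapidly_decreasing_integrable_mult[OF rapidly_decreasing_cnj[OF F] tempered_family_poly_bounded[OF u H]])
    have "(\<integral>z. cnj (F z) * u (K z) \<partial>lborel) = (\<integral>z. cnj (F z) * u (K c) + cnj (F z) * u (?H z) \<partial>lborel)"
      unfolding uH by (intro Bochner_Integration.integral_cong) (auto simp: algebra_simps)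
    also have "\<dots> = cnj ?c * u (K c) + (\<integral>z. cnj (F z) * u (?H z) \<partial>lborel)"
      using uHi Fi by (subst Bochner_Integration.integral_add) auto
    finally have u2: "(\<integral>z. cnj (F z) * u (K z) \<partial>lborel) = cnj ?c * u (K c) + (\<integral>z. cnj (F z) * u (?H z) \<partial>lborel)" .
    have "norm (\<integral>z. cnj (F z) * u (?H z) \<partial>lborel) \<le> (\<integral>z. C * (norm (F z) * e) \<partial>lborel)"
    proof (rule Bochner_Integration.integral_norm_bound_integral[OF uHi integrable_mult_right[OF Fn]])
      fix z
      show "norm (cnj (F z) * u (?H z)) \<le> C * (norm (F z) * e)"
      proof (cases "z \<in> S")
        case True
        have "norm (u (?H z)) \<le> C * e" by (rule C(2)[OF schwartz_familyD[OF H] e[OF True]])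
        then have "norm (F z) * norm (u (?H z)) \<le> norm (F z) * (C * e)" by (intro mult_left_mono) auto
        then show ?thesis by (simp add: norm_mult mult_ac)
      qed (use S in simp)
    qed
    then have b2: "norm (\<integral>z. cnj (F z) * u (?H z) \<partial>lborel) \<le> C * e * (\<integral>z. norm (F z) \<partial>lborel)"
      by (simp add: mult_ac)
    have "D F = u (\<lambda>t. \<integral>z. F z * ?H z t \<partial>lborel) - (\<integral>z. cnj (F z) * u (?H z) \<partial>lborel)"
      unfolding D_def u1 u2 by simp
    then have "norm (D F) \<le> C * e * (\<integral>z. norm (F z) \<partial>lborel) + C * e * (\<integral>z. norm (F z) \<partial>lborel)"
      using order_trans[OF norm_triangle_ineq4 add_mono[OF b1 b2]] by simp
    then show ?thesis by simp
  qed

  \<comment> \<open>One set of the cover is split off at a time. The bound is proportional to the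
    integral of \<open>norm (F z)\<close>, which adds up over disjoint pieces, so the constant does
    not depend on the number of sets.\<close>
  have D_cover: "norm (D F) \<le> 2 * C * e * (\<integral>z. norm (F z) \<partial>lborel)"
    if "finite T" "rapidly_decreasing F" "\<And>z. z \<notin> (\<Union>c\<in>T. U c) \<Longrightarrow> F z = 0" "\<And>c. open (U c)"
      "\<And>c z k bs t. z \<in> U c \<Longrightarrow> k \<le> N \<Longrightarrow> set bs \<subseteq> Basis \<Longrightarrow> length bs \<le> N \<Longrightarrow>
         norm t ^ k * norm (iter_deriv bs (\<lambda>t. K z t - K c t) t) \<le> e" for T F U e
    using that(1,2,3)
  proof (induction T arbitrary: F)
    case empty
    then have "F = (\<lambda>z. 0)" by auto
    moreover have "D (\<lambda>z. 0) = 0"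
    proof -
      have "u (\<lambda>_. 0) = 0" using tempered_scale[OF u schwartz_familyD[OF K], of 0] by simp
      then show ?thesis by (simp add: D_def)
    qed
    ultimately show ?case by simp
  next
    case (insert c T)
    let ?F1 = "\<lambda>z. if z \<in> U c then F z else 0" and ?F2 = "\<lambda>z. if z \<in> - U c then F z else 0"
    have S: "U c \<in> sets borel" "- U c \<in> sets borel" using that(4)[of c] by auto
    have "norm (D ?F1) \<le> 2 * C * e * (\<integral>z. norm (?F1 z) \<partial>lborel)"
      by (rule D_small[OF rapidly_decreasing_restrict[OF insert.prems(1) S(1)], of "U c" c]) (use that(5) in auto)
    moreover have "norm (D ?F2) \<le> 2 * C * e * (\<integral>z. norm (?F2 z) \<partial>lborel)"
      by (rule insert.IH[OF rapidly_decreasing_restrict[OF insert.prems(1) S(2)]]) (use insert.prems(2) in auto)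
    moreover have "norm (D F) \<le> norm (D ?F1) + norm (D ?F2)"
      unfolding D_add[OF insert.prems(1) S(1)] by (rule norm_triangle_ineq)
    ultimately have "norm (D F) \<le> 2 * C * e * (\<integral>z. norm (?F1 z) \<partial>lborel) + 2 * C * e * (\<integral>z. norm (?F2 z) \<partial>lborel)"
      by linarith
    then show ?case unfolding rapidly_decreasing_split[OF insert.prems(1) S(1)] distrib_left .
  qed

  obtain M m where M: "0 \<le> M" "\<And>k bs z t. k \<le> N \<Longrightarrow> set bs \<subseteq> Basis \<Longrightarrow> length bs \<le> N \<Longrightarrow>
     norm t ^ k * norm (iter_deriv bs (K z) t) \<le> M * (1 + norm z) ^ m"
    by (rule schwartz_family_uniform_bound[OF K]) blast
  \<comment> \<open>One power more than the growth of the family: outside the ball of radius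
    \<open>R\<close> the spare factor is worth \<open>1 / R\<close>.\<close>
  obtain A where A: "0 \<le> A" "\<And>z. (1 + norm z) ^ Suc m * norm (F z) \<le> A * decay z"
    by (rule rapidly_decreasing_bound[OF F]) blast
  define I where "I = (\<integral>z. decay (z::'z) \<partial>lborel)"
  have D_far: "norm (D (\<lambda>z. if z \<in> - cball 0 R then F z else 0)) \<le> 2 * C * (M * A * I) / R" if R: "0 < R" for R
  proof -
    let ?G = "\<lambda>z. if z \<in> - cball 0 R then F z else 0"
    have G: "rapidly_decreasing ?G" by (rule rapidly_decreasing_restrict[OF F]) auto
    have W: "integrable lborel (\<lambda>z::'z. M * A / R * decay z)" by (rule integrable_mult_right[OF integrable_decay])
    have b: "norm (?G z) * (M * (1 + norm z) ^ m) \<le> M * A / R * decay z" for z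
    proof (cases "norm z \<le> R")
      case True
      then show ?thesis using M A R by auto
    next
      case False
      have "R * ((1 + norm z) ^ m * norm (F z)) \<le> (1 + norm z) * ((1 + norm z) ^ m * norm (F z))"
        using False R by (intro mult_right_mono) auto
      also have "\<dots> \<le> A * decay z" using A(2)[of z] by (simp add: mult.assoc)
      finally have "(1 + norm z) ^ m * norm (F z) \<le> A * decay z / R" using R by (simp add: le_divide_eq mult.commute)
      then have "M * ((1 + norm z) ^ m * norm (F z)) \<le> M * (A * decay z / R)" using M by (intro mult_left_mono) auto
      then show ?thesis using False by (simp add: mult_ac)
    qed
    have "norm (u (\<lambda>t. \<integral>z. ?G z * K z t \<partial>lborel)) \<le> C * (\<integral>z. M * A / R * decay (z::'z) \<partial>lborel)"
    proof (rule C(2)[OF schwartz_integral[OF K G]])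
      fix k bs and x :: 'a assume k: "k \<le> N" "set bs \<subseteq> (Basis :: 'a set)" "length bs \<le> N"
      show "norm x ^ k * norm (iter_deriv bs (\<lambda>t. \<integral>z. ?G z * K z t \<partial>lborel) x) \<le> (\<integral>z. M * A / R * decay (z::'z) \<partial>lborel)"
        unfolding iter_deriv_integral[OF K G k(2)]
      proof (rule integral_norm_bound_family[OF K G k(2) W])
        fix z
        have "norm x ^ k * norm (?G z * iter_deriv bs (K z) x) = norm (?G z) * (norm x ^ k * norm (iter_deriv bs (K z) x))"
          unfolding norm_mult by (simp only: mult_ac)
        also have "\<dots> \<le> norm (?G z) * (M * (1 + norm z) ^ m)" using M(2)[OF k] by (intro mult_left_mono) auto
        also note b
        finally show "norm x ^ k * norm (?G z * iter_deriv bs (K z) x) \<le> M * A / R * decay z" .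
      qed simp
    qed
    moreover have "norm (\<integral>z. cnj (?G z) * u (K z) \<partial>lborel) \<le> (\<integral>z. C * (M * A / R * decay (z::'z)) \<partial>lborel)"
    proof (rule Bochner_Integration.integral_norm_bound_integral[OF uint[OF G] integrable_mult_right[OF W]])
      fix z
      have "norm (u (K z)) \<le> C * (M * (1 + norm z) ^ m)" by (rule C(2)[OF schwartz_familyD[OF K] M(2)])
      then have "norm (?G z) * norm (u (K z)) \<le> norm (?G z) * (C * (M * (1 + norm z) ^ m))" by (intro mult_left_mono) auto
      also have "\<dots> = C * (norm (?G z) * (M * (1 + norm z) ^ m))" by (simp only: mult_ac)
      also have "\<dots> \<le> C * (M * A / R * decay z)" by (intro mult_left_mono b C(1))
      finally show "norm (cnj (?G z) * u (K z)) \<le> C * (M * A / R * decay z)" unfolding norm_mult complex_mod_cnj .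
    qed
    ultimately have "norm (D ?G) \<le> C * (\<integral>z. M * A / R * decay (z::'z) \<partial>lborel) + C * (\<integral>z. M * A / R * decay (z::'z) \<partial>lborel)"
      unfolding D_def integral_mult_right_zero by (intro order_trans[OF norm_triangle_ineq4 add_mono])
    then show ?thesis unfolding integral_mult_right_zero I_def[symmetric] by (simp add: mult_ac)
  qed

  have main: "norm (D F) \<le> 2 * C * e * (\<integral>z. norm (F z) \<partial>lborel) + 2 * C * (M * A * I) * e" if e: "0 < e" for e
  proof -
    \<comment> \<open>Tying the radius to \<open>e\<close> makes the tail term proportional to
      \<open>e\<close> as well.\<close>
    let ?R = "inverse e"
    let ?F1 = "\<lambda>z. if z \<in> cball 0 ?R then F z else 0" and ?F2 = "\<lambda>z. if z \<in> - cball 0 ?R then F z else 0"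
    have "\<forall>c. \<exists>U. open U \<and> c \<in> U \<and> (\<forall>z\<in>U. \<forall>k bs t. k \<le> N \<longrightarrow> set bs \<subseteq> Basis \<longrightarrow> length bs \<le> N \<longrightarrow>
         norm t ^ k * norm (iter_deriv bs (\<lambda>t. K z t - K c t) t) \<le> e)"
    proof
      fix c
      show "\<exists>U. open U \<and> c \<in> U \<and> (\<forall>z\<in>U. \<forall>k bs t. k \<le> N \<longrightarrow> set bs \<subseteq> Basis \<longrightarrow> length bs \<le> N \<longrightarrow>
         norm t ^ k * norm (iter_deriv bs (\<lambda>t. K z t - K c t) t) \<le> e)"
        using schwartz_family_continuous_uniform[OF K e, of N c] by (simp only: eventually_nhds)
    qed
    then obtain U where U: "\<And>c. open (U c)" "\<And>c. c \<in> U c"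
      "\<And>c. \<forall>z\<in>U c. \<forall>k bs t. k \<le> N \<longrightarrow> set bs \<subseteq> Basis \<longrightarrow> length bs \<le> N \<longrightarrow>
         norm t ^ k * norm (iter_deriv bs (\<lambda>t. K z t - K c t) t) \<le> e" by metis
    obtain T where T: "finite T" "cball 0 ?R \<subseteq> (\<Union>c\<in>T. U c)"
    proof (rule compactE_image[of "cball (0::'z) ?R" UNIV U])
      show "cball 0 ?R \<subseteq> (\<Union>c\<in>UNIV. U c)" using U(2) by blast
      show "open (U c)" for c by (rule U(1))
    qed (use that in simp_all)
    have "norm (D ?F1) \<le> 2 * C * e * (\<integral>z. norm (?F1 z) \<partial>lborel)"
    proof (rule D_cover[OF T(1), of _ U])
      show "rapidly_decreasing ?F1" by (rule rapidly_decreasing_restrict[OF F]) auto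
      show "?F1 z = 0" if "z \<notin> (\<Union>c\<in>T. U c)" for z using that T(2) by auto
      show "open (U c)" for c by (rule U(1))
    qed (use U(3) in blast)
    also have "\<dots> \<le> 2 * C * e * (\<integral>z. norm (F z) \<partial>lborel)"
      using rapidly_decreasing_split[OF F, of "cball 0 ?R"] C(1) e by (intro mult_left_mono) auto
    finally have "norm (D ?F1) \<le> 2 * C * e * (\<integral>z. norm (F z) \<partial>lborel)" .
    moreover have "norm (D ?F2) \<le> 2 * C * (M * A * I) * e" using D_far[of ?R] e by (simp add: field_simps)
    moreover have "norm (D F) \<le> norm (D ?F1) + norm (D ?F2)"
      unfolding D_add[OF F borel_closed[OF closed_cball, of 0 ?R]] by (rule norm_triangle_ineq)
    ultimately show ?thesis by linarith
  qed
  have "norm (D F) \<le> 0"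
  proof (rule field_le_epsilon)
    fix e :: real assume e: "0 < e"
    define L where "L = 2 * C * (\<integral>z. norm (F z) \<partial>lborel) + 2 * C * (M * A * I)"
    have "0 \<le> L"
    proof -
      have "0 \<le> I" unfolding I_def by simp
      then show ?thesis unfolding L_def using C(1) M(1) A(1) by simp
    qed
    define e' where "e' = e / (L + 1)"
    have e': "0 < e'" using e \<open>0 \<le> L\<close> by (simp add: e'_def)
    have "2 * C * e' * (\<integral>z. norm (F z) \<partial>lborel) + 2 * C * (M * A * I) * e' = L * e'"
      unfolding L_def by (simp add: algebra_simps)
    then have "norm (D F) \<le> L * e'" using main[OF e'] by simp
    also have "\<dots> \<le> (L + 1) * e'" using e' by (intro mult_right_mono) auto
    also have "\<dots> = e" using \<open>0 \<le> L\<close> by (simp add: e'_def)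
    finally show "norm (D F) \<le> 0 + e" by simp
  qed
  then show ?thesis unfolding D_def by simp
qed

subsection \<open>Affine substitutions and Fubini\<close>

lemma nn_integral_lborel_affine:
  fixes f :: "'a::euclidean_space \<Rightarrow> ennreal"
  assumes [measurable]: "borel_fun f" and c: "c \<noteq> 0"
  shows "(\<integral>\<^sup>+x. f (t + c *\<^sub>R x) \<partial>lborel) = ennreal (1 / \<bar>c\<bar> ^ DIM('a)) * (\<integral>\<^sup>+x. f x \<partial>lborel)"
proof -
  have "(\<integral>\<^sup>+x. f x \<partial>lborel) = (\<integral>\<^sup>+x. ennreal (\<bar>c\<bar> ^ DIM('a)) * f (t + c *\<^sub>R x) \<partial>lborel)"
    by (subst lborel_affine[OF c, of t]) (simp add: nn_integral_density nn_integral_distr)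
  also have "\<dots> = ennreal (\<bar>c\<bar> ^ DIM('a)) * (\<integral>\<^sup>+x. f (t + c *\<^sub>R x) \<partial>lborel)"
    by (simp add: nn_integral_cmult)
  finally have eq: "(\<integral>\<^sup>+x. f x \<partial>lborel) = ennreal (\<bar>c\<bar> ^ DIM('a)) * (\<integral>\<^sup>+x. f (t + c *\<^sub>R x) \<partial>lborel)" .
  have k: "ennreal (1 / \<bar>c\<bar> ^ DIM('a)) * ennreal (\<bar>c\<bar> ^ DIM('a)) = 1"
    using c by (simp add: ennreal_mult'[symmetric])
  show ?thesis unfolding eq mult.assoc[symmetric] k by simp
qed

lemma integral_lborel_affine:
  fixes f :: "'a::euclidean_space \<Rightarrow> complex"
  assumes [measurable]: "borel_fun f" and c: "c \<noteq> 0"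
  shows "(\<integral>x. f x \<partial>lborel) = \<bar>c\<bar> ^ DIM('a) *\<^sub>R (\<integral>x. f (t + c *\<^sub>R x) \<partial>lborel)"
  by (subst lborel_affine[OF c, of t]) (simp add: integral_density integral_distr)

lemma integrable_lborel_affine:
  fixes f :: "'a::euclidean_space \<Rightarrow> complex"
  assumes "integrable lborel f" and c: "c \<noteq> 0"
  shows "integrable lborel (\<lambda>x. f (t + c *\<^sub>R x))"
proof -
  have [measurable]: "borel_fun f" using assms(1) by auto
  have "(\<integral>\<^sup>+x. ennreal (norm (f (t + c *\<^sub>R x))) \<partial>lborel) < \<infinity>"
    using nn_integral_lborel_affine[of "\<lambda>x. ennreal (norm (f x))", OF _ c, of t] assms(1)
    unfolding integrable_iff_bounded by (simp add: ennreal_mult_less_top)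
  then show ?thesis unfolding integrable_iff_bounded by simp
qed

lemma integral_translate:
  fixes f :: "'a::euclidean_space \<Rightarrow> complex"
  assumes "borel_fun f"
  shows "(\<integral>x. f (x + t) \<partial>lborel) = (\<integral>x. f x \<partial>lborel)"
  using integral_lborel_affine[OF assms, of 1 t] by (simp add: add.commute)

lemma integral_reflect:
  fixes f :: "'a::euclidean_space \<Rightarrow> complex"
  assumes "borel_fun f"
  shows "(\<integral>x. f (t - x) \<partial>lborel) = (\<integral>x. f x \<partial>lborel)"
  using integral_lborel_affine[OF assms, of "-1" t] by simp

lemma lborel_Fubini:
  fixes f :: "'a::euclidean_space \<times> 'b::euclidean_space \<Rightarrow> complex"
  assumes "integrable lborel f"
  shows "(\<integral>z. f z \<partial>lborel) = (\<integral>x. \<integral>y. f (x, y) \<partial>lborel \<partial>lborel)"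
    and "(\<integral>z. f z \<partial>lborel) = (\<integral>y. \<integral>x. f (x, y) \<partial>lborel \<partial>lborel)"
proof -
  have f: "integrable (lborel \<Otimes>\<^sub>M lborel) (\<lambda>(x, y). f (x, y))" using assms by (simp add: lborel_prod)
  show "(\<integral>z. f z \<partial>lborel) = (\<integral>x. \<integral>y. f (x, y) \<partial>lborel \<partial>lborel)"
    using lborel_pair.integral_fst[OF f] by (simp add: lborel_prod)
  show "(\<integral>z. f z \<partial>lborel) = (\<integral>y. \<integral>x. f (x, y) \<partial>lborel \<partial>lborel)"
    using lborel_pair.integral_snd[OF f] by (simp add: lborel_prod)
qed

lemma integrable_tensor:
  fixes g :: "'a::euclidean_space \<Rightarrow> real" and h :: "'b::euclidean_space \<Rightarrow> real"
  assumes g: "integrable lborel g" and h: "integrable lborel h"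
  shows "integrable lborel (\<lambda>z. g (fst z) * h (snd z))"
proof -
  have [measurable]: "borel_fun g" "borel_fun h" using g h by auto
  have "integrable (lborel \<Otimes>\<^sub>M lborel) (\<lambda>z. g (fst z) * h (snd z))"
  proof (rule lborel_pair.Fubini_integrable)
    show "integrable lborel (\<lambda>x. \<integral>y. norm (g (fst (x, y)) * h (snd (x, y))) \<partial>lborel)"
      using g h by (simp add: norm_mult abs_mult)
    show "AE x in lborel. integrable lborel (\<lambda>y. g (fst (x, y)) * h (snd (x, y)))"
      using h by simp
  qed measurable
  then show ?thesis by (simp add: lborel_prod)
qed

lemma integrable_pairI:
  fixes F :: "'a::euclidean_space \<times> 'b::euclidean_space \<Rightarrow> complex"
  assumes "borel_fun F" "integrable lborel g" "integrable lborel h"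
    and "\<And>x y. norm (F (x, y)) \<le> g x * h y"
  shows "integrable lborel F"
proof (rule Bochner_Integration.integrable_bound[OF integrable_tensor[OF assms(2,3)]])
  show "AE z in lborel. norm (F z) \<le> norm (g (fst z) * h (snd z))"
    using assms(4) by (auto intro!: AE_I2 order_trans[OF _ abs_ge_self])
qed (use assms(1) in simp)

subsection \<open>Gaussians and Fourier inversion\<close>

text \<open>The substitution \<open>s = x / sqrt (2 * pi)\<close> turns the integrand into a
  multiple of the standard normal density times a character, so the value is read off the
  characteristic function of the normal distribution.\<close>

lemma fourier_gauss_real:
  "integrable lborel (\<lambda>s. cis (2 * pi * (\<xi> * s)) * of_real (exp (- pi * s\<^sup>2)))" (is "integrable _ ?f")
  "(\<integral>s. cis (2 * pi * (\<xi> * s)) * of_real (exp (- pi * s\<^sup>2)) \<partial>lborel) = of_real (exp (- pi * \<xi>\<^sup>2))"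
proof -
  define c where "c = 1 / sqrt (2 * pi)"
  have c: "c \<noteq> 0" "0 < c" by (auto simp: c_def)
  have c2: "pi * (c * x)\<^sup>2 = x\<^sup>2 / 2" for x by (simp add: c_def power_mult_distrib power_divide)
  have cx: "2 * pi * (\<xi> * (c * x)) = sqrt (2 * pi) * \<xi> * x" for x
  proof -
    have "2 * pi * c = sqrt (2 * pi)" unfolding c_def by (simp add: real_div_sqrt)
    then show ?thesis by (metis mult.assoc mult.left_commute)
  qed
  have fm: "borel_fun ?f"
    by (intro borel_measurable_continuous_onI continuous_intros)
  have g: "?f (0 + c *\<^sub>R x) = (sqrt (2 * pi)) *\<^sub>R (std_normal_density x *\<^sub>R iexp (sqrt (2 * pi) * \<xi> * x))" for x
  proof -
    have z: "0 + c *\<^sub>R x = c * x" and e: "- pi * (c * x)\<^sup>2 = - x\<^sup>2 / 2" using c2[of x] by auto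
    show ?thesis unfolding z e cx std_normal_density_def
      by (simp add: cis_conv_exp scaleR_conv_of_real del: of_real_exp)
  qed
  have i: "integrable lborel (\<lambda>x. std_normal_density x *\<^sub>R iexp (sqrt (2 * pi) * \<xi> * x))"
    by (rule Bochner_Integration.integrable_bound[OF integrable_normal_density[of 1 0]]) auto
  have "integrable lborel (\<lambda>x. ?f (0 + c *\<^sub>R x))" unfolding g by (intro integrable_scaleR_right i)
  from integrable_lborel_affine[OF this, of "1 / c" 0] show "integrable lborel ?f"
    using c by simp
  have "(\<integral>s. ?f s \<partial>lborel) = c *\<^sub>R (\<integral>x. ?f (0 + c *\<^sub>R x) \<partial>lborel)"
    using integral_lborel_affine[OF fm c(1), of 0] c by simp
  also have "\<dots> = (c * sqrt (2 * pi)) *\<^sub>R (\<integral>x. std_normal_density x *\<^sub>R iexp (sqrt (2 * pi) * \<xi> * x) \<partial>lborel)"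
    unfolding g Bochner_Integration.integral_scaleR_right by simp
  also have "(\<integral>x. std_normal_density x *\<^sub>R iexp (sqrt (2 * pi) * \<xi> * x) \<partial>lborel) = char std_normal_distribution (sqrt (2 * pi) * \<xi>)"
    unfolding char_def by (subst integral_density) (auto simp: mult.assoc)
  also have "\<dots> = of_real (exp (- pi * \<xi>\<^sup>2))"
    unfolding char_std_normal_distribution by (simp add: power_mult_distrib)
  also have "c * sqrt (2 * pi) = 1" by (simp add: c_def)
  finally show "(\<integral>s. ?f s \<partial>lborel) = of_real (exp (- pi * \<xi>\<^sup>2))" by simp
qed

lemma norm_square_sum: "(norm x)\<^sup>2 = (\<Sum>b\<in>Basis. (x \<bullet> b)\<^sup>2)"
  unfolding power2_norm_eq_inner by (subst euclidean_inner) (simp add: power2_eq_square)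

lemma fourier_exp_norm:
  fixes \<xi> :: "'a::euclidean_space"
  shows "integrable lborel (\<lambda>t. cis (2 * pi * (\<xi> \<bullet> t)) * of_real (exp (- pi * (norm t)\<^sup>2)))"
    and "(\<integral>t. cis (2 * pi * (\<xi> \<bullet> t)) * of_real (exp (- pi * (norm t)\<^sup>2)) \<partial>lborel) = of_real (exp (- pi * (norm \<xi>)\<^sup>2))"
proof -
  have cs: "cis (\<Sum>b\<in>A. f b) = (\<Prod>b\<in>A. cis (f b))" for A :: "'a set" and f
    by (induction A rule: infinite_finite_induct) (auto simp: cis_mult[symmetric])
  have e: "of_real (exp (- pi * (norm t)\<^sup>2)) = (\<Prod>b\<in>Basis. complex_of_real (exp (- pi * (t \<bullet> b)\<^sup>2)))" for t :: 'a
    by (simp add: norm_square_sum sum_distrib_left exp_sum sum_negf[symmetric])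
  have c: "cis (2 * pi * (\<xi> \<bullet> t)) = (\<Prod>b\<in>Basis. cis (2 * pi * ((\<xi> \<bullet> b) * (t \<bullet> b))))" for t
    by (subst euclidean_inner) (simp add: sum_distrib_left cs)
  note f = fourier_gauss_real(1)[of "\<xi> \<bullet> b" for b]
  show "integrable lborel (\<lambda>t. cis (2 * pi * (\<xi> \<bullet> t)) * of_real (exp (- pi * (norm t)\<^sup>2)))"
    unfolding e c prod.distrib[symmetric]
    by (rule integrable_prod_Basis(1)[where f = "\<lambda>b s. cis (2 * pi * ((\<xi> \<bullet> b) * s)) * of_real (exp (- pi * s\<^sup>2))"]) (rule f)
  have "(\<integral>t. cis (2 * pi * (\<xi> \<bullet> t)) * of_real (exp (- pi * (norm t)\<^sup>2)) \<partial>lborel)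
    = (\<Prod>b\<in>Basis. \<integral>s. cis (2 * pi * ((\<xi> \<bullet> b) * s)) * of_real (exp (- pi * s\<^sup>2)) \<partial>lborel)"
    unfolding e c prod.distrib[symmetric]
    by (rule integrable_prod_Basis(2)[where f = "\<lambda>b s. cis (2 * pi * ((\<xi> \<bullet> b) * s)) * of_real (exp (- pi * s\<^sup>2))"]) (rule f)
  then show "(\<integral>t. cis (2 * pi * (\<xi> \<bullet> t)) * of_real (exp (- pi * (norm t)\<^sup>2)) \<partial>lborel) = of_real (exp (- pi * (norm \<xi>)\<^sup>2))"
    unfolding fourier_gauss_real(2) e .
qed

lemma fourier_gauss:
  "(\<integral>t. cis (2 * pi * (\<xi> \<bullet> t)) * gauss t \<partial>lborel) = gauss (\<xi> :: 'a::euclidean_space)"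
proof -
  have "(\<integral>t. cis (2 * pi * (\<xi> \<bullet> t)) * gauss t \<partial>lborel)
    = (\<integral>t. of_real (2 powr (real DIM('a) / 4)) * (cis (2 * pi * (\<xi> \<bullet> t)) * of_real (exp (- pi * (norm t)\<^sup>2))) \<partial>(lborel :: 'a measure))"
    by (intro Bochner_Integration.integral_cong) (auto simp: gauss_def)
  then show ?thesis by (simp only: integral_mult_right_zero fourier_exp_norm(2)) (simp add: gauss_def)
qed

text \<open>Scaling by \<open>1 / sqrt 2\<close> turns the squared Gaussian into a multiple of
  \<open>exp (- pi * (norm x)\<^sup>2)\<close>, whose integral is 1; the constant in
  \<open>gauss\<close> is the one that compensates the Jacobian.\<close>

lemma gauss_norm: "(\<integral>t. gauss t * cnj (gauss t) \<partial>(lborel :: 'a::euclidean_space measure)) = 1"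
proof -
  define c where "c = 1 / sqrt 2"
  have c: "c \<noteq> 0" "0 < c" by (auto simp: c_def)
  let ?e = "\<lambda>t::'a. complex_of_real (exp (- pi * (norm t)\<^sup>2))"
  have m: "(\<lambda>t. gauss t * cnj (gauss t)) \<in> borel_measurable (borel :: 'a measure)"
    using schwartz_measurable[OF schwartz_gauss] by (intro borel_measurable_times borel_measurable_cnj) auto
  have g: "gauss (0 + c *\<^sub>R x) * cnj (gauss (0 + c *\<^sub>R x)) = of_real (2 powr (real DIM('a) / 2)) * ?e x" for x :: 'a
  proof -
    have e: "exp (- pi * (norm (c *\<^sub>R x))\<^sup>2) * exp (- pi * (norm (c *\<^sub>R x))\<^sup>2) = exp (- pi * (norm x)\<^sup>2)"
      unfolding exp_add[symmetric] by (simp add: c_def power_mult_distrib power_divide)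
    have p: "2 powr (real DIM('a) / 4) * 2 powr (real DIM('a) / 4) = 2 powr (real DIM('a) / 2)"
      unfolding powr_add[symmetric] by simp
    have "gauss (c *\<^sub>R x) * cnj (gauss (c *\<^sub>R x))
      = of_real ((2 powr (real DIM('a) / 4) * 2 powr (real DIM('a) / 4)) * (exp (- pi * (norm (c *\<^sub>R x))\<^sup>2) * exp (- pi * (norm (c *\<^sub>R x))\<^sup>2)))"
      unfolding gauss_def complex_cnj_complex_of_real of_real_mult[symmetric] by (simp only: mult_ac)
    then show ?thesis unfolding e p by simp
  qed
  have "(\<integral>t. ?e t \<partial>lborel) = 1" using fourier_exp_norm(2)[of "0::'a"] by simp
  then have "(\<integral>t. gauss t * cnj (gauss t) \<partial>(lborel :: 'a measure)) = c ^ DIM('a) *\<^sub>R of_real (2 powr (real DIM('a) / 2))"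
    using c unfolding integral_lborel_affine[OF m c(1), of 0] g integral_mult_right_zero by simp
  also have "\<dots> = 1"
  proof -
    have "2 powr (real DIM('a) / 2) = sqrt 2 ^ DIM('a)"
      by (simp add: powr_half_sqrt[symmetric] powr_power)
    then show ?thesis by (simp add: c_def power_divide scaleR_conv_of_real)
  qed
  finally show ?thesis .
qed

text \<open>Gaussian regularisation. The regularised integral \<open>A n\<close> tends to the left
  side by dominated convergence, for which \<open>hhat\<close> supplies the majorant. By Fubini and
  the Fourier transform of the Gaussian it is also an average of \<open>h\<close> around
  \<open>t\<close> at scale \<open>1 / Suc n\<close>, which tends to \<open>h t\<close> by
  continuity and boundedness.\<close>

lemma fourier_inversion:
  fixes h :: "'a::euclidean_space \<Rightarrow> complex"
  assumes h: "integrable lborel h" and hc: "continuous_on UNIV h" and hb: "\<And>s. norm (h s) \<le> B"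
    and hhat: "integrable lborel (\<lambda>\<xi>. \<integral>s. h s * cis (- 2 * pi * (\<xi> \<bullet> s)) \<partial>lborel)"
  shows "(\<integral>\<xi>. (\<integral>s. h s * cis (- 2 * pi * (\<xi> \<bullet> s)) \<partial>lborel) * cis (2 * pi * (\<xi> \<bullet> t)) \<partial>lborel) = h t"
proof -
  let ?H = "\<lambda>\<xi>. \<integral>s. h s * cis (- 2 * pi * (\<xi> \<bullet> s)) \<partial>lborel"
  let ?e = "\<lambda>x::'a. complex_of_real (exp (- pi * (norm x)\<^sup>2))"
  define A where "A n = (\<integral>\<xi>. ?H \<xi> * cis (2 * pi * (\<xi> \<bullet> t)) * ?e ((1 / real (Suc n)) *\<^sub>R \<xi>) \<partial>lborel)" for n
  have cism: "borel_fun (\<lambda>\<xi>::'a. cis (c * (\<xi> \<bullet> t)))" for c t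
    by (intro borel_measurable_continuous_onI continuous_intros)
  have em: "borel_fun ?e"
    by (intro borel_measurable_continuous_onI continuous_intros)
  have ec: "isCont ?e x" for x by (intro continuous_intros)
  have ei: "integrable lborel ?e" using fourier_exp_norm(1)[of "0::'a"] by simp
  have n: "1 / real (Suc n) \<noteq> 0" for n by simp
  have esm: "borel_fun (\<lambda>\<xi>. ?e ((1 / real (Suc n)) *\<^sub>R \<xi>))" for n
    by (intro borel_measurable_continuous_onI continuous_intros)
  have esi: "integrable lborel (\<lambda>\<xi>. ?e ((1 / real (Suc n)) *\<^sub>R \<xi>))" for n
    using integrable_lborel_affine[OF ei n, of 0] by simp
  have hm: "borel_fun h" using h by auto
  have Hm: "borel_fun ?H" using hhat by auto
  have lim0: "(\<lambda>n. 1 / real (Suc n)) \<longlonglongrightarrow> 0" using LIMSEQ_inverse_real_of_nat by (simp add: inverse_eq_divide)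
  have "A \<longlonglongrightarrow> (\<integral>\<xi>. ?H \<xi> * cis (2 * pi * (\<xi> \<bullet> t)) \<partial>lborel)"
    unfolding A_def
  proof (rule integral_dominated_convergence[where w = "\<lambda>\<xi>. norm (?H \<xi>)"])
    show "AE \<xi> in lborel. (\<lambda>n. ?H \<xi> * cis (2 * pi * (\<xi> \<bullet> t)) * ?e ((1 / real (Suc n)) *\<^sub>R \<xi>)) \<longlonglongrightarrow> ?H \<xi> * cis (2 * pi * (\<xi> \<bullet> t))"
    proof (rule AE_I2)
      fix \<xi> :: 'a
      have "(\<lambda>n. (1 / real (Suc n)) *\<^sub>R \<xi>) \<longlonglongrightarrow> 0"
        using tendsto_scaleR[OF lim0 tendsto_const[of \<xi>]] by simp
      from isCont_tendsto_compose[OF ec this] have "(\<lambda>n. ?e ((1 / real (Suc n)) *\<^sub>R \<xi>)) \<longlonglongrightarrow> 1" by simp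
      from tendsto_mult[OF tendsto_const this]
      show "(\<lambda>n. ?H \<xi> * cis (2 * pi * (\<xi> \<bullet> t)) * ?e ((1 / real (Suc n)) *\<^sub>R \<xi>)) \<longlonglongrightarrow> ?H \<xi> * cis (2 * pi * (\<xi> \<bullet> t))" by simp
    qed
    show "AE \<xi> in lborel. norm (?H \<xi> * cis (2 * pi * (\<xi> \<bullet> t)) * ?e ((1 / real (Suc n)) *\<^sub>R \<xi>)) \<le> norm (?H \<xi>)" for n
      by (intro AE_I2) (simp add: norm_mult mult_left_le)
    show "integrable lborel (\<lambda>\<xi>. norm (?H \<xi>))" using hhat by (rule integrable_norm)
  qed (use Hm cism esm in \<open>auto intro!: borel_measurable_times\<close>)
  moreover have "A \<longlonglongrightarrow> h t"
  proof -
    have A: "A n = (\<integral>s. h (t - (1 / real (Suc n)) *\<^sub>R s) * ?e s \<partial>lborel)" for n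
    proof -
      let ?n = "real (Suc n)"
      let ?F = "\<lambda>z::'a \<times> 'a. h (snd z) * cis (2 * pi * (fst z \<bullet> (t - snd z))) * ?e ((1 / ?n) *\<^sub>R fst z)"
      have F: "integrable lborel ?F"
      proof (rule integrable_pairI)
        have "borel_fun (\<lambda>z::'a\<times>'a. cis (2 * pi * (fst z \<bullet> (t - snd z))))"
          "borel_fun (\<lambda>z::'a\<times>'a. ?e ((1 / ?n) *\<^sub>R fst z))"
          by (intro borel_measurable_continuous_onI continuous_intros)+
        moreover have "borel_fun (\<lambda>z::'a\<times>'a. h (snd z))"
          by (intro borel_measurable_continuous_onI continuous_on_compose2[OF hc]) (auto intro: continuous_intros)
        ultimately show "borel_fun ?F" by (intro borel_measurable_times)
        show "integrable lborel (\<lambda>\<xi>. norm (?e ((1 / ?n) *\<^sub>R \<xi>)))" "integrable lborel (\<lambda>s. norm (h s))"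
          using integrable_norm[OF esi] integrable_norm[OF h] by auto
      qed (simp add: norm_mult)
      have "A n = (\<integral>\<xi>. \<integral>s. ?F (\<xi>, s) \<partial>lborel \<partial>lborel)"
        unfolding A_def
      proof (intro Bochner_Integration.integral_cong refl)
        fix \<xi> :: 'a
        have "?F (\<xi>, s) = (h s * cis (- 2 * pi * (\<xi> \<bullet> s))) * (cis (2 * pi * (\<xi> \<bullet> t)) * ?e ((1 / ?n) *\<^sub>R \<xi>))" for s
        proof -
          have "cis (2 * pi * (\<xi> \<bullet> (t - s))) = cis (- 2 * pi * (\<xi> \<bullet> s)) * cis (2 * pi * (\<xi> \<bullet> t))"
            unfolding cis_mult by (simp add: inner_diff_right algebra_simps)
          then show ?thesis by simp
        qed
        then have "(\<integral>s. ?F (\<xi>, s) \<partial>lborel)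
            = (\<integral>s. (h s * cis (- 2 * pi * (\<xi> \<bullet> s))) * (cis (2 * pi * (\<xi> \<bullet> t)) * ?e ((1 / ?n) *\<^sub>R \<xi>)) \<partial>lborel)"
          by (intro Bochner_Integration.integral_cong refl)
        also have "\<dots> = ?H \<xi> * (cis (2 * pi * (\<xi> \<bullet> t)) * ?e ((1 / ?n) *\<^sub>R \<xi>))"
          by (rule integral_mult_left_zero)
        finally show "?H \<xi> * cis (2 * pi * (\<xi> \<bullet> t)) * ?e ((1 / ?n) *\<^sub>R \<xi>) = (\<integral>s. ?F (\<xi>, s) \<partial>lborel)"
          by (simp only: mult.assoc)
      qed
      also have "\<dots> = (\<integral>s. \<integral>\<xi>. ?F (\<xi>, s) \<partial>lborel \<partial>lborel)"
        using lborel_Fubini[OF F] by simp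
      also have "\<dots> = (\<integral>s. h s * (?n ^ DIM('a) *\<^sub>R ?e (?n *\<^sub>R (t - s))) \<partial>lborel)"
      proof (intro Bochner_Integration.integral_cong refl)
        fix s
        let ?g = "\<lambda>\<xi>. cis (2 * pi * (\<xi> \<bullet> (t - s))) * ?e ((1 / ?n) *\<^sub>R \<xi>)"
        have gm: "borel_fun ?g"
          by (intro borel_measurable_times cism esm)
        have "(\<integral>\<xi>. ?g \<xi> \<partial>lborel) = ?n ^ DIM('a) *\<^sub>R (\<integral>\<xi>. ?g (0 + ?n *\<^sub>R \<xi>) \<partial>lborel)"
          using integral_lborel_affine[OF gm, of ?n 0] by simp
        also have "(\<lambda>\<xi>. ?g (0 + ?n *\<^sub>R \<xi>)) = (\<lambda>\<xi>. cis (2 * pi * ((?n *\<^sub>R (t - s)) \<bullet> \<xi>)) * ?e \<xi>)"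
          by (simp add: inner_commute)
        finally have "(\<integral>\<xi>. ?g \<xi> \<partial>lborel) = ?n ^ DIM('a) *\<^sub>R ?e (?n *\<^sub>R (t - s))"
          by (simp only: fourier_exp_norm(2))
        then show "(\<integral>\<xi>. ?F (\<xi>, s) \<partial>lborel) = h s * (?n ^ DIM('a) *\<^sub>R ?e (?n *\<^sub>R (t - s)))"
          by (simp only: fst_conv snd_conv mult.assoc integral_mult_right_zero)
      qed
      \<comment> \<open>The approximate identity is rescaled so that the Gaussian stays fixed and
        only the argument of \<open>h\<close> moves; the Jacobian cancels the power of
        \<open>?n\<close>.\<close>
      also have "\<dots> = (\<integral>s. h (t - (1 / ?n) *\<^sub>R s) * ?e s \<partial>lborel)"
      proof -
        let ?G = "\<lambda>s. h s * (?n ^ DIM('a) *\<^sub>R ?e (?n *\<^sub>R (t - s)))"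
        have G: "borel_fun ?G"
          by (intro borel_measurable_times hm borel_measurable_continuous_onI continuous_intros)
        have "(\<integral>s. ?G s \<partial>lborel) = \<bar>- (1 / ?n)\<bar> ^ DIM('a) *\<^sub>R (\<integral>s. ?G (t + (- (1 / ?n)) *\<^sub>R s) \<partial>lborel)"
          by (rule integral_lborel_affine[OF G]) simp
        also have "\<dots> = (\<integral>s. \<bar>- (1 / ?n)\<bar> ^ DIM('a) *\<^sub>R ?G (t + (- (1 / ?n)) *\<^sub>R s) \<partial>lborel)" by simp
        also have "\<dots> = (\<integral>s. h (t - (1 / ?n) *\<^sub>R s) * ?e s \<partial>lborel)"
        proof (intro Bochner_Integration.integral_cong refl)
          fix s :: 'a
          have "\<bar>- (1 / ?n)\<bar> ^ DIM('a) * ?n ^ DIM('a) = 1" by (simp add: power_mult_distrib[symmetric])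
          moreover have "?n *\<^sub>R (t - (t + (- (1 / ?n)) *\<^sub>R s)) = s" by simp
          ultimately show "\<bar>- (1 / ?n)\<bar> ^ DIM('a) *\<^sub>R ?G (t + (- (1 / ?n)) *\<^sub>R s) = h (t - (1 / ?n) *\<^sub>R s) * ?e s"
            by (simp only: mult_scaleR_right scaleR_scaleR scaleR_one) simp
        qed
        finally show ?thesis .
      qed
      finally show ?thesis .
    qed
    have "(\<lambda>n. \<integral>s. h (t - (1 / real (Suc n)) *\<^sub>R s) * ?e s \<partial>lborel) \<longlonglongrightarrow> (\<integral>s. h t * ?e s \<partial>lborel)"
    proof (rule integral_dominated_convergence[where w = "\<lambda>s. B * norm (?e s)"])
      show "AE s in lborel. (\<lambda>n. h (t - (1 / real (Suc n)) *\<^sub>R s) * ?e s) \<longlonglongrightarrow> h t * ?e s"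
      proof (rule AE_I2)
        fix s :: 'a
        have "(\<lambda>n. t - (1 / real (Suc n)) *\<^sub>R s) \<longlonglongrightarrow> t - 0"
          using tendsto_scaleR[OF lim0 tendsto_const[of s]] by (intro tendsto_diff tendsto_const) simp
        moreover have "isCont h t" using hc by (simp add: continuous_on_eq_continuous_at)
        ultimately have "(\<lambda>n. h (t - (1 / real (Suc n)) *\<^sub>R s)) \<longlonglongrightarrow> h t"
          using isCont_tendsto_compose by fastforce
        then show "(\<lambda>n. h (t - (1 / real (Suc n)) *\<^sub>R s) * ?e s) \<longlonglongrightarrow> h t * ?e s" by (intro tendsto_mult tendsto_const)
      qed
      show "AE s in lborel. norm (h (t - (1 / real (Suc n)) *\<^sub>R s) * ?e s) \<le> B * norm (?e s)" for n
        unfolding norm_mult by (intro AE_I2 mult_right_mono hb) simp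
      show "integrable lborel (\<lambda>s. B * norm (?e s))" by (intro integrable_mult_right integrable_norm ei)
      show "(\<lambda>s. h t * ?e s) \<in> borel_measurable lborel" using em by simp
      have "borel_fun (\<lambda>s. h (t - (1 / real (Suc n)) *\<^sub>R s))" for n
        by (intro borel_measurable_continuous_onI continuous_on_compose2[OF hc]) (auto intro!: continuous_intros)
      then show "(\<lambda>s. h (t - (1 / real (Suc n)) *\<^sub>R s) * ?e s) \<in> borel_measurable lborel" for n
        using em by simp
    qed
    moreover have "(\<integral>s. ?e s \<partial>lborel) = 1" using fourier_exp_norm(2)[of "0::'a"] by simp
    ultimately show ?thesis unfolding A by simp
  qed
  ultimately show ?thesis by (rule LIMSEQ_unique)
qed

subsection \<open>The short-time Fourier transform of Schwartz functions\<close>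

text \<open>Peetre's inequality for the weight: a decaying bound can be recentred at polynomial
  cost.\<close>

lemma decay_shift:
  fixes x y :: "'a::euclidean_space"
  shows "decay (x + y) \<le> (1 + norm y) ^ (2 * DIM('a)) * decay x"
proof -
  have "1 + norm x \<le> (1 + norm (x + y)) * (1 + norm y)"
    using one_plus_norm_add_le[of "x + y" "- y"] by simp
  then have "(1 + norm x) ^ (2 * DIM('a)) \<le> ((1 + norm (x + y)) * (1 + norm y)) ^ (2 * DIM('a))"
    by (intro power_mono) auto
  then have "(1 + norm x) ^ (2 * DIM('a)) * (decay x * decay (x + y))
     \<le> ((1 + norm (x + y)) ^ (2 * DIM('a)) * (1 + norm y) ^ (2 * DIM('a))) * (decay x * decay (x + y))"
    unfolding power_mult_distrib by (intro mult_right_mono) auto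
  moreover have "(1 + norm x) ^ (2 * DIM('a)) * (decay x * decay (x + y)) = decay (x + y)"
    using decay_cancel[of x] by (simp only: mult.assoc[symmetric] mult_1_left)
  moreover have "((1 + norm (x + y)) ^ (2 * DIM('a)) * (1 + norm y) ^ (2 * DIM('a))) * (decay x * decay (x + y))
     = (1 + norm y) ^ (2 * DIM('a)) * decay x * ((1 + norm (x + y)) ^ (2 * DIM('a)) * decay (x + y))"
    by (simp only: mult_ac)
  ultimately show ?thesis unfolding decay_cancel by simp
qed

lemma le_decayI:
  assumes "(1 + norm z) ^ (2 * DIM('a)) * c \<le> C"
  shows "c \<le> C * decay (z :: 'a::euclidean_space)"
proof -
  have "c = ((1 + norm z) ^ (2 * DIM('a)) * decay z) * c" by (simp only: decay_cancel mult_1_left)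
  also have "\<dots> = ((1 + norm z) ^ (2 * DIM('a)) * c) * decay z" by (simp only: mult_ac)
  also have "\<dots> \<le> C * decay z" using assms by (intro mult_right_mono) auto
  finally show ?thesis .
qed

text \<open>The integral of \<open>h (z + s *\<^sub>R b)\<close> does not depend on \<open>s\<close>
  by translation invariance; differentiating under the integral at \<open>s = 0\<close> gives the
  claim. \<open>W\<close> dominates the shifted derivatives for all \<open>s\<close> of absolute
  value below 1.\<close>

lemma integral_partial_derivative:
  fixes h :: "'a::euclidean_space \<Rightarrow> complex"
  assumes h: "integrable lborel h" and der: "\<And>t. (h has_derivative h' t) (at t)"
    and bd: "\<And>t v. norm (h' t v) \<le> A * decay t * norm v" and A: "0 \<le> A"
    and meas: "\<And>v. borel_fun (\<lambda>t. h' t v)"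
  shows "(\<integral>t. h' t b \<partial>lborel) = 0"
proof -
  have hm: "borel_fun h" using h by auto
  define W where "W z = (A * (1 + norm b) ^ (2 * DIM('a)) * norm b) * decay z" for z :: 'a
  have "((\<lambda>s::real. \<integral>z. h (z + s *\<^sub>R b) \<partial>lborel) has_derivative (\<lambda>r. \<integral>z. h' (z + 0 *\<^sub>R b) (r *\<^sub>R b) \<partial>lborel)) (at 0)"
  proof (rule has_derivative_integral)
    show "integrable lborel (\<lambda>z. h (z + s *\<^sub>R b))" for s
      using integrable_lborel_affine[OF h, of 1 "s *\<^sub>R b"] by (simp add: add.commute)
    show "((\<lambda>s. h (z + s *\<^sub>R b)) has_derivative (\<lambda>r. h' (z + s *\<^sub>R b) (r *\<^sub>R b))) (at s)" for z s
      by (rule has_derivative_compose[OF _ der]) (auto intro!: derivative_eq_intros)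
    show "norm (h' (z + s *\<^sub>R b) (r *\<^sub>R b)) \<le> W z * norm r" if "dist s 0 < 1" for z s r
    proof -
      have "norm (s *\<^sub>R b) \<le> norm b" using that by (simp add: mult_left_le_one_le)
      then have "decay (z + s *\<^sub>R b) \<le> (1 + norm b) ^ (2 * DIM('a)) * decay z"
        by (intro order_trans[OF decay_shift] mult_right_mono power_mono) auto
      then have "A * decay (z + s *\<^sub>R b) * norm (r *\<^sub>R b) \<le> A * ((1 + norm b) ^ (2 * DIM('a)) * decay z) * norm (r *\<^sub>R b)"
        using A by (intro mult_right_mono mult_left_mono) auto
      also have "\<dots> = W z * norm r" by (simp add: W_def mult_ac)
      finally show ?thesis using bd[of "z + s *\<^sub>R b" "r *\<^sub>R b"] by linarith
    qed
    show "integrable lborel W" unfolding W_def by (rule integrable_mult_right[OF integrable_decay])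
    show "(\<lambda>z. h' (z + 0 *\<^sub>R b) (r *\<^sub>R b)) \<in> borel_measurable lborel" for r
      using meas by simp
  qed
  moreover have "(\<lambda>s::real. \<integral>z. h (z + s *\<^sub>R b) \<partial>lborel) = (\<lambda>s. \<integral>z. h z \<partial>lborel)"
    using integral_translate[OF hm] by simp
  ultimately have "((\<lambda>s::real. \<integral>z. h z \<partial>lborel) has_derivative (\<lambda>r. \<integral>z. h' (z + 0 *\<^sub>R b) (r *\<^sub>R b) \<partial>lborel)) (at 0)"
    by simp
  from has_derivative_unique[OF this has_derivative_const] have "(\<integral>z. h' (z + 0 *\<^sub>R b) (1 *\<^sub>R b) \<partial>lborel) = 0"
    by metis
  then show ?thesis by simp
qed

lemma schwartz_decay_bound:
  assumes "schwartz (f :: 'a::euclidean_space \<Rightarrow> complex)"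
  obtains C where "0 \<le> C" "\<And>t. norm (f t) \<le> C * decay t"
proof -
  obtain C where "0 \<le> C" "\<And>t. (1 + norm t) ^ (2 * DIM('a)) * norm (f t) \<le> C"
    by (rule schwartz_bound[OF assms, where k = "2 * DIM('a)"]) blast
  then show ?thesis using that le_decayI by blast
qed

lemma schwartz_integrable: "schwartz f \<Longrightarrow> integrable lborel f"
proof -
  assume f: "schwartz f"
  then obtain C where C: "0 \<le> C" "\<And>t. norm (f t) \<le> C * decay t" by (rule schwartz_decay_bound) blast
  have "integrable lborel (\<lambda>t. C * decay t)" by (rule integrable_mult_right[OF integrable_decay])
  then show ?thesis
    by (rule Bochner_Integration.integrable_bound) (use C schwartz_measurable[OF f] in auto)
qed

lemma schwartz_bounded:
  assumes "schwartz f" obtains B where "0 \<le> B" "\<And>t. norm (f t) \<le> B"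
  by (rule schwartz_bound[OF assms, where k = 0]) (use that in auto)

lemma schwartz_bounded_mult_integrable:
  assumes f: "schwartz f" and g: "borel_fun g" "\<And>t. norm (g t) \<le> B"
  shows "integrable lborel (\<lambda>t. f t * g t)"
proof (rule Bochner_Integration.integrable_bound[OF integrable_mult_left[OF integrable_norm[OF schwartz_integrable[OF f]], of B]])
  show "(\<lambda>t. f t * g t) \<in> borel_measurable lborel" using schwartz_measurable[OF f] g(1) by simp
  show "AE t in lborel. norm (f t * g t) \<le> norm (norm (f t) * B)"
    unfolding norm_mult real_norm_def
    by (intro AE_I2 order_trans[OF mult_left_mono[OF g(2)] abs_ge_self]) auto
qed

lemma schwartz_mult_integrable:
  assumes "schwartz f" "schwartz g"
  shows "integrable lborel (\<lambda>t. f t * cnj (g t))"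
proof -
  obtain B where "\<And>t. norm (g t) \<le> B" by (rule schwartz_bounded[OF assms(2)]) blast
  then show ?thesis
    using schwartz_measurable[OF assms(2)]
    by (intro schwartz_bounded_mult_integrable[OF assms(1)] borel_measurable_cnj) auto
qed

lemma tempered_dist_of_fun:
  assumes "schwartz (f :: 'a::euclidean_space \<Rightarrow> complex)"
  shows "tempered (dist_of_fun f)"
  unfolding tempered_def
proof (intro conjI allI impI exI)
  fix \<phi> \<psi> :: "'a \<Rightarrow> complex" and c
  assume \<phi>: "schwartz \<phi>"
  show "dist_of_fun f (\<lambda>x. c * \<phi> x) = cnj c * dist_of_fun f \<phi>"
    unfolding dist_of_fun_def by (simp add: mult.left_commute)
  assume \<psi>: "schwartz \<psi>"
  show "dist_of_fun f (\<lambda>x. \<phi> x + \<psi> x) = dist_of_fun f \<phi> + dist_of_fun f \<psi>"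
    unfolding dist_of_fun_def
    by (simp add: distrib_left Bochner_Integration.integral_add[OF schwartz_mult_integrable[OF assms \<phi>] schwartz_mult_integrable[OF assms \<psi>]])
next
  fix \<phi> :: "'a \<Rightarrow> complex" assume \<phi>: "schwartz \<phi>"
  have "norm (dist_of_fun f \<phi>) \<le> (\<integral>x. norm (f x) * schwartz_norm 0 \<phi> \<partial>lborel)"
    unfolding dist_of_fun_def
  proof (rule Bochner_Integration.integral_norm_bound_integral[OF schwartz_mult_integrable[OF assms \<phi>]])
    show "integrable lborel (\<lambda>x. norm (f x) * schwartz_norm 0 \<phi>)"
      by (intro integrable_mult_left integrable_norm schwartz_integrable assms)
    show "norm (f x * cnj (\<phi> x)) \<le> norm (f x) * schwartz_norm 0 \<phi>" for x
      using schwartz_norm_upper[OF \<phi>, of "[]" 0 0 x] by (simp add: norm_mult mult_left_mono)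
  qed
  also have "\<dots> = (\<integral>x. norm (f x) \<partial>lborel) * schwartz_norm 0 \<phi>" by simp
  finally show "norm (dist_of_fun f \<phi>) \<le> (\<integral>x. norm (f x) \<partial>lborel) *
     (\<Sum>k\<le>0. \<Sum>bs | set bs \<subseteq> Basis \<and> length bs \<le> 0. schwartz_seminorm k bs \<phi>)"
    unfolding schwartz_norm_def .
qed

lemma schwartz_norm_deriv_le:
  fixes \<psi> :: "'a::euclidean_space \<Rightarrow> complex"
  assumes \<psi>: "schwartz \<psi>" and "length cs \<le> n" "set cs \<subseteq> Basis" "N + n \<le> M"
  shows "schwartz_norm N (iter_deriv cs \<psi>)
    \<le> real (Suc N) * real (card {bs. set bs \<subseteq> (Basis :: 'a set) \<and> length bs \<le> N}) * schwartz_norm M \<psi>"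
proof (rule schwartz_norm_le)
  fix k bs and x :: 'a assume "k \<le> N" "set bs \<subseteq> (Basis :: 'a set)" "length bs \<le> N"
  then show "norm x ^ k * norm (iter_deriv bs (iter_deriv cs \<psi>) x) \<le> schwartz_norm M \<psi>"
    unfolding iter_deriv_append[symmetric] using assms by (intro schwartz_norm_upper[OF \<psi>]) auto
qed

lemma stft_integrand_integrable:
  assumes "schwartz \<gamma>" "schwartz \<psi>"
  shows "integrable lborel (\<lambda>t. \<psi> t * cnj (tf_shift \<gamma> z t))"
  by (rule schwartz_mult_integrable[OF assms(2) schwartz_tf_shift[OF assms(1)]])

text \<open>Integration by parts without boundary terms: the derivative of
  \<open>\<psi> t * cnj (tf_shift \<gamma> z t)\<close> has integral 0, and the modulation
  contributes the frequency as a factor. Multiplication by a frequency is thereby exchanged for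
  derivatives of \<open>\<psi>\<close> and \<open>\<gamma>\<close>.\<close>

lemma stft_deriv_identity:
  assumes \<gamma>: "schwartz \<gamma>" and \<psi>: "schwartz \<psi>" and b: "b \<in> Basis"
  shows "(2 * pi * \<i> * (snd z \<bullet> b)) * dist_of_fun \<psi> (tf_shift \<gamma> z)
    = dist_of_fun (iter_deriv [b] \<psi>) (tf_shift \<gamma> z) + dist_of_fun \<psi> (tf_shift (iter_deriv [b] \<gamma>) z)"
proof -
  let ?g = "tf_shift \<gamma> z"
  have g: "schwartz ?g" by (rule schwartz_tf_shift[OF \<gamma>])
  let ?h' = "\<lambda>t v. \<psi> t * cnj (\<Sum>c\<in>Basis. (v \<bullet> c) *\<^sub>R iter_deriv [c] ?g t) + (\<Sum>c\<in>Basis. (v \<bullet> c) *\<^sub>R iter_deriv [c] \<psi> t) * cnj (?g t)"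
  have d\<psi>: "schwartz (iter_deriv [c] \<psi>)" and dg: "schwartz (iter_deriv [c] ?g)" and d\<gamma>: "schwartz (iter_deriv [c] \<gamma>)" if "c \<in> Basis" for c
    using that schwartz_iter_deriv[OF \<psi>, of "[c]"] schwartz_iter_deriv[OF g, of "[c]"] schwartz_iter_deriv[OF \<gamma>, of "[c]"] by auto
  obtain B where B: "0 \<le> B" "\<And>t. norm (?g t) \<le> B" by (rule schwartz_bounded[OF g]) blast
  have "\<exists>B. 0 \<le> B \<and> (\<forall>t. norm (iter_deriv [c] ?g t) \<le> B)" if "c \<in> Basis" for c
    by (rule schwartz_bounded[OF dg[OF that]]) blast
  then obtain B' where B': "\<And>c. c \<in> Basis \<Longrightarrow> 0 \<le> B' c" "\<And>c t. c \<in> Basis \<Longrightarrow> norm (iter_deriv [c] ?g t) \<le> B' c" by metis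
  obtain A where A: "0 \<le> A" "\<And>t. norm (\<psi> t) \<le> A * decay t" by (rule schwartz_decay_bound[OF \<psi>]) blast
  have "\<exists>B. 0 \<le> B \<and> (\<forall>t. norm (iter_deriv [c] \<psi> t) \<le> B * decay t)" if "c \<in> Basis" for c
    by (rule schwartz_decay_bound[OF d\<psi>[OF that]]) blast
  then obtain A' where A': "\<And>c. c \<in> Basis \<Longrightarrow> 0 \<le> A' c" "\<And>c t. c \<in> Basis \<Longrightarrow> norm (iter_deriv [c] \<psi> t) \<le> A' c * decay t" by metis
  have "(\<integral>t. ?h' t b \<partial>lborel) = 0"
  proof (rule integral_partial_derivative)
    show "integrable lborel (\<lambda>t. \<psi> t * cnj (?g t))" by (rule schwartz_mult_integrable[OF \<psi> g])
    show "((\<lambda>t. \<psi> t * cnj (?g t)) has_derivative ?h' t) (at t)" for t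
      by (rule has_derivative_mult[OF schwartz_has_derivative[OF \<psi>] has_derivative_cnj[OF schwartz_has_derivative[OF g]]])
    show "norm (?h' t v) \<le> (A * (\<Sum>c\<in>Basis. B' c) + (\<Sum>c\<in>Basis. A' c) * B) * decay t * norm v" for t v
    proof -
      have "norm (\<Sum>c\<in>Basis. (v \<bullet> c) *\<^sub>R iter_deriv [c] ?g t) \<le> (\<Sum>c\<in>Basis. norm v * B' c)"
      proof (rule order_trans[OF norm_sum sum_mono])
        fix c :: 'a assume "c \<in> Basis"
        then show "norm ((v \<bullet> c) *\<^sub>R iter_deriv [c] ?g t) \<le> norm v * B' c"
          unfolding norm_scaleR by (intro mult_mono B' Basis_le_norm) auto
      qed
      then have 1: "norm (\<psi> t * cnj (\<Sum>c\<in>Basis. (v \<bullet> c) *\<^sub>R iter_deriv [c] ?g t)) \<le> (A * decay t) * (norm v * (\<Sum>c\<in>Basis. B' c))"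
        unfolding norm_mult complex_mod_cnj sum_distrib_left[symmetric] using A(1) by (intro mult_mono A(2)) auto
      have "norm (\<Sum>c\<in>Basis. (v \<bullet> c) *\<^sub>R iter_deriv [c] \<psi> t) \<le> (\<Sum>c\<in>Basis. norm v * (A' c * decay t))"
      proof (rule order_trans[OF norm_sum sum_mono])
        fix c :: 'a assume "c \<in> Basis"
        then show "norm ((v \<bullet> c) *\<^sub>R iter_deriv [c] \<psi> t) \<le> norm v * (A' c * decay t)"
          unfolding norm_scaleR by (intro mult_mono A' Basis_le_norm) auto
      qed
      also have "\<dots> = norm v * decay t * (\<Sum>c\<in>Basis. A' c)"
        unfolding sum_distrib_left by (intro sum.cong refl) simp
      finally have 2: "norm ((\<Sum>c\<in>Basis. (v \<bullet> c) *\<^sub>R iter_deriv [c] \<psi> t) * cnj (?g t)) \<le> (norm v * decay t * (\<Sum>c\<in>Basis. A' c)) * B"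
        unfolding norm_mult complex_mod_cnj using A'(1) by (intro mult_mono B(2)) (auto intro!: mult_nonneg_nonneg sum_nonneg)
      have "norm (?h' t v) \<le> (A * decay t) * (norm v * (\<Sum>c\<in>Basis. B' c)) + (norm v * decay t * (\<Sum>c\<in>Basis. A' c)) * B"
        by (rule order_trans[OF norm_triangle_ineq add_mono[OF 1 2]])
      then show ?thesis by (simp only: distrib_left distrib_right mult_ac)
    qed
    show "0 \<le> A * (\<Sum>c\<in>Basis. B' c) + (\<Sum>c\<in>Basis. A' c) * B"
      using A(1) B(1) A'(1) B'(1) by (intro add_nonneg_nonneg mult_nonneg_nonneg sum_nonneg) auto
    show "borel_fun (\<lambda>t. ?h' t v)" for v
      using schwartz_measurable[OF \<psi>] schwartz_measurable[OF g] schwartz_measurable[OF d\<psi>] schwartz_measurable[OF dg]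
      by (intro borel_measurable_add borel_measurable_times borel_measurable_cnj borel_measurable_sum borel_measurable_scaleR) auto
  qed
  moreover have "(\<Sum>c\<in>Basis. (b \<bullet> c) *\<^sub>R iter_deriv [c] f t) = iter_deriv [b] f t" for f :: "'a \<Rightarrow> complex" and t
  proof -
    have "(\<Sum>c\<in>Basis. (b \<bullet> c) *\<^sub>R iter_deriv [c] f t) = (\<Sum>c\<in>Basis. if c = b then iter_deriv [c] f t else 0)"
      using b by (intro sum.cong) (auto simp: inner_Basis)
    then show ?thesis using b by simp
  qed
  ultimately have 0: "(\<integral>t. \<psi> t * cnj (iter_deriv [b] ?g t) + iter_deriv [b] \<psi> t * cnj (?g t) \<partial>lborel) = 0" by (simp only:)
  have "iter_deriv [b] ?g t = 2 * pi * \<i> * (snd z \<bullet> b) * ?g t + tf_shift (iter_deriv [b] \<gamma>) z t" for t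
  proof -
    have "iter_deriv [b] ?g t = (\<Sum>c\<in>Basis. (b \<bullet> c) *\<^sub>R (2 * pi * \<i> * (snd z \<bullet> c) * ?g t + tf_shift (iter_deriv [c] \<gamma>) z t))"
      using frechet_derivative_at[OF tf_shift_has_derivative[OF \<gamma>], of z t, symmetric] by (simp add: fun_eq_iff)
    also have "\<dots> = (\<Sum>c\<in>Basis. if c = b then (2 * pi * \<i> * (snd z \<bullet> c) * ?g t + tf_shift (iter_deriv [c] \<gamma>) z t) else 0)"
      using b by (intro sum.cong) (auto simp: inner_Basis)
    finally show ?thesis using b by simp
  qed
  then have id: "\<psi> t * cnj (iter_deriv [b] ?g t) + iter_deriv [b] \<psi> t * cnj (?g t)
    = - (2 * pi * \<i> * (snd z \<bullet> b)) * (\<psi> t * cnj (?g t)) + (\<psi> t * cnj (tf_shift (iter_deriv [b] \<gamma>) z t) + iter_deriv [b] \<psi> t * cnj (?g t))" for t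
    by (simp add: algebra_simps)
  have "0 = (\<integral>t. - (2 * pi * \<i> * (snd z \<bullet> b)) * (\<psi> t * cnj (?g t)) + (\<psi> t * cnj (tf_shift (iter_deriv [b] \<gamma>) z t) + iter_deriv [b] \<psi> t * cnj (?g t)) \<partial>lborel)"
    by (rule trans[OF 0[symmetric]]) (intro Bochner_Integration.integral_cong refl id)
  also have "\<dots> = - (2 * pi * \<i> * (snd z \<bullet> b)) * dist_of_fun \<psi> ?g + (dist_of_fun \<psi> (tf_shift (iter_deriv [b] \<gamma>) z) + dist_of_fun (iter_deriv [b] \<psi>) ?g)"
    unfolding dist_of_fun_def
    using schwartz_mult_integrable[OF \<psi> g] schwartz_mult_integrable[OF \<psi> schwartz_tf_shift[OF d\<gamma>[OF b]], of z] schwartz_mult_integrable[OF d\<psi>[OF b] g]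
    by (simp only: Bochner_Integration.integral_add Bochner_Integration.integrable_add integrable_mult_right integral_mult_right_zero)
  finally show ?thesis by (simp add: algebra_simps)
qed

text \<open>Induction on the power of the frequency, each step paying with one derivative of
  \<open>\<psi>\<close> or of the window, which is why the window is arbitrary in the induction.
  Constants independent of \<open>\<psi>\<close> serve twice: for estimates uniform in \<tau> and
  for the temperedness of \<open>op_tau \<tau> a f\<close>.\<close>

lemma stft_decay:
  assumes "schwartz (\<gamma> :: 'a::euclidean_space \<Rightarrow> complex)"
  shows "\<exists>C N. 0 \<le> C \<and> (\<forall>\<psi> z. schwartz \<psi> \<longrightarrow>
    (1 + norm (fst z)) ^ j * norm (snd z) ^ k * norm (dist_of_fun \<psi> (tf_shift \<gamma> z)) \<le> C * schwartz_norm N \<psi>)"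
  using assms
proof (induction k arbitrary: \<gamma>)
  case 0
  obtain B where B: "0 \<le> B" "\<And>t. (1 + norm t) ^ j * norm (\<gamma> t) \<le> B"
    by (rule schwartz_bound[OF 0, where k = j]) blast
  let ?M = "j + 2 * DIM('a)"
  define I where "I = (\<integral>t. decay (t::'a) \<partial>lborel)"
  show ?case
  proof (intro exI conjI allI impI)
    show "0 \<le> 2 ^ Suc ?M * B * I" using B(1) by (simp add: I_def)
    fix \<psi> :: "'a \<Rightarrow> complex" and z assume \<psi>: "schwartz \<psi>"
    let ?s = "schwartz_norm ?M \<psi>"
    have \<psi>b: "(1 + norm t) ^ j * norm (\<psi> t) \<le> 2 ^ Suc ?M * ?s * decay t" for t
    proof (rule le_decayI)
      have "(1 + norm t) ^ ?M * norm (\<psi> t) \<le> 2 ^ ?M * (1 + norm t ^ ?M) * norm (\<psi> t)"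
        by (intro mult_right_mono power_one_plus_le) auto
      also have "\<dots> = 2 ^ ?M * (norm t ^ 0 * norm (iter_deriv [] \<psi> t) + norm t ^ ?M * norm (iter_deriv [] \<psi> t))"
        by (simp add: algebra_simps)
      also have "\<dots> \<le> 2 ^ ?M * (?s + ?s)"
        by (intro mult_left_mono add_mono schwartz_norm_upper[OF \<psi>]) auto
      finally show "(1 + norm t) ^ (2 * DIM('a)) * ((1 + norm t) ^ j * norm (\<psi> t)) \<le> 2 ^ Suc ?M * ?s"
        by (simp add: power_add mult_ac)
    qed
    have "(1 + norm (fst z)) ^ j * norm (dist_of_fun \<psi> (tf_shift \<gamma> z))
      = norm (\<integral>t. (1 + norm (fst z)) ^ j *\<^sub>R (\<psi> t * cnj (tf_shift \<gamma> z t)) \<partial>lborel)"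
      by (simp add: dist_of_fun_def)
    also have "\<dots> \<le> (\<integral>t. 2 ^ Suc ?M * ?s * B * decay (t::'a) \<partial>lborel)"
    proof (rule Bochner_Integration.integral_norm_bound_integral)
      show "integrable lborel (\<lambda>t. (1 + norm (fst z)) ^ j *\<^sub>R (\<psi> t * cnj (tf_shift \<gamma> z t)))"
        by (intro integrable_scaleR_right stft_integrand_integrable 0 \<psi>)
      show "integrable lborel (\<lambda>t. 2 ^ Suc ?M * ?s * B * decay (t::'a))"
        by (rule integrable_mult_right[OF integrable_decay])
      fix t :: 'a
      have "1 + norm (fst z) \<le> (1 + norm t) * (1 + norm (t - fst z))"
        using one_plus_norm_add_le[of t "- (t - fst z)"] by (simp add: norm_minus_commute)
      then have "(1 + norm (fst z)) ^ j \<le> ((1 + norm t) * (1 + norm (t - fst z))) ^ j" by (intro power_mono) auto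
      then have "norm ((1 + norm (fst z)) ^ j *\<^sub>R (\<psi> t * cnj (tf_shift \<gamma> z t)))
         \<le> ((1 + norm t) * (1 + norm (t - fst z))) ^ j * (norm (\<psi> t) * norm (\<gamma> (t - fst z)))"
        by (simp add: norm_mult norm_tf_shift mult_right_mono)
      also have "\<dots> = ((1 + norm t) ^ j * norm (\<psi> t)) * ((1 + norm (t - fst z)) ^ j * norm (\<gamma> (t - fst z)))"
        by (simp add: power_mult_distrib mult_ac)
      also have "\<dots> \<le> (2 ^ Suc ?M * ?s * decay t) * B"
        by (intro mult_mono \<psi>b B) (use schwartz_norm_nonneg[OF \<psi>] in auto)
      finally show "norm ((1 + norm (fst z)) ^ j *\<^sub>R (\<psi> t * cnj (tf_shift \<gamma> z t))) \<le> 2 ^ Suc ?M * ?s * B * decay t"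
        by (simp only: mult_ac)
    qed
    also have "\<dots> = 2 ^ Suc ?M * B * I * ?s" unfolding I_def integral_mult_right_zero by (simp only: mult_ac)
    finally show "(1 + norm (fst z)) ^ j * norm (snd z) ^ 0 * norm (dist_of_fun \<psi> (tf_shift \<gamma> z)) \<le> 2 ^ Suc ?M * B * I * ?s"
      by simp
  qed
next
  case (Suc k)
  let ?V = "\<lambda>\<psi> \<gamma> z. (1 + norm (fst z)) ^ j * norm (snd z) ^ k * norm (dist_of_fun \<psi> (tf_shift \<gamma> z))"
  obtain C N where C: "0 \<le> C" "\<And>\<psi> z. schwartz \<psi> \<Longrightarrow> ?V \<psi> \<gamma> z \<le> C * schwartz_norm N \<psi>"
    using Suc.IH[OF Suc.prems] by blast
  have d\<gamma>: "schwartz (iter_deriv [b] \<gamma>)" if "b \<in> Basis" for b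
    using schwartz_iter_deriv[OF Suc.prems, of "[b]"] that by simp
  have "\<exists>C N. 0 \<le> C \<and> (\<forall>\<psi> z. schwartz \<psi> \<longrightarrow> ?V \<psi> (iter_deriv [b] \<gamma>) z \<le> C * schwartz_norm N \<psi>)"
    if "b \<in> Basis" for b using Suc.IH[OF d\<gamma>[OF that]] .
  then obtain C' N' where C': "\<And>b. b \<in> Basis \<Longrightarrow> 0 \<le> C' b"
    "\<And>b \<psi> z. b \<in> Basis \<Longrightarrow> schwartz \<psi> \<Longrightarrow> ?V \<psi> (iter_deriv [b] \<gamma>) z \<le> C' b * schwartz_norm (N' b) \<psi>" by metis
  \<comment> \<open>One order for all directions: \<open>Suc\<close> pays for the derivative of
    \<open>\<psi>\<close>, and the sum dominates every \<open>N' b\<close>.\<close>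
  define M where "M = Suc N + (\<Sum>b\<in>Basis. N' b)"
  define c where "c n = real (Suc n) * real (card {bs. set bs \<subseteq> (Basis :: 'a set) \<and> length bs \<le> n})" for n
  have c0: "0 \<le> c n" for n by (simp add: c_def)
  show ?case
  proof (intro exI conjI allI impI)
    show "0 \<le> (\<Sum>b\<in>(Basis :: 'a set). C * c N + C' b * c (N' b))"
      using C(1) C'(1) c0 by (intro sum_nonneg add_nonneg_nonneg mult_nonneg_nonneg) auto
    fix \<psi> :: "'a \<Rightarrow> complex" and z assume \<psi>: "schwartz \<psi>"
    have b: "\<bar>snd z \<bullet> b\<bar> * ?V \<psi> \<gamma> z \<le> (C * c N + C' b * c (N' b)) * schwartz_norm M \<psi>" if b: "b \<in> Basis" for b
    proof -
      have d\<psi>: "schwartz (iter_deriv [b] \<psi>)" using schwartz_iter_deriv[OF \<psi>, of "[b]"] b by simp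
      have "2 * pi * (\<bar>snd z \<bullet> b\<bar> * norm (dist_of_fun \<psi> (tf_shift \<gamma> z)))
        = norm ((2 * pi * \<i> * (snd z \<bullet> b)) * dist_of_fun \<psi> (tf_shift \<gamma> z))"
        by (simp add: norm_mult)
      also have "\<dots> \<le> norm (dist_of_fun (iter_deriv [b] \<psi>) (tf_shift \<gamma> z)) + norm (dist_of_fun \<psi> (tf_shift (iter_deriv [b] \<gamma>) z))"
        unfolding stft_deriv_identity[OF Suc.prems \<psi> b] by (rule norm_triangle_ineq)
      finally have "\<bar>snd z \<bullet> b\<bar> * norm (dist_of_fun \<psi> (tf_shift \<gamma> z))
         \<le> norm (dist_of_fun (iter_deriv [b] \<psi>) (tf_shift \<gamma> z)) + norm (dist_of_fun \<psi> (tf_shift (iter_deriv [b] \<gamma>) z))"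
      proof -
        assume "2 * pi * (\<bar>snd z \<bullet> b\<bar> * norm (dist_of_fun \<psi> (tf_shift \<gamma> z))) \<le> norm (dist_of_fun (iter_deriv [b] \<psi>) (tf_shift \<gamma> z)) + norm (dist_of_fun \<psi> (tf_shift (iter_deriv [b] \<gamma>) z))"
        moreover have "1 * (\<bar>snd z \<bullet> b\<bar> * norm (dist_of_fun \<psi> (tf_shift \<gamma> z))) \<le> 2 * pi * (\<bar>snd z \<bullet> b\<bar> * norm (dist_of_fun \<psi> (tf_shift \<gamma> z)))"
          using pi_ge_two by (intro mult_right_mono) auto
        ultimately show ?thesis by linarith
      qed
      then have "(1 + norm (fst z)) ^ j * norm (snd z) ^ k * (\<bar>snd z \<bullet> b\<bar> * norm (dist_of_fun \<psi> (tf_shift \<gamma> z)))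
         \<le> (1 + norm (fst z)) ^ j * norm (snd z) ^ k * (norm (dist_of_fun (iter_deriv [b] \<psi>) (tf_shift \<gamma> z)) + norm (dist_of_fun \<psi> (tf_shift (iter_deriv [b] \<gamma>) z)))"
        by (intro mult_left_mono) auto
      then have "\<bar>snd z \<bullet> b\<bar> * ?V \<psi> \<gamma> z \<le> ?V (iter_deriv [b] \<psi>) \<gamma> z + ?V \<psi> (iter_deriv [b] \<gamma>) z"
        by (simp only: distrib_left mult_ac)
      also have "\<dots> \<le> C * schwartz_norm N (iter_deriv [b] \<psi>) + C' b * schwartz_norm (N' b) (iter_deriv [] \<psi>)"
        using C(2)[OF d\<psi>, of z] C'(2)[OF b \<psi>, of z] by simp
      also have "\<dots> \<le> C * (c N * schwartz_norm M \<psi>) + C' b * (c (N' b) * schwartz_norm M \<psi>)"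
      proof -
        have "N' b \<le> (\<Sum>b\<in>Basis. N' b)" using b by (intro member_le_sum) auto
        then have "schwartz_norm N (iter_deriv [b] \<psi>) \<le> c N * schwartz_norm M \<psi>"
          "schwartz_norm (N' b) (iter_deriv [] \<psi>) \<le> c (N' b) * schwartz_norm M \<psi>"
          unfolding c_def using b by (intro schwartz_norm_deriv_le[OF \<psi>, where n = 1] schwartz_norm_deriv_le[OF \<psi>, where n = 0]; simp add: M_def)+
        then show ?thesis using C(1) C'(1)[OF b] by (intro add_mono mult_left_mono) auto
      qed
      finally show ?thesis by (simp only: distrib_right mult.assoc)
    qed
    have "norm (snd z) * ?V \<psi> \<gamma> z \<le> (\<Sum>b\<in>Basis. \<bar>snd z \<bullet> b\<bar>) * ?V \<psi> \<gamma> z"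
      by (intro mult_right_mono norm_le_l1) auto
    also have "\<dots> \<le> (\<Sum>b\<in>Basis. (C * c N + C' b * c (N' b)) * schwartz_norm M \<psi>)"
      unfolding sum_distrib_right by (intro sum_mono b)
    finally show "(1 + norm (fst z)) ^ j * norm (snd z) ^ Suc k * norm (dist_of_fun \<psi> (tf_shift \<gamma> z))
       \<le> (\<Sum>b\<in>Basis. C * c N + C' b * c (N' b)) * schwartz_norm M \<psi>"
      unfolding sum_distrib_right by (simp only: power_Suc mult_ac)
  qed
qed

lemma stft_schwartz_bound:
  fixes \<gamma> :: "'a::euclidean_space \<Rightarrow> complex"
  assumes \<gamma>: "schwartz \<gamma>"
  obtains C N where "0 \<le> C" "\<And>\<psi> z. schwartz \<psi> \<Longrightarrow>
    (1 + norm z) ^ m * norm (dist_of_fun \<psi> (tf_shift \<gamma> z)) \<le> C * schwartz_norm N \<psi>"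
proof -
  let ?V = "\<lambda>k \<psi> z. (1 + norm (fst z)) ^ m * norm (snd z) ^ k * norm (dist_of_fun \<psi> (tf_shift \<gamma> z))"
  obtain C N where C: "0 \<le> C" "\<And>\<psi> z. schwartz \<psi> \<Longrightarrow> ?V 0 \<psi> z \<le> C * schwartz_norm N \<psi>"
    using stft_decay[OF \<gamma>, of m 0] by blast
  obtain D M where D: "0 \<le> D" "\<And>\<psi> z. schwartz \<psi> \<Longrightarrow> ?V m \<psi> z \<le> D * schwartz_norm M \<psi>"
    using stft_decay[OF \<gamma>, of m m] by blast
  define c where "c n = real (Suc n) * real (card {bs. set bs \<subseteq> (Basis :: 'a set) \<and> length bs \<le> n})" for n
  have c0: "0 \<le> c n" for n by (simp add: c_def)
  show ?thesis
  proof (rule that[of "2 ^ m * (C * c N + D * c M)" "N + M"])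
    show "0 \<le> 2 ^ m * (C * c N + D * c M)" using C(1) D(1) c0 by simp
    fix \<psi> :: "'a \<Rightarrow> complex" and z :: "'a \<times> 'a" assume \<psi>: "schwartz \<psi>"
    have "1 + norm z \<le> (1 + norm (fst z)) * (1 + norm (snd z))"
    proof -
      have "norm z \<le> norm (fst z) + norm (snd z)" by (metis norm_Pair_le prod.collapse)
      moreover have "0 \<le> norm (fst z) * norm (snd z)" by simp
      ultimately show ?thesis unfolding distrib_left distrib_right by linarith
    qed
    then have "(1 + norm z) ^ m \<le> (1 + norm (fst z)) ^ m * (1 + norm (snd z)) ^ m"
      unfolding power_mult_distrib[symmetric] by (intro power_mono) auto
    also have "\<dots> \<le> (1 + norm (fst z)) ^ m * (2 ^ m * (1 + norm (snd z) ^ m))"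
      by (intro mult_left_mono power_one_plus_le) auto
    finally have "(1 + norm z) ^ m * norm (dist_of_fun \<psi> (tf_shift \<gamma> z))
      \<le> (1 + norm (fst z)) ^ m * (2 ^ m * (1 + norm (snd z) ^ m)) * norm (dist_of_fun \<psi> (tf_shift \<gamma> z))"
      by (intro mult_right_mono) auto
    also have "\<dots> = 2 ^ m * (?V 0 \<psi> z + ?V m \<psi> z)" by (simp add: algebra_simps)
    also have "\<dots> \<le> 2 ^ m * (C * schwartz_norm N (iter_deriv [] \<psi>) + D * schwartz_norm M (iter_deriv [] \<psi>))"
      using C(2)[OF \<psi>, of z] D(2)[OF \<psi>, of z] by simp
    also have "\<dots> \<le> 2 ^ m * (C * (c N * schwartz_norm (N + M) \<psi>) + D * (c M * schwartz_norm (N + M) \<psi>))"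
    proof -
      have "schwartz_norm N (iter_deriv [] \<psi>) \<le> c N * schwartz_norm (N + M) \<psi>"
        "schwartz_norm M (iter_deriv [] \<psi>) \<le> c M * schwartz_norm (N + M) \<psi>"
        unfolding c_def by (rule schwartz_norm_deriv_le[OF \<psi>, where n = 0]; simp)+
      then show ?thesis using C(1) D(1) by (intro mult_left_mono add_mono) auto
    qed
    finally show "(1 + norm z) ^ m * norm (dist_of_fun \<psi> (tf_shift \<gamma> z)) \<le> 2 ^ m * (C * c N + D * c M) * schwartz_norm (N + M) \<psi>"
      by (simp only: distrib_left distrib_right mult.assoc)
  qed
qed

lemma stft_poly_bounded: "tempered u \<Longrightarrow> schwartz \<gamma> \<Longrightarrow> poly_bounded (\<lambda>z. u (tf_shift \<gamma> z))"
  by (rule tempered_family_poly_bounded[OF _ schwartz_family_tf_shift])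

lemma stft_rapidly_decreasing:
  assumes "schwartz \<gamma>" "schwartz \<psi>"
  shows "rapidly_decreasing (\<lambda>z. dist_of_fun \<psi> (tf_shift \<gamma> z))"
  unfolding rapidly_decreasing_def
proof (intro conjI allI)
  show "borel_fun (\<lambda>z. dist_of_fun \<psi> (tf_shift \<gamma> z))"
    by (rule poly_bounded_measurable[OF stft_poly_bounded[OF tempered_dist_of_fun[OF assms(2)] assms(1)]])
  fix m
  obtain C N where "\<And>\<psi> z. schwartz \<psi> \<Longrightarrow>
    (1 + norm z) ^ m * norm (dist_of_fun \<psi> (tf_shift \<gamma> z)) \<le> C * schwartz_norm N \<psi>"
    by (rule stft_schwartz_bound[OF assms(1), where m = m]) blast
  from this[OF assms(2)] show "\<exists>C. \<forall>z. (1 + norm z) ^ m * norm (dist_of_fun \<psi> (tf_shift \<gamma> z)) \<le> C" by blast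
qed

text \<open>At a fixed position \<open>x\<close> the integral over frequencies is Fourier inversion
  of the function \<open>\<psi> s * cnj (\<gamma> (s - x))\<close> of \<open>s\<close>; integrating
  over \<open>x\<close> leaves the squared norm of the window.\<close>

lemma stft_inversion:
  fixes \<gamma> :: "'a::euclidean_space \<Rightarrow> complex"
  assumes \<gamma>: "schwartz \<gamma>" and \<psi>: "schwartz \<psi>"
  shows "(\<integral>z. dist_of_fun \<psi> (tf_shift \<gamma> z) * tf_shift \<gamma> z t \<partial>lborel) = (\<integral>s. \<gamma> s * cnj (\<gamma> s) \<partial>lborel) * \<psi> t"
proof -
  let ?V = "\<lambda>z. dist_of_fun \<psi> (tf_shift \<gamma> z)"
  have Vr: "rapidly_decreasing ?V" by (rule stft_rapidly_decreasing[OF \<gamma> \<psi>])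
  have int: "integrable lborel (\<lambda>z. ?V z * tf_shift \<gamma> z t)"
    using schwartz_family_integrable[OF schwartz_family_tf_shift[OF \<gamma>] Vr, of "[]"] by simp
  obtain B where B: "\<And>t. norm (\<gamma> t) \<le> B" by (rule schwartz_bounded[OF \<gamma>]) blast
  obtain B' where B': "\<And>t. norm (\<psi> t) \<le> B'" by (rule schwartz_bounded[OF \<psi>]) blast
  have inner: "(\<integral>\<xi>. ?V (x, \<xi>) * tf_shift \<gamma> (x, \<xi>) t \<partial>lborel) = (\<gamma> (t - x) * cnj (\<gamma> (t - x))) * \<psi> t" for x
  proof -
    let ?h = "\<lambda>s. \<psi> s * cnj (\<gamma> (s - x))"
    have V: "?V (x, \<xi>) = (\<integral>s. ?h s * cis (- 2 * pi * (\<xi> \<bullet> s)) \<partial>lborel)" for \<xi>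
      unfolding dist_of_fun_def tf_shift_def by (simp add: cis_cnj mult_ac)
    have tf0: "tf_shift \<gamma> (x, 0) = (\<lambda>s. \<gamma> (s - x))" by (simp add: tf_shift_def fun_eq_iff)
    have h: "integrable lborel ?h" using stft_integrand_integrable[OF \<gamma> \<psi>, of "(x, 0)"] unfolding tf0 .
    have hc: "continuous_on UNIV ?h"
      by (intro continuous_on_mult schwartz_continuous[OF \<psi>] continuous_on_cnj continuous_on_compose2[OF schwartz_continuous[OF \<gamma>, of UNIV]])
         (auto intro: continuous_intros)
    have hb: "norm (?h s) \<le> B' * B" for s
      unfolding norm_mult complex_mod_cnj by (intro mult_mono B B' order_trans[OF norm_ge_zero B']) auto
    have hhat: "integrable lborel (\<lambda>\<xi>. ?V (x, \<xi>))"
    proof -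
      obtain C where C: "\<And>z. (1 + norm z) ^ (2 * DIM('a)) * norm (?V z) \<le> C"
        using Vr unfolding rapidly_decreasing_def by meson
      have "norm (?V (x, \<xi>)) \<le> C * decay \<xi>" for \<xi>
      proof (rule le_decayI)
        have "norm \<xi> \<le> norm (x, \<xi>)" using norm_snd_le[of \<xi> x] by simp
        then have "(1 + norm \<xi>) ^ (2 * DIM('a)) * norm (?V (x, \<xi>)) \<le> (1 + norm (x, \<xi>)) ^ (2 * DIM('a)) * norm (?V (x, \<xi>))"
          by (intro mult_right_mono power_mono) auto
        then show "(1 + norm \<xi>) ^ (2 * DIM('a)) * norm (?V (x, \<xi>)) \<le> C" using C[of "(x, \<xi>)"] by linarith
      qed
      then have "norm (?V (x, \<xi>)) \<le> norm (C * decay \<xi>)" for \<xi> by (metis abs_ge_self order_trans real_norm_def)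
      moreover have "borel_fun (\<lambda>\<xi>. ?V (x, \<xi>))"
      proof -
        have c: "continuous_on UNIV ?V"
          using stft_poly_bounded[OF tempered_dist_of_fun[OF \<psi>] \<gamma>] by (simp add: poly_bounded_def)
        from continuous_on_compose2[OF c continuous_on_Pair[OF continuous_on_const continuous_on_id, of UNIV x]]
        show ?thesis by (intro borel_measurable_continuous_onI) simp
      qed
      ultimately show ?thesis
        by (intro Bochner_Integration.integrable_bound[OF integrable_mult_right[OF integrable_decay, of C]] AE_I2) auto
    qed
    have "(\<integral>\<xi>. ?V (x, \<xi>) * cis (2 * pi * (\<xi> \<bullet> t)) \<partial>lborel) = ?h t"
      using fourier_inversion[OF h hc hb hhat[unfolded V], of t] unfolding V .
    moreover have "?V (x, \<xi>) * tf_shift \<gamma> (x, \<xi>) t = \<gamma> (t - x) * (?V (x, \<xi>) * cis (2 * pi * (\<xi> \<bullet> t)))" for \<xi>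
      by (simp add: tf_shift_def mult_ac)
    ultimately show ?thesis by (simp only: integral_mult_right_zero) (simp add: mult_ac)
  qed
  have "(\<integral>z. ?V z * tf_shift \<gamma> z t \<partial>lborel) = (\<integral>x. (\<gamma> (t - x) * cnj (\<gamma> (t - x))) * \<psi> t \<partial>lborel)"
    unfolding lborel_Fubini(1)[OF int] inner ..
  also have "\<dots> = (\<integral>x. \<gamma> (t - x) * cnj (\<gamma> (t - x)) \<partial>lborel) * \<psi> t" by (rule integral_mult_left_zero)
  also have "(\<integral>x. \<gamma> (t - x) * cnj (\<gamma> (t - x)) \<partial>lborel) = (\<integral>s. \<gamma> s * cnj (\<gamma> s) \<partial>lborel)"
    using schwartz_measurable[OF \<gamma>] by (intro integral_reflect[of "\<lambda>s. \<gamma> s * cnj (\<gamma> s)" t]) (auto intro: borel_measurable_cnj)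
  finally show ?thesis .
qed

text \<open>The reconstruction formula for \<open>\<psi>\<close> is fed into \<open>u\<close>, and
  \<open>u\<close> is exchanged with the integral. A tempered distribution is thus determined by its
  values on the shifts of one window.\<close>

lemma tempered_inversion:
  fixes \<gamma> :: "'a::euclidean_space \<Rightarrow> complex"
  assumes u: "tempered u" and \<gamma>: "schwartz \<gamma>" and \<psi>: "schwartz \<psi>"
  shows "(\<integral>s. \<gamma> s * cnj (\<gamma> s) \<partial>lborel) * u \<psi> = (\<integral>z. u (tf_shift \<gamma> z) * cnj (dist_of_fun \<psi> (tf_shift \<gamma> z)) \<partial>lborel)"
    and "integrable lborel (\<lambda>z. u (tf_shift \<gamma> z) * cnj (dist_of_fun \<psi> (tf_shift \<gamma> z)))"
proof -
  let ?c = "\<integral>s. \<gamma> s * cnj (\<gamma> s) \<partial>lborel"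
  have V: "rapidly_decreasing (\<lambda>z. dist_of_fun \<psi> (tf_shift \<gamma> z))" by (rule stft_rapidly_decreasing[OF \<gamma> \<psi>])
  have "cnj ?c = (\<integral>s. cnj (\<gamma> s * cnj (\<gamma> s)) \<partial>lborel)" by (rule Bochner_Integration.integral_cnj[symmetric])
  \<comment> \<open>\<open>u\<close> is antilinear, so the constant comes out conjugated; being
    real, it is unchanged.\<close>
  then have "cnj ?c = ?c" by (simp add: mult.commute)
  then have "?c * u \<psi> = u (\<lambda>t. ?c * \<psi> t)" using tempered_scale[OF u \<psi>] by simp
  also have "\<dots> = u (\<lambda>t. \<integral>z. dist_of_fun \<psi> (tf_shift \<gamma> z) * tf_shift \<gamma> z t \<partial>lborel)"
    unfolding stft_inversion[OF \<gamma> \<psi>] ..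
  also have "\<dots> = (\<integral>z. cnj (dist_of_fun \<psi> (tf_shift \<gamma> z)) * u (tf_shift \<gamma> z) \<partial>lborel)"
    by (rule tempered_integral[OF u schwartz_family_tf_shift[OF \<gamma>] V])
  finally show "?c * u \<psi> = (\<integral>z. u (tf_shift \<gamma> z) * cnj (dist_of_fun \<psi> (tf_shift \<gamma> z)) \<partial>lborel)"
    by (simp add: mult.commute)
  show "integrable lborel (\<lambda>z. u (tf_shift \<gamma> z) * cnj (dist_of_fun \<psi> (tf_shift \<gamma> z)))"
    using rapidly_decreasing_integrable_mult[OF rapidly_decreasing_cnj[OF V] stft_poly_bounded[OF u \<gamma>]]
    by (simp add: mult.commute)
qed

text \<open>The two transforms differ by phase factors, which the norm removes. This turns
  superpositions over shifts into convolutions, both in the change of windows and in the estimate of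
  the operator.\<close>

lemma stft_covariance:
  fixes \<gamma> \<psi> :: "'a::euclidean_space \<Rightarrow> complex"
  assumes \<gamma>: "schwartz \<gamma>" and \<psi>: "schwartz \<psi>"
  shows "norm (dist_of_fun (tf_shift \<psi> w) (tf_shift \<gamma> z)) = norm (dist_of_fun \<psi> (tf_shift \<gamma> (z - w)))"
proof -
  let ?f = "\<lambda>t. tf_shift \<psi> w t * cnj (tf_shift \<gamma> z t)"
  have f: "borel_fun ?f"
    using schwartz_measurable[OF schwartz_tf_shift[OF \<psi>]] schwartz_measurable[OF schwartz_tf_shift[OF \<gamma>]]
    by (intro borel_measurable_times borel_measurable_cnj)
  have eq: "dist_of_fun (tf_shift \<psi> w) (tf_shift \<gamma> z) = (\<integral>t. ?f (t + fst w) \<partial>lborel)"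
    unfolding dist_of_fun_def by (rule integral_translate[OF f, symmetric])
  have f_eq: "?f (t + fst w) = cis (2 * pi * ((snd w - snd z) \<bullet> fst w)) * (\<psi> t * cnj (tf_shift \<gamma> (z - w) t))" for t
  proof -
    have 1: "cis (2 * pi * (snd w \<bullet> (t + fst w))) * cnj (cis (2 * pi * (snd z \<bullet> (t + fst w))))
      = cis (2 * pi * ((snd w - snd z) \<bullet> fst w)) * cnj (cis (2 * pi * ((snd z - snd w) \<bullet> t)))"
      unfolding cis_cnj cis_mult by (simp add: inner_diff_left inner_add_right algebra_simps)
    have 2: "t + fst w - fst z = t - (fst z - fst w)" by simp
    have "?f (t + fst w) = (cis (2 * pi * (snd w \<bullet> (t + fst w))) * cnj (cis (2 * pi * (snd z \<bullet> (t + fst w)))))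
       * (\<psi> t * cnj (\<gamma> (t - (fst z - fst w))))"
      unfolding tf_shift_def complex_cnj_mult 2 by simp
    then show ?thesis unfolding 1 by (simp add: tf_shift_def mult_ac)
  qed
  show ?thesis unfolding eq f_eq by (simp add: dist_of_fun_def norm_mult)
qed

text \<open>A vanishing integral of \<open>(norm (\<gamma> s))\<^sup>2\<close> makes
  \<open>\<gamma>\<close> zero almost everywhere, while by continuity a nonzero value persists on a
  ball of positive measure.\<close>

lemma schwartz_l2_norm_pos:
  fixes \<gamma> :: "'a::euclidean_space \<Rightarrow> complex"
  assumes \<gamma>: "schwartz \<gamma>" and nz: "\<gamma> \<noteq> (\<lambda>_. 0)"
  shows "(\<integral>s. \<gamma> s * cnj (\<gamma> s) \<partial>lborel) \<noteq> 0"
proof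
  assume 0: "(\<integral>s. \<gamma> s * cnj (\<gamma> s) \<partial>lborel) = 0"
  have eq: "\<gamma> s * cnj (\<gamma> s) = of_real ((norm (\<gamma> s))\<^sup>2)" for s by (simp only: complex_norm_square)
  have i: "integrable lborel (\<lambda>s. (norm (\<gamma> s))\<^sup>2)"
    using integrable_norm[OF schwartz_mult_integrable[OF \<gamma> \<gamma>]] by (simp add: norm_mult power2_eq_square)
  have "(\<integral>s. (norm (\<gamma> s))\<^sup>2 \<partial>lborel) = 0" using 0 unfolding eq integral_complex_of_real by simp
  then have "AE s in lborel. (norm (\<gamma> s))\<^sup>2 = 0"
    using integral_nonneg_eq_0_iff_AE[OF i] by simp
  then have "AE s in lborel. \<gamma> s = 0" by simp
  moreover obtain s0 where s0: "\<gamma> s0 \<noteq> 0" using nz by auto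
  have op: "open (\<gamma> -` (- {0}))"
    by (rule open_vimage[OF open_Compl[OF closed_singleton] schwartz_continuous[OF \<gamma>]])
  have "s0 \<in> \<gamma> -` (- {0})" using s0 by simp
  then obtain e where e: "0 < e" "ball s0 e \<subseteq> \<gamma> -` (- {0})" by (rule openE[OF op])
  ultimately have "AE s in lborel. s \<notin> ball s0 e" by (elim AE_mp) (intro AE_I2, use e(2) in blast)
  then have "emeasure lborel (ball s0 e) = 0"
    by (subst (asm) AE_iff_measurable[where N = "ball s0 e"]) auto
  moreover have "0 < emeasure lborel (ball s0 e)" using e(1) by (simp add: emeasure_ball)
  ultimately show False by simp
qed

subsection \<open>Cross-Wigner distributions\<close>

lemma poly_boundedI:
  assumes "continuous_on UNIV h" "\<And>z. norm (h z) \<le> C * (1 + norm z) ^ m"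
  shows "poly_bounded h"
  using assms unfolding poly_bounded_def by blast

lemma poly_bounded_linear_growth:
  assumes "continuous_on UNIV h" "\<And>z. norm (h z) \<le> C * norm z" "0 \<le> C"
  shows "poly_bounded h"
proof (rule poly_boundedI[OF assms(1)])
  fix z :: 'a
  have "C * norm z \<le> C * (1 + norm z)" using assms(3) by (intro mult_left_mono) auto
  then show "norm (h z) \<le> C * (1 + norm z) ^ 1" using assms(2)[of z] by simp
qed

lemma poly_bounded_cnj: "poly_bounded c \<Longrightarrow> poly_bounded (\<lambda>z. cnj (c z))"
  unfolding poly_bounded_def by (auto intro: continuous_on_cnj)

lemma rapidly_decreasing_mult:
  assumes F: "rapidly_decreasing F" and c: "poly_bounded c"
  shows "rapidly_decreasing (\<lambda>z. F z * c z)"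
  unfolding rapidly_decreasing_def
proof (intro conjI allI)
  show "borel_fun (\<lambda>z. F z * c z)"
    using rapidly_decreasing_measurable[OF F] poly_bounded_measurable[OF c] by (rule borel_measurable_times)
  fix k
  obtain D n where D: "\<And>z. norm (c z) \<le> D * (1 + norm z) ^ n" using c unfolding poly_bounded_def by blast
  obtain C where C: "\<And>z. (1 + norm z) ^ (k + n) * norm (F z) \<le> C" using F unfolding rapidly_decreasing_def by meson
  have "(1 + norm z) ^ k * norm (F z * c z) \<le> \<bar>D\<bar> * C" for z
  proof -
    have "norm (c z) \<le> \<bar>D\<bar> * (1 + norm z) ^ n" by (rule poly_bound_mono[OF D]) auto
    then have "((1 + norm z) ^ k * norm (F z)) * norm (c z) \<le> ((1 + norm z) ^ k * norm (F z)) * (\<bar>D\<bar> * (1 + norm z) ^ n)"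
      by (intro mult_left_mono) auto
    also have "\<dots> = \<bar>D\<bar> * ((1 + norm z) ^ (k + n) * norm (F z))" by (simp add: power_add mult_ac)
    also have "\<dots> \<le> \<bar>D\<bar> * C" by (intro mult_left_mono C) auto
    finally show ?thesis by (simp add: norm_mult mult_ac)
  qed
  then show "\<exists>C. \<forall>z. (1 + norm z) ^ k * norm (F z * c z) \<le> C" by blast
qed

lemma schwartz_family_poly_bounded:
  assumes "schwartz_family K"
  shows "poly_bounded (\<lambda>z. K z t)"
proof -
  have "continuous_on UNIV (\<lambda>(z, t). iter_deriv [] (K z) t)"
    using assms unfolding schwartz_family_def rapid_family_def by (metis empty_set empty_subsetI)
  from continuous_on_compose2[OF this continuous_on_Pair[OF continuous_on_id continuous_on_const[of UNIV t]]]
  have c: "continuous_on UNIV (\<lambda>z. K z t)" by simp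
  have "set [] \<subseteq> (Basis :: 'b set)" by simp
  then obtain C m where "\<And>z t. (1 + norm t) ^ 0 * norm (iter_deriv [] (K z) t) \<le> C * (1 + norm z) ^ m"
    by (rule schwartz_family_bound[OF assms, where k = 0]) blast
  then show ?thesis by (intro poly_boundedI[OF c]) simp
qed

lemma gauss_Pair:
  fixes u v :: "'a::euclidean_space"
  shows "gauss (u, v) = gauss u * gauss v"
proof -
  have n: "(norm (u, v))\<^sup>2 = (norm u)\<^sup>2 + (norm v)\<^sup>2" by (simp add: norm_Pair)
  have p: "2 powr (real DIM('a \<times> 'a) / 4) = 2 powr (real DIM('a) / 4) * 2 powr (real DIM('a) / 4)"
    unfolding powr_add[symmetric] by simp
  show ?thesis unfolding gauss_def n p of_real_mult[symmetric]
    by (simp add: exp_add[symmetric] algebra_simps flip: of_real_mult)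
qed

lemma tf_shift_gauss_Pair:
  fixes a b c d u v :: "'a::euclidean_space"
  shows "tf_shift gauss ((a, b), (c, d)) (u, v) = tf_shift gauss (a, c) u * tf_shift gauss (b, d) v"
  by (simp add: tf_shift_def gauss_Pair distrib_left cis_mult[symmetric])

lemma cnj_tf_shift_gauss: "cnj (tf_shift gauss (b, d) v) = tf_shift gauss (b, - d) v"
  by (simp add: tf_shift_def gauss_def cis_cnj)

lemma fourier_tf_shift_gauss:
  fixes b d s :: "'a::euclidean_space"
  shows "(\<integral>\<xi>. cis (2 * pi * (s \<bullet> \<xi>)) * tf_shift gauss (b, d) \<xi> \<partial>lborel) = cis (2 * pi * ((s + d) \<bullet> b)) * gauss (s + d)"
proof -
  let ?f = "\<lambda>\<xi>. cis (2 * pi * (s \<bullet> \<xi>)) * tf_shift gauss (b, d) \<xi>"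
  have m: "borel_fun ?f"
    using schwartz_measurable[OF schwartz_tf_shift[OF schwartz_gauss]]
    by (intro borel_measurable_times borel_measurable_continuous_onI[of "\<lambda>\<xi>. cis (2 * pi * (s \<bullet> \<xi>))"] continuous_intros)
  have e: "?f (\<xi> + b) = cis (2 * pi * ((s + d) \<bullet> b)) * (cis (2 * pi * ((s + d) \<bullet> \<xi>)) * gauss \<xi>)" for \<xi>
  proof -
    have "cis (2 * pi * (s \<bullet> (\<xi> + b))) * cis (2 * pi * (d \<bullet> (\<xi> + b))) = cis (2 * pi * ((s + d) \<bullet> b)) * cis (2 * pi * ((s + d) \<bullet> \<xi>))"
      unfolding cis_mult by (simp add: inner_add_left inner_add_right algebra_simps)
    then show ?thesis by (simp add: tf_shift_def mult.assoc[symmetric])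
  qed
  have "(\<integral>\<xi>. ?f \<xi> \<partial>lborel) = (\<integral>\<xi>. ?f (\<xi> + b) \<partial>lborel)" by (rule integral_translate[OF m, symmetric])
  then show ?thesis unfolding e integral_mult_right_zero fourier_gauss .
qed

section \<open>Linear coordinates of the Wigner kernel\<close>

definition wigner_lin :: "real \<Rightarrow> 'a::euclidean_space \<times> 'a \<Rightarrow> 'a \<times> 'a" where
  "wigner_lin \<tau> p = ((1 - \<tau>) *\<^sub>R fst p + \<tau> *\<^sub>R snd p, fst p - snd p)"

definition wigner_lin_inv :: "real \<Rightarrow> 'a::euclidean_space \<times> 'a \<Rightarrow> 'a \<times> 'a" where
  "wigner_lin_inv \<tau> p = (fst p + \<tau> *\<^sub>R snd p, fst p - (1 - \<tau>) *\<^sub>R snd p)"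

text \<open>The phase-space point where the kernel of a Gaussian shifted by
  \<open>w = ((X1, X2), (Z1, Z2))\<close> is concentrated: the position \<open>(u, v)\<close> solves
  \<open>(1 - \<tau>) u + \<tau> v = X1\<close> and \<open>u - v = - Z2\<close>, and the frequency
  is the transpose of \<open>wigner_lin \<tau>\<close> applied to \<open>(Z1, X2)\<close>.\<close>

definition wigner_point :: "real \<Rightarrow> ('a::euclidean_space \<times> 'a) \<times> ('a \<times> 'a) \<Rightarrow> ('a \<times> 'a) \<times> ('a \<times> 'a)" where
  "wigner_point \<tau> w = (wigner_lin_inv \<tau> (fst (fst w), - snd (snd w)),
     ((1 - \<tau>) *\<^sub>R fst (snd w) + snd (fst w), \<tau> *\<^sub>R fst (snd w) - snd (fst w)))"

lemma wigner_lin_inverse: "wigner_lin \<tau> (wigner_lin_inv \<tau> p) = p" "wigner_lin_inv \<tau> (wigner_lin \<tau> p) = p"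
  by (cases p; simp add: wigner_lin_def wigner_lin_inv_def algebra_simps)+

lemma norm_lin_comb_le:
  assumes "\<bar>\<alpha>\<bar> \<le> c" "\<bar>\<beta>\<bar> \<le> c"
  shows "norm (\<alpha> *\<^sub>R fst p + \<beta> *\<^sub>R snd p) \<le> 2 * c * norm p"
proof -
  have "norm (\<alpha> *\<^sub>R fst p + \<beta> *\<^sub>R snd p) \<le> \<bar>\<alpha>\<bar> * norm (fst p) + \<bar>\<beta>\<bar> * norm (snd p)"
    by (rule order_trans[OF norm_triangle_ineq]) simp
  also have "\<dots> \<le> c * norm p + c * norm p"
    using assms norm_fst_le[of "fst p" "snd p"] norm_snd_le[of "snd p" "fst p"]
    by (intro add_mono mult_mono) auto
  finally show ?thesis by simp
qed

lemma norm_wigner_lin_le: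
  "norm (wigner_lin \<tau> p) \<le> 4 * (1 + norm \<tau>) * norm p"
  "norm (wigner_lin_inv \<tau> p) \<le> 4 * (1 + norm \<tau>) * norm p"
proof -
  have "norm (wigner_lin \<tau> p) \<le> norm ((1 - \<tau>) *\<^sub>R fst p + \<tau> *\<^sub>R snd p) + norm (1 *\<^sub>R fst p + (-1) *\<^sub>R snd p)"
    unfolding wigner_lin_def by (rule order_trans[OF norm_Pair_le]) simp
  also have "\<dots> \<le> 2 * (1 + norm \<tau>) * norm p + 2 * (1 + norm \<tau>) * norm p"
    by (intro add_mono norm_lin_comb_le) auto
  finally show "norm (wigner_lin \<tau> p) \<le> 4 * (1 + norm \<tau>) * norm p" by (simp add: algebra_simps)
  have "norm (wigner_lin_inv \<tau> p) \<le> norm (1 *\<^sub>R fst p + \<tau> *\<^sub>R snd p) + norm (1 *\<^sub>R fst p + (\<tau> - 1) *\<^sub>R snd p)"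
    unfolding wigner_lin_inv_def by (rule order_trans[OF norm_Pair_le]) (simp add: algebra_simps)
  also have "\<dots> \<le> 2 * (1 + norm \<tau>) * norm p + 2 * (1 + norm \<tau>) * norm p"
    by (intro add_mono norm_lin_comb_le) auto
  finally show "norm (wigner_lin_inv \<tau> p) \<le> 4 * (1 + norm \<tau>) * norm p" by (simp add: algebra_simps)
qed

text \<open>The inverse of \<open>wigner_lin \<tau>\<close> is affine in \<tau> too, as the
  determinant has absolute value 1 for every \<tau>. Both maps are therefore bounded above and below
  with constants growing linearly in \<open>norm \<tau>\<close>, and nothing degenerates at
  \<open>\<tau> = 0\<close> or \<open>\<tau> = 1\<close>.\<close>

lemma schwartz_family_wigner_lin:
  assumes f: "schwartz f"
  shows "schwartz_family (\<lambda>\<tau> p. f (wigner_lin \<tau> p))" "schwartz_family (\<lambda>\<tau> p. f (wigner_lin_inv \<tau> p))"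
proof -
  have lin: "linear (wigner_lin \<tau> :: 'a \<times> 'a \<Rightarrow> _)" "linear (wigner_lin_inv \<tau> :: 'a \<times> 'a \<Rightarrow> _)" for \<tau>
    by (auto intro!: linearI simp: wigner_lin_def wigner_lin_inv_def algebra_simps)
  have cont: "continuous_on UNIV (\<lambda>(\<tau>, p). wigner_lin \<tau> (p :: 'a \<times> 'a))"
    "continuous_on UNIV (\<lambda>(\<tau>, p). wigner_lin_inv \<tau> (p :: 'a \<times> 'a))"
    unfolding wigner_lin_def wigner_lin_inv_def split_beta by (intro continuous_intros)+
  show "schwartz_family (\<lambda>\<tau> p. f (wigner_lin \<tau> p))"
  proof (rule schwartz_family_compose_linear[OF f lin(1) cont(1)])
    show "norm (wigner_lin \<tau> p) \<le> 4 * (1 + norm \<tau>) ^ 1 * norm p" for \<tau> and p :: "'a \<times> 'a"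
      using norm_wigner_lin_le(1) by simp
    show "norm p \<le> 4 * (1 + norm \<tau>) ^ 1 * norm (wigner_lin \<tau> p)" for \<tau> and p :: "'a \<times> 'a"
      using norm_wigner_lin_le(2)[of \<tau> "wigner_lin \<tau> p"] by (simp add: wigner_lin_inverse)
  qed
  show "schwartz_family (\<lambda>\<tau> p. f (wigner_lin_inv \<tau> p))"
  proof (rule schwartz_family_compose_linear[OF f lin(2) cont(2)])
    show "norm (wigner_lin_inv \<tau> p) \<le> 4 * (1 + norm \<tau>) ^ 1 * norm p" for \<tau> and p :: "'a \<times> 'a"
      using norm_wigner_lin_le(2) by simp
    show "norm p \<le> 4 * (1 + norm \<tau>) ^ 1 * norm (wigner_lin_inv \<tau> p)" for \<tau> and p :: "'a \<times> 'a"
      using norm_wigner_lin_le(1)[of \<tau> "wigner_lin_inv \<tau> p"] by (simp add: wigner_lin_inverse)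
  qed
qed

definition gauss_lin :: "real \<Rightarrow> 'a::euclidean_space \<times> 'a \<Rightarrow> complex" where
  "gauss_lin \<tau> p = gauss (wigner_lin \<tau> p)"

lemma schwartz_gauss_lin: "schwartz (gauss_lin \<tau>)"
  using schwartz_familyD[OF schwartz_family_wigner_lin(1)[OF schwartz_gauss]] by (simp add: gauss_lin_def[abs_def])

text \<open>The seminorms of \<open>gauss_lin \<tau>\<close> are bounded by a polynomial in
  \<open>norm \<tau>\<close>, hence by one constant for \<tau> between 0 and 1. The uniformity of
  the final constant originates here.\<close>

lemma stft_gauss_lin_bound:
  obtains C where "0 \<le> C" "\<And>\<tau> \<omega>. 0 < \<tau> \<Longrightarrow> \<tau> < 1 \<Longrightarrow>
    (1 + norm \<omega>) ^ m * norm (dist_of_fun (gauss_lin \<tau> :: 'a::euclidean_space \<times> 'a \<Rightarrow> _) (tf_shift gauss \<omega>)) \<le> C"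
proof -
  obtain C N where C: "0 \<le> C" "\<And>\<psi> z. schwartz \<psi> \<Longrightarrow>
    (1 + norm z) ^ m * norm (dist_of_fun \<psi> (tf_shift (gauss :: 'a \<times> 'a \<Rightarrow> _) z)) \<le> C * schwartz_norm N \<psi>"
    by (rule stft_schwartz_bound[OF schwartz_gauss, where m = m]) blast
  obtain D n where D: "0 \<le> D" "\<And>k bs (\<tau>::real) (t :: 'a \<times> 'a). k \<le> N \<Longrightarrow> set bs \<subseteq> Basis \<Longrightarrow> length bs \<le> N \<Longrightarrow>
     norm t ^ k * norm (iter_deriv bs (gauss_lin \<tau>) t) \<le> D * (1 + norm \<tau>) ^ n"
    unfolding gauss_lin_def[abs_def]
    by (rule schwartz_family_uniform_bound[OF schwartz_family_wigner_lin(1)[OF schwartz_gauss], where N = N]) blast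
  define c where "c = real (Suc N) * real (card {bs. set bs \<subseteq> (Basis :: ('a \<times> 'a) set) \<and> length bs \<le> N})"
  show ?thesis
  proof (rule that[of "C * (c * (D * 2 ^ n))"])
    show "0 \<le> C * (c * (D * 2 ^ n))" using C(1) D(1) by (simp add: c_def)
    fix \<tau> :: real and \<omega> :: "('a \<times> 'a) \<times> ('a \<times> 'a)" assume \<tau>: "0 < \<tau>" "\<tau> < 1"
    have "D * (1 + norm \<tau>) ^ n \<le> D * 2 ^ n" using D(1) \<tau> by (intro mult_left_mono power_mono) auto
    then have "schwartz_norm N (gauss_lin \<tau> :: 'a \<times> 'a \<Rightarrow> _) \<le> c * (D * 2 ^ n)"
      unfolding c_def by (intro schwartz_norm_le order_trans[OF D(2)])
    then have "C * schwartz_norm N (gauss_lin \<tau> :: 'a \<times> 'a \<Rightarrow> _) \<le> C * (c * (D * 2 ^ n))" using C(1) by (intro mult_left_mono)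
    with C(2)[OF schwartz_gauss_lin, of \<omega> \<tau>]
    show "(1 + norm \<omega>) ^ m * norm (dist_of_fun (gauss_lin \<tau> :: 'a \<times> 'a \<Rightarrow> _) (tf_shift gauss \<omega>)) \<le> C * (c * (D * 2 ^ n))"
      by linarith
  qed
qed

definition wigner_theta :: "real \<Rightarrow> ('a::euclidean_space \<times> 'a) \<times> ('a \<times> 'a) \<Rightarrow> 'a \<times> 'a \<Rightarrow> complex" where
  "wigner_theta \<tau> w p = wigner_kernel \<tau> (tf_shift gauss w) (fst p) (snd p)"

text \<open>The integral defining the kernel is the Fourier transform of a shifted Gaussian, hence a
  Gaussian with a phase. Collecting phases leaves one time-frequency shift of
  \<open>gauss_lin \<tau>\<close> and a constant of modulus 1.\<close>

lemma wigner_theta_eq: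
  "wigner_theta \<tau> w p = cis (2 * pi * (snd (snd w) \<bullet> snd (fst w))) * tf_shift (gauss_lin \<tau>) (wigner_point \<tau> w) p"
proof -
  obtain X1 X2 Z1 Z2 where w: "w = ((X1, X2), (Z1, Z2))" by (metis prod.collapse)
  obtain u v where p: "p = (u, v)" by (cases p)
  let ?x = "(1 - \<tau>) *\<^sub>R u + \<tau> *\<^sub>R v"
  have "wigner_theta \<tau> w p = (\<integral>\<xi>. tf_shift gauss (X1, Z1) ?x * (cis (2 * pi * ((u - v) \<bullet> \<xi>)) * tf_shift gauss (X2, Z2) \<xi>) \<partial>lborel)"
    unfolding wigner_theta_def wigner_kernel_def w p tf_shift_gauss_Pair by (simp add: mult_ac)
  also have "\<dots> = tf_shift gauss (X1, Z1) ?x * (cis (2 * pi * ((u - v + Z2) \<bullet> X2)) * gauss (u - v + Z2))"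
    unfolding integral_mult_right_zero fourier_tf_shift_gauss ..
  also have "\<dots> = (cis (2 * pi * (Z1 \<bullet> ?x)) * cis (2 * pi * ((u - v + Z2) \<bullet> X2))) * (gauss (?x - X1) * gauss (u - v + Z2))"
    by (simp add: tf_shift_def)
  also have "cis (2 * pi * (Z1 \<bullet> ?x)) * cis (2 * pi * ((u - v + Z2) \<bullet> X2))
    = cis (2 * pi * (Z2 \<bullet> X2)) * cis (2 * pi * (((1 - \<tau>) *\<^sub>R Z1 + X2, \<tau> *\<^sub>R Z1 - X2) \<bullet> (u, v)))"
    unfolding cis_mult by (simp add: inner_add_left inner_add_right inner_diff_left inner_diff_right algebra_simps inner_commute)
  also have "gauss (?x - X1) * gauss (u - v + Z2) = gauss_lin \<tau> ((u, v) - wigner_lin_inv \<tau> (X1, - Z2))"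
    unfolding gauss_Pair[symmetric] gauss_lin_def wigner_lin_def wigner_lin_inv_def
    by (rule arg_cong[of _ _ gauss]) (simp add: algebra_simps)
  finally show ?thesis unfolding w p wigner_point_def tf_shift_def by (simp add: mult.assoc)
qed

lemma schwartz_wigner_theta: "schwartz (wigner_theta \<tau> w)"
  unfolding wigner_theta_eq[abs_def] by (intro schwartz_scale schwartz_tf_shift schwartz_gauss_lin)

lemma norm_stft_wigner_theta:
  "norm (dist_of_fun (wigner_theta \<tau> w) (tf_shift gauss \<omega>))
    = norm (dist_of_fun (gauss_lin \<tau>) (tf_shift gauss (\<omega> - wigner_point \<tau> w)))"
proof -
  have "dist_of_fun (wigner_theta \<tau> w) (tf_shift gauss \<omega>)
    = cis (2 * pi * (snd (snd w) \<bullet> snd (fst w))) * dist_of_fun (tf_shift (gauss_lin \<tau>) (wigner_point \<tau> w)) (tf_shift gauss \<omega>)"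
    unfolding wigner_theta_eq[abs_def] dist_of_fun_def by (simp add: mult.assoc)
  then show ?thesis using stft_covariance[OF schwartz_gauss schwartz_gauss_lin] by (simp add: norm_mult)
qed

lemma stft_wigner_theta_measurable:
  "borel_fun (\<lambda>(w, \<omega>). dist_of_fun (wigner_theta \<tau> w) (tf_shift gauss \<omega>))"
proof -
  have c1: "continuous_on UNIV (\<lambda>x :: ((('a \<times> 'a) \<times> ('a \<times> 'a)) \<times> (('a \<times> 'a) \<times> ('a \<times> 'a))) \<times> ('a \<times> 'a).
      wigner_theta \<tau> (fst (fst x)) (snd x))"
    unfolding wigner_theta_eq tf_shift_def wigner_point_def wigner_lin_inv_def
    by (intro continuous_intros continuous_on_compose2[OF schwartz_continuous[OF schwartz_gauss_lin, of UNIV]]) auto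
  have c2: "continuous_on UNIV (\<lambda>x :: ((('a \<times> 'a) \<times> ('a \<times> 'a)) \<times> (('a \<times> 'a) \<times> ('a \<times> 'a))) \<times> ('a \<times> 'a).
      cnj (tf_shift gauss (snd (fst x)) (snd x)))"
    unfolding tf_shift_def
    by (intro continuous_intros continuous_on_compose2[OF schwartz_continuous[OF schwartz_gauss, of UNIV]]) auto
  have "borel_fun (\<lambda>x :: ((('a \<times> 'a) \<times> ('a \<times> 'a)) \<times> (('a \<times> 'a) \<times> ('a \<times> 'a))) \<times> ('a \<times> 'a).
      wigner_theta \<tau> (fst (fst x)) (snd x) * cnj (tf_shift gauss (snd (fst x)) (snd x)))"
    by (rule borel_measurable_continuous_onI[OF continuous_on_mult[OF c1 c2]])
  then have "(\<lambda>(y :: (('a \<times> 'a) \<times> ('a \<times> 'a)) \<times> (('a \<times> 'a) \<times> ('a \<times> 'a)), p).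
      wigner_theta \<tau> (fst y) p * cnj (tf_shift gauss (snd y) p)) \<in> borel_measurable (borel \<Otimes>\<^sub>M lborel)"
    by (simp add: split_beta borel_prod[symmetric] cong: measurable_cong_sets)
  from lborel.borel_measurable_lebesgue_integral[OF this]
  show ?thesis unfolding dist_of_fun_def by (simp add: split_beta)
qed

definition swap_left :: "('a::euclidean_space \<times> 'a) \<times> ('a \<times> 'a) \<Rightarrow> 'a \<times> 'a" where
  "swap_left \<omega> = (fst (fst \<omega>), fst (snd \<omega>))"

text \<open>The minus sign arises because \<open>f\<close> enters the Wigner distribution
  conjugated, and a conjugated Gaussian shift has the opposite frequency.\<close>

definition swap_right :: "('a::euclidean_space \<times> 'a) \<times> ('a \<times> 'a) \<Rightarrow> 'a \<times> 'a" where
  "swap_right \<omega> = (snd (fst \<omega>), - snd (snd \<omega>))"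

lemma tf_shift_gauss_swap:
  "tf_shift gauss \<omega> (u, v) = tf_shift gauss (swap_left \<omega>) u * cnj (tf_shift gauss (swap_right \<omega>) v)"
  using tf_shift_gauss_Pair[of "fst (fst \<omega>)" "snd (fst \<omega>)" "fst (snd \<omega>)" "snd (snd \<omega>)" u v]
  by (simp add: swap_left_def swap_right_def cnj_tf_shift_gauss)

lemma norm_Pair_le_2:
  assumes "norm a \<le> c" "norm b \<le> c"
  shows "norm (a, b) \<le> 2 * c"
  using norm_Pair_le[of a b] assms by linarith

lemma swap_props:
  "continuous_on UNIV (swap_left :: ('a::euclidean_space \<times> 'a) \<times> ('a \<times> 'a) \<Rightarrow> _)"
  "continuous_on UNIV (swap_right :: ('a \<times> 'a) \<times> ('a \<times> 'a) \<Rightarrow> _)"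
  "norm (swap_left \<omega>) \<le> 2 * norm \<omega>" "norm (swap_right \<omega>) \<le> 2 * norm (\<omega> :: ('a \<times> 'a) \<times> ('a \<times> 'a))"
proof -
  show "continuous_on UNIV (swap_left :: ('a::euclidean_space \<times> 'a) \<times> ('a \<times> 'a) \<Rightarrow> _)"
    "continuous_on UNIV (swap_right :: ('a \<times> 'a) \<times> ('a \<times> 'a) \<Rightarrow> _)"
    unfolding swap_left_def[abs_def] swap_right_def[abs_def] by (intro continuous_intros)+
  have f: "norm (fst x) \<le> norm x" "norm (snd x) \<le> norm x" for x :: "'x::real_normed_vector \<times> 'y::real_normed_vector"
    using norm_fst_le[of "fst x" "snd x"] norm_snd_le[of "snd x" "fst x"] by auto
  show "norm (swap_left \<omega>) \<le> 2 * norm \<omega>" unfolding swap_left_def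
    by (intro norm_Pair_le_2) (auto intro: order_trans[OF f(1) f(1)] order_trans[OF f(1) f(2)])
  show "norm (swap_right \<omega>) \<le> 2 * norm \<omega>" unfolding swap_right_def
    by (intro norm_Pair_le_2) (auto intro: order_trans[OF f(2) f(1)] order_trans[OF f(2) f(2)])
qed

text \<open>Inversion writes the kernel as a superposition of Gaussian shifts in
  \<open>(u, v)\<close>, each the product of a shift in \<open>u\<close> and a conjugated shift in
  \<open>v\<close>. Exchanging the integral with \<open>f\<close> and then with \<open>g\<close>
  replaces the shifts by values of the two short-time Fourier transforms. The third conclusion
  matters in its own right: distributions are meaningful on Schwartz functions only, so the argument
  of \<open>g\<close> has to be one.\<close>

lemma wigner_dist_expansion:
  fixes f g :: "'a::euclidean_space distribution" and \<tau> :: real and w :: "('a \<times> 'a) \<times> ('a \<times> 'a)"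
  assumes f: "tempered f" and g: "tempered g"
  defines "F \<equiv> \<lambda>\<omega>. dist_of_fun (wigner_theta \<tau> w) (tf_shift gauss \<omega>) * f (tf_shift gauss (swap_right \<omega>))"
  shows "wigner_dist \<tau> g f (tf_shift gauss w) = (\<integral>\<omega>. cnj (F \<omega>) * g (tf_shift gauss (swap_left \<omega>)) \<partial>lborel)"
    and "rapidly_decreasing F"
    and "schwartz (\<lambda>u. f (\<lambda>v. cnj (wigner_kernel \<tau> (tf_shift gauss w) u v)))"
    and "wigner_dist \<tau> g f (tf_shift gauss w) = g (\<lambda>u. f (\<lambda>v. cnj (wigner_kernel \<tau> (tf_shift gauss w) u v)))"
proof -
  let ?V = "\<lambda>\<omega>. dist_of_fun (wigner_theta \<tau> w) (tf_shift gauss \<omega>)"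
  have V: "rapidly_decreasing ?V" by (rule stft_rapidly_decreasing[OF schwartz_gauss schwartz_wigner_theta])
  have Kl: "schwartz_family (\<lambda>\<omega>. tf_shift (gauss :: 'a \<Rightarrow> _) (swap_left \<omega>))"
    by (rule schwartz_family_reindex[OF poly_bounded_linear_growth[OF swap_props(1,3)] schwartz_family_tf_shift[OF schwartz_gauss]]) simp
  have Kr: "schwartz_family (\<lambda>\<omega>. tf_shift (gauss :: 'a \<Rightarrow> _) (swap_right \<omega>))"
    by (rule schwartz_family_reindex[OF poly_bounded_linear_growth[OF swap_props(2,4)] schwartz_family_tf_shift[OF schwartz_gauss]]) simp
  have "cnj (wigner_kernel \<tau> (tf_shift gauss w) u v)
      = (\<integral>\<omega>. (cnj (?V \<omega>) * cnj (tf_shift gauss (swap_left \<omega>) u)) * tf_shift gauss (swap_right \<omega>) v \<partial>lborel)" for u v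
  proof -
    have "wigner_kernel \<tau> (tf_shift gauss w) u v = (\<integral>\<omega>. ?V \<omega> * tf_shift gauss \<omega> (u, v) \<partial>lborel)"
      using stft_inversion[OF schwartz_gauss schwartz_wigner_theta, of \<tau> w "(u, v)"]
      by (simp add: gauss_norm) (simp add: wigner_theta_def)
    then have "cnj (wigner_kernel \<tau> (tf_shift gauss w) u v) = (\<integral>\<omega>. cnj (?V \<omega> * tf_shift gauss \<omega> (u, v)) \<partial>lborel)"
      by (simp only: Bochner_Integration.integral_cnj)
    then show ?thesis by (simp add: tf_shift_gauss_swap mult.assoc)
  qed
  then have eq: "(\<lambda>v. cnj (wigner_kernel \<tau> (tf_shift gauss w) u v))
      = (\<lambda>v. \<integral>\<omega>. (cnj (?V \<omega>) * cnj (tf_shift gauss (swap_left \<omega>) u)) * tf_shift gauss (swap_right \<omega>) v \<partial>lborel)" for u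
    by (rule ext)
  have "f (\<lambda>v. cnj (wigner_kernel \<tau> (tf_shift gauss w) u v))
    = (\<integral>\<omega>. cnj (cnj (?V \<omega>) * cnj (tf_shift gauss (swap_left \<omega>) u)) * f (tf_shift gauss (swap_right \<omega>)) \<partial>lborel)" for u
    unfolding eq
    by (rule tempered_integral[OF f Kr rapidly_decreasing_mult[OF rapidly_decreasing_cnj[OF V] poly_bounded_cnj[OF schwartz_family_poly_bounded[OF Kl]]]])
  then have feq: "(\<lambda>u. f (\<lambda>v. cnj (wigner_kernel \<tau> (tf_shift gauss w) u v))) = (\<lambda>u. \<integral>\<omega>. F \<omega> * tf_shift gauss (swap_left \<omega>) u \<partial>lborel)"
    unfolding F_def by (simp add: mult_ac)
  show F: "rapidly_decreasing F"
    unfolding F_def by (rule rapidly_decreasing_mult[OF V tempered_family_poly_bounded[OF f Kr]])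
  show "schwartz (\<lambda>u. f (\<lambda>v. cnj (wigner_kernel \<tau> (tf_shift gauss w) u v)))"
    unfolding feq by (rule schwartz_integral[OF Kl F])
  show "wigner_dist \<tau> g f (tf_shift gauss w) = g (\<lambda>u. f (\<lambda>v. cnj (wigner_kernel \<tau> (tf_shift gauss w) u v)))"
    by (simp add: wigner_dist_def)
  show "wigner_dist \<tau> g f (tf_shift gauss w) = (\<integral>\<omega>. cnj (F \<omega>) * g (tf_shift gauss (swap_left \<omega>)) \<partial>lborel)"
    unfolding wigner_dist_def feq by (rule tempered_integral[OF g Kl F])
qed

section \<open>Wigner distributions of Schwartz functions\<close>

lemma norm_components_le:
  fixes \<omega> :: "('a::real_normed_vector \<times> 'b::real_normed_vector) \<times> ('c::real_normed_vector \<times> 'd::real_normed_vector)"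
  shows "norm (fst (fst \<omega>)) \<le> norm \<omega>" "norm (snd (fst \<omega>)) \<le> norm \<omega>"
    "norm (fst (snd \<omega>)) \<le> norm \<omega>" "norm (snd (snd \<omega>)) \<le> norm \<omega>"
proof -
  have f: "norm (fst x) \<le> norm x" "norm (snd x) \<le> norm x" for x :: "'x::real_normed_vector \<times> 'y::real_normed_vector"
    using norm_fst_le[of "fst x" "snd x"] norm_snd_le[of "snd x" "fst x"] by auto
  show "norm (fst (fst \<omega>)) \<le> norm \<omega>" "norm (snd (fst \<omega>)) \<le> norm \<omega>"
    "norm (fst (snd \<omega>)) \<le> norm \<omega>" "norm (snd (snd \<omega>)) \<le> norm \<omega>"
    by (rule order_trans[OF f(1) f(1)] order_trans[OF f(2) f(1)] order_trans[OF f(1) f(2)] order_trans[OF f(2) f(2)])+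
qed

text \<open>Derivatives of the product are avoided: the function is exhibited as a superposition of
  shifted Gaussians on the product space, to which \<open>schwartz_integral\<close> applies.\<close>

lemma schwartz_tensor:
  fixes f g :: "'a::euclidean_space \<Rightarrow> complex"
  assumes f: "schwartz f" and g: "schwartz g"
  shows "schwartz (\<lambda>p. g (fst p) * cnj (f (snd p)))"
proof -
  let ?h = "\<lambda>\<omega> :: ('a \<times> 'a) \<times> ('a \<times> 'a). ((fst (fst \<omega>), fst (snd \<omega>)), (snd (fst \<omega>), - snd (snd \<omega>)))"
  let ?g = "\<lambda>z. dist_of_fun g (tf_shift gauss z)" and ?f = "\<lambda>z. dist_of_fun f (tf_shift gauss z)"
  have nh: "norm (?h \<omega>) \<le> 4 * norm \<omega>" for \<omega>
  proof -
    have "norm (?h \<omega>) \<le> 2 * (2 * norm \<omega>)" by (intro norm_Pair_le_2) (simp_all add: norm_components_le)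
    then show ?thesis by simp
  qed
  have ch: "continuous_on UNIV ?h" by (intro continuous_intros)
  have K: "schwartz_family (\<lambda>\<omega>. tf_shift gauss (?h \<omega>))"
    by (rule schwartz_family_reindex[OF poly_bounded_linear_growth[OF ch nh] schwartz_family_tf_shift[OF schwartz_gauss]]) simp
  have pb: "rapidly_decreasing ?g" "rapidly_decreasing ?f"
    using stft_rapidly_decreasing[OF schwartz_gauss] f g by auto
  have F: "rapidly_decreasing (\<lambda>\<omega>. ?g (fst \<omega>) * cnj (?f (snd \<omega>)))"
    unfolding rapidly_decreasing_def
  proof (intro conjI allI)
    have cont: "continuous_on UNIV ?g" "continuous_on UNIV ?f"
      using stft_poly_bounded[OF tempered_dist_of_fun schwartz_gauss] f g by (auto simp: poly_bounded_def)
    show "borel_fun (\<lambda>\<omega>. ?g (fst \<omega>) * cnj (?f (snd \<omega>)))"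
      by (intro borel_measurable_continuous_onI continuous_on_mult continuous_on_cnj
        continuous_on_compose2[OF cont(1) continuous_on_fst[OF continuous_on_id]]
        continuous_on_compose2[OF cont(2) continuous_on_snd[OF continuous_on_id]]) auto
    fix k
    obtain C D where C: "\<And>z. (1 + norm z) ^ k * norm (?g z) \<le> C" "\<And>z. (1 + norm z) ^ k * norm (?f z) \<le> D"
      using pb unfolding rapidly_decreasing_def by meson
    have "(1 + norm \<omega>) ^ k * norm (?g (fst \<omega>) * cnj (?f (snd \<omega>))) \<le> C * D" for \<omega> :: "('a \<times> 'a) \<times> ('a \<times> 'a)"
    proof -
      have "1 + norm \<omega> \<le> (1 + norm (fst \<omega>)) * (1 + norm (snd \<omega>))"
        using norm_Pair_le[of "fst \<omega>" "snd \<omega>"] mult_nonneg_nonneg[OF norm_ge_zero[of "fst \<omega>"] norm_ge_zero[of "snd \<omega>"]]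
        unfolding distrib_left distrib_right prod.collapse by linarith
      then have "(1 + norm \<omega>) ^ k \<le> (1 + norm (fst \<omega>)) ^ k * (1 + norm (snd \<omega>)) ^ k"
        unfolding power_mult_distrib[symmetric] by (intro power_mono) auto
      then have "(1 + norm \<omega>) ^ k * norm (?g (fst \<omega>) * cnj (?f (snd \<omega>)))
        \<le> ((1 + norm (fst \<omega>)) ^ k * (1 + norm (snd \<omega>)) ^ k) * (norm (?g (fst \<omega>)) * norm (?f (snd \<omega>)))"
        unfolding norm_mult complex_mod_cnj by (intro mult_right_mono) auto
      also have "\<dots> = ((1 + norm (fst \<omega>)) ^ k * norm (?g (fst \<omega>))) * ((1 + norm (snd \<omega>)) ^ k * norm (?f (snd \<omega>)))"
        by (simp only: mult_ac)
      also have "\<dots> \<le> C * D"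
        by (intro mult_mono C order_trans[OF _ C(1)]) auto
      finally show ?thesis .
    qed
    then show "\<exists>C. \<forall>\<omega>. (1 + norm \<omega>) ^ k * norm (?g (fst \<omega>) * cnj (?f (snd \<omega>))) \<le> C" by blast
  qed
  have eq: "g (fst p) * cnj (f (snd p)) = (\<integral>\<omega>. (?g (fst \<omega>) * cnj (?f (snd \<omega>))) * tf_shift gauss (?h \<omega>) p \<partial>lborel)" for p
  proof -
    have i: "integrable lborel (\<lambda>\<omega>. (?g (fst \<omega>) * cnj (?f (snd \<omega>))) * tf_shift gauss (?h \<omega>) p)"
      using schwartz_family_integrable[OF K F, of "[]"] by simp
    have e: "(?g (fst \<omega>) * cnj (?f (snd \<omega>))) * tf_shift gauss (?h \<omega>) p
      = (?g (fst \<omega>) * tf_shift gauss (fst \<omega>) (fst p)) * cnj (?f (snd \<omega>) * tf_shift gauss (snd \<omega>) (snd p))" for \<omega>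
      using tf_shift_gauss_swap[of "?h \<omega>" "fst p" "snd p"] by (simp add: swap_left_def swap_right_def)
    have "(\<integral>\<omega>. (?g (fst \<omega>) * cnj (?f (snd \<omega>))) * tf_shift gauss (?h \<omega>) p \<partial>lborel)
      = (\<integral>x. \<integral>y. (?g x * tf_shift gauss x (fst p)) * cnj (?f y * tf_shift gauss y (snd p)) \<partial>lborel \<partial>lborel)"
      unfolding e using lborel_Fubini(1)[OF i[unfolded e]] by (simp only: fst_conv snd_conv)
    also have "\<dots> = (\<integral>x. ?g x * tf_shift gauss x (fst p) \<partial>lborel) * cnj (\<integral>y. ?f y * tf_shift gauss y (snd p) \<partial>lborel)"
      by (simp only: integral_mult_right_zero integral_mult_left_zero Bochner_Integration.integral_cnj)
    finally show ?thesis
      by (simp add: stft_inversion[OF schwartz_gauss f] stft_inversion[OF schwartz_gauss g] gauss_norm)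
  qed
  show ?thesis unfolding eq by (rule schwartz_integral[OF K F])
qed

text \<open>The partial Fourier transform of a shifted Gaussian is the Gaussian shifted to
  \<open>?h \<omega>\<close> times the phase \<open>?c \<omega>\<close>. A superposition for
  \<open>H\<close> therefore becomes one for its transform, with the same weights up to
  phases.\<close>

lemma schwartz_partial_fourier:
  fixes H :: "'a::euclidean_space \<times> 'a \<Rightarrow> complex"
  assumes H: "schwartz H"
  shows "schwartz (\<lambda>p. \<integral>t. cis (2 * pi * ((- snd p) \<bullet> t)) * H (fst p, t) \<partial>lborel)"
proof -
  let ?V = "\<lambda>\<omega>. dist_of_fun H (tf_shift gauss \<omega>)"
  let ?h = "\<lambda>\<omega> :: ('a \<times> 'a) \<times> ('a \<times> 'a). ((fst (fst \<omega>), snd (snd \<omega>)), (fst (snd \<omega>), - snd (fst \<omega>)))"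
  let ?c = "\<lambda>\<omega> :: ('a \<times> 'a) \<times> ('a \<times> 'a). cis (2 * pi * (snd (snd \<omega>) \<bullet> snd (fst \<omega>)))"
  have V: "rapidly_decreasing ?V" by (rule stft_rapidly_decreasing[OF schwartz_gauss H])
  have nh: "norm (?h \<omega>) \<le> 4 * norm \<omega>" for \<omega>
  proof -
    have "norm (?h \<omega>) \<le> 2 * (2 * norm \<omega>)" by (intro norm_Pair_le_2) (simp_all add: norm_components_le)
    then show ?thesis by simp
  qed
  have ch: "continuous_on UNIV ?h" by (intro continuous_intros)
  have K: "schwartz_family (\<lambda>\<omega>. tf_shift gauss (?h \<omega>))"
    by (rule schwartz_family_reindex[OF poly_bounded_linear_growth[OF ch nh] schwartz_family_tf_shift[OF schwartz_gauss]]) simp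
  have cc: "continuous_on UNIV ?c" by (intro continuous_intros)
  have c: "poly_bounded ?c"
    by (rule poly_boundedI[OF cc, of 1 0]) simp
  have F: "rapidly_decreasing (\<lambda>\<omega>. ?V \<omega> * ?c \<omega>)" by (rule rapidly_decreasing_mult[OF V c])
  have "(\<integral>t. cis (2 * pi * ((- \<xi>) \<bullet> t)) * H (x, t) \<partial>lborel) = (\<integral>\<omega>. (?V \<omega> * ?c \<omega>) * tf_shift gauss (?h \<omega>) (x, \<xi>) \<partial>lborel)" for x \<xi>
  proof -
    let ?F = "\<lambda>z. ?V (snd z) * (cis (2 * pi * ((- \<xi>) \<bullet> fst z)) * tf_shift gauss (snd z) (x, fst z))"
    \<comment> \<open>The Gaussian in \<open>t\<close> is centred at a coordinate of
      \<open>\<omega>\<close>; recentring its decay at the origin costs the power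
      \<open>2 * DIM('a)\<close> of \<open>1 + norm \<omega>\<close>, which the bound on
      \<open>?V\<close> therefore includes.\<close>
    obtain C where C: "0 \<le> C" "\<And>\<omega>. (1 + norm \<omega>) ^ (2 * DIM('a)) * norm (?V \<omega>) \<le> C * decay \<omega>"
      by (rule rapidly_decreasing_bound[OF V, where k = "2 * DIM('a)"]) blast
    obtain B where B: "0 \<le> B" "\<And>t::'a. norm (gauss t :: complex) \<le> B * decay t"
      by (rule schwartz_decay_bound[OF schwartz_gauss]) blast
    obtain B' where B': "0 \<le> B'" "\<And>t::'a. norm (gauss t :: complex) \<le> B'"
      by (rule schwartz_bounded[OF schwartz_gauss]) blast
    have Fi: "integrable lborel ?F"
    proof (rule integrable_pairI)
      have "continuous_on UNIV ?V"
        using stft_poly_bounded[OF tempered_dist_of_fun[OF H] schwartz_gauss] by (simp add: poly_bounded_def)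
      then have "continuous_on UNIV (\<lambda>z :: 'a \<times> (('a \<times> 'a) \<times> ('a \<times> 'a)). ?V (snd z))"
        by (rule continuous_on_compose2[OF _ continuous_on_snd[OF continuous_on_id]]) simp
      moreover have "continuous_on UNIV (\<lambda>z :: 'a \<times> (('a \<times> 'a) \<times> ('a \<times> 'a)). tf_shift gauss (snd z) (x, fst z))"
        unfolding tf_shift_def
        by (intro continuous_intros continuous_on_compose2[OF schwartz_continuous[OF schwartz_gauss, of UNIV]]) auto
      ultimately show "borel_fun ?F"
        by (intro borel_measurable_continuous_onI continuous_intros)
      show "integrable lborel (\<lambda>t::'a. B' * B * decay t)" "integrable lborel (\<lambda>\<omega>::('a\<times>'a)\<times>('a\<times>'a). C * decay \<omega>)"
        by (rule integrable_mult_right[OF integrable_decay])+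
      fix t and \<omega> :: "('a \<times> 'a) \<times> ('a \<times> 'a)"
      let ?b = "snd (fst \<omega>)"
      have "norm (tf_shift gauss \<omega> (x, t)) = norm (gauss (x - fst (fst \<omega>)) :: complex) * norm (gauss (t - ?b) :: complex)"
        unfolding norm_tf_shift by (simp add: gauss_Pair[symmetric] norm_mult[symmetric] minus_prod_def)
      also have "\<dots> \<le> B' * (B * ((1 + norm \<omega>) ^ (2 * DIM('a)) * decay t))"
      proof (intro mult_mono B')
        have "decay (t - ?b) \<le> (1 + norm ?b) ^ (2 * DIM('a)) * decay t" using decay_shift[of t "- ?b"] by simp
        also have "\<dots> \<le> (1 + norm \<omega>) ^ (2 * DIM('a)) * decay t"
          using norm_components_le(2)[of \<omega>] by (intro mult_right_mono power_mono) auto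
        finally have "B * decay (t - ?b) \<le> B * ((1 + norm \<omega>) ^ (2 * DIM('a)) * decay t)" using B(1) by (intro mult_left_mono)
        then show "norm (gauss (t - ?b) :: complex) \<le> B * ((1 + norm \<omega>) ^ (2 * DIM('a)) * decay t)"
          using B(2)[of "t - ?b"] by linarith
      qed auto
      finally have "norm (?F (t, \<omega>)) \<le> norm (?V \<omega>) * (B' * (B * ((1 + norm \<omega>) ^ (2 * DIM('a)) * decay t)))"
        by (simp add: norm_mult mult_left_mono)
      also have "\<dots> = (B' * B * decay t) * ((1 + norm \<omega>) ^ (2 * DIM('a)) * norm (?V \<omega>))" by (simp only: mult_ac)
      also have "\<dots> \<le> (B' * B * decay t) * (C * decay \<omega>)" using B(1) B'(1) by (intro mult_left_mono C) auto
      finally show "norm (?F (t, \<omega>)) \<le> (B' * B * decay t) * (C * decay \<omega>)" .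
    qed
    have "H (x, t) = (\<integral>\<omega>. ?V \<omega> * tf_shift gauss \<omega> (x, t) \<partial>lborel)" for t
      using stft_inversion[OF schwartz_gauss H, of "(x, t)"] by (simp add: gauss_norm)
    then have "(\<integral>t. cis (2 * pi * ((- \<xi>) \<bullet> t)) * H (x, t) \<partial>lborel)
      = (\<integral>t. cis (2 * pi * ((- \<xi>) \<bullet> t)) * (\<integral>\<omega>. ?V \<omega> * tf_shift gauss \<omega> (x, t) \<partial>lborel) \<partial>lborel)" by (simp only:)
    also have "\<dots> = (\<integral>t. \<integral>\<omega>. ?F (t, \<omega>) \<partial>lborel \<partial>lborel)"
      unfolding integral_mult_right_zero[symmetric] by (simp add: mult_ac)
    also have "\<dots> = (\<integral>\<omega>. \<integral>t. ?F (t, \<omega>) \<partial>lborel \<partial>lborel)" using lborel_Fubini[OF Fi] by simp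
    also have "\<dots> = (\<integral>\<omega>. (?V \<omega> * ?c \<omega>) * tf_shift gauss (?h \<omega>) (x, \<xi>) \<partial>lborel)"
    proof (intro Bochner_Integration.integral_cong refl)
      fix \<omega> :: "('a \<times> 'a) \<times> ('a \<times> 'a)"
      obtain a b c d where \<omega>: "\<omega> = ((a, b), (c, d))" by (metis prod.collapse)
      have "(\<integral>t. ?F (t, \<omega>) \<partial>lborel)
        = (\<integral>t. (?V \<omega> * tf_shift gauss (a, c) x) * (cis (2 * pi * ((- \<xi>) \<bullet> t)) * tf_shift gauss (b, d) t) \<partial>lborel)"
        unfolding \<omega> fst_conv snd_conv tf_shift_gauss_Pair by (intro Bochner_Integration.integral_cong refl) (simp only: mult_ac)
      also have "\<dots> = (?V \<omega> * tf_shift gauss (a, c) x) * (cis (2 * pi * ((- \<xi> + d) \<bullet> b)) * gauss (- \<xi> + d))"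
        unfolding integral_mult_right_zero fourier_tf_shift_gauss ..
      also have "cis (2 * pi * ((- \<xi> + d) \<bullet> b)) * gauss (- \<xi> + d) = cis (2 * pi * (d \<bullet> b)) * tf_shift gauss (d, - b) \<xi>"
      proof -
        have "cis (2 * pi * ((- \<xi> + d) \<bullet> b)) = cis (2 * pi * (d \<bullet> b)) * cis (2 * pi * ((- b) \<bullet> \<xi>))"
          unfolding cis_mult by (simp add: inner_diff_left algebra_simps inner_commute)
        moreover have "gauss (- \<xi> + d) = (gauss (\<xi> - d) :: complex)"
          by (simp add: gauss_def norm_minus_commute)
        ultimately show ?thesis by (simp add: tf_shift_def)
      qed
      finally show "(\<integral>t. ?F (t, \<omega>) \<partial>lborel) = (?V \<omega> * ?c \<omega>) * tf_shift gauss (?h \<omega>) (x, \<xi>)"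
        unfolding \<omega> fst_conv snd_conv tf_shift_gauss_Pair by (simp only: mult_ac)
    qed
    finally show ?thesis .
  qed
  then have "(\<lambda>p. \<integral>t. cis (2 * pi * ((- snd p) \<bullet> t)) * H (fst p, t) \<partial>lborel) = (\<lambda>p. \<integral>\<omega>. (?V \<omega> * ?c \<omega>) * tf_shift gauss (?h \<omega>) p \<partial>lborel)"
    by (simp add: fun_eq_iff)
  then show ?thesis using schwartz_integral[OF K F] by simp
qed

lemma wigner_eq:
  "wigner \<tau> g f p = (\<integral>t. cis (2 * pi * ((- snd p) \<bullet> t)) * (g (fst (wigner_lin_inv \<tau> (fst p, t))) * cnj (f (snd (wigner_lin_inv \<tau> (fst p, t))))) \<partial>lborel)"
  by (simp add: wigner_def split_beta wigner_lin_inv_def inner_commute mult.assoc)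

lemma schwartz_wigner:
  fixes f g :: "'a::euclidean_space \<Rightarrow> complex"
  assumes f: "schwartz f" and g: "schwartz g"
  shows "schwartz (wigner \<tau> g f)"
proof -
  have "schwartz (\<lambda>p. g (fst (wigner_lin_inv \<tau> p)) * cnj (f (snd (wigner_lin_inv \<tau> p))))"
    by (rule schwartz_familyD[OF schwartz_family_wigner_lin(2)[OF schwartz_tensor[OF f g]]])
  from schwartz_partial_fourier[OF this] show ?thesis unfolding wigner_eq[abs_def] by simp
qed

lemma nn_integral_lborel_Fubini:
  fixes h :: "'a::euclidean_space \<times> 'b::euclidean_space \<Rightarrow> ennreal"
  assumes h: "borel_fun h"
  shows "(\<integral>\<^sup>+z. h z \<partial>lborel) = (\<integral>\<^sup>+x. \<integral>\<^sup>+y. h (x, y) \<partial>lborel \<partial>lborel)"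
    and "(\<integral>\<^sup>+z. h z \<partial>lborel) = (\<integral>\<^sup>+y. \<integral>\<^sup>+x. h (x, y) \<partial>lborel \<partial>lborel)"
proof -
  have m: "h \<in> borel_measurable (lborel \<Otimes>\<^sub>M lborel)" using h by (simp add: lborel_prod)
  show "(\<integral>\<^sup>+z. h z \<partial>lborel) = (\<integral>\<^sup>+x. \<integral>\<^sup>+y. h (x, y) \<partial>lborel \<partial>lborel)"
    using lborel.nn_integral_fst[OF m] by (simp add: lborel_prod)
  show "(\<integral>\<^sup>+z. h z \<partial>lborel) = (\<integral>\<^sup>+y. \<integral>\<^sup>+x. h (x, y) \<partial>lborel \<partial>lborel)"
    using lborel_pair.nn_integral_snd[OF m] by (simp add: lborel_prod)
qed

lemma borel_slice:
  fixes h :: "'a::second_countable_topology \<times> 'b::second_countable_topology \<Rightarrow> 'c::topological_space"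
  assumes "borel_fun h"
  shows "borel_fun (\<lambda>y. h (x, y))" "borel_fun (\<lambda>x. h (x, y))"
proof -
  have m: "h \<in> borel_measurable (borel \<Otimes>\<^sub>M borel)" using assms by (simp add: borel_prod)
  show "borel_fun (\<lambda>y. h (x, y))" "borel_fun (\<lambda>x. h (x, y))"
    using measurable_compose[OF _ m, of "\<lambda>y. (x, y)" borel] measurable_compose[OF _ m, of "\<lambda>x. (x, y)" borel] by auto
qed

lemma nn_integral_translate:
  fixes f :: "'a::euclidean_space \<Rightarrow> ennreal"
  assumes "borel_fun f"
  shows "(\<integral>\<^sup>+x. f (x + t) \<partial>lborel) = (\<integral>\<^sup>+x. f x \<partial>lborel)"
    "(\<integral>\<^sup>+x. f (t - x) \<partial>lborel) = (\<integral>\<^sup>+x. f x \<partial>lborel)"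
  using nn_integral_lborel_affine[OF assms, of 1 t] nn_integral_lborel_affine[OF assms, of "-1" t]
  by (simp_all add: add.commute)

lemma wigner_lin_inv_measurable [measurable]:
  "wigner_lin_inv \<tau> \<in> borel_measurable (borel :: ('a::euclidean_space \<times> 'a) measure)"
  unfolding wigner_lin_inv_def[abs_def] by (intro borel_measurable_continuous_onI continuous_intros)

text \<open>A translation in \<open>x\<close> at fixed \<open>t\<close>, then a reflected
  translation in \<open>t\<close> at fixed \<open>x\<close>: both preserve Lebesgue measure, so no
  power of \<tau> appears.\<close>

lemma nn_integral_wigner_lin_inv:
  fixes h :: "'a::euclidean_space \<times> 'a \<Rightarrow> ennreal"
  assumes h: "borel_fun h"
  shows "(\<integral>\<^sup>+p. h (wigner_lin_inv \<tau> p) \<partial>lborel) = (\<integral>\<^sup>+p. h p \<partial>lborel)"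
proof -
  have c: "continuous_on UNIV (\<lambda>p::'a\<times>'a. (fst p, fst p - snd p))" by (intro continuous_intros)
  have h': "borel_fun (\<lambda>p. h (fst p, fst p - snd p))"
    by (rule measurable_compose[OF borel_measurable_continuous_onI[OF c] h])
  have "(\<integral>\<^sup>+p. h (wigner_lin_inv \<tau> p) \<partial>lborel) = (\<integral>\<^sup>+t. \<integral>\<^sup>+x. h (wigner_lin_inv \<tau> (x, t)) \<partial>lborel \<partial>lborel)"
    by (rule nn_integral_lborel_Fubini(2)[OF measurable_compose[OF wigner_lin_inv_measurable h]])
  also have "\<dots> = (\<integral>\<^sup>+t. \<integral>\<^sup>+x. h (x, x - t) \<partial>lborel \<partial>lborel)"
  proof (rule nn_integral_cong)
    fix t :: 'a
    have "wigner_lin_inv \<tau> (x, t) = (x + \<tau> *\<^sub>R t, (x + \<tau> *\<^sub>R t) - t)" for x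
      by (simp add: wigner_lin_inv_def algebra_simps)
    then show "(\<integral>\<^sup>+x. h (wigner_lin_inv \<tau> (x, t)) \<partial>lborel) = (\<integral>\<^sup>+x. h (x, x - t) \<partial>lborel)"
      using nn_integral_translate(1)[of "\<lambda>x. h (x, x - t)" "\<tau> *\<^sub>R t"] borel_slice(2)[OF h', of t] by simp
  qed
  also have "\<dots> = (\<integral>\<^sup>+x. \<integral>\<^sup>+t. h (x, x - t) \<partial>lborel \<partial>lborel)"
    using nn_integral_lborel_Fubini[OF h'] by simp
  also have "\<dots> = (\<integral>\<^sup>+x. \<integral>\<^sup>+t. h (x, t) \<partial>lborel \<partial>lborel)"
    by (intro nn_integral_cong nn_integral_translate(2) borel_slice h)
  also have "\<dots> = (\<integral>\<^sup>+p. h p \<partial>lborel)" using nn_integral_lborel_Fubini[OF h] by simp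
  finally show ?thesis .
qed

lemma integral_wigner_lin_inv:
  fixes h :: "'a::euclidean_space \<times> 'a \<Rightarrow> complex"
  assumes h: "borel_fun h"
  shows "(\<integral>p. h (wigner_lin_inv \<tau> p) \<partial>lborel) = (\<integral>p. h p \<partial>lborel)"
proof -
  have "distr lborel borel (wigner_lin_inv \<tau>) = (lborel :: ('a \<times> 'a) measure)"
  proof (rule measure_eqI)
    fix A :: "('a \<times> 'a) set" assume "A \<in> sets (distr lborel borel (wigner_lin_inv \<tau>))"
    then have A: "A \<in> sets borel" by simp
    have "emeasure (distr lborel borel (wigner_lin_inv \<tau>)) A = (\<integral>\<^sup>+x. indicator A x \<partial>distr lborel borel (wigner_lin_inv \<tau>))"
      using A by simp
    also have "\<dots> = (\<integral>\<^sup>+x. indicator A (wigner_lin_inv \<tau> x) \<partial>lborel)"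
      using A by (subst nn_integral_distr) auto
    also have "\<dots> = (\<integral>\<^sup>+x. indicator A x \<partial>lborel)"
      using A by (intro nn_integral_wigner_lin_inv) auto
    finally show "emeasure (distr lborel borel (wigner_lin_inv \<tau>)) A = emeasure lborel A" using A by simp
  qed simp
  then show ?thesis using integral_distr[of "wigner_lin_inv \<tau>" lborel borel h] h by simp
qed

lemma schwartz_slice_bound:
  fixes S :: "'a::euclidean_space \<times> 'b::euclidean_space \<Rightarrow> complex"
  assumes "schwartz S"
  obtains C where "0 \<le> C" "\<And>x t. norm (S (x, t)) \<le> C * decay t"
proof -
  obtain C where C: "0 \<le> C" "\<And>p. (1 + norm p) ^ (2 * DIM('b)) * norm (S p) \<le> C"
    by (rule schwartz_bound[OF assms, where k = "2 * DIM('b)"]) blast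
  have "norm (S (x, t)) \<le> C * decay t" for x t
  proof (rule le_decayI)
    have "norm t \<le> norm (x, t)" using norm_snd_le[of t x] by simp
    then have "(1 + norm t) ^ (2 * DIM('b)) * norm (S (x, t)) \<le> (1 + norm (x, t)) ^ (2 * DIM('b)) * norm (S (x, t))"
      by (intro mult_right_mono power_mono) auto
    then show "(1 + norm t) ^ (2 * DIM('b)) * norm (S (x, t)) \<le> C" using C(2)[of "(x, t)"] by linarith
  qed
  then show ?thesis using that C(1) by blast
qed

text \<open>Moving the integral over \<xi> inside turns \<open>?\<Phi>\<close> into the kernel at
  \<open>wigner_lin_inv \<tau> (x, t)\<close>; the measure-preserving substitution then passes from
  \<open>(x, t)\<close> to \<open>(u, v)\<close>, where \<open>g\<close> and \<open>cnj f\<close>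
  separate. This ties the distributional definition of the Wigner distribution to the
  integral.\<close>

lemma stft_wigner:
  fixes f g :: "'a::euclidean_space \<Rightarrow> complex"
  assumes f: "schwartz f" and g: "schwartz g"
  shows "dist_of_fun (wigner \<tau> g f) (tf_shift gauss w)
    = wigner_dist \<tau> (dist_of_fun g) (dist_of_fun f) (tf_shift gauss w)"
proof -
  let ?\<Phi> = "tf_shift gauss w" and ?\<Theta> = "wigner_theta \<tau> w"
  let ?T = "\<lambda>p. g (fst p) * cnj (f (snd p))"
  let ?H = "\<lambda>p. ?T (wigner_lin_inv \<tau> p)"
  have \<Phi>: "schwartz ?\<Phi>" by (rule schwartz_tf_shift[OF schwartz_gauss])
  have T: "schwartz ?T" by (rule schwartz_tensor[OF f g])
  have H: "schwartz ?H" by (rule schwartz_familyD[OF schwartz_family_wigner_lin(2)[OF T]])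
  obtain B where B: "\<And>p. norm (?\<Theta> p) \<le> B" by (rule schwartz_bounded[OF schwartz_wigner_theta]) blast
  have \<Theta>m: "borel_fun ?\<Theta>" by (rule schwartz_measurable[OF schwartz_wigner_theta])
  have Q: "integrable lborel (\<lambda>p. ?T p * cnj (?\<Theta> p))" by (rule schwartz_mult_integrable[OF T schwartz_wigner_theta])
  have HQ: "integrable lborel (\<lambda>p. ?H p * cnj (?\<Theta> (wigner_lin_inv \<tau> p)))"
    by (rule schwartz_bounded_mult_integrable[OF H, where B = B])
       (use measurable_compose[OF wigner_lin_inv_measurable borel_measurable_cnj[OF \<Theta>m]] B in auto)
  have "dist_of_fun (wigner \<tau> g f) ?\<Phi> = (\<integral>x. \<integral>\<xi>. wigner \<tau> g f (x, \<xi>) * cnj (?\<Phi> (x, \<xi>)) \<partial>lborel \<partial>lborel)"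
    unfolding dist_of_fun_def by (rule lborel_Fubini(1)[OF schwartz_mult_integrable[OF schwartz_wigner[OF f g] \<Phi>]])
  also have "\<dots> = (\<integral>x. \<integral>t. ?H (x, t) * cnj (?\<Theta> (wigner_lin_inv \<tau> (x, t))) \<partial>lborel \<partial>lborel)"
  proof (rule Bochner_Integration.integral_cong[OF refl])
    fix x :: 'a
    let ?F = "\<lambda>z :: 'a \<times> 'a. cis (2 * pi * ((- fst z) \<bullet> snd z)) * ?H (x, snd z) * cnj (?\<Phi> (x, fst z))"
    obtain C where C: "0 \<le> C" "\<And>x t. norm (?H (x, t)) \<le> C * decay t" by (rule schwartz_slice_bound[OF H]) blast
    obtain D where D: "0 \<le> D" "\<And>x t. norm (?\<Phi> (x, t)) \<le> D * decay t" by (rule schwartz_slice_bound[OF \<Phi>]) blast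
    have F: "integrable lborel ?F"
    proof (rule integrable_pairI)
      have c1: "continuous_on UNIV (\<lambda>z :: 'a \<times> 'a. cis (2 * pi * ((- fst z) \<bullet> snd z)))"
        by (intro continuous_intros)
      have cH: "continuous_on UNIV (\<lambda>z :: 'a \<times> 'a. ?H (x, snd z))"
        by (rule continuous_on_compose2[OF schwartz_continuous[OF H, of UNIV]]) (auto intro!: continuous_intros)
      have c\<Phi>: "continuous_on UNIV (\<lambda>z :: 'a \<times> 'a. ?\<Phi> (x, fst z))"
        by (rule continuous_on_compose2[OF schwartz_continuous[OF \<Phi>, of UNIV]]) (auto intro!: continuous_intros)
      show "borel_fun ?F"
        by (rule borel_measurable_continuous_onI[OF continuous_on_mult[OF continuous_on_mult[OF c1 cH] continuous_on_cnj[OF c\<Phi>]]])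
      show "integrable lborel (\<lambda>\<xi>::'a. D * decay \<xi>)" "integrable lborel (\<lambda>t::'a. C * decay t)"
        by (rule integrable_mult_right[OF integrable_decay])+
      show "norm (?F (\<xi>, t)) \<le> (D * decay \<xi>) * (C * decay t)" for \<xi> t
      proof -
        have "norm (?F (\<xi>, t)) = norm (?\<Phi> (x, \<xi>)) * norm (?H (x, t))" by (simp add: norm_mult)
        also have "\<dots> \<le> (D * decay \<xi>) * (C * decay t)" using D(1) by (intro mult_mono C D) auto
        finally show ?thesis .
      qed
    qed
    have "(\<integral>\<xi>. wigner \<tau> g f (x, \<xi>) * cnj (?\<Phi> (x, \<xi>)) \<partial>lborel) = (\<integral>\<xi>. \<integral>t. ?F (\<xi>, t) \<partial>lborel \<partial>lborel)"
      unfolding wigner_eq integral_mult_left_zero[symmetric] fst_conv snd_conv ..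
    also have "\<dots> = (\<integral>t. \<integral>\<xi>. ?F (\<xi>, t) \<partial>lborel \<partial>lborel)" using lborel_Fubini[OF F] by simp
    also have "\<dots> = (\<integral>t. ?H (x, t) * cnj (?\<Theta> (wigner_lin_inv \<tau> (x, t))) \<partial>lborel)"
    proof (rule Bochner_Integration.integral_cong[OF refl])
      fix t :: 'a
      have "?\<Theta> (wigner_lin_inv \<tau> (x, t)) = (\<integral>\<xi>. cis (2 * pi * (t \<bullet> \<xi>)) * ?\<Phi> (x, \<xi>) \<partial>lborel)"
      proof -
        have "fst (wigner_lin_inv \<tau> (x, t)) - snd (wigner_lin_inv \<tau> (x, t)) = t"
          "(1 - \<tau>) *\<^sub>R fst (wigner_lin_inv \<tau> (x, t)) + \<tau> *\<^sub>R snd (wigner_lin_inv \<tau> (x, t)) = x"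
          using wigner_lin_inverse(1)[of \<tau> "(x, t)"] by (auto simp: wigner_lin_def)
        then show ?thesis unfolding wigner_theta_def wigner_kernel_def by simp
      qed
      then have "cnj (?\<Theta> (wigner_lin_inv \<tau> (x, t))) = (\<integral>\<xi>. cnj (cis (2 * pi * (t \<bullet> \<xi>)) * ?\<Phi> (x, \<xi>)) \<partial>lborel)"
        by (simp only: Bochner_Integration.integral_cnj)
      also have "\<dots> = (\<integral>\<xi>. cis (2 * pi * ((- \<xi>) \<bullet> t)) * cnj (?\<Phi> (x, \<xi>)) \<partial>lborel)"
        by (intro Bochner_Integration.integral_cong refl) (simp add: cis_cnj inner_commute)
      finally have "?H (x, t) * cnj (?\<Theta> (wigner_lin_inv \<tau> (x, t)))
        = (\<integral>\<xi>. ?H (x, t) * (cis (2 * pi * ((- \<xi>) \<bullet> t)) * cnj (?\<Phi> (x, \<xi>))) \<partial>lborel)"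
        by (simp only: integral_mult_right_zero)
      then show "(\<integral>\<xi>. ?F (\<xi>, t) \<partial>lborel) = ?H (x, t) * cnj (?\<Theta> (wigner_lin_inv \<tau> (x, t)))"
        by (simp only: fst_conv snd_conv mult_ac)
    qed
    finally show "(\<integral>\<xi>. wigner \<tau> g f (x, \<xi>) * cnj (?\<Phi> (x, \<xi>)) \<partial>lborel)
      = (\<integral>t. ?H (x, t) * cnj (?\<Theta> (wigner_lin_inv \<tau> (x, t))) \<partial>lborel)" .
  qed
  also have "\<dots> = (\<integral>p. ?H p * cnj (?\<Theta> (wigner_lin_inv \<tau> p)) \<partial>lborel)" by (rule lborel_Fubini(1)[OF HQ, symmetric])
  also have "\<dots> = (\<integral>p. ?T p * cnj (?\<Theta> p) \<partial>lborel)"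
    using Q by (intro integral_wigner_lin_inv) auto
  also have "\<dots> = (\<integral>u. \<integral>v. ?T (u, v) * cnj (?\<Theta> (u, v)) \<partial>lborel \<partial>lborel)" by (rule lborel_Fubini(1)[OF Q])
  also have "\<dots> = (\<integral>u. g u * cnj (\<integral>v. f v * ?\<Theta> (u, v) \<partial>lborel) \<partial>lborel)"
  proof (rule Bochner_Integration.integral_cong[OF refl])
    fix u :: 'a
    have "g u * cnj (\<integral>v. f v * ?\<Theta> (u, v) \<partial>lborel) = (\<integral>v. g u * cnj (f v * ?\<Theta> (u, v)) \<partial>lborel)"
      by (simp only: integral_mult_right_zero Bochner_Integration.integral_cnj)
    then show "(\<integral>v. ?T (u, v) * cnj (?\<Theta> (u, v)) \<partial>lborel) = g u * cnj (\<integral>v. f v * ?\<Theta> (u, v) \<partial>lborel)"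
      by (simp only: complex_cnj_mult mult.assoc fst_conv snd_conv)
  qed
  finally show ?thesis
    unfolding wigner_dist_def dist_of_fun_def wigner_theta_def by simp
qed

text \<open>\<open>pairing\<close> sees \<open>v\<close> through its values on Gaussian shifts only,
  and the inversion formula with a window of norm 1 evaluates the resulting integral.\<close>

lemma pairing_dist_of_fun:
  assumes u: "tempered u" and \<psi>: "schwartz \<psi>" and v: "\<And>z. v (tf_shift gauss z) = dist_of_fun \<psi> (tf_shift gauss z)"
  shows "pairing u v = u \<psi>"
  using tempered_inversion(1)[OF u schwartz_gauss \<psi>]
  unfolding pairing_def stft_eq case_prod_unfold prod.collapse by (simp add: gauss_norm v)

lemma op_tau_schwartz:
  assumes "tempered a" "schwartz f" "schwartz g"
  shows "op_tau \<tau> a (dist_of_fun f) g = a (wigner \<tau> g f)"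
  unfolding op_tau_def using assms by (intro pairing_dist_of_fun schwartz_wigner) (simp_all add: stft_wigner)

subsection \<open>Powers of extended nonnegative reals\<close>

lemma ennreal_powr_ennreal: "0 \<le> r \<Longrightarrow> ennreal_powr (ennreal r) s = ennreal (r powr s)"
  by (simp add: ennreal_powr_def)

lemma ennreal_powr_top [simp]: "ennreal_powr \<top> s = \<top>"
  by (simp add: ennreal_powr_def)

lemma ennreal_powr_zero [simp]: "ennreal_powr 0 s = 0"
  by (simp add: ennreal_powr_def)

lemma ennreal_powr_one [simp]: "ennreal_powr x 1 = x" "ennreal_powr 1 s = 1"
  by (cases x; simp add: ennreal_powr_def) (simp add: ennreal_powr_def)

lemma ennreal_powr_mono: "x \<le> y \<Longrightarrow> 0 \<le> s \<Longrightarrow> ennreal_powr x s \<le> ennreal_powr y s"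
  by (cases x; cases y) (auto simp: ennreal_powr_ennreal top_unique intro!: ennreal_leI powr_mono2)

lemma ennreal_powr_eq_0 [simp]: "ennreal_powr x s = 0 \<longleftrightarrow> x = 0"
  by (cases x) (auto simp: ennreal_powr_ennreal)

lemma ennreal_powr_eq_top [simp]: "ennreal_powr x s = \<top> \<longleftrightarrow> x = \<top>"
  by (cases x) (auto simp: ennreal_powr_ennreal)

lemma ennreal_powr_less_top [simp]: "ennreal_powr x s < \<top> \<longleftrightarrow> x < \<top>"
  by (simp add: less_top[symmetric])

lemma ennreal_powr_mult: "ennreal_powr (x * y) s = ennreal_powr x s * ennreal_powr y s"
proof (cases "x = \<top> \<or> y = \<top>")
  case True
  then show ?thesis by (auto simp: ennreal_mult_eq_top_iff ennreal_top_mult ennreal_mult_top)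
next
  case False
  then obtain a b where "x = ennreal a" "y = ennreal b" "0 \<le> a" "0 \<le> b"
    by (metis ennreal_cases)
  then show ?thesis by (simp add: ennreal_mult'[symmetric] ennreal_powr_ennreal powr_mult)
qed

text \<open>The convention \<open>ennreal_powr \<infinity> s = \<infinity>\<close> for every \<open>s\<close>, and the value 0 of \<open>0 powr s\<close> for every \<open>s\<close>,
  make this law of exponents hold without side conditions, even for negative exponents.\<close>

lemma ennreal_powr_add: "ennreal_powr x (s + t) = ennreal_powr x s * ennreal_powr x t"
  by (cases x) (auto simp: ennreal_powr_ennreal powr_add ennreal_mult'[symmetric] ennreal_top_mult)

lemma ennreal_powr_powr: "ennreal_powr (ennreal_powr x s) t = ennreal_powr x (s * t)"
  by (cases x) (auto simp: ennreal_powr_ennreal powr_powr)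

lemma ennreal_powr_inverse [simp]:
  "s \<noteq> 0 \<Longrightarrow> ennreal_powr (ennreal_powr x s) (1 / s) = x"
  "s \<noteq> 0 \<Longrightarrow> ennreal_powr (ennreal_powr x (1 / s)) s = x"
  by (simp_all add: ennreal_powr_powr)

lemma ennreal_powr_le_iff:
  assumes "0 < s"
  shows "ennreal_powr x s \<le> ennreal_powr y s \<longleftrightarrow> x \<le> y"
proof
  assume "ennreal_powr x s \<le> ennreal_powr y s"
  then have "ennreal_powr (ennreal_powr x s) (1 / s) \<le> ennreal_powr (ennreal_powr y s) (1 / s)"
    by (rule ennreal_powr_mono) (use assms in auto)
  moreover have "s * (1 / s) = 1" using assms by simp
  ultimately show "x \<le> y" unfolding ennreal_powr_powr by simp
qed (use assms in \<open>auto intro: ennreal_powr_mono\<close>)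

lemma ennreal_powr_le_self: "x \<le> 1 \<Longrightarrow> 1 \<le> s \<Longrightarrow> ennreal_powr x s \<le> x"
proof (cases x)
  case (real r)
  assume "x \<le> 1" "1 \<le> s"
  then have "r powr s \<le> r powr 1" using real by (intro powr_mono') auto
  then show ?thesis using real by (simp add: ennreal_powr_ennreal ennreal_leI)
qed auto

lemma ennreal_powr_measurable [measurable]:
  "f \<in> borel_measurable M \<Longrightarrow> (\<lambda>x. ennreal_powr (f x) s) \<in> borel_measurable M"
proof -
  assume f: "f \<in> borel_measurable M"
  have "(\<lambda>x. ennreal (enn2real (f x) powr s)) \<in> borel_measurable M"
    using f by measurable
  moreover have "{x \<in> space M. f x = \<infinity>} \<in> sets M"
    using measurable_sets[OF f, of "{\<infinity>}"] by (simp add: vimage_def Int_def conj_commute)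
  ultimately show "(\<lambda>x. ennreal_powr (f x) s) \<in> borel_measurable M"
    unfolding ennreal_powr_def by (intro measurable_If) auto
qed

subsection \<open>The inequalities of Hoelder and Minkowski\<close>

lemma holder2:
  assumes [measurable]: "f \<in> borel_measurable M" "g \<in> borel_measurable M"
    and a: "0 \<le> a" "0 \<le> b" "a + b = 1"
  shows "(\<integral>\<^sup>+x. ennreal_powr (f x) a * ennreal_powr (g x) b \<partial>M)
     \<le> ennreal_powr (\<integral>\<^sup>+x. f x \<partial>M) a * ennreal_powr (\<integral>\<^sup>+x. g x \<partial>M) b"
proof -
  let ?F = "\<integral>\<^sup>+x. f x \<partial>M" and ?G = "\<integral>\<^sup>+x. g x \<partial>M"
  consider "?F = 0 \<or> ?G = 0" | "?F \<noteq> 0" "?G \<noteq> 0" "?F = \<top> \<or> ?G = \<top>" | "?F \<noteq> 0" "?G \<noteq> 0" "?F \<noteq> \<top>" "?G \<noteq> \<top>"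
    by blast
  then show ?thesis
  proof cases
    case 1
    then have "AE x in M. ennreal_powr (f x) a * ennreal_powr (g x) b = 0"
      by (auto simp: nn_integral_0_iff_AE elim!: eventually_mono)
    then have "(\<integral>\<^sup>+x. ennreal_powr (f x) a * ennreal_powr (g x) b \<partial>M) = 0"
      by (subst nn_integral_0_iff_AE) auto
    then show ?thesis by simp
  next
    case 2
    then have "ennreal_powr ?F a * ennreal_powr ?G b = \<top>"
      by (auto simp: ennreal_mult_eq_top_iff)
    then show ?thesis by simp
  next
    case 3
    define F G where "F = enn2real ?F" and "G = enn2real ?G"
    have FG: "?F = ennreal F" "?G = ennreal G" "0 < F" "0 < G"
      using 3 unfolding F_def G_def by (auto simp: less_top enn2real_positive_iff zero_less_iff_neq_zero)
    have "AE x in M. f x \<noteq> \<top>" "AE x in M. g x \<noteq> \<top>"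
      using 3 nn_integral_PInf_AE[of f M] nn_integral_PInf_AE[of g M] by simp_all
    then have "AE x in M. ennreal_powr (f x) a * ennreal_powr (g x) b
      \<le> ennreal (F powr a * G powr b) * (ennreal (a / F) * f x + ennreal (b / G) * g x)"
    proof eventually_elim
      case (elim x)
      define u v where "u = enn2real (f x)" and "v = enn2real (g x)"
      have uv: "f x = ennreal u" "g x = ennreal v" "0 \<le> u" "0 \<le> v"
        using elim unfolding u_def v_def by (auto simp: less_top)
      have "u powr a * v powr b \<le> (F powr a * G powr b) * (a / F * u + b / G * v)"
      proof (cases "u = 0 \<or> v = 0")
        case True
        then show ?thesis using uv FG a by auto
      next
        case False
        then have "(u / F) powr a * (v / G) powr b \<le> a * (u / F) + b * (v / G)"
          using uv FG a by (intro Youngs_inequality_0) auto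
        then have "(F powr a * G powr b) * ((u / F) powr a * (v / G) powr b) \<le> (F powr a * G powr b) * (a * (u / F) + b * (v / G))"
          using FG by (intro mult_left_mono) auto
        moreover have "(F powr a * G powr b) * ((u / F) powr a * (v / G) powr b) = u powr a * v powr b"
          using FG uv by (simp add: powr_divide)
        ultimately show ?thesis by simp
      qed
      then have "ennreal (u powr a * v powr b) \<le> ennreal ((F powr a * G powr b) * (a / F * u + b / G * v))"
        by (rule ennreal_leI)
      then show ?case using uv FG a
        by (simp add: ennreal_powr_ennreal ennreal_mult'[symmetric] ennreal_plus[symmetric] del: ennreal_plus)
    qed
    then have "(\<integral>\<^sup>+x. ennreal_powr (f x) a * ennreal_powr (g x) b \<partial>M)
      \<le> (\<integral>\<^sup>+x. ennreal (F powr a * G powr b) * (ennreal (a / F) * f x + ennreal (b / G) * g x) \<partial>M)"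
      by (rule nn_integral_mono_AE)
    also have "\<dots> = ennreal (F powr a * G powr b) * (ennreal (a / F) * ?F + ennreal (b / G) * ?G)"
      by (simp add: nn_integral_cmult nn_integral_add)
    also have "ennreal (a / F) * ?F + ennreal (b / G) * ?G = 1"
      using FG a by (simp add: ennreal_mult'[symmetric] ennreal_plus[symmetric] del: ennreal_plus)
    also have "ennreal (F powr a * G powr b) * 1 = ennreal_powr ?F a * ennreal_powr ?G b"
      using FG by (simp add: ennreal_powr_ennreal ennreal_mult')
    finally show ?thesis .
  qed
qed

lemma holder4:
  assumes [measurable]: "f \<in> borel_measurable M" "g \<in> borel_measurable M" "h \<in> borel_measurable M" "k \<in> borel_measurable M"
    and a: "0 \<le> a" "0 \<le> b" "0 \<le> c" "0 \<le> d" "a + b + c + d = 1"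
  shows "(\<integral>\<^sup>+x. ennreal_powr (f x) a * ennreal_powr (g x) b * (ennreal_powr (h x) c * ennreal_powr (k x) d) \<partial>M)
     \<le> ennreal_powr (\<integral>\<^sup>+x. f x \<partial>M) a * ennreal_powr (\<integral>\<^sup>+x. g x \<partial>M) b
       * (ennreal_powr (\<integral>\<^sup>+x. h x \<partial>M) c * ennreal_powr (\<integral>\<^sup>+x. k x \<partial>M) d)"
proof -
  \<comment> \<open>Two exponents are rescaled to weights of sum 1, so that their factors combine
    into a single power \<open>x + y\<close> and \<open>holder2\<close> can be applied in two
    layers.\<close>
  have split: "\<exists>\<alpha> \<beta>. 0 \<le> \<alpha> \<and> 0 \<le> \<beta> \<and> \<alpha> + \<beta> = 1 \<and> x = \<alpha> * (x + y) \<and> y = \<beta> * (x + y)" if "0 \<le> x" "0 \<le> y" for x y :: real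
  proof (cases "x + y = 0")
    case True
    then show ?thesis using that by (intro exI[of _ "1/2"]) auto
  next
    case False
    then show ?thesis using that
      by (intro exI[of _ "x / (x + y)"] exI[of _ "y / (x + y)"]) (auto simp: add_divide_distrib[symmetric])
  qed
  obtain \<alpha> \<beta> where u: "0 \<le> \<alpha>" "0 \<le> \<beta>" "\<alpha> + \<beta> = 1" "a = \<alpha> * (a + b)" "b = \<beta> * (a + b)" using split[OF a(1,2)] by blast
  obtain \<gamma> \<delta> where v: "0 \<le> \<gamma>" "0 \<le> \<delta>" "\<gamma> + \<delta> = 1" "c = \<gamma> * (c + d)" "d = \<delta> * (c + d)" using split[OF a(3,4)] by blast
  have 1: "ennreal_powr x a * ennreal_powr y b = ennreal_powr (ennreal_powr x \<alpha> * ennreal_powr y \<beta>) (a + b)" for x y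
    unfolding ennreal_powr_mult ennreal_powr_powr u(4,5)[symmetric] ..
  have 2: "ennreal_powr x c * ennreal_powr y d = ennreal_powr (ennreal_powr x \<gamma> * ennreal_powr y \<delta>) (c + d)" for x y
    unfolding ennreal_powr_mult ennreal_powr_powr v(4,5)[symmetric] ..
  have "(\<integral>\<^sup>+x. ennreal_powr (f x) a * ennreal_powr (g x) b * (ennreal_powr (h x) c * ennreal_powr (k x) d) \<partial>M)
    \<le> ennreal_powr (\<integral>\<^sup>+x. ennreal_powr (f x) \<alpha> * ennreal_powr (g x) \<beta> \<partial>M) (a + b)
      * ennreal_powr (\<integral>\<^sup>+x. ennreal_powr (h x) \<gamma> * ennreal_powr (k x) \<delta> \<partial>M) (c + d)"
    unfolding 1 2 using a by (intro holder2) (auto, measurable)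
  also have "\<dots> \<le> ennreal_powr (ennreal_powr (\<integral>\<^sup>+x. f x \<partial>M) \<alpha> * ennreal_powr (\<integral>\<^sup>+x. g x \<partial>M) \<beta>) (a + b)
      * ennreal_powr (ennreal_powr (\<integral>\<^sup>+x. h x \<partial>M) \<gamma> * ennreal_powr (\<integral>\<^sup>+x. k x \<partial>M) \<delta>) (c + d)"
    using a u v by (intro mult_mono ennreal_powr_mono holder2) auto
  finally show ?thesis unfolding 1 2 .
qed

lemma Lp_norm_top [simp]: "Lp_norm \<top> h = esssup lborel h"
  by (simp add: Lp_norm_def)

lemma Lp_norm_ennreal:
  assumes "1 \<le> r"
  shows "Lp_norm (ennreal r) h = ennreal_powr (\<integral>\<^sup>+x. ennreal_powr (h x) r \<partial>lborel) (1 / r)"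
  using assms by (simp add: Lp_norm_def)

lemma Lp_norm_1 [simp]: "Lp_norm 1 h = (\<integral>\<^sup>+x. h x \<partial>lborel)"
  using Lp_norm_ennreal[of 1 h] by simp

lemma exponent_cases:
  assumes "1 \<le> (p :: ennreal)"
  obtains (top) "p = \<top>" | (real) r where "p = ennreal r" "1 \<le> r"
proof (cases p)
  case (real r)
  then show ?thesis using assms that(2)[of r] by (auto simp: ennreal_1[symmetric] simp del: ennreal_1)
next
  case top
  then show ?thesis using that(1) by simp
qed

lemma Lp_norm_mono_AE:
  assumes "1 \<le> p" "borel_fun f" "AE x in lborel. f x \<le> g x"
  shows "Lp_norm p f \<le> Lp_norm p g"
  using assms(1)
proof (cases p rule: exponent_cases)
  case top
  then show ?thesis using assms by (simp add: esssup_AE_mono)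
next
  case (real r)
  then show ?thesis using assms(3)
    by (auto simp: Lp_norm_ennreal intro!: ennreal_powr_mono nn_integral_mono_AE elim!: eventually_mono)
qed

lemma Lp_norm_mono:
  assumes "1 \<le> p" "borel_fun f" "\<And>x. f x \<le> g x"
  shows "Lp_norm p f \<le> Lp_norm p g"
  by (rule Lp_norm_mono_AE[OF assms(1,2)]) (simp add: assms(3))

lemma esssup_le_iff:
  assumes "f \<in> borel_measurable M"
  shows "esssup M f \<le> c \<longleftrightarrow> (AE x in M. f x \<le> c)"
proof
  assume "esssup M f \<le> c"
  then show "AE x in M. f x \<le> c" using esssup_AE[of f M] by (auto elim!: eventually_mono)
qed (use assms in auto)

text \<open>For a finite exponent this is Tonelli's theorem. For \<open>p = \<top>\<close> a
  sublevel set of the essential supremum is described by the vanishing of the measure of a section,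
  which is a measurable condition.\<close>

lemma Lp_norm_measurable:
  fixes F :: "'a::euclidean_space \<times> 'b::euclidean_space \<Rightarrow> ennreal"
  assumes F: "borel_fun F" and p: "1 \<le> p"
  shows "borel_fun (\<lambda>y. Lp_norm p (\<lambda>x. F (x, y)))"
proof -
  have "continuous_on UNIV (\<lambda>z :: 'b \<times> 'a. (snd z, fst z))" by (intro continuous_intros)
  from measurable_compose[OF borel_measurable_continuous_onI[OF this] F]
  have F': "(\<lambda>z. F (snd z, fst z)) \<in> borel_measurable (borel \<Otimes>\<^sub>M lborel)"
    by (simp add: borel_prod[symmetric] cong: measurable_cong_sets)
  show ?thesis using p
  proof (cases p rule: exponent_cases)
    case top
    show ?thesis
    proof (rule borel_measurableI_le)
      fix c
      have "{y \<in> space borel. Lp_norm p (\<lambda>x. F (x, y)) \<le> c} = {y \<in> space borel. AE x in lborel. F (x, y) \<le> c}"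
        unfolding top Lp_norm_top using borel_slice(2)[OF F] by (subst esssup_le_iff) auto
      also have "\<dots> = {y \<in> space borel. emeasure lborel (Pair y -` {z. \<not> F (snd z, fst z) \<le> c}) = 0}"
      proof (rule Collect_cong)
        fix y
        have "(AE x in lborel. F (x, y) \<le> c) \<longleftrightarrow> emeasure lborel {x. \<not> F (x, y) \<le> c} = 0"
          using borel_slice(2)[OF F, of y] by (subst AE_iff_measurable[OF _ refl]) auto
        then show "(y \<in> space borel \<and> (AE x in lborel. F (x, y) \<le> c)) = (y \<in> space borel \<and> emeasure lborel (Pair y -` {z. \<not> F (snd z, fst z) \<le> c}) = 0)"
          by (simp add: vimage_def)
      qed
      also have "\<dots> \<in> sets borel"
      proof -
        have "{z. \<not> F (snd z, fst z) \<le> c} \<in> sets (borel \<Otimes>\<^sub>M lborel)"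
          using measurable_sets[OF F', of "{c<..}"] by (simp add: vimage_def space_pair_measure not_le)
        then have "borel_fun (\<lambda>y. emeasure lborel (Pair y -` {z. \<not> F (snd z, fst z) \<le> c}))"
          by (rule lborel.measurable_emeasure_Pair)
        then show ?thesis by simp
      qed
      finally show "{y \<in> space borel. Lp_norm p (\<lambda>x. F (x, y)) \<le> c} \<in> sets borel" .
    qed
  next
    case (real r)
    have "(\<lambda>(y, x). ennreal_powr (F (x, y)) r) \<in> borel_measurable (borel \<Otimes>\<^sub>M lborel)"
      using ennreal_powr_measurable[OF F', of r] by (simp add: split_beta)
    from lborel.borel_measurable_nn_integral[OF this]
    show ?thesis unfolding real(1) Lp_norm_ennreal[OF real(2)] by (intro ennreal_powr_measurable) simp
  qed
qed

lemma conj_exp_top [simp]: "conj_exp \<top> = 1"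
  by (simp add: conj_exp_def)

lemma conj_exp_1 [simp]: "conj_exp 1 = \<top>"
  by (simp add: conj_exp_def)

lemma conj_exp_ennreal:
  assumes "1 < r"
  shows "conj_exp (ennreal r) = ennreal (r / (r - 1))"
proof -
  have "1 - inverse (ennreal r) = ennreal (1 - inverse r)"
    using assms by (simp add: inverse_ennreal ennreal_1[symmetric] ennreal_minus del: ennreal_1)
  moreover have "0 < 1 - inverse r" using assms by (simp add: inverse_less_1_iff)
  ultimately have "conj_exp (ennreal r) = ennreal (inverse (1 - inverse r))"
    by (simp add: conj_exp_def inverse_ennreal)
  also have "inverse (1 - inverse r) = r / (r - 1)" using assms by (simp add: field_simps)
  finally show ?thesis .
qed

lemma conj_exp_cases:
  assumes "1 \<le> p"
  obtains (top) "p = \<top>" "conj_exp p = 1" | (one) "p = 1" "conj_exp p = \<top>"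
  | (real) r where "p = ennreal r" "conj_exp p = ennreal (r / (r - 1))" "1 < r"
  using assms
proof (cases p rule: exponent_cases)
  case (real r)
  show ?thesis
  proof (cases "r = 1")
    case True
    then show ?thesis using real that(2) by simp
  next
    case False
    then show ?thesis using real that(3)[of r] conj_exp_ennreal[of r] by simp
  qed
qed (use that(1) in simp)

lemma conj_exp_ge_1:
  assumes "1 \<le> p"
  shows "1 \<le> conj_exp p"
  using assms
proof (cases p rule: conj_exp_cases)
  case (real r)
  then show ?thesis by (simp add: ennreal_1[symmetric] ennreal_le_iff2 del: ennreal_1)
qed auto

lemma Lp_holder:
  fixes f g :: "'a::euclidean_space \<Rightarrow> ennreal"
  assumes p: "1 \<le> p" and [measurable]: "borel_fun f" "borel_fun g"
  shows "(\<integral>\<^sup>+x. f x * g x \<partial>lborel) \<le> Lp_norm p f * Lp_norm (conj_exp p) g"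
  using p
proof (cases p rule: conj_exp_cases)
  case top
  have "AE x in lborel. f x * g x \<le> esssup lborel f * g x"
    using esssup_AE[of f lborel] by eventually_elim (auto intro: mult_right_mono)
  then have "(\<integral>\<^sup>+x. f x * g x \<partial>lborel) \<le> (\<integral>\<^sup>+x. esssup lborel f * g x \<partial>lborel)"
    by (rule nn_integral_mono_AE)
  then show ?thesis using top by (simp add: nn_integral_cmult)
next
  case one
  have "AE x in lborel. f x * g x \<le> f x * esssup lborel g"
    using esssup_AE[of g lborel] by eventually_elim (auto intro: mult_left_mono)
  then have "(\<integral>\<^sup>+x. f x * g x \<partial>lborel) \<le> (\<integral>\<^sup>+x. f x * esssup lborel g \<partial>lborel)"
    by (rule nn_integral_mono_AE)
  then show ?thesis using one by (simp add: nn_integral_multc)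
next
  case (real r)
  define s where "s = r / (r - 1)"
  have s: "1 < s" "1 / r + 1 / s = 1" using real(3) by (auto simp: s_def field_simps)
  have "(\<integral>\<^sup>+x. f x * g x \<partial>lborel)
    = (\<integral>\<^sup>+x. ennreal_powr (ennreal_powr (f x) r) (1 / r) * ennreal_powr (ennreal_powr (g x) s) (1 / s) \<partial>lborel)"
    using real(3) s(1) by simp
  also have "\<dots> \<le> ennreal_powr (\<integral>\<^sup>+x. ennreal_powr (f x) r \<partial>lborel) (1 / r) * ennreal_powr (\<integral>\<^sup>+x. ennreal_powr (g x) s \<partial>lborel) (1 / s)"
    using s real(3) by (intro holder2) auto
  also have "\<dots> = Lp_norm p f * Lp_norm (conj_exp p) g"
    using s(1) real(3) unfolding real(2) by (simp only: Lp_norm_ennreal less_imp_le real(1) s_def)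
  finally show ?thesis .
qed

lemma Lp_norm_cmult_le:
  fixes f :: "'a::euclidean_space \<Rightarrow> ennreal"
  assumes p: "1 \<le> p" and [measurable]: "borel_fun f"
  shows "Lp_norm p (\<lambda>x. c * f x) \<le> c * Lp_norm p f"
  using p
proof (cases p rule: exponent_cases)
  case top
  have "AE x in lborel. c * f x \<le> c * esssup lborel f"
    using esssup_AE[of f lborel] by eventually_elim (auto intro: mult_left_mono)
  then show ?thesis using top by auto
next
  case (real r)
  then show ?thesis
    by (simp add: Lp_norm_ennreal ennreal_powr_mult nn_integral_cmult ennreal_powr_powr)
qed

text \<open>Hoelder's inequality gives \<open>J \<le> J\<^bsup>1 - 1/r\<^esup> K\<close> for the integral \<open>J\<close> of the \<open>r\<close>-th power; the
  truncations \<open>T k\<close> make \<open>J\<close> finite, so that it can be cancelled.\<close>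

lemma Lp_norm_minkowski:
  fixes F :: "'a::euclidean_space \<times> 'b::euclidean_space \<Rightarrow> ennreal"
  assumes F: "borel_fun F" and p: "1 \<le> p"
  shows "Lp_norm p (\<lambda>x. \<integral>\<^sup>+y. F (x, y) \<partial>lborel) \<le> (\<integral>\<^sup>+y. Lp_norm p (\<lambda>x. F (x, y)) \<partial>lborel)"
proof -
  define N where "N y = Lp_norm p (\<lambda>x. F (x, y))" for y
  have Nm[measurable]: "borel_fun N" unfolding N_def by (rule Lp_norm_measurable[OF F p])
  have F'[measurable]: "F \<in> borel_measurable (borel \<Otimes>\<^sub>M borel)" using F by (simp add: borel_prod)
  define S where "S x = (\<integral>\<^sup>+y. F (x, y) \<partial>lborel)" for x
  have Sm[measurable]: "borel_fun S"
    unfolding S_def by measurable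
  show ?thesis using p
  proof (cases p rule: exponent_cases)
    case top
    have "AE y in lborel. AE x in lborel. F (x, y) \<le> N y"
    proof (rule AE_I2)
      fix y
      show "AE x in lborel. F (x, y) \<le> N y" unfolding N_def top Lp_norm_top by (rule esssup_AE)
    qed
    moreover have "{z \<in> space (lborel \<Otimes>\<^sub>M lborel). F (fst z, snd z) \<le> N (snd z)} \<in> sets (lborel \<Otimes>\<^sub>M lborel)"
      by measurable
    ultimately have "AE x in lborel. AE y in lborel. F (x, y) \<le> N y"
      using lborel_pair.AE_commute[of "\<lambda>x y. F (x, y) \<le> N y"] by simp
    then have "AE x in lborel. S x \<le> (\<integral>\<^sup>+y. N y \<partial>lborel)"
      by eventually_elim (auto simp: S_def intro: nn_integral_mono_AE)
    then show ?thesis unfolding top Lp_norm_top S_def[symmetric] N_def[unfolded top Lp_norm_top, symmetric] by auto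
  next
    case (real r)
    let ?K = "\<integral>\<^sup>+y. N y \<partial>lborel"
    define T where "T k x = (if norm x \<le> real k then min (S x) (of_nat k) else 0)" for k x
    have Tm[measurable]: "borel_fun (T k)" for k unfolding T_def by measurable
    have r: "1 \<le> r" by (rule real(2))
    have J: "(\<integral>\<^sup>+x. ennreal_powr (T k x) r \<partial>lborel) \<le> ennreal_powr ?K r" for k
    proof -
      let ?J = "\<integral>\<^sup>+x. ennreal_powr (T k x) r \<partial>lborel"
      have "?J \<le> (\<integral>\<^sup>+x. ennreal_powr (of_nat k) r * indicator (cball (0::'a) (real k)) x \<partial>lborel)"
      proof (rule nn_integral_mono)
        fix x :: 'a
        show "ennreal_powr (T k x) r \<le> ennreal_powr (of_nat k) r * indicator (cball 0 (real k)) x"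
        proof (cases "norm x \<le> real k")
          case True
          then have "T k x \<le> of_nat k" by (simp add: T_def)
          then show ?thesis using True r by (simp add: ennreal_powr_mono)
        qed (simp add: T_def)
      qed
      also have "\<dots> = ennreal_powr (of_nat k) r * emeasure lborel (cball (0::'a) (real k))"
        by (simp add: nn_integral_cmult_indicator)
      also have "\<dots> < \<top>" using emeasure_lborel_cball_finite[of "0::'a" "real k"] by (simp add: ennreal_mult_less_top of_nat_less_top)
      finally have Jfin: "?J < \<top>" .
      have "?J \<le> (\<integral>\<^sup>+x. ennreal_powr (T k x) (r - 1) * S x \<partial>lborel)"
      proof (rule nn_integral_mono)
        fix x
        have "ennreal_powr (T k x) r = ennreal_powr (T k x) (r - 1) * T k x"
          using ennreal_powr_add[of "T k x" "r - 1" 1] by simp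
        also have "\<dots> \<le> ennreal_powr (T k x) (r - 1) * S x"
          by (intro mult_left_mono) (auto simp: T_def)
        finally show "ennreal_powr (T k x) r \<le> ennreal_powr (T k x) (r - 1) * S x" .
      qed
      also have "\<dots> = (\<integral>\<^sup>+x. \<integral>\<^sup>+y. ennreal_powr (T k x) (r - 1) * F (x, y) \<partial>lborel \<partial>lborel)"
        unfolding S_def by (intro nn_integral_cong nn_integral_cmult[symmetric]) measurable
      also have "\<dots> = (\<integral>\<^sup>+y. \<integral>\<^sup>+x. ennreal_powr (T k x) (r - 1) * F (x, y) \<partial>lborel \<partial>lborel)"
        by (rule lborel_pair.Fubini'[symmetric]) measurable
      also have "\<dots> \<le> (\<integral>\<^sup>+y. ennreal_powr ?J (1 - 1 / r) * N y \<partial>lborel)"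
      proof (rule nn_integral_mono)
        fix y
        have "ennreal_powr x (r - 1) = ennreal_powr (ennreal_powr x r) (1 - 1 / r)" for x
          using r by (simp add: ennreal_powr_powr algebra_simps)
        then have "(\<integral>\<^sup>+x. ennreal_powr (T k x) (r - 1) * F (x, y) \<partial>lborel)
          = (\<integral>\<^sup>+x. ennreal_powr (ennreal_powr (T k x) r) (1 - 1 / r) * ennreal_powr (ennreal_powr (F (x, y)) r) (1 / r) \<partial>lborel)"
          using r by simp
        also have "\<dots> \<le> ennreal_powr ?J (1 - 1 / r) * ennreal_powr (\<integral>\<^sup>+x. ennreal_powr (F (x, y)) r \<partial>lborel) (1 / r)"
          using r borel_slice(2)[OF F, of y] by (intro holder2) (auto intro!: ennreal_powr_measurable)
        finally show "(\<integral>\<^sup>+x. ennreal_powr (T k x) (r - 1) * F (x, y) \<partial>lborel) \<le> ennreal_powr ?J (1 - 1 / r) * N y"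
          unfolding N_def real(1) Lp_norm_ennreal[OF r] .
      qed
      also have "\<dots> = ennreal_powr ?J (1 - 1 / r) * ?K" by (simp add: nn_integral_cmult)
      finally have le: "?J \<le> ennreal_powr ?J (1 - 1 / r) * ?K" .
      have "ennreal_powr ?J (1 / r) \<le> ?K"
      proof (cases "?J = 0")
        case False
        have "ennreal_powr ?J (1 - 1 / r) * ennreal_powr ?J (1 / r) \<le> ennreal_powr ?J (1 - 1 / r) * ?K"
          using le ennreal_powr_add[of ?J "1 - 1 / r" "1 / r"] by simp
        then show ?thesis using False Jfin
          by (subst (asm) ennreal_mult_le_mult_iff) (auto simp: less_top)
      qed simp
      then have "ennreal_powr (ennreal_powr ?J (1 / r)) r \<le> ennreal_powr ?K r" using r by (intro ennreal_powr_mono) auto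
      then show ?thesis using r by simp
    qed
    have "ennreal_powr (S x) r = (SUP k. ennreal_powr (T k x) r)" for x
    proof (rule antisym)
      show "(SUP k. ennreal_powr (T k x) r) \<le> ennreal_powr (S x) r"
        using r by (intro SUP_least ennreal_powr_mono) (auto simp: T_def)
      show "ennreal_powr (S x) r \<le> (SUP k. ennreal_powr (T k x) r)"
      proof (cases "S x")
        case (real s)
        obtain k where k: "max (norm x) s \<le> real k" using real_arch_simple by blast
        have "S x \<le> of_nat k" unfolding real(2) ennreal_of_nat_eq_real_of_nat using k by (intro ennreal_leI) auto
        then have "T k x = S x" using k by (simp add: T_def min_def)
        then show ?thesis by (intro SUP_upper2[of k]) auto
      next
        case top
        have "(SUP k. ennreal_powr (T k x) r) = \<top>"
        proof (rule ennreal_SUP_eq_top)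
          fix n :: nat
          obtain m where m: "norm x \<le> real m" using real_arch_simple[of "norm x"] by blast
          obtain l where l: "norm x \<le> real l" "n \<le> l" "1 \<le> l"
          proof
            show "norm x \<le> real (n + m + 1)" using m by simp
          qed simp_all
          have "min \<top> (of_nat l) = (of_nat l :: ennreal)" by (rule min_absorb2) simp
          then have "T l x = of_nat l" using l(1) top unfolding T_def by simp
          then have "ennreal_powr (T l x) r = ennreal (real l powr r)"
            by (simp add: ennreal_of_nat_eq_real_of_nat[of l] ennreal_powr_ennreal del: ennreal_of_nat_eq_real_of_nat)
          moreover have "real n \<le> real l powr r"
          proof -
            have "real n \<le> real l powr 1" using l by simp
            also have "\<dots> \<le> real l powr r" using r l by (intro powr_mono) auto
            finally show ?thesis .
          qed
          ultimately have "of_nat n \<le> ennreal_powr (T l x) r"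
            unfolding ennreal_of_nat_eq_real_of_nat[of n] by (metis ennreal_leI)
          then show "\<exists>i\<in>UNIV. of_nat n \<le> ennreal_powr (T i x) r" by blast
        qed
        then show ?thesis by (metis top_greatest)
      qed
    qed
    then have "(\<integral>\<^sup>+x. ennreal_powr (S x) r \<partial>lborel) = (SUP k. \<integral>\<^sup>+x. ennreal_powr (T k x) r \<partial>lborel)"
    proof (simp only:, intro nn_integral_monotone_convergence_SUP)
      show "incseq (\<lambda>k x. ennreal_powr (T k x) r)"
        using r by (auto simp: incseq_def le_fun_def T_def intro!: ennreal_powr_mono min.mono of_nat_mono)
    qed measurable
    also have "\<dots> \<le> ennreal_powr ?K r" by (intro SUP_least J)
    finally have "ennreal_powr (\<integral>\<^sup>+x. ennreal_powr (S x) r \<partial>lborel) (1 / r) \<le> ennreal_powr (ennreal_powr ?K r) (1 / r)"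
      using r by (intro ennreal_powr_mono) auto
    then show ?thesis using r unfolding S_def[symmetric] N_def[symmetric] real(1) by (simp add: Lp_norm_ennreal N_def real(1))
  qed
qed

subsection \<open>Mixed norms\<close>

lemma AE_lborel_affine:
  fixes P :: "'a::euclidean_space \<Rightarrow> bool"
  assumes [measurable]: "{x. P x} \<in> sets borel" and AE: "AE x in lborel. P x" and c: "c \<noteq> 0"
  shows "AE x in lborel. P (t + c *\<^sub>R x)"
proof -
  have N[measurable]: "{x. \<not> P x} \<in> sets borel" using sets.compl_sets[OF assms(1)] by (simp add: Compl_eq_Diff_UNIV[symmetric] Collect_neg_eq)
  have "(\<integral>\<^sup>+x. indicator {x. \<not> P x} x \<partial>lborel) = emeasure lborel {x. \<not> P x}" by simp
  also have "\<dots> = 0" using AE by (subst (asm) AE_iff_measurable[OF _ refl]) auto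
  finally have "(\<integral>\<^sup>+x. indicator {x. \<not> P x} (t + c *\<^sub>R x) \<partial>lborel) = 0"
    by (subst nn_integral_lborel_affine[OF _ c]) auto
  then have "AE x in lborel. (indicator {x. \<not> P x} (t + c *\<^sub>R x) :: ennreal) = 0"
    by (subst (asm) nn_integral_0_iff_AE) auto
  then show ?thesis by eventually_elim (auto split: split_indicator_asm)
qed

lemma Lp_norm_affine_le:
  fixes f :: "'a::euclidean_space \<Rightarrow> ennreal"
  assumes [measurable]: "borel_fun f" and p: "1 \<le> p" and c: "c \<noteq> 0"
  shows "Lp_norm p (\<lambda>x. f (t + c *\<^sub>R x))
    \<le> ennreal (\<bar>c\<bar> powr (- real DIM('a) * enn2real (inverse p))) * Lp_norm p f"
  using p
proof (cases p rule: exponent_cases)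
  case top
  have "AE x in lborel. f (t + c *\<^sub>R x) \<le> esssup lborel f"
    by (rule AE_lborel_affine[OF _ esssup_AE c]) measurable
  moreover have "(\<lambda>x. f (t + c *\<^sub>R x)) \<in> borel_measurable lborel" by measurable
  ultimately have "esssup lborel (\<lambda>x. f (t + c *\<^sub>R x)) \<le> esssup lborel f" by (simp add: esssup_le_iff)
  then show ?thesis using top c by simp
next
  case (real r)
  have "(1 / \<bar>c\<bar> ^ DIM('a)) powr (1 / r) = \<bar>c\<bar> powr (- real DIM('a) * (1 / r))"
    using c by (simp add: powr_realpow[symmetric] powr_powr powr_minus[symmetric] divide_inverse)
  then show ?thesis using real nn_integral_lborel_affine[of "\<lambda>x. ennreal_powr (f x) r" c t] c
    by (simp add: Lp_norm_ennreal ennreal_powr_mult ennreal_powr_ennreal inverse_ennreal inverse_eq_divide)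
qed

lemma Lp_norm_translate:
  fixes f :: "'a::euclidean_space \<Rightarrow> ennreal"
  assumes "borel_fun f" "1 \<le> p"
  shows "Lp_norm p (\<lambda>x. f (x + t)) \<le> Lp_norm p f" "Lp_norm p (\<lambda>x. f (t - x)) \<le> Lp_norm p f"
  using Lp_norm_affine_le[OF assms, of 1 t] Lp_norm_affine_le[OF assms, of "-1" t]
  by (simp_all add: add.commute)

text \<open>The inner norm is in the first component, as in \<open>modulation_norm\<close>; the
  amalgam norm is the same expression with the components of the argument exchanged.\<close>

definition mixed_norm :: "ennreal \<Rightarrow> ennreal \<Rightarrow> ('a::euclidean_space \<times> 'b::euclidean_space \<Rightarrow> ennreal) \<Rightarrow> ennreal" where
  "mixed_norm p q F = Lp_norm q (\<lambda>y. Lp_norm p (\<lambda>x. F (x, y)))"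

lemma borel_compose:
  fixes h :: "'a::topological_space \<Rightarrow> 'b::topological_space"
  assumes "borel_fun f" "continuous_on UNIV h"
  shows "borel_fun (\<lambda>x. f (h x))"
  by (rule measurable_compose[OF borel_measurable_continuous_onI[OF assms(2)] assms(1)])

lemma mixed_norm_mono:
  assumes "1 \<le> p" "1 \<le> q" "borel_fun F" "\<And>z. F z \<le> G z"
  shows "mixed_norm p q F \<le> mixed_norm p q G"
  unfolding mixed_norm_def
  by (intro Lp_norm_mono assms Lp_norm_measurable borel_slice)

lemma mixed_norm_cmult_le:
  assumes "1 \<le> p" "1 \<le> q" "borel_fun F"
  shows "mixed_norm p q (\<lambda>z. c * F z) \<le> c * mixed_norm p q F"
proof -
  have m: "borel_fun (\<lambda>y. Lp_norm p (\<lambda>x. F (x, y)))"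
    by (rule Lp_norm_measurable[OF assms(3,1)])
  have m': "borel_fun (\<lambda>z. c * F z)" using assms(3) by measurable
  have "mixed_norm p q (\<lambda>z. c * F z) \<le> Lp_norm q (\<lambda>y. c * Lp_norm p (\<lambda>x. F (x, y)))"
    unfolding mixed_norm_def
    by (intro Lp_norm_mono Lp_norm_measurable[OF m'] Lp_norm_cmult_le borel_slice assms)
  also have "\<dots> \<le> c * mixed_norm p q F" unfolding mixed_norm_def
    by (rule Lp_norm_cmult_le[OF assms(2) m])
  finally show ?thesis .
qed

lemma mixed_norm_translate:
  assumes "1 \<le> p" "1 \<le> q" "borel_fun F"
  shows "mixed_norm p q (\<lambda>z. F (z + w)) \<le> mixed_norm p q F"
proof -
  have m: "borel_fun (\<lambda>y. Lp_norm p (\<lambda>x. F (x, y)))"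
    by (rule Lp_norm_measurable[OF assms(3,1)])
  have m': "borel_fun (\<lambda>z. F (z + w))"
    by (rule borel_compose[OF assms(3)]) (intro continuous_intros)
  have "mixed_norm p q (\<lambda>z. F (z + w)) \<le> Lp_norm q (\<lambda>y. Lp_norm p (\<lambda>x. F (x, y + snd w)))"
    unfolding mixed_norm_def
  proof (rule Lp_norm_mono[OF assms(2) Lp_norm_measurable[OF m' assms(1)]])
    fix y
    show "Lp_norm p (\<lambda>x. F ((x, y) + w)) \<le> Lp_norm p (\<lambda>x. F (x, y + snd w))"
      using Lp_norm_translate(1)[OF borel_slice(2)[OF assms(3), of "y + snd w"] assms(1), of "fst w"]
      by (simp add: plus_prod_def)
  qed
  also have "\<dots> \<le> mixed_norm p q F" unfolding mixed_norm_def
    by (rule Lp_norm_translate(1)[OF m assms(2)])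
  finally show ?thesis .
qed

lemma borel_nn_integral:
  fixes F :: "'a::euclidean_space \<times> 'b::euclidean_space \<Rightarrow> ennreal"
  assumes "borel_fun F"
  shows "borel_fun (\<lambda>x. \<integral>\<^sup>+y. F (x, y) \<partial>lborel)"
proof -
  have [measurable]: "F \<in> borel_measurable (borel \<Otimes>\<^sub>M borel)" using assms by (simp add: borel_prod)
  show ?thesis by measurable
qed

lemma mixed_norm_minkowski:
  fixes F :: "('a::euclidean_space \<times> 'b::euclidean_space) \<times> 'c::euclidean_space \<Rightarrow> ennreal"
  assumes F: "borel_fun F" and p: "1 \<le> p" and q: "1 \<le> q"
  shows "mixed_norm p q (\<lambda>z. \<integral>\<^sup>+v. F (z, v) \<partial>lborel) \<le> (\<integral>\<^sup>+v. mixed_norm p q (\<lambda>z. F (z, v)) \<partial>lborel)"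
proof -
  have F1: "borel_fun (\<lambda>z. F ((fst z, y), snd z))" for y
    by (rule borel_compose[OF F]) (intro continuous_intros)
  have F2: "borel_fun (\<lambda>z. F ((fst z, fst (snd z)), snd (snd z)))"
    by (rule borel_compose[OF F]) (intro continuous_intros)
  have G: "borel_fun (\<lambda>w. Lp_norm p (\<lambda>x. F ((x, fst w), snd w)))"
    using Lp_norm_measurable[OF F2 p] by simp
  have "mixed_norm p q (\<lambda>z. \<integral>\<^sup>+v. F (z, v) \<partial>lborel)
    \<le> Lp_norm q (\<lambda>y. \<integral>\<^sup>+v. Lp_norm p (\<lambda>x. F ((x, y), v)) \<partial>lborel)"
    unfolding mixed_norm_def
  proof (rule Lp_norm_mono[OF q Lp_norm_measurable[OF borel_nn_integral[OF F] p]])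
    fix y
    show "Lp_norm p (\<lambda>x. \<integral>\<^sup>+v. F ((x, y), v) \<partial>lborel) \<le> (\<integral>\<^sup>+v. Lp_norm p (\<lambda>x. F ((x, y), v)) \<partial>lborel)"
      using Lp_norm_minkowski[OF F1[of y] p] by simp
  qed
  also have "\<dots> \<le> (\<integral>\<^sup>+v. mixed_norm p q (\<lambda>z. F (z, v)) \<partial>lborel)"
    unfolding mixed_norm_def using Lp_norm_minkowski[OF G q] by simp
  finally show ?thesis .
qed

text \<open>Minkowski's inequality moves the norm under the integral, where translation invariance
  applies.\<close>

lemma mixed_norm_convolution:
  fixes F :: "'a::euclidean_space \<times> 'b::euclidean_space \<Rightarrow> ennreal"
  assumes F: "borel_fun F" and k: "borel_fun k" and p: "1 \<le> p" and q: "1 \<le> q"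
  shows "mixed_norm p q (\<lambda>z. \<integral>\<^sup>+v. k v * F (z + v) \<partial>lborel) \<le> (\<integral>\<^sup>+v. k v \<partial>lborel) * mixed_norm p q F"
proof -
  have F': "borel_fun (\<lambda>z. F (z + v))" for v
    by (rule borel_compose[OF F]) (intro continuous_intros)
  have "borel_fun (\<lambda>z. F (fst z + snd z))" "borel_fun (\<lambda>z. k (snd z))"
    by (rule borel_compose[OF F] borel_compose[OF k]; intro continuous_intros)+
  then have m: "borel_fun (\<lambda>z. k (snd z) * F (fst z + snd z))"
    by (rule borel_measurable_times_ennreal[rotated])
  have "mixed_norm p q (\<lambda>z. \<integral>\<^sup>+v. k v * F (z + v) \<partial>lborel) \<le> (\<integral>\<^sup>+v. mixed_norm p q (\<lambda>z. k v * F (z + v)) \<partial>lborel)"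
    using mixed_norm_minkowski[OF m p q] by simp
  also have "\<dots> \<le> (\<integral>\<^sup>+v. k v * mixed_norm p q F \<partial>lborel)"
  proof (rule nn_integral_mono)
    fix v
    have "mixed_norm p q (\<lambda>z. k v * F (z + v)) \<le> k v * mixed_norm p q (\<lambda>z. F (z + v))"
      by (rule mixed_norm_cmult_le[OF p q F'])
    also have "\<dots> \<le> k v * mixed_norm p q F" by (intro mult_left_mono mixed_norm_translate p q F) simp
    finally show "mixed_norm p q (\<lambda>z. k v * F (z + v)) \<le> k v * mixed_norm p q F" .
  qed
  also have "\<dots> = (\<integral>\<^sup>+v. k v \<partial>lborel) * mixed_norm p q F" using k by (simp add: nn_integral_multc)
  finally show ?thesis .
qed

lemma mixed_norm_holder:
  fixes F G :: "'a::euclidean_space \<times> 'b::euclidean_space \<Rightarrow> ennreal"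
  assumes F: "borel_fun F" and G: "borel_fun G" and p: "1 \<le> p" and q: "1 \<le> q"
  shows "(\<integral>\<^sup>+z. F z * G z \<partial>lborel) \<le> mixed_norm p q F * mixed_norm (conj_exp p) (conj_exp q) G"
proof -
  have m: "borel_fun (\<lambda>z. F z * G z)" using F G by measurable
  have "(\<integral>\<^sup>+z. F z * G z \<partial>lborel) = (\<integral>\<^sup>+y. \<integral>\<^sup>+x. F (x, y) * G (x, y) \<partial>lborel \<partial>lborel)"
    by (rule nn_integral_lborel_Fubini(2)[OF m])
  also have "\<dots> \<le> (\<integral>\<^sup>+y. Lp_norm p (\<lambda>x. F (x, y)) * Lp_norm (conj_exp p) (\<lambda>x. G (x, y)) \<partial>lborel)"
    by (intro nn_integral_mono Lp_holder p borel_slice F G)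
  also have "\<dots> \<le> mixed_norm p q F * mixed_norm (conj_exp p) (conj_exp q) G"
    unfolding mixed_norm_def by (intro Lp_holder q Lp_norm_measurable F G p conj_exp_ge_1)
  finally show ?thesis .
qed

text \<open>Values at most 1 satisfy \<open>ennreal_powr (f x) r \<le> f x\<close>, and the maximum
  with 1 makes the outer root harmless. One constant thus bounds the norms of a weight for all
  exponents.\<close>

lemma Lp_norm_le_1:
  fixes f :: "'a::euclidean_space \<Rightarrow> ennreal"
  assumes "borel_fun f" "\<And>x. f x \<le> 1" "1 \<le> p"
  shows "Lp_norm p f \<le> max 1 (\<integral>\<^sup>+x. f x \<partial>lborel)"
  using assms(3)
proof (cases p rule: exponent_cases)
  case top
  have "esssup lborel f \<le> 1" using assms by (subst esssup_le_iff) auto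
  then show ?thesis using top by (simp add: le_max_iff_disj)
next
  case (real r)
  let ?M = "max 1 (\<integral>\<^sup>+x. f x \<partial>lborel)"
  have "(\<integral>\<^sup>+x. ennreal_powr (f x) r \<partial>lborel) \<le> (\<integral>\<^sup>+x. f x \<partial>lborel)"
    using real assms by (intro nn_integral_mono ennreal_powr_le_self) auto
  also have "\<dots> \<le> ?M" by simp
  finally have "ennreal_powr (\<integral>\<^sup>+x. ennreal_powr (f x) r \<partial>lborel) (1 / r) \<le> ennreal_powr ?M (1 / r)"
    using real by (intro ennreal_powr_mono) auto
  also have "\<dots> \<le> ?M"
  proof -
    define M where "M = ?M"
    have "ennreal_powr 1 (1 - 1 / r) \<le> ennreal_powr M (1 - 1 / r)"
      using real by (intro ennreal_powr_mono) (auto simp: M_def)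
    then have "ennreal_powr M (1 / r) * 1 \<le> ennreal_powr M (1 / r) * ennreal_powr M (1 - 1 / r)"
      by (intro mult_left_mono) auto
    also have "\<dots> = M" using ennreal_powr_add[of M "1 / r" "1 - 1 / r"] by simp
    finally show ?thesis unfolding M_def by simp
  qed
  finally show ?thesis using real by (simp add: Lp_norm_ennreal)
qed

lemma nn_integral_decay: "(\<integral>\<^sup>+x. ennreal (decay (x::'a::euclidean_space)) \<partial>lborel) < \<top>"
  using integrable_decay[where 'a = 'a] decay_pos
  by (simp add: integrable_iff_bounded less_imp_le)

lemma Lp_norm_decay:
  assumes "1 \<le> r"
  shows "Lp_norm r (\<lambda>x::'a::euclidean_space. ennreal (decay x)) < \<top>"
proof -
  have "Lp_norm r (\<lambda>x::'a. ennreal (decay x)) \<le> max 1 (\<integral>\<^sup>+x. ennreal (decay (x::'a)) \<partial>lborel)"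
    using assms decay_le_1 by (intro Lp_norm_le_1) (auto simp: ennreal_1[symmetric] simp del: ennreal_1 intro!: ennreal_leI)
  then show ?thesis using nn_integral_decay[where 'a = 'a] by (auto simp: max_def split: if_splits intro: le_less_trans)
qed

lemma mixed_norm_decay:
  assumes p: "1 \<le> p" and q: "1 \<le> q"
  shows "mixed_norm p q (\<lambda>z :: 'a::euclidean_space \<times> 'b::euclidean_space. ennreal (decay (fst z) * decay (snd z))) < \<top>"
proof -
  have m1: "borel_fun (\<lambda>x::'a. ennreal (decay x))" and m2: "borel_fun (\<lambda>x::'b. ennreal (decay x))"
    by measurable
  let ?c = "Lp_norm p (\<lambda>x::'a. ennreal (decay x))"
  have "mixed_norm p q (\<lambda>z :: 'a \<times> 'b. ennreal (decay (fst z) * decay (snd z)))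
    \<le> Lp_norm q (\<lambda>y::'b. ?c * ennreal (decay y))"
    unfolding mixed_norm_def
  proof (rule Lp_norm_mono[OF q Lp_norm_measurable[OF _ p]])
    show "borel_fun (\<lambda>z :: 'a \<times> 'b. ennreal (decay (fst z) * decay (snd z)))"
      by (simp add: borel_prod[symmetric])
    fix y :: 'b
    show "Lp_norm p (\<lambda>x::'a. ennreal (decay (fst (x, y)) * decay (snd (x, y)))) \<le> ?c * ennreal (decay y)"
      using Lp_norm_cmult_le[OF p m1, of "ennreal (decay y)"] decay_pos
      by (simp add: ennreal_mult'' less_imp_le mult.commute)
  qed
  also have "\<dots> \<le> ?c * Lp_norm q (\<lambda>y::'b. ennreal (decay y))" by (rule Lp_norm_cmult_le[OF q m2])
  also have "\<dots> < \<top>" using Lp_norm_decay[OF p, where 'a = 'a] Lp_norm_decay[OF q, where 'a = 'b] by (simp add: ennreal_mult_less_top)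
  finally show ?thesis .
qed

subsection \<open>Norm estimates for \<open>\<tau>\<close>-dependent kernels\<close>

text \<open>The substitution has determinant 1, so integrating over both variables costs no power of
  \<tau>. Powers appear when one of the variables is held fixed.\<close>

lemma nn_integral_tau_shear:
  fixes h :: "'a::euclidean_space \<times> 'a \<Rightarrow> ennreal"
  assumes h: "borel_fun h"
  shows "(\<integral>\<^sup>+z. \<integral>\<^sup>+y. h ((1 - \<tau>) *\<^sub>R z + \<tau> *\<^sub>R y, y - z) \<partial>lborel \<partial>lborel)
      = (\<integral>\<^sup>+X. \<integral>\<^sup>+u. h (X, u) \<partial>lborel \<partial>lborel)"
proof -
  define h' where "h' p = h ((1 - \<tau>) *\<^sub>R fst p + \<tau> *\<^sub>R snd p, snd p - fst p)" for p
  have h': "borel_fun h'" unfolding h'_def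
    by (rule borel_compose[OF h]) (intro continuous_intros)
  have i: "h' (wigner_lin_inv \<tau> p) = h (fst p, 0 - snd p)" for p
    by (simp add: h'_def wigner_lin_inv_def algebra_simps)
  have m: "borel_fun (\<lambda>p. h (fst p, 0 - snd p))"
    by (rule borel_compose[OF h]) (intro continuous_intros)
  have "(\<integral>\<^sup>+z. \<integral>\<^sup>+y. h ((1 - \<tau>) *\<^sub>R z + \<tau> *\<^sub>R y, y - z) \<partial>lborel \<partial>lborel) = (\<integral>\<^sup>+p. h' p \<partial>lborel)"
    using nn_integral_lborel_Fubini(1)[OF h'] by (simp add: h'_def)
  also have "\<dots> = (\<integral>\<^sup>+p. h (fst p, 0 - snd p) \<partial>lborel)"
    using nn_integral_wigner_lin_inv[OF h', of \<tau>] by (simp only: i)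
  also have "\<dots> = (\<integral>\<^sup>+X. \<integral>\<^sup>+u. h (X, 0 - u) \<partial>lborel \<partial>lborel)"
    using nn_integral_lborel_Fubini(1)[OF m] by simp
  also have "\<dots> = (\<integral>\<^sup>+X. \<integral>\<^sup>+u. h (X, u) \<partial>lborel \<partial>lborel)"
    by (intro nn_integral_cong nn_integral_translate(2) borel_slice h)
  finally show ?thesis .
qed

lemma enn2real_inverse_conj_exp:
  assumes "1 \<le> r"
  shows "enn2real (inverse (conj_exp r)) = 1 - enn2real (inverse r)"
  using assms
proof (cases r rule: conj_exp_cases)
  case (real s)
  then show ?thesis by (simp add: inverse_ennreal field_simps)
qed auto

text \<open>This is the endpoint \<open>p = \<top>\<close>. The dependence of \<open>B\<close> on
  the difference is replaced by the essential supremum \<open>\<beta>\<close>, leaving a kernel in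
  \<open>X = (1 - \<tau>) z + \<tau> y\<close> alone. With \<open>X\<close> as variable Minkowski's
  inequality applies, each \<open>X\<close> contributing \<open>\<beta> X\<close> times a dilated
  copy of \<open>F\<close>.\<close>

lemma Lp_norm_tau_kernel_top:
  fixes B :: "'a::euclidean_space \<times> 'a \<Rightarrow> ennreal" and F :: "'a \<Rightarrow> ennreal"
  assumes B: "borel_fun B" and F: "borel_fun F"
    and \<tau>: "0 < \<tau>" "\<tau> < 1" and r: "1 \<le> r"
  shows "Lp_norm r (\<lambda>z. \<integral>\<^sup>+y. B ((1 - \<tau>) *\<^sub>R z + \<tau> *\<^sub>R y, y - z) * F y \<partial>lborel)
    \<le> ennreal (\<tau> powr (- real DIM('a) * enn2real (inverse (conj_exp r))) * (1 - \<tau>) powr (- real DIM('a) * enn2real (inverse r)))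
      * (\<integral>\<^sup>+X. esssup lborel (\<lambda>u. B (X, u)) \<partial>lborel) * Lp_norm r F"
proof -
  define \<beta> where "\<beta> X = esssup lborel (\<lambda>u. B (X, u))" for X
  have Bs: "borel_fun (\<lambda>z. B (snd z, fst z))"
    by (rule borel_compose[OF B]) (intro continuous_intros)
  have \<beta>: "borel_fun \<beta>" unfolding \<beta>_def
    using Lp_norm_measurable[OF Bs, of \<top>] by simp
  \<comment> \<open>For each \<open>X\<close> the set of \<open>u\<close> violating the bound by
    \<open>\<beta> X\<close> is null; \<open>nn_integral_tau_shear\<close> carries this over to
    almost every \<open>z\<close> and almost every \<open>y\<close>, where the bound is
    used.\<close>
  define Z where "Z = {p. \<not> B p \<le> \<beta> (fst p)}"
  have Zm: "Z \<in> sets borel"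
  proof -
    have "borel_fun (\<lambda>p. \<beta> (fst p))"
      by (rule borel_compose[OF \<beta>]) (intro continuous_intros)
    then have "{p \<in> space borel. \<beta> (fst p) < B p} \<in> sets borel" using B by measurable
    then show ?thesis by (simp add: Z_def not_le)
  qed
  then have Zi: "borel_fun (indicator Z)" by simp
  have Zc: "borel_fun (\<lambda>z. indicator Z ((1 - \<tau>) *\<^sub>R fst z + \<tau> *\<^sub>R snd z, snd z - fst z) :: ennreal)"
    by (rule borel_compose[OF Zi]) (intro continuous_intros)
  have "(\<integral>\<^sup>+u. indicator Z (X, u) \<partial>lborel) = 0" for X
  proof -
    have "AE u in lborel. (indicator Z (X, u) :: ennreal) = 0"
      using esssup_AE[of "\<lambda>u. B (X, u)" lborel] by eventually_elim (simp add: Z_def \<beta>_def)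
    then show ?thesis
      using borel_slice(1)[OF Zi, of X] by (subst nn_integral_0_iff_AE) auto
  qed
  then have "(\<integral>\<^sup>+z. \<integral>\<^sup>+y. indicator Z ((1 - \<tau>) *\<^sub>R z + \<tau> *\<^sub>R y, y - z) \<partial>lborel \<partial>lborel) = 0"
    using nn_integral_tau_shear[OF Zi, of \<tau>] by simp
  then have "AE z in lborel. (\<integral>\<^sup>+y. indicator Z ((1 - \<tau>) *\<^sub>R z + \<tau> *\<^sub>R y, y - z) \<partial>lborel) = 0"
    using borel_nn_integral[OF Zc] by (subst (asm) nn_integral_0_iff_AE) auto
  then have AE: "AE z in lborel. (\<integral>\<^sup>+y. B ((1 - \<tau>) *\<^sub>R z + \<tau> *\<^sub>R y, y - z) * F y \<partial>lborel)
      \<le> (\<integral>\<^sup>+y. \<beta> ((1 - \<tau>) *\<^sub>R z + \<tau> *\<^sub>R y) * F y \<partial>lborel)"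
  proof eventually_elim
    fix z assume "(\<integral>\<^sup>+y. indicator Z ((1 - \<tau>) *\<^sub>R z + \<tau> *\<^sub>R y, y - z) \<partial>lborel) = 0"
    then have "AE y in lborel. (indicator Z ((1 - \<tau>) *\<^sub>R z + \<tau> *\<^sub>R y, y - z) :: ennreal) = 0"
      using borel_slice(1)[OF Zc, of z] by (subst (asm) nn_integral_0_iff_AE) auto
    then show "(\<integral>\<^sup>+y. B ((1 - \<tau>) *\<^sub>R z + \<tau> *\<^sub>R y, y - z) * F y \<partial>lborel)
      \<le> (\<integral>\<^sup>+y. \<beta> ((1 - \<tau>) *\<^sub>R z + \<tau> *\<^sub>R y) * F y \<partial>lborel)"
      by (intro nn_integral_mono_AE, eventually_elim)
        (auto simp: Z_def split: split_indicator_asm intro: mult_right_mono)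
  qed
  \<comment> \<open>Solving \<open>X = (1 - \<tau>) z + \<tau> y\<close> gives
    \<open>y = X / \<tau> + c z\<close>, and \<open>t\<close> is the Jacobian at fixed
    \<open>z\<close>. Together with the dilation factor of \<open>c\<close> in the norm it produces
    the stated powers.\<close>
  define c where "c = - ((1 - \<tau>) / \<tau>)"
  define t where "t = ennreal (1 / \<tau> ^ DIM('a))"
  have c: "c \<noteq> 0" using \<tau> by (simp add: c_def)
  have k: "(\<integral>\<^sup>+y. \<beta> ((1 - \<tau>) *\<^sub>R z + \<tau> *\<^sub>R y) * F y \<partial>lborel) = (\<integral>\<^sup>+X. t * \<beta> X * F ((1 / \<tau>) *\<^sub>R X + c *\<^sub>R z) \<partial>lborel)" for z
  proof -
    have Fa: "borel_fun (\<lambda>X. F ((1 / \<tau>) *\<^sub>R X + c *\<^sub>R z))"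
      by (rule borel_compose[OF F]) (intro continuous_intros)
    then have m: "borel_fun (\<lambda>X. \<beta> X * F ((1 / \<tau>) *\<^sub>R X + c *\<^sub>R z))" using \<beta> by measurable
    have cm: "(\<integral>\<^sup>+X. t * (\<beta> X * F ((1 / \<tau>) *\<^sub>R X + c *\<^sub>R z)) \<partial>lborel)
      = t * (\<integral>\<^sup>+X. \<beta> X * F ((1 / \<tau>) *\<^sub>R X + c *\<^sub>R z) \<partial>lborel)"
      by (rule nn_integral_cmult) (use m in simp)
    have "(1 / \<tau>) *\<^sub>R ((1 - \<tau>) *\<^sub>R z + \<tau> *\<^sub>R y) + c *\<^sub>R z = y" for y
      using \<tau> by (simp add: c_def scaleR_add_right)
    then show ?thesis
      using nn_integral_lborel_affine[OF m, of \<tau> "(1 - \<tau>) *\<^sub>R z"] \<tau> cm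
      by (simp add: t_def mult.assoc)
  qed
  have mB: "borel_fun (\<lambda>z. B ((1 - \<tau>) *\<^sub>R fst z + \<tau> *\<^sub>R snd z, snd z - fst z))"
    by (rule borel_compose[OF B]) (intro continuous_intros)
  have mF: "borel_fun (\<lambda>z::'a\<times>'a. F (snd z))"
    by (rule borel_compose[OF F]) (intro continuous_intros)
  have mH: "borel_fun (\<lambda>z. \<integral>\<^sup>+y. B ((1 - \<tau>) *\<^sub>R z + \<tau> *\<^sub>R y, y - z) * F y \<partial>lborel)"
    using borel_nn_integral[OF borel_measurable_times_ennreal[OF mB mF]] by simp
  have mb: "borel_fun (\<lambda>z::'a\<times>'a. \<beta> (snd z))"
    by (rule borel_compose[OF \<beta>]) (intro continuous_intros)
  have mf: "borel_fun (\<lambda>z::'a\<times>'a. F ((1 / \<tau>) *\<^sub>R snd z + c *\<^sub>R fst z))"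
    by (rule borel_compose[OF F]) (intro continuous_intros)
  have mk: "borel_fun (\<lambda>z. t * \<beta> (snd z) * F ((1 / \<tau>) *\<^sub>R snd z + c *\<^sub>R fst z))"
    using mb mf by measurable
  let ?e = "ennreal (\<bar>c\<bar> powr (- real DIM('a) * enn2real (inverse r)))"
  have "Lp_norm r (\<lambda>z. \<integral>\<^sup>+y. B ((1 - \<tau>) *\<^sub>R z + \<tau> *\<^sub>R y, y - z) * F y \<partial>lborel)
    \<le> Lp_norm r (\<lambda>z. \<integral>\<^sup>+X. t * \<beta> X * F ((1 / \<tau>) *\<^sub>R X + c *\<^sub>R z) \<partial>lborel)"
    using AE unfolding k by (intro Lp_norm_mono_AE[OF r mH])
  also have "\<dots> \<le> (\<integral>\<^sup>+X. Lp_norm r (\<lambda>z. t * \<beta> X * F ((1 / \<tau>) *\<^sub>R X + c *\<^sub>R z)) \<partial>lborel)"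
    using Lp_norm_minkowski[OF mk r] by simp
  also have "\<dots> \<le> (\<integral>\<^sup>+X. (t * \<beta> X) * (?e * Lp_norm r F) \<partial>lborel)"
  proof (rule nn_integral_mono)
    fix X :: 'a
    have m: "borel_fun (\<lambda>z. F ((1 / \<tau>) *\<^sub>R X + c *\<^sub>R z))"
      by (rule borel_compose[OF F]) (intro continuous_intros)
    have "Lp_norm r (\<lambda>z. t * \<beta> X * F ((1 / \<tau>) *\<^sub>R X + c *\<^sub>R z)) \<le> t * \<beta> X * Lp_norm r (\<lambda>z. F ((1 / \<tau>) *\<^sub>R X + c *\<^sub>R z))"
      by (rule Lp_norm_cmult_le[OF r m])
    also have "\<dots> \<le> (t * \<beta> X) * (?e * Lp_norm r F)"
      by (intro mult_left_mono Lp_norm_affine_le F r c) simp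
    finally show "Lp_norm r (\<lambda>z. t * \<beta> X * F ((1 / \<tau>) *\<^sub>R X + c *\<^sub>R z)) \<le> (t * \<beta> X) * (?e * Lp_norm r F)" .
  qed
  also have "\<dots> = t * ?e * (\<integral>\<^sup>+X. \<beta> X \<partial>lborel) * Lp_norm r F"
    using \<beta> by (simp add: nn_integral_multc nn_integral_cmult mult_ac)
  also have "t * ?e = ennreal (\<tau> powr (- real DIM('a) * enn2real (inverse (conj_exp r))) * (1 - \<tau>) powr (- real DIM('a) * enn2real (inverse r)))"
  proof -
    let ?n = "real DIM('a)" and ?i = "enn2real (inverse r)"
    have "1 / \<tau> ^ DIM('a) = \<tau> powr (- ?n)" using \<tau> by (simp add: powr_minus powr_realpow inverse_eq_divide)
    moreover have "\<bar>c\<bar> powr (- ?n * ?i) = (1 - \<tau>) powr (- ?n * ?i) * \<tau> powr (?n * ?i)"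
      using \<tau> by (simp add: c_def powr_divide powr_minus field_simps)
    moreover have "\<tau> powr (- ?n) * \<tau> powr (?n * ?i) = \<tau> powr (- ?n * (1 - ?i))"
      by (simp add: powr_add[symmetric] algebra_simps)
    ultimately have "1 / \<tau> ^ DIM('a) * \<bar>c\<bar> powr (- ?n * ?i) = \<tau> powr (- ?n * (1 - ?i)) * (1 - \<tau>) powr (- ?n * ?i)"
      by (simp add: mult_ac)
    then show ?thesis unfolding t_def enn2real_inverse_conj_exp[OF r] using \<tau>
      by (subst ennreal_mult'[symmetric]) auto
  qed
  finally show ?thesis unfolding \<beta>_def .
qed

text \<open>With \<open>\<beta> X\<close> the integral of \<open>B (X, u)\<^sup>P\<close> over \<open>u\<close>, \<open>E = \<beta>\<^bsup>1/(P - 1)\<^esup>\<close> and \<open>D = B\<^sup>P \<beta>\<^bsup>1/(P - 1) - 1\<^esup>\<close>, both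
  \<open>D\<close> and \<open>E\<close> have the same integral and \<open>B \<le> D\<^bsup>1/P\<^esup> E\<^bsup>1 - 2/P\<^esup>\<close>.  Hoelder's inequality is applied to the
  factors \<open>D\<close>, \<open>F\<^sup>\<rho>\<close>, \<open>F\<^sup>\<rho> E\<close> and \<open>E\<close> with the exponents \<open>1/P\<close>, \<open>1/P\<close>, \<open>c\<close> and \<open>d\<close>.  Strict positivity of
  \<open>B\<close> avoids the junk value of \<open>0 powr (s - 1)\<close>.\<close>

lemma Lp_norm_tau_kernel_real:
  fixes B :: "'a::euclidean_space \<times> 'a \<Rightarrow> ennreal" and F :: "'a \<Rightarrow> ennreal"
  assumes B: "borel_fun B" and F: "borel_fun F" and pos: "\<And>z. B z \<noteq> 0"
    and \<tau>: "0 < \<tau>" "\<tau> < 1" and P: "1 < P" and \<rho>: "1 \<le> \<rho>" "1 / P \<le> 1 / \<rho>" "1 / P \<le> 1 - 1 / \<rho>"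
  shows "Lp_norm \<rho> (\<lambda>z. \<integral>\<^sup>+y. B ((1 - \<tau>) *\<^sub>R z + \<tau> *\<^sub>R y, y - z) * F y \<partial>lborel)
    \<le> ennreal (\<tau> powr (- real DIM('a) * (1 - 1 / \<rho>)) * (1 - \<tau>) powr (- real DIM('a) * (1 / \<rho>)))
      * Lp_norm (ennreal (P / (P - 1))) (\<lambda>X. Lp_norm (ennreal P) (\<lambda>u. B (X, u))) * Lp_norm \<rho> F"
proof -
  define s where "s = 1 / (P - 1)"
  \<comment> \<open>The two powers of \<open>F\<close> must add up to 1, that is
    \<open>\<rho> / P + \<rho> * c = 1\<close>; this fixes \<open>c\<close>, and \<open>d\<close>
    completes the four Hoelder exponents to sum 1. The hypotheses on \<open>\<rho>\<close> say that
    both are nonnegative.\<close>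
  define c where "c = 1 / \<rho> - 1 / P"
  define d where "d = 1 - 1 / \<rho> - 1 / P"
  define n where "n = real DIM('a)"
  have cd: "0 \<le> c" "0 \<le> d" "1 / P + 1 / P + c + d = 1" using \<rho> by (auto simp: c_def d_def)
  define \<beta> where "\<beta> X = (\<integral>\<^sup>+u. ennreal_powr (B (X, u)) P \<partial>lborel)" for X
  define E where "E X = ennreal_powr (\<beta> X) s" for X
  define D where "D z = ennreal_powr (B z) P * ennreal_powr (\<beta> (fst z)) (s - 1)" for z
  define \<epsilon> where "\<epsilon> = (\<integral>\<^sup>+X. E X \<partial>lborel)"
  define \<Phi> where "\<Phi> = (\<integral>\<^sup>+y. ennreal_powr (F y) \<rho> \<partial>lborel)"
  have BP: "borel_fun (\<lambda>z. ennreal_powr (B z) P)" using B by measurable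
  have \<beta>: "borel_fun \<beta>" unfolding \<beta>_def
    by (rule borel_nn_integral[OF BP])
  have E: "borel_fun E" unfolding E_def using \<beta> by measurable
  have "borel_fun (\<lambda>z. \<beta> (fst z))"
    by (rule borel_compose[OF \<beta>]) (intro continuous_intros)
  then have D: "borel_fun D" unfolding D_def using BP by measurable
  have \<beta>pos: "\<beta> X \<noteq> 0" for X
  proof
    assume "\<beta> X = 0"
    then have "AE u in lborel. ennreal_powr (B (X, u)) P = 0"
      unfolding \<beta>_def using borel_slice(1)[OF BP, of X] by (subst (asm) nn_integral_0_iff_AE) auto
    then have "AE u in (lborel :: 'a measure). False" using pos by simp
    then show False by (simp add: eventually_False ae_filter_eq_bot_iff)
  qed
  have norm_B: "Lp_norm (ennreal (P / (P - 1))) (\<lambda>X. Lp_norm (ennreal P) (\<lambda>u. B (X, u))) = ennreal_powr \<epsilon> (1 - 1 / P)"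
  proof -
    have "1 / P * (P / (P - 1)) = s" "1 / (P / (P - 1)) = 1 - 1 / P" "1 \<le> P / (P - 1)"
      using P by (auto simp: s_def field_simps)
    then show ?thesis using P unfolding \<epsilon>_def E_def \<beta>_def
      by (simp only: Lp_norm_ennreal less_imp_le ennreal_powr_powr)
  qed
  have intD: "(\<integral>\<^sup>+X. \<integral>\<^sup>+u. D (X, u) \<partial>lborel \<partial>lborel) = \<epsilon>"
  proof -
    have "(\<integral>\<^sup>+u. D (X, u) \<partial>lborel) = E X" for X
    proof -
      have "(\<integral>\<^sup>+u. D (X, u) \<partial>lborel) = \<beta> X * ennreal_powr (\<beta> X) (s - 1)"
        unfolding D_def fst_conv \<beta>_def[of X]
        by (rule nn_integral_multc) (use borel_slice(1)[OF BP, of X] in simp)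
      also have "\<dots> = E X" using ennreal_powr_add[of "\<beta> X" 1 "s - 1"] by (simp add: E_def)
      finally show ?thesis .
    qed
    then show ?thesis by (simp add: \<epsilon>_def)
  qed
  have B_le: "B z \<le> ennreal_powr (D z) (1 / P) * ennreal_powr (E (fst z)) (c + d)" for z
  proof -
    have e0: "(s - 1) * (1 / P) + s * (c + d) = 0"
      using P by (simp add: s_def c_def d_def divide_simps) (simp add: algebra_simps)
    \<comment> \<open>The exponents of \<open>\<beta>\<close> cancel to 0, and the power 0 of a
      nonzero value is 1 or, for an infinite value, \<top>. Hence an inequality and not an
      equation.\<close>
    have "1 \<le> ennreal_powr (\<beta> (fst z)) 0"
      using \<beta>pos[of "fst z"] by (cases "\<beta> (fst z)") (auto simp: ennreal_powr_ennreal powr_zero_eq_one)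
    then have "B z * 1 \<le> B z * ennreal_powr (\<beta> (fst z)) ((s - 1) * (1 / P) + s * (c + d))"
      unfolding e0 by (intro mult_left_mono) auto
    also have "\<dots> = ennreal_powr (D z) (1 / P) * ennreal_powr (E (fst z)) (c + d)"
      using P unfolding D_def E_def ennreal_powr_mult ennreal_powr_powr ennreal_powr_add[of _ "(s - 1) * (1 / P)"]
      by (simp add: mult.assoc)
    finally show ?thesis by simp
  qed
  define M where "M z y = (1 - \<tau>) *\<^sub>R z + \<tau> *\<^sub>R y" for z y :: 'a
  define H where "H z = (\<integral>\<^sup>+y. B (M z y, y - z) * F y \<partial>lborel)" for z
  define D1 where "D1 z = (\<integral>\<^sup>+y. D (M z y, y - z) \<partial>lborel)" for z
  define D2 where "D2 z = (\<integral>\<^sup>+y. ennreal_powr (F y) \<rho> * E (M z y) \<partial>lborel)" for z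
  let ?t = "ennreal (1 / \<tau> ^ DIM('a))" and ?t' = "ennreal (1 / (1 - \<tau>) ^ DIM('a))"
  have mD: "borel_fun (\<lambda>z. D (M (fst z) (snd z), snd z - fst z))" unfolding M_def
    by (rule borel_compose[OF D]) (intro continuous_intros)
  have mE: "borel_fun (\<lambda>z. E (M (fst z) (snd z)))" unfolding M_def
    by (rule borel_compose[OF E]) (intro continuous_intros)
  have mF: "borel_fun (\<lambda>z::'a\<times>'a. F (snd z))"
    by (rule borel_compose[OF F]) (intro continuous_intros)
  have mFE: "borel_fun (\<lambda>z. ennreal_powr (F (snd z)) \<rho> * E (M (fst z) (snd z)))"
    using mF mE by measurable
  have D1: "borel_fun D1" unfolding D1_def using borel_nn_integral[OF mD] by simp
  have D2: "borel_fun D2" unfolding D2_def using borel_nn_integral[OF mFE] by simp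
  have intD1: "(\<integral>\<^sup>+z. D1 z \<partial>lborel) = \<epsilon>"
    unfolding D1_def M_def nn_integral_tau_shear[OF D] by (rule intD)
  have intD2: "(\<integral>\<^sup>+z. D2 z \<partial>lborel) = ?t' * \<epsilon> * \<Phi>"
  proof -
    have "(\<integral>\<^sup>+z. D2 z \<partial>lborel) = (\<integral>\<^sup>+y. \<integral>\<^sup>+z. ennreal_powr (F y) \<rho> * E (M z y) \<partial>lborel \<partial>lborel)"
      unfolding D2_def using nn_integral_lborel_Fubini[OF mFE] by simp
    also have "\<dots> = (\<integral>\<^sup>+y. ennreal_powr (F y) \<rho> * (?t' * \<epsilon>) \<partial>lborel)"
    proof (rule nn_integral_cong)
      fix y :: 'a
      have "(\<integral>\<^sup>+z. E (M z y) \<partial>lborel) = ?t' * \<epsilon>"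
        using nn_integral_lborel_affine[OF E, of "1 - \<tau>" "\<tau> *\<^sub>R y"] \<tau> by (simp add: M_def \<epsilon>_def add.commute)
      moreover have "(\<lambda>z. E (M z y)) \<in> borel_measurable lborel" using borel_slice(2)[OF mE, of y] by simp
      ultimately show "(\<integral>\<^sup>+z. ennreal_powr (F y) \<rho> * E (M z y) \<partial>lborel) = ennreal_powr (F y) \<rho> * (?t' * \<epsilon>)"
        by (simp add: nn_integral_cmult)
    qed
    also have "\<dots> = \<Phi> * (?t' * \<epsilon>)" unfolding \<Phi>_def using F by (intro nn_integral_multc) simp
    finally show ?thesis by (simp add: mult_ac)
  qed
  define K where "K = ennreal_powr \<Phi> (1 / P) * ennreal_powr (?t * \<epsilon>) d"
  have H_le: "H z \<le> K * (ennreal_powr (D1 z) (1 / P) * ennreal_powr (D2 z) c)" for z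
  proof -
    have "H z \<le> (\<integral>\<^sup>+y. ennreal_powr (D (M z y, y - z)) (1 / P) * ennreal_powr (ennreal_powr (F y) \<rho>) (1 / P)
        * (ennreal_powr (ennreal_powr (F y) \<rho> * E (M z y)) c * ennreal_powr (E (M z y)) d) \<partial>lborel)"
      unfolding H_def
    proof (rule nn_integral_mono)
      fix y
      have "\<rho> * (1 / P) + \<rho> * c = 1" using \<rho>(1) by (simp add: c_def field_simps)
      then have "F y = ennreal_powr (ennreal_powr (F y) \<rho>) (1 / P) * ennreal_powr (ennreal_powr (F y) \<rho>) c"
        using ennreal_powr_add[of "F y" "\<rho> * (1 / P)" "\<rho> * c"] unfolding ennreal_powr_powr by simp
      then have "B (M z y, y - z) * F y \<le> (ennreal_powr (D (M z y, y - z)) (1 / P) * ennreal_powr (E (M z y)) (c + d))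
          * (ennreal_powr (ennreal_powr (F y) \<rho>) (1 / P) * ennreal_powr (ennreal_powr (F y) \<rho>) c)"
        using mult_right_mono[OF B_le[of "(M z y, y - z)"], of "F y"] by simp
      then show "B (M z y, y - z) * F y \<le> ennreal_powr (D (M z y, y - z)) (1 / P) * ennreal_powr (ennreal_powr (F y) \<rho>) (1 / P)
        * (ennreal_powr (ennreal_powr (F y) \<rho> * E (M z y)) c * ennreal_powr (E (M z y)) d)"
        by (simp only: ennreal_powr_add ennreal_powr_mult mult_ac)
    qed
    also have "\<dots> \<le> ennreal_powr (\<integral>\<^sup>+y. D (M z y, y - z) \<partial>lborel) (1 / P) * ennreal_powr \<Phi> (1 / P)
        * (ennreal_powr (\<integral>\<^sup>+y. ennreal_powr (F y) \<rho> * E (M z y) \<partial>lborel) c * ennreal_powr (\<integral>\<^sup>+y. E (M z y) \<partial>lborel) d)"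
      unfolding \<Phi>_def using borel_slice(1)[OF mD, of z] borel_slice(1)[OF mE, of z] F cd P
      by (intro holder4) auto
    also have "(\<integral>\<^sup>+y. E (M z y) \<partial>lborel) = ?t * \<epsilon>"
      using nn_integral_lborel_affine[OF E, of \<tau> "(1 - \<tau>) *\<^sub>R z"] \<tau> by (simp add: M_def \<epsilon>_def)
    finally show ?thesis unfolding D1_def D2_def K_def by (simp add: mult_ac)
  qed
  \<comment> \<open>Hoelder's inequality once more, now in \<open>z\<close>, with exponents
    \<open>\<rho> / P\<close> and \<open>\<rho> * c\<close>. The integrals of \<open>D1\<close> and
    \<open>D2\<close> are known exactly; only the latter, computed at fixed \<open>y\<close>, costs
    a power of \<open>1 - \<tau>\<close>.\<close>
  have "Lp_norm \<rho> H \<le> K * (ennreal_powr \<epsilon> (1 / P) * ennreal_powr (?t' * \<epsilon> * \<Phi>) c)"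
  proof -
    have "(\<integral>\<^sup>+z. ennreal_powr (H z) \<rho> \<partial>lborel) \<le> (\<integral>\<^sup>+z. ennreal_powr K \<rho> * (ennreal_powr (D1 z) (\<rho> / P) * ennreal_powr (D2 z) (\<rho> * c)) \<partial>lborel)"
    proof (rule nn_integral_mono)
      fix z
      have "ennreal_powr (H z) \<rho> \<le> ennreal_powr (K * (ennreal_powr (D1 z) (1 / P) * ennreal_powr (D2 z) c)) \<rho>"
        using \<rho>(1) by (intro ennreal_powr_mono H_le) simp
      then show "ennreal_powr (H z) \<rho> \<le> ennreal_powr K \<rho> * (ennreal_powr (D1 z) (\<rho> / P) * ennreal_powr (D2 z) (\<rho> * c))"
        by (simp add: ennreal_powr_mult ennreal_powr_powr mult.commute)
    qed
    also have "\<dots> = ennreal_powr K \<rho> * (\<integral>\<^sup>+z. ennreal_powr (D1 z) (\<rho> / P) * ennreal_powr (D2 z) (\<rho> * c) \<partial>lborel)"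
      using D1 D2 by (intro nn_integral_cmult) simp
    also have "\<dots> \<le> ennreal_powr K \<rho> * (ennreal_powr (\<integral>\<^sup>+z. D1 z \<partial>lborel) (\<rho> / P) * ennreal_powr (\<integral>\<^sup>+z. D2 z \<partial>lborel) (\<rho> * c))"
    proof (intro mult_left_mono holder2)
      show "\<rho> / P + \<rho> * c = 1" using \<rho>(1) by (simp add: c_def field_simps)
    qed (use D1 D2 \<rho>(1) P cd in auto)
    finally have "ennreal_powr (\<integral>\<^sup>+z. ennreal_powr (H z) \<rho> \<partial>lborel) (1 / \<rho>)
        \<le> ennreal_powr (ennreal_powr K \<rho> * (ennreal_powr \<epsilon> (\<rho> / P) * ennreal_powr (?t' * \<epsilon> * \<Phi>) (\<rho> * c))) (1 / \<rho>)"
      unfolding intD1 intD2 using \<rho>(1) by (intro ennreal_powr_mono) auto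
    also have "\<dots> = K * (ennreal_powr \<epsilon> (1 / P) * ennreal_powr (?t' * \<epsilon> * \<Phi>) c)"
      using \<rho>(1) by (simp add: ennreal_powr_mult ennreal_powr_powr)
    finally show ?thesis by (simp only: Lp_norm_ennreal[OF \<rho>(1)])
  qed
  also have "\<dots> = (ennreal_powr ?t d * ennreal_powr ?t' c) * ennreal_powr \<epsilon> (d + (1 / P + c)) * ennreal_powr \<Phi> (1 / P + c)"
    unfolding K_def ennreal_powr_add ennreal_powr_mult by (simp only: mult_ac)
  also have "d + (1 / P + c) = 1 - 1 / P" by (simp add: c_def d_def)
  also have "1 / P + c = 1 / \<rho>" by (simp add: c_def)
  also have "ennreal_powr ?t d * ennreal_powr ?t' c \<le> ennreal (\<tau> powr (- n * (1 - 1 / \<rho>)) * (1 - \<tau>) powr (- n * (1 / \<rho>)))"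
  proof -
    have e: "(1 / t ^ DIM('a)) powr e = t powr (- n * e)" if "0 < t" for t e
      using that by (simp add: n_def powr_realpow[symmetric] powr_powr powr_minus[symmetric] divide_inverse)
    \<comment> \<open>The estimate has produced the smaller exponents \<open>n * d\<close> and
      \<open>n * c\<close>. Enlarging each by \<open>n / P\<close> is admissible because \<tau> and
      \<open>1 - \<tau>\<close> are below 1, and gives the form shared with the endpoint
      \<open>p = \<top>\<close>.\<close>
    have nd: "n * d \<le> n * (1 - 1 / \<rho>)" "n * c \<le> n * (1 / \<rho>)"
      using P by (intro mult_left_mono; simp add: n_def c_def d_def)+
    have "\<tau> powr (- n * d) \<le> \<tau> powr (- n * (1 - 1 / \<rho>))" "(1 - \<tau>) powr (- n * c) \<le> (1 - \<tau>) powr (- n * (1 / \<rho>))"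
      using nd \<tau> by (intro powr_mono'; simp)+
    then have "\<tau> powr (- n * d) * (1 - \<tau>) powr (- n * c) \<le> \<tau> powr (- n * (1 - 1 / \<rho>)) * (1 - \<tau>) powr (- n * (1 / \<rho>))"
      by (intro mult_mono) auto
    then show ?thesis using \<tau> by (simp add: ennreal_powr_ennreal e ennreal_mult'[symmetric] ennreal_leI)
  qed
  finally show ?thesis
    unfolding norm_B n_def by (simp add: H_def M_def \<Phi>_def Lp_norm_ennreal[OF \<rho>(1)] mult_right_mono)
qed

lemma Lp_norm_tau_kernel:
  fixes B :: "'a::euclidean_space \<times> 'a \<Rightarrow> ennreal" and F :: "'a \<Rightarrow> ennreal"
  assumes B: "borel_fun B" and F: "borel_fun F" and pos: "\<And>z. B z \<noteq> 0"
    and \<tau>: "0 < \<tau>" "\<tau> < 1" and p: "1 \<le> p" and r: "1 \<le> r" and le: "r \<le> p" "conj_exp r \<le> p"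
  shows "Lp_norm r (\<lambda>z. \<integral>\<^sup>+y. B ((1 - \<tau>) *\<^sub>R z + \<tau> *\<^sub>R y, y - z) * F y \<partial>lborel)
    \<le> ennreal (\<tau> powr (- real DIM('a) * enn2real (inverse (conj_exp r))) * (1 - \<tau>) powr (- real DIM('a) * enn2real (inverse r)))
      * Lp_norm (conj_exp p) (\<lambda>X. Lp_norm p (\<lambda>u. B (X, u))) * Lp_norm r F"
  using p
proof (cases p rule: conj_exp_cases)
  case top
  then show ?thesis using Lp_norm_tau_kernel_top[OF B F \<tau> r] by simp
next
  case one
  \<comment> \<open>\<open>p = 1\<close> would force \<open>r\<close> and \<open>conj_exp r\<close>
    both to be at most 1, but one of two conjugate exponents exceeds 1.\<close>
  from r show ?thesis
    by (cases r rule: conj_exp_cases)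
      (use one le in \<open>auto simp: top_unique ennreal_1[symmetric] ennreal_le_iff2 simp del: ennreal_1\<close>)
next
  case (real P)
  from r obtain \<rho> where \<rho>: "r = ennreal \<rho>" "conj_exp r = ennreal (\<rho> / (\<rho> - 1))" "1 < \<rho>"
    by (cases r rule: conj_exp_cases) (use real(1) le in \<open>auto simp: top_unique\<close>)
  have "\<rho> \<le> P" "\<rho> / (\<rho> - 1) \<le> P" using le \<rho> real by (auto simp: ennreal_le_iff2)
  then have P: "1 / P \<le> 1 / \<rho>" "1 / P \<le> 1 - 1 / \<rho>"
    using \<rho>(3) real(3) by (auto simp: field_simps)
  have "enn2real (inverse r) = 1 / \<rho>" using \<rho> by (simp add: inverse_ennreal inverse_eq_divide)
  then show ?thesis
    using Lp_norm_tau_kernel_real[OF B F pos \<tau> real(3) less_imp_le[OF \<rho>(3)] P]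
    unfolding enn2real_inverse_conj_exp[OF r] real(2) by (simp only: \<rho>(1) real(1))
qed

text \<open>Minkowski's integral inequality with exponent \<open>q = p / s\<close>, applied to the
  power \<open>s\<close> of \<open>K\<close>: the larger exponent may be moved inside.\<close>

lemma Lp_norm_swap_le:
  fixes K :: "'a::euclidean_space \<times> 'b::euclidean_space \<Rightarrow> ennreal"
  assumes K: "borel_fun K" and s: "1 \<le> s" "s \<noteq> \<top>" "s \<le> p"
  shows "Lp_norm p (\<lambda>x. Lp_norm s (\<lambda>y. K (x, y))) \<le> Lp_norm s (\<lambda>y. Lp_norm p (\<lambda>x. K (x, y)))"
proof -
  obtain \<sigma> where \<sigma>: "s = ennreal \<sigma>" "1 \<le> \<sigma>"
    using s(1,2) by (cases s rule: exponent_cases) auto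
  have p: "1 \<le> p" using s by simp
  have Ks: "borel_fun (\<lambda>z. ennreal_powr (K z) \<sigma>)" using K by measurable
  have scale: "Lp_norm p (\<lambda>x. ennreal_powr (f x) (1 / \<sigma>)) = ennreal_powr (Lp_norm q f) (1 / \<sigma>)"
    if f: "borel_fun f" and q: "q = (if p = \<top> then \<top> else p / s)" for f :: "'a \<Rightarrow> ennreal" and q
  proof (cases "p = \<top>")
    case True
    have m: "borel_fun (\<lambda>x. ennreal_powr (f x) (1 / \<sigma>))" using f by measurable
    have le: "ennreal_powr x (1 / \<sigma>) \<le> y \<longleftrightarrow> x \<le> ennreal_powr y \<sigma>" for x y
      using ennreal_powr_le_iff[of \<sigma> "ennreal_powr x (1 / \<sigma>)" y] \<sigma>(2) by simp
    have "esssup lborel (\<lambda>x. ennreal_powr (f x) (1 / \<sigma>)) \<le> y \<longleftrightarrow> ennreal_powr (esssup lborel f) (1 / \<sigma>) \<le> y" for y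
      using f m by (simp add: esssup_le_iff le)
    then have "esssup lborel (\<lambda>x. ennreal_powr (f x) (1 / \<sigma>)) = ennreal_powr (esssup lborel f) (1 / \<sigma>)"
      by (intro antisym) (metis order_refl)+
    then show ?thesis using True q by simp
  next
    case False
    with p obtain P where P: "p = ennreal P" "1 \<le> P" by (cases p rule: exponent_cases) auto
    have "\<sigma> \<le> P" using s(3) \<sigma> P by (simp add: ennreal_le_iff2)
    then have "q = ennreal (P / \<sigma>)" "1 \<le> P / \<sigma>" using q False \<sigma> P by (auto simp: divide_ennreal)
    then show ?thesis using P \<sigma> by (simp add: Lp_norm_ennreal ennreal_powr_powr)
  qed
  define q where "q = (if p = \<top> then \<top> else p / s)"
  have q: "1 \<le> q"
  proof (cases "p = \<top>")
    case False
    with p obtain P where P: "p = ennreal P" "1 \<le> P" by (cases p rule: exponent_cases) auto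
    have "\<sigma> \<le> P" using s(3) \<sigma> P by (simp add: ennreal_le_iff2)
    then have "1 \<le> P / \<sigma>" using \<sigma> by simp
    then show ?thesis using P \<sigma> False unfolding q_def
      by (simp add: divide_ennreal ennreal_1[symmetric] ennreal_le_iff2 del: ennreal_1)
  qed (simp add: q_def)
  have "Lp_norm p (\<lambda>x. Lp_norm s (\<lambda>y. K (x, y)))
    = Lp_norm p (\<lambda>x. ennreal_powr (\<integral>\<^sup>+y. ennreal_powr (K (x, y)) \<sigma> \<partial>lborel) (1 / \<sigma>))"
    unfolding \<sigma>(1) using \<sigma>(2) by (simp only: Lp_norm_ennreal)
  also have "\<dots> = ennreal_powr (Lp_norm q (\<lambda>x. \<integral>\<^sup>+y. ennreal_powr (K (x, y)) \<sigma> \<partial>lborel)) (1 / \<sigma>)"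
    by (rule scale[OF borel_nn_integral[OF Ks] q_def])
  also have "\<dots> \<le> ennreal_powr (\<integral>\<^sup>+y. Lp_norm q (\<lambda>x. ennreal_powr (K (x, y)) \<sigma>) \<partial>lborel) (1 / \<sigma>)"
    using \<sigma>(2) by (intro ennreal_powr_mono Lp_norm_minkowski[OF Ks q]) simp
  also have "(\<integral>\<^sup>+y. Lp_norm q (\<lambda>x. ennreal_powr (K (x, y)) \<sigma>) \<partial>lborel) = (\<integral>\<^sup>+y. ennreal_powr (Lp_norm p (\<lambda>x. K (x, y))) \<sigma> \<partial>lborel)"
  proof (rule nn_integral_cong)
    fix y
    have "Lp_norm p (\<lambda>x. K (x, y)) = ennreal_powr (Lp_norm q (\<lambda>x. ennreal_powr (K (x, y)) \<sigma>)) (1 / \<sigma>)"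
      using scale[OF borel_slice(2)[OF Ks, of y] q_def] \<sigma>(2) by simp
    then show "Lp_norm q (\<lambda>x. ennreal_powr (K (x, y)) \<sigma>) = ennreal_powr (Lp_norm p (\<lambda>x. K (x, y))) \<sigma>"
      using \<sigma>(2) by simp
  qed
  also have "ennreal_powr (\<integral>\<^sup>+y. ennreal_powr (Lp_norm p (\<lambda>x. K (x, y))) \<sigma> \<partial>lborel) (1 / \<sigma>) = Lp_norm s (\<lambda>y. Lp_norm p (\<lambda>x. K (x, y)))"
    unfolding \<sigma>(1) using \<sigma>(2) by (simp only: Lp_norm_ennreal)
  finally show ?thesis .
qed

lemma Lp_norm_iterated_le:
  fixes K :: "'a::euclidean_space \<times> 'b::euclidean_space \<Rightarrow> ennreal"
  assumes K: "borel_fun K" and p: "1 \<le> p"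
  shows "Lp_norm p (\<lambda>x. Lp_norm p (\<lambda>y. K (x, y))) \<le> Lp_norm p K"
    "Lp_norm p (\<lambda>y. Lp_norm p (\<lambda>x. K (x, y))) \<le> Lp_norm p K"
proof -
  have Ks: "borel_fun (\<lambda>z. K (snd z, fst z))"
    by (rule borel_compose[OF K]) (intro continuous_intros)
  show "Lp_norm p (\<lambda>x. Lp_norm p (\<lambda>y. K (x, y))) \<le> Lp_norm p K"
    using p
  proof (cases p rule: exponent_cases)
    case top
    have "AE z in lborel \<Otimes>\<^sub>M lborel. K z \<le> esssup lborel K"
      unfolding lborel_prod by (rule esssup_AE)
    then have "AE x in lborel. AE y in lborel. K (x, y) \<le> esssup lborel K"
      by (rule lborel_pair.AE_pair)
    then have "AE x in lborel. esssup lborel (\<lambda>y. K (x, y)) \<le> esssup lborel K"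
      by eventually_elim (use borel_slice(1)[OF K] in \<open>simp add: esssup_le_iff\<close>)
    moreover have "(\<lambda>x. esssup lborel (\<lambda>y. K (x, y))) \<in> borel_measurable lborel"
      using Lp_norm_measurable[OF Ks, of \<top>] by simp
    ultimately show ?thesis using top by (simp add: esssup_le_iff)
  next
    case (real P)
    have "borel_fun (\<lambda>z. ennreal_powr (K z) P)" using K by measurable
    then show ?thesis using real nn_integral_lborel_Fubini(1)[of "\<lambda>z. ennreal_powr (K z) P"]
      by (simp add: Lp_norm_ennreal)
  qed
  show "Lp_norm p (\<lambda>y. Lp_norm p (\<lambda>x. K (x, y))) \<le> Lp_norm p K"
    using p
  proof (cases p rule: exponent_cases)
    case top
    have "AE z in lborel \<Otimes>\<^sub>M lborel. K z \<le> esssup lborel K"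
      unfolding lborel_prod by (rule esssup_AE)
    then have "AE x in lborel. AE y in lborel. K (x, y) \<le> esssup lborel K"
      by (rule lborel_pair.AE_pair)
    moreover have "{z \<in> space (lborel \<Otimes>\<^sub>M lborel). K (fst z, snd z) \<le> esssup lborel K} \<in> sets (lborel \<Otimes>\<^sub>M lborel)"
      unfolding lborel_prod prod.collapse using K by measurable
    ultimately have "AE y in lborel. AE x in lborel. K (x, y) \<le> esssup lborel K"
      using lborel_pair.AE_commute[of "\<lambda>x y. K (x, y) \<le> esssup lborel K"] by simp
    then have "AE y in lborel. esssup lborel (\<lambda>x. K (x, y)) \<le> esssup lborel K"
      by eventually_elim (use borel_slice(2)[OF K] in \<open>simp add: esssup_le_iff\<close>)
    moreover have "(\<lambda>y. esssup lborel (\<lambda>x. K (x, y))) \<in> borel_measurable lborel"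
      using Lp_norm_measurable[OF K, of \<top>] by simp
    ultimately show ?thesis using top by (simp add: esssup_le_iff)
  next
    case (real P)
    have "borel_fun (\<lambda>z. ennreal_powr (K z) P)" using K by measurable
    then show ?thesis using real nn_integral_lborel_Fubini(2)[of "\<lambda>z. ennreal_powr (K z) P"]
      by (simp add: Lp_norm_ennreal)
  qed
qed

text \<open>Carries strict positivity from a kernel to the kernel obtained by taking norms in some
  of its variables, as needed to apply \<open>Lp_norm_tau_kernel\<close> a second time.\<close>

lemma Lp_norm_pos:
  fixes f :: "'a::euclidean_space \<Rightarrow> ennreal"
  assumes f: "borel_fun f" and pos: "\<And>x. f x \<noteq> 0" and p: "1 \<le> p"
  shows "Lp_norm p f \<noteq> 0"
proof
  assume 0: "Lp_norm p f = 0"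
  have "AE x in lborel. f x = 0" using p
  proof (cases p rule: exponent_cases)
    case top
    then show ?thesis using 0 esssup_AE[of f lborel] by simp
  next
    case (real r)
    have m: "(\<lambda>x. ennreal_powr (f x) r) \<in> borel_measurable lborel" using f by measurable
    have "(\<integral>\<^sup>+x. ennreal_powr (f x) r \<partial>lborel) = 0" using 0 real by (simp add: Lp_norm_ennreal)
    then show ?thesis using m by (subst (asm) nn_integral_0_iff_AE) auto
  qed
  then have "AE x in (lborel :: 'a measure). False" using pos by simp
  then show False by (simp add: eventually_False ae_filter_eq_bot_iff)
qed

lemma Lp_norm_convolution:
  fixes f k :: "'a::euclidean_space \<Rightarrow> ennreal"
  assumes f: "borel_fun f" and k: "borel_fun k" and p: "1 \<le> p"
  shows "Lp_norm p (\<lambda>x. \<integral>\<^sup>+y. k (x - y) * f y \<partial>lborel) \<le> (\<integral>\<^sup>+v. k v \<partial>lborel) * Lp_norm p f"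
proof -
  have mf: "borel_fun (\<lambda>z::'a\<times>'a. f (fst z - snd z))"
    by (rule borel_compose[OF f]) (intro continuous_intros)
  have mk: "borel_fun (\<lambda>z::'a\<times>'a. k (snd z))"
    by (rule borel_compose[OF k]) (intro continuous_intros)
  have m: "borel_fun (\<lambda>z. k (snd z) * f (fst z - snd z))" by (rule borel_measurable_times_ennreal[OF mk mf])
  have "(\<integral>\<^sup>+y. k (x - y) * f y \<partial>lborel) = (\<integral>\<^sup>+v. k v * f (x - v) \<partial>lborel)" for x
    using nn_integral_translate(2)[OF borel_slice(1)[OF m, of x], of x] by simp
  then have "Lp_norm p (\<lambda>x. \<integral>\<^sup>+y. k (x - y) * f y \<partial>lborel) \<le> (\<integral>\<^sup>+v. Lp_norm p (\<lambda>x. k v * f (x - v)) \<partial>lborel)"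
    using Lp_norm_minkowski[OF m p] by simp
  also have "\<dots> \<le> (\<integral>\<^sup>+v. k v * Lp_norm p f \<partial>lborel)"
  proof (rule nn_integral_mono)
    fix v
    have fv: "borel_fun (\<lambda>x. f (x - v))"
      by (rule borel_compose[OF f]) (intro continuous_intros)
    have "Lp_norm p (\<lambda>x. k v * f (x - v)) \<le> k v * Lp_norm p (\<lambda>x. f (x - v))"
      by (rule Lp_norm_cmult_le[OF p fv])
    also have "\<dots> \<le> k v * Lp_norm p f"
      using Lp_norm_translate(1)[OF f p, of "- v"] by (intro mult_left_mono) auto
    finally show "Lp_norm p (\<lambda>x. k v * f (x - v)) \<le> k v * Lp_norm p f" .
  qed
  also have "\<dots> = (\<integral>\<^sup>+v. k v \<partial>lborel) * Lp_norm p f" using k by (simp add: nn_integral_multc)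
  finally show ?thesis .
qed

text \<open>As \<open>k\<close> is at most 1, its norm in the conjugate exponent is at most the
  maximum of 1 and its integral, so the convolution \<open>J\<close> is bounded pointwise by
  \<open>N\<close>; its norm with exponent \<open>q\<close> is at most \<open>N\<close> too. The
  larger exponent follows by interpolation: the power \<open>\<sigma>\<close> of \<open>J\<close> is
  at most the power \<open>\<sigma> - \<rho>\<close> of \<open>N\<close> times the power
  \<open>\<rho>\<close> of \<open>J\<close>.\<close>

lemma Lp_norm_young:
  fixes f k :: "'a::euclidean_space \<Rightarrow> ennreal"
  assumes f: "borel_fun f" and k: "borel_fun k" and k1: "\<And>x. k x \<le> 1"
    and q: "1 \<le> q" "q \<le> s" "s \<noteq> \<top>"
  shows "Lp_norm s (\<lambda>x. \<integral>\<^sup>+y. k (x - y) * f y \<partial>lborel) \<le> max 1 (\<integral>\<^sup>+v. k v \<partial>lborel) * Lp_norm q f"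
proof -
  define S where "S = max 1 (\<integral>\<^sup>+v. k v \<partial>lborel)"
  define J where "J x = (\<integral>\<^sup>+y. k (x - y) * f y \<partial>lborel)" for x
  define N where "N = S * Lp_norm q f"
  have s: "1 \<le> s" using q by simp
  obtain \<sigma> where \<sigma>: "s = ennreal \<sigma>" "1 \<le> \<sigma>" using s q(3) by (cases s rule: exponent_cases) auto
  have "q \<noteq> \<top>" using q by (auto simp: top_unique)
  with q(1) obtain \<rho> where \<rho>: "q = ennreal \<rho>" "1 \<le> \<rho>" by (cases q rule: exponent_cases) auto
  have le: "\<rho> \<le> \<sigma>" using q(2) \<sigma> \<rho> by (simp add: ennreal_le_iff2)
  have JN: "J x \<le> N" for x
  proof -
    have kx: "borel_fun (\<lambda>y. k (x - y))"
      by (rule borel_compose[OF k]) (intro continuous_intros)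
    have "J x \<le> Lp_norm q f * Lp_norm (conj_exp q) (\<lambda>y. k (x - y))"
      unfolding J_def using Lp_holder[OF q(1) f kx] by (simp add: mult.commute)
    also have "\<dots> \<le> Lp_norm q f * S"
    proof (rule mult_left_mono)
      have "Lp_norm (conj_exp q) (\<lambda>y. k (x - y)) \<le> max 1 (\<integral>\<^sup>+y. k (x - y) \<partial>lborel)"
        by (rule Lp_norm_le_1[OF kx k1 conj_exp_ge_1[OF q(1)]])
      then show "Lp_norm (conj_exp q) (\<lambda>y. k (x - y)) \<le> S"
        using nn_integral_translate(2)[OF k, of x] by (simp add: S_def)
    qed simp
    finally show ?thesis by (simp add: N_def mult.commute)
  qed
  have "Lp_norm q J \<le> N"
  proof -
    have "Lp_norm q J \<le> (\<integral>\<^sup>+v. k v \<partial>lborel) * Lp_norm q f"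
      unfolding J_def by (rule Lp_norm_convolution[OF f k q(1)])
    also have "\<dots> \<le> N" unfolding N_def S_def by (intro mult_right_mono) auto
    finally show ?thesis .
  qed
  then have Jq: "(\<integral>\<^sup>+x. ennreal_powr (J x) \<rho> \<partial>lborel) \<le> ennreal_powr N \<rho>"
    using ennreal_powr_le_iff[of "1 / \<rho>" "\<integral>\<^sup>+x. ennreal_powr (J x) \<rho> \<partial>lborel" "ennreal_powr N \<rho>"] \<rho>
    by (simp add: Lp_norm_ennreal)
  have "(\<integral>\<^sup>+x. ennreal_powr (J x) \<sigma> \<partial>lborel) \<le> (\<integral>\<^sup>+x. ennreal_powr N (\<sigma> - \<rho>) * ennreal_powr (J x) \<rho> \<partial>lborel)"
  proof (rule nn_integral_mono)
    fix x
    have "ennreal_powr (J x) \<sigma> = ennreal_powr (J x) (\<sigma> - \<rho>) * ennreal_powr (J x) \<rho>"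
      using ennreal_powr_add[of "J x" "\<sigma> - \<rho>" \<rho>] by simp
    also have "\<dots> \<le> ennreal_powr N (\<sigma> - \<rho>) * ennreal_powr (J x) \<rho>"
      using le by (intro mult_right_mono ennreal_powr_mono JN) auto
    finally show "ennreal_powr (J x) \<sigma> \<le> ennreal_powr N (\<sigma> - \<rho>) * ennreal_powr (J x) \<rho>" .
  qed
  also have "\<dots> = ennreal_powr N (\<sigma> - \<rho>) * (\<integral>\<^sup>+x. ennreal_powr (J x) \<rho> \<partial>lborel)"
  proof (rule nn_integral_cmult)
    have mf: "borel_fun (\<lambda>z::'a\<times>'a. f (snd z))"
      by (rule borel_compose[OF f]) (intro continuous_intros)
    have mk: "borel_fun (\<lambda>z::'a\<times>'a. k (fst z - snd z))"
      by (rule borel_compose[OF k]) (intro continuous_intros)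
    have "borel_fun J"
      unfolding J_def using borel_nn_integral[OF borel_measurable_times_ennreal[OF mk mf]] by simp
    then show "(\<lambda>x. ennreal_powr (J x) \<rho>) \<in> borel_measurable lborel" by measurable
  qed
  also have "\<dots> \<le> ennreal_powr N (\<sigma> - \<rho>) * ennreal_powr N \<rho>" by (intro mult_left_mono Jq) simp
  also have "\<dots> = ennreal_powr N \<sigma>" using ennreal_powr_add[of N "\<sigma> - \<rho>" \<rho>] by simp
  finally have "ennreal_powr (\<integral>\<^sup>+x. ennreal_powr (J x) \<sigma> \<partial>lborel) (1 / \<sigma>) \<le> ennreal_powr (ennreal_powr N \<sigma>) (1 / \<sigma>)"
    using \<sigma> by (intro ennreal_powr_mono) auto
  then have "Lp_norm s J \<le> N" using \<sigma> by (simp add: Lp_norm_ennreal)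
  then show ?thesis unfolding J_def N_def S_def .
qed

text \<open>The reciprocals of \<open>r\<close> and \<open>conj_exp r\<close> add up to 1 and are
  both at least that of \<open>p\<close>, which forces \<open>p \<ge> 2\<close>. The result is the
  order of exponents that \<open>Lp_norm_swap_le\<close> needs with
  \<open>s = conj_exp p\<close>.\<close>

lemma conj_exp_le_self:
  assumes r: "1 \<le> r" "r \<le> p" "conj_exp r \<le> p"
  shows "conj_exp p \<le> p" "conj_exp p \<noteq> \<top>"
proof -
  have p: "1 \<le> p" using r by simp
  have "conj_exp p \<le> p \<and> conj_exp p \<noteq> \<top>" using p
  proof (cases p rule: conj_exp_cases)
    case one
    from r(1) show ?thesis
      by (cases r rule: conj_exp_cases)
        (use one r in \<open>auto simp: top_unique ennreal_1[symmetric] ennreal_le_iff2 simp del: ennreal_1\<close>)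
  next
    case (real P)
    from r(1) obtain \<rho> where \<rho>: "r = ennreal \<rho>" "conj_exp r = ennreal (\<rho> / (\<rho> - 1))" "1 < \<rho>"
      by (cases r rule: conj_exp_cases) (use real(1) r in \<open>auto simp: top_unique\<close>)
    have "\<rho> \<le> P" "\<rho> / (\<rho> - 1) \<le> P" using r \<rho> real by (auto simp: ennreal_le_iff2)
    then have "1 / P \<le> 1 / \<rho>" "1 / P \<le> 1 - 1 / \<rho>"
      using \<rho>(3) real(3) by (auto simp: field_simps)
    then have "2 / P \<le> 1" by simp
    then have "2 \<le> P" using real(3) by (simp add: field_simps)
    then have "P / (P - 1) \<le> P" using mult_left_mono[of 2 P P] by (simp add: field_simps)
    then show ?thesis using real by (simp add: ennreal_leI)
  qed auto
  then show "conj_exp p \<le> p" "conj_exp p \<noteq> \<top>" by auto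
qed

text \<open>The point \<open>M\<^sub>\<tau>(z, y)\<close> near which \<open>V g z * cnj (V f y)\<close> contributes to the short-time Fourier
  transform of \<open>W\<^sub>\<tau>(g, f)\<close>; up to the order of the coordinates it inverts \<open>wigner_point\<close>.\<close>

definition tau_point :: "real \<Rightarrow> 'a::euclidean_space \<times> 'a \<Rightarrow> 'a \<times> 'a \<Rightarrow> ('a \<times> 'a) \<times> ('a \<times> 'a)" where
  "tau_point \<tau> z y = (((1 - \<tau>) *\<^sub>R fst z + \<tau> *\<^sub>R fst y, \<tau> *\<^sub>R snd z + (1 - \<tau>) *\<^sub>R snd y), (snd z - snd y, fst y - fst z))"

text \<open>The right side is the product of the constants of \<open>Lp_norm_tau_kernel\<close> for
  the two blocks, the second with \<open>1 - \<tau>\<close> in the place of \<tau>; the form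
  \<open>1 - (1 - \<tau>)\<close> is kept to match that instance.\<close>

lemma alpha_eq:
  assumes "0 < \<tau>" "\<tau> < 1"
  shows "alpha n r1 r2 \<tau>
    = (\<tau> powr (- real n * enn2real (inverse (conj_exp r1))) * (1 - \<tau>) powr (- real n * enn2real (inverse r1)))
    * ((1 - \<tau>) powr (- real n * enn2real (inverse (conj_exp r2))) * (1 - (1 - \<tau>)) powr (- real n * enn2real (inverse r2)))"
  using assms by (simp add: alpha_def powr_minus powr_add distrib_left divide_inverse mult_ac)

text \<open>Minkowski's inequality in \<open>y2\<close> leaves, for fixed \<open>z2\<close> and
  \<open>y2\<close>, an integral operator in the position variables, whose bound contributes the
  factor \<open>Bc\<close>. Evaluated at \<open>(\<tau> z2 + (1 - \<tau>) y2, z2 - y2)\<close>, this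
  factor is in turn the kernel of an operator of the same kind in the frequency variables.\<close>

lemma mixed_norm_tau_kernel:
  fixes B :: "('a::euclidean_space \<times> 'a) \<times> ('a \<times> 'a) \<Rightarrow> ennreal" and F :: "'a \<times> 'a \<Rightarrow> ennreal"
  assumes B: "borel_fun B" and F: "borel_fun F" and pos: "\<And>z. B z \<noteq> 0"
    and \<tau>: "0 < \<tau>" "\<tau> < 1" and r1: "1 \<le> r1" "r1 \<le> p" "conj_exp r1 \<le> p" and r2: "1 \<le> r2" "r2 \<le> p" "conj_exp r2 \<le> p"
  shows "mixed_norm r1 r2 (\<lambda>z. \<integral>\<^sup>+y. B (tau_point \<tau> z y) * F y \<partial>lborel)
    \<le> ennreal (alpha DIM('a) r1 r2 \<tau>) * Lp_norm (conj_exp p) (\<lambda>X. Lp_norm p (\<lambda>\<zeta>. B (X, \<zeta>))) * mixed_norm r1 r2 F"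
proof -
  have p: "1 \<le> p" using r1 by simp
  define p' where "p' = conj_exp p"
  have p': "1 \<le> p'" "p' \<noteq> \<top>" "p' \<le> p" unfolding p'_def
    using conj_exp_le_self[OF r1] conj_exp_ge_1[OF p] by auto
  \<comment> \<open>\<open>tau_point\<close> crosses the variables: \<open>X1\<close> goes with
    \<open>y1 - z1\<close>, the last coordinate, and \<open>X2\<close> with \<open>z2 - y2\<close>,
    the one before it. The inner norm for the first block is therefore over the last
    coordinate.\<close>
  define N1 where "N1 w = Lp_norm p (\<lambda>u. B ((fst w, fst (snd w)), (snd (snd w), u)))" for w
  define Bc where "Bc w = Lp_norm p' (\<lambda>X1. N1 (X1, w))" for w
  define G where "G y = Lp_norm r1 (\<lambda>x. F (x, y))" for y
  have "borel_fun (\<lambda>v::'a \<times> 'a \<times> 'a \<times> 'a. B ((fst (snd v), fst (snd (snd v))), (snd (snd (snd v)), fst v)))"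
    by (rule borel_compose[OF B]) (intro continuous_intros)
  from Lp_norm_measurable[OF this p] have N1: "borel_fun N1" by (simp add: N1_def[abs_def])
  have Bc: "borel_fun Bc" unfolding Bc_def by (rule Lp_norm_measurable[OF N1 p'(1)])
  have G: "borel_fun G" unfolding G_def by (rule Lp_norm_measurable[OF F r1(1)])
  define c1 where "c1 = ennreal (\<tau> powr (- real DIM('a) * enn2real (inverse (conj_exp r1))) * (1 - \<tau>) powr (- real DIM('a) * enn2real (inverse r1)))"
  define c2 where "c2 = ennreal ((1 - \<tau>) powr (- real DIM('a) * enn2real (inverse (conj_exp r2))) * (1 - (1 - \<tau>)) powr (- real DIM('a) * enn2real (inverse r2)))"
  have "borel_fun (\<lambda>v. B (tau_point \<tau> (fst v) (snd v)))" unfolding tau_point_def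
    by (rule borel_compose[OF B]) (intro continuous_intros)
  moreover have "borel_fun (\<lambda>v::('a \<times> 'a) \<times> ('a \<times> 'a). F (snd v))"
    by (rule borel_compose[OF F]) (intro continuous_intros)
  ultimately have BF: "borel_fun (\<lambda>v. B (tau_point \<tau> (fst v) (snd v)) * F (snd v))"
    by (rule borel_measurable_times_ennreal)
  have step1: "Lp_norm r1 (\<lambda>z1. \<integral>\<^sup>+y. B (tau_point \<tau> (z1, z2) y) * F y \<partial>lborel)
      \<le> c1 * (\<integral>\<^sup>+y2. Bc (\<tau> *\<^sub>R z2 + (1 - \<tau>) *\<^sub>R y2, z2 - y2) * G y2 \<partial>lborel)" for z2
  proof -
    define Q where "Q = (\<lambda>v. B (tau_point \<tau> (fst (fst v), z2) (snd v, snd (fst v))) * F (snd v, snd (fst v)))"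
    have Q: "borel_fun Q"
      using borel_compose[OF BF, of "\<lambda>v. ((fst (fst v), z2), (snd v, snd (fst v)))"]
      unfolding Q_def by (simp add: continuous_intros)
    have "Lp_norm r1 (\<lambda>z1. \<integral>\<^sup>+y. B (tau_point \<tau> (z1, z2) y) * F y \<partial>lborel)
      = Lp_norm r1 (\<lambda>z1. \<integral>\<^sup>+y2. \<integral>\<^sup>+y1. Q ((z1, y2), y1) \<partial>lborel \<partial>lborel)"
      using nn_integral_lborel_Fubini(2)[OF borel_slice(1)[OF BF]] by (simp add: Q_def)
    also have "\<dots> \<le> (\<integral>\<^sup>+y2. Lp_norm r1 (\<lambda>z1. \<integral>\<^sup>+y1. Q ((z1, y2), y1) \<partial>lborel) \<partial>lborel)"
      by (rule Lp_norm_minkowski[OF borel_nn_integral[OF Q] r1(1)])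
    also have "\<dots> \<le> (\<integral>\<^sup>+y2. c1 * (Bc (\<tau> *\<^sub>R z2 + (1 - \<tau>) *\<^sub>R y2, z2 - y2) * G y2) \<partial>lborel)"
    proof (rule nn_integral_mono)
      fix y2 :: 'a
      let ?B = "\<lambda>v. B ((fst v, \<tau> *\<^sub>R z2 + (1 - \<tau>) *\<^sub>R y2), (z2 - y2, snd v))"
      have "borel_fun ?B"
        by (rule borel_compose[OF B]) (intro continuous_intros)
      from Lp_norm_tau_kernel[OF this borel_slice(2)[OF F, of y2] pos \<tau> p r1]
      show "Lp_norm r1 (\<lambda>z1. \<integral>\<^sup>+y1. Q ((z1, y2), y1) \<partial>lborel) \<le> c1 * (Bc (\<tau> *\<^sub>R z2 + (1 - \<tau>) *\<^sub>R y2, z2 - y2) * G y2)"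
        by (simp add: Q_def tau_point_def c1_def Bc_def N1_def G_def p'_def mult.assoc)
    qed
    also have "\<dots> = c1 * (\<integral>\<^sup>+y2. Bc (\<tau> *\<^sub>R z2 + (1 - \<tau>) *\<^sub>R y2, z2 - y2) * G y2 \<partial>lborel)"
    proof (rule nn_integral_cmult)
      have "borel_fun (\<lambda>y2. Bc (\<tau> *\<^sub>R z2 + (1 - \<tau>) *\<^sub>R y2, z2 - y2))"
        by (rule borel_compose[OF Bc]) (intro continuous_intros)
      then show "(\<lambda>y2. Bc (\<tau> *\<^sub>R z2 + (1 - \<tau>) *\<^sub>R y2, z2 - y2) * G y2) \<in> borel_measurable lborel"
        using G by simp
    qed
    finally show ?thesis .
  qed
  \<comment> \<open>The second block has \<open>z2 - y2\<close> where
    \<open>Lp_norm_tau_kernel\<close> expects \<open>y2 - z2\<close>; the kernel is reflected, which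
    its norms do not notice.\<close>
  have Br: "borel_fun (\<lambda>v. Bc (fst v, - snd v))"
    by (rule borel_compose[OF Bc]) (intro continuous_intros)
  have N1_pos: "N1 w \<noteq> 0" for w
    unfolding N1_def
  proof (rule Lp_norm_pos[OF _ pos p])
    show "borel_fun (\<lambda>u. B ((fst w, fst (snd w)), (snd (snd w), u)))"
      by (rule borel_compose[OF B]) (intro continuous_intros)
  qed
  have Bc_pos: "Bc w \<noteq> 0" for w
    unfolding Bc_def by (rule Lp_norm_pos[OF borel_slice(2)[OF N1] N1_pos p'(1)])
  have mQ: "borel_fun (\<lambda>z2. \<integral>\<^sup>+y2. Bc (\<tau> *\<^sub>R z2 + (1 - \<tau>) *\<^sub>R y2, z2 - y2) * G y2 \<partial>lborel)"
  proof -
    have "borel_fun (\<lambda>v. Bc (\<tau> *\<^sub>R fst v + (1 - \<tau>) *\<^sub>R snd v, fst v - snd v))"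
      by (rule borel_compose[OF Bc]) (intro continuous_intros)
    moreover have "borel_fun (\<lambda>v::'a\<times>'a. G (snd v))"
      by (rule borel_compose[OF G]) (intro continuous_intros)
    ultimately show ?thesis
      using borel_nn_integral[OF borel_measurable_times_ennreal] by fastforce
  qed
  have "mixed_norm r1 r2 (\<lambda>z. \<integral>\<^sup>+y. B (tau_point \<tau> z y) * F y \<partial>lborel)
    \<le> Lp_norm r2 (\<lambda>z2. c1 * (\<integral>\<^sup>+y2. Bc (\<tau> *\<^sub>R z2 + (1 - \<tau>) *\<^sub>R y2, z2 - y2) * G y2 \<partial>lborel))"
    unfolding mixed_norm_def
    using borel_nn_integral[OF BF]
    by (intro Lp_norm_mono[OF r2(1) Lp_norm_measurable[OF _ r1(1)]] step1) simp
  also have "\<dots> \<le> c1 * Lp_norm r2 (\<lambda>z2. \<integral>\<^sup>+y2. Bc (\<tau> *\<^sub>R z2 + (1 - \<tau>) *\<^sub>R y2, z2 - y2) * G y2 \<partial>lborel)"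
    by (rule Lp_norm_cmult_le[OF r2(1) mQ])
  also have "\<dots> \<le> c1 * (c2 * Lp_norm p' (\<lambda>X. Lp_norm p (\<lambda>u. Bc (X, - u))) * Lp_norm r2 G)"
  proof (rule mult_left_mono)
    show "Lp_norm r2 (\<lambda>z2. \<integral>\<^sup>+y2. Bc (\<tau> *\<^sub>R z2 + (1 - \<tau>) *\<^sub>R y2, z2 - y2) * G y2 \<partial>lborel)
      \<le> c2 * Lp_norm p' (\<lambda>X. Lp_norm p (\<lambda>u. Bc (X, - u))) * Lp_norm r2 G"
      using Lp_norm_tau_kernel[OF Br G Bc_pos _ _ p r2, of "1 - \<tau>"] \<tau> by (simp add: c2_def p'_def)
  qed simp
  \<comment> \<open>Read from the outside, the norms are over \<open>X2\<close>, the first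
    coordinate of \<open>\<zeta>\<close>, \<open>X1\<close>, and the second coordinate of
    \<open>\<zeta>\<close>. Exchanging the middle two is allowed since \<open>p' \<le> p\<close>;
    then the norms over \<open>X\<close> and those over \<open>\<zeta>\<close> combine.\<close>
  also have "Lp_norm p' (\<lambda>X. Lp_norm p (\<lambda>u. Bc (X, - u))) \<le> Lp_norm p' (\<lambda>X. Lp_norm p (\<lambda>\<zeta>. B (X, \<zeta>)))"
  proof -
    have Bcs: "borel_fun (\<lambda>v. Bc (snd v, fst v))" "borel_fun (\<lambda>v. Bc (snd v, - fst v))"
      by (rule borel_compose[OF Bc]; intro continuous_intros)+
    have N2: "borel_fun (\<lambda>v. N1 (fst (snd v), snd (snd v), fst v))"
      by (rule borel_compose[OF N1]) (intro continuous_intros)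
    define N3 where "N3 v = Lp_norm p (\<lambda>\<eta>. N1 (fst v, snd v, \<eta>))" for v
    have N3: "borel_fun N3" using Lp_norm_measurable[OF N2 p] by (simp add: N3_def[abs_def])
    have "Lp_norm p' (\<lambda>X. Lp_norm p (\<lambda>u. Bc (X, - u))) \<le> Lp_norm p' (\<lambda>X2. Lp_norm p' (\<lambda>X1. N3 (X1, X2)))"
    proof (rule Lp_norm_mono[OF p'(1)])
      show "borel_fun (\<lambda>X. Lp_norm p (\<lambda>u. Bc (X, - u)))"
        using Lp_norm_measurable[OF Bcs(2) p] by simp
      fix X2 :: 'a
      have K: "borel_fun (\<lambda>v. N1 (snd v, X2, fst v))"
        by (rule borel_compose[OF N1]) (intro continuous_intros)
      have "Lp_norm p (\<lambda>u. Bc (X2, - u)) \<le> Lp_norm p (\<lambda>u. Bc (X2, u))"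
        using Lp_norm_translate(2)[OF borel_slice(1)[OF Bc] p, of X2 0] by simp
      also have "\<dots> \<le> Lp_norm p' (\<lambda>X1. N3 (X1, X2))"
        using Lp_norm_swap_le[OF K p'] by (simp add: Bc_def N3_def)
      finally show "Lp_norm p (\<lambda>u. Bc (X2, - u)) \<le> Lp_norm p' (\<lambda>X1. N3 (X1, X2))" .
    qed
    also have "\<dots> \<le> Lp_norm p' N3" by (rule Lp_norm_iterated_le(2)[OF N3 p'(1)])
    also have "\<dots> \<le> Lp_norm p' (\<lambda>X. Lp_norm p (\<lambda>\<zeta>. B (X, \<zeta>)))"
    proof (rule Lp_norm_mono[OF p'(1) N3])
      fix X :: "'a \<times> 'a"
      show "N3 X \<le> Lp_norm p (\<lambda>\<zeta>. B (X, \<zeta>))"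
        using Lp_norm_iterated_le(1)[OF borel_slice(1)[OF B, of X] p] by (simp add: N3_def N1_def)
    qed
    finally show ?thesis .
  qed
  finally have "mixed_norm r1 r2 (\<lambda>z. \<integral>\<^sup>+y. B (tau_point \<tau> z y) * F y \<partial>lborel)
    \<le> c1 * (c2 * Lp_norm p' (\<lambda>X. Lp_norm p (\<lambda>\<zeta>. B (X, \<zeta>))) * Lp_norm r2 G)"
    by (simp add: mult_left_mono mult_right_mono)
  moreover have "c1 * c2 = ennreal (alpha DIM('a) r1 r2 \<tau>)"
    unfolding alpha_eq[OF \<tau>] c1_def c2_def by (rule ennreal_mult'[symmetric]) simp
  ultimately show ?thesis unfolding mixed_norm_def[of r1 r2 F] G_def[symmetric] p'_def
    by (simp add: mult.assoc[symmetric])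
qed

text \<open>The two variables play different roles. In \<open>\<zeta>\<close> the exponent
  \<open>p\<close> is kept, and the integral of \<open>l\<close> is the price; in \<open>X\<close>
  the exponent rises from \<open>q\<close> to \<open>s\<close>, for which \<open>k\<close> has to be
  bounded as well. The application has \<open>s = conj_exp p\<close>.\<close>

lemma Lp_norm_amalgam_convolution:
  fixes A :: "'a::euclidean_space \<times> 'b::euclidean_space \<Rightarrow> ennreal"
  assumes A: "borel_fun A" and k: "borel_fun k" and k1: "\<And>x. k x \<le> 1"
    and l: "borel_fun l" and p: "1 \<le> p" and q: "1 \<le> q" "q \<le> s" "s \<noteq> \<top>"
  shows "Lp_norm s (\<lambda>X. Lp_norm p (\<lambda>\<zeta>. \<integral>\<^sup>+w. k (X - fst w) * l (\<zeta> - snd w) * A w \<partial>lborel))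
    \<le> max 1 (\<integral>\<^sup>+v. k v \<partial>lborel) * (\<integral>\<^sup>+v. l v \<partial>lborel) * Lp_norm q (\<lambda>X. Lp_norm p (\<lambda>\<zeta>. A (X, \<zeta>)))"
proof -
  have s: "1 \<le> s" using q by simp
  define S where "S = (\<integral>\<^sup>+v. l v \<partial>lborel)"
  define A' where "A' X = Lp_norm p (\<lambda>\<zeta>. A (X, \<zeta>))" for X
  have As: "borel_fun (\<lambda>v. A (snd v, fst v))"
    by (rule borel_compose[OF A]) (intro continuous_intros)
  have A': "borel_fun A'" unfolding A'_def using Lp_norm_measurable[OF As p] by simp
  have m: "borel_fun (\<lambda>v::('b \<times> 'a) \<times> ('a \<times> 'b). k (snd (fst v) - fst (snd v)) * l (fst (fst v) - snd (snd v)) * A (snd v))"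
    by (intro borel_measurable_times_ennreal borel_compose[OF A] borel_compose[OF k]
        borel_compose[OF l] continuous_intros)
  have le: "Lp_norm p (\<lambda>\<zeta>. \<integral>\<^sup>+w. k (X - fst w) * l (\<zeta> - snd w) * A w \<partial>lborel) \<le> (\<integral>\<^sup>+Y. k (X - Y) * (S * A' Y) \<partial>lborel)" for X
  proof -
    define C where "C v = (\<integral>\<^sup>+z. l (fst v - z) * A (snd v, z) \<partial>lborel)" for v
    have mC: "borel_fun (\<lambda>v::('b \<times> 'a) \<times> 'b. l (fst (fst v) - snd v) * A (snd (fst v), snd v))"
      by (intro borel_measurable_times_ennreal borel_compose[OF A]
        borel_compose[OF l] continuous_intros)
    then have C: "borel_fun C" using borel_nn_integral[OF mC] by (simp add: C_def[abs_def])
    have kX: "borel_fun (\<lambda>v::'b \<times> 'a. k (X - snd v))"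
      by (rule borel_compose[OF k]) (intro continuous_intros)
    have "(\<integral>\<^sup>+w. k (X - fst w) * l (\<zeta> - snd w) * A w \<partial>lborel) = (\<integral>\<^sup>+Y. k (X - Y) * C (\<zeta>, Y) \<partial>lborel)" for \<zeta>
    proof -
      have "(\<integral>\<^sup>+w. k (X - fst w) * l (\<zeta> - snd w) * A w \<partial>lborel) = (\<integral>\<^sup>+Y. \<integral>\<^sup>+z. k (X - Y) * (l (\<zeta> - z) * A (Y, z)) \<partial>lborel \<partial>lborel)"
        using nn_integral_lborel_Fubini(1)[OF borel_slice(1)[OF m, of "(\<zeta>, X)"]] by (simp add: mult.assoc)
      also have "\<dots> = (\<integral>\<^sup>+Y. k (X - Y) * C (\<zeta>, Y) \<partial>lborel)"
        unfolding C_def fst_conv snd_conv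
      proof (rule nn_integral_cong)
        fix Y
        show "(\<integral>\<^sup>+z. k (X - Y) * (l (\<zeta> - z) * A (Y, z)) \<partial>lborel) = k (X - Y) * (\<integral>\<^sup>+z. l (\<zeta> - z) * A (Y, z) \<partial>lborel)"
          using borel_slice(1)[OF mC, of "(\<zeta>, Y)"] by (intro nn_integral_cmult) simp
      qed
      finally show ?thesis .
    qed
    then have "Lp_norm p (\<lambda>\<zeta>. \<integral>\<^sup>+w. k (X - fst w) * l (\<zeta> - snd w) * A w \<partial>lborel)
      \<le> (\<integral>\<^sup>+Y. Lp_norm p (\<lambda>\<zeta>. k (X - Y) * C (\<zeta>, Y)) \<partial>lborel)"
      using Lp_norm_minkowski[OF borel_measurable_times_ennreal[OF kX C] p] by simp
    also have "\<dots> \<le> (\<integral>\<^sup>+Y. k (X - Y) * (S * A' Y) \<partial>lborel)"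
    proof (rule nn_integral_mono)
      fix Y
      have "Lp_norm p (\<lambda>\<zeta>. k (X - Y) * C (\<zeta>, Y)) \<le> k (X - Y) * Lp_norm p (\<lambda>\<zeta>. C (\<zeta>, Y))"
        by (rule Lp_norm_cmult_le[OF p borel_slice(2)[OF C]])
      also have "\<dots> \<le> k (X - Y) * (S * A' Y)"
        using Lp_norm_convolution[OF borel_slice(1)[OF A, of Y] l p]
        by (intro mult_left_mono) (simp_all add: C_def S_def A'_def)
      finally show "Lp_norm p (\<lambda>\<zeta>. k (X - Y) * C (\<zeta>, Y)) \<le> k (X - Y) * (S * A' Y)" .
    qed
    finally show ?thesis .
  qed
  have ms: "borel_fun (\<lambda>v::'b \<times> 'a. \<integral>\<^sup>+w. k (snd v - fst w) * l (fst v - snd w) * A w \<partial>lborel)"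
    using borel_nn_integral[OF m] by simp
  have "Lp_norm s (\<lambda>X. Lp_norm p (\<lambda>\<zeta>. \<integral>\<^sup>+w. k (X - fst w) * l (\<zeta> - snd w) * A w \<partial>lborel))
    \<le> Lp_norm s (\<lambda>X. \<integral>\<^sup>+Y. k (X - Y) * (S * A' Y) \<partial>lborel)"
    using Lp_norm_measurable[OF ms p] by (intro Lp_norm_mono[OF s] le) simp
  also have "\<dots> \<le> max 1 (\<integral>\<^sup>+v. k v \<partial>lborel) * Lp_norm q (\<lambda>Y. S * A' Y)"
    using A' by (intro Lp_norm_young k k1 q) simp
  also have "\<dots> \<le> max 1 (\<integral>\<^sup>+v. k v \<partial>lborel) * (S * Lp_norm q A')"
    by (intro mult_left_mono Lp_norm_cmult_le[OF q(1) A']) simp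
  finally show ?thesis unfolding S_def A'_def by (simp add: mult.assoc)
qed

subsection \<open>A majorant for the pairing of a symbol with Wigner distributions\<close>

lemma nn_integral_regroup:
  fixes h :: "('a::euclidean_space \<times> 'a) \<times> ('a \<times> 'a) \<Rightarrow> ennreal"
  assumes h: "borel_fun h"
  shows "(\<integral>\<^sup>+\<omega>. h \<omega> \<partial>lborel) = (\<integral>\<^sup>+v. h ((fst (fst v), fst (snd v)), (snd (fst v), - snd (snd v))) \<partial>lborel)"
proof -
  let ?g = "\<lambda>v. h ((fst (fst v), fst (snd v)), (snd (fst v), - snd (snd v)))"
  have g: "borel_fun ?g"
    by (rule borel_compose[OF h]) (intro continuous_intros)
  have "(\<integral>\<^sup>+v. ?g v \<partial>lborel) = (\<integral>\<^sup>+z. \<integral>\<^sup>+y. ?g (z, y) \<partial>lborel \<partial>lborel)"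
    by (rule nn_integral_lborel_Fubini(1)[OF g])
  also have "\<dots> = (\<integral>\<^sup>+z. \<integral>\<^sup>+b. \<integral>\<^sup>+d. h ((fst z, b), (snd z, d)) \<partial>lborel \<partial>lborel \<partial>lborel)"
  proof (rule nn_integral_cong)
    fix z :: "'a \<times> 'a"
    have hz: "borel_fun (\<lambda>v. h ((fst z, fst v), (snd z, snd v)))"
      by (rule borel_compose[OF h]) (intro continuous_intros)
    have "(\<integral>\<^sup>+y. ?g (z, y) \<partial>lborel) = (\<integral>\<^sup>+b. \<integral>\<^sup>+d. ?g (z, (b, d)) \<partial>lborel \<partial>lborel)"
      by (rule nn_integral_lborel_Fubini(1)[OF borel_slice(1)[OF g]])
    also have "\<dots> = (\<integral>\<^sup>+b. \<integral>\<^sup>+d. h ((fst z, b), (snd z, d)) \<partial>lborel \<partial>lborel)"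
    proof (rule nn_integral_cong)
      fix b
      show "(\<integral>\<^sup>+d. ?g (z, (b, d)) \<partial>lborel) = (\<integral>\<^sup>+d. h ((fst z, b), (snd z, d)) \<partial>lborel)"
        using nn_integral_translate(2)[OF borel_slice(1)[OF hz, of b], of 0] by simp
    qed
    finally show "(\<integral>\<^sup>+y. ?g (z, y) \<partial>lborel) = (\<integral>\<^sup>+b. \<integral>\<^sup>+d. h ((fst z, b), (snd z, d)) \<partial>lborel \<partial>lborel)" .
  qed
  also have "\<dots> = (\<integral>\<^sup>+a. \<integral>\<^sup>+c. \<integral>\<^sup>+b. \<integral>\<^sup>+d. h ((a, b), (c, d)) \<partial>lborel \<partial>lborel \<partial>lborel \<partial>lborel)"
  proof -
    have m1: "borel_fun (\<lambda>v::(('a \<times> 'a) \<times> 'a) \<times> 'a. h ((fst (fst (fst v)), snd (fst v)), (snd (fst (fst v)), snd v)))"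
      by (rule borel_compose[OF h]) (intro continuous_intros)
    from nn_integral_lborel_Fubini(1)[OF borel_nn_integral[OF borel_nn_integral[OF m1]]]
    show ?thesis by simp
  qed
  also have "\<dots> = (\<integral>\<^sup>+a. \<integral>\<^sup>+b. \<integral>\<^sup>+c. \<integral>\<^sup>+d. h ((a, b), (c, d)) \<partial>lborel \<partial>lborel \<partial>lborel \<partial>lborel)"
  proof (rule nn_integral_cong)
    fix a :: 'a
    have m2: "borel_fun (\<lambda>v::('a \<times> 'a) \<times> 'a. h ((a, snd (fst v)), (fst (fst v), snd v)))"
      by (rule borel_compose[OF h]) (intro continuous_intros)
    show "(\<integral>\<^sup>+c. \<integral>\<^sup>+b. \<integral>\<^sup>+d. h ((a, b), (c, d)) \<partial>lborel \<partial>lborel \<partial>lborel)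
      = (\<integral>\<^sup>+b. \<integral>\<^sup>+c. \<integral>\<^sup>+d. h ((a, b), (c, d)) \<partial>lborel \<partial>lborel \<partial>lborel)"
      using nn_integral_lborel_Fubini[OF borel_nn_integral[OF m2]] by simp
  qed
  also have "\<dots> = (\<integral>\<^sup>+a. \<integral>\<^sup>+b. \<integral>\<^sup>+q. h ((a, b), q) \<partial>lborel \<partial>lborel \<partial>lborel)"
    by (intro nn_integral_cong nn_integral_lborel_Fubini(1)[symmetric] borel_slice h)
  also have "\<dots> = (\<integral>\<^sup>+\<omega>. h \<omega> \<partial>lborel)"
    using nn_integral_lborel_Fubini(1)[OF borel_nn_integral[OF h]] nn_integral_lborel_Fubini(1)[OF h] by simp
  finally show ?thesis by simp
qed

text \<open>A product weight instead of \<open>decay\<close> on the product space, so that the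
  smearing kernel separates into position and frequency factors.\<close>

definition decay2 :: "'a::euclidean_space \<times> 'b::euclidean_space \<Rightarrow> real" where
  "decay2 v = decay (fst v) * decay (snd v)"

lemma decay2_pos: "0 < decay2 v" and decay2_nonneg: "0 \<le> decay2 v"
  using decay_pos[of "fst v"] decay_pos[of "snd v"] by (simp_all add: decay2_def)

lemma continuous_decay2 [continuous_intros]: "continuous_on UNIV f \<Longrightarrow> continuous_on UNIV (\<lambda>x. decay2 (f x))"
  unfolding decay2_def by (intro continuous_intros continuous_on_compose2[OF decay_continuous[of UNIV]]) auto

lemma decay2_bound:
  fixes v :: "'a::euclidean_space \<times> 'b::euclidean_space"
  shows "1 \<le> (1 + norm v) ^ (2 * DIM('a) + 2 * DIM('b)) * decay2 v"
proof -
  have "(1 + norm (fst v)) ^ (2 * DIM('a)) * (1 + norm (snd v)) ^ (2 * DIM('b))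
      \<le> (1 + norm v) ^ (2 * DIM('a)) * (1 + norm v) ^ (2 * DIM('b))"
    using norm_fst_le[of "fst v" "snd v"] norm_snd_le[of "snd v" "fst v"] by (intro mult_mono power_mono) auto
  also have "\<dots> = (1 + norm v) ^ (2 * DIM('a) + 2 * DIM('b))" by (simp add: power_add)
  finally have "(1 + norm (fst v)) ^ (2 * DIM('a)) * (1 + norm (snd v)) ^ (2 * DIM('b)) * decay2 v
      \<le> (1 + norm v) ^ (2 * DIM('a) + 2 * DIM('b)) * decay2 v"
    by (rule mult_right_mono) (rule decay2_nonneg)
  moreover have "(1 + norm (fst v)) ^ (2 * DIM('a)) * (1 + norm (snd v)) ^ (2 * DIM('b)) * decay2 v = 1"
  proof -
    have "(1 + norm x) ^ (2 * DIM('c)) \<noteq> 0" for x :: "'c::euclidean_space"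
      using norm_ge_zero[of x] by (simp add: add_nonneg_eq_0_iff)
    then show ?thesis by (simp add: decay2_def decay_def field_simps add_nonneg_eq_0_iff)
  qed
  ultimately show ?thesis by simp
qed

lemma le_decay2I:
  fixes v :: "'a::euclidean_space \<times> 'b::euclidean_space"
  assumes "(1 + norm v) ^ (2 * DIM('a) + 2 * DIM('b)) * x \<le> C" "0 \<le> x"
  shows "x \<le> C * decay2 v"
proof -
  have "x * 1 \<le> x * ((1 + norm v) ^ (2 * DIM('a) + 2 * DIM('b)) * decay2 v)"
    by (intro mult_left_mono decay2_bound assms)
  also have "\<dots> \<le> C * decay2 v"
    using mult_right_mono[OF assms(1) decay2_nonneg[of v]] by (simp add: mult_ac)
  finally show ?thesis by simp
qed

definition regroup :: "'a::euclidean_space \<times> 'a \<Rightarrow> 'a \<times> 'a \<Rightarrow> ('a \<times> 'a) \<times> ('a \<times> 'a)" where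
  "regroup z y = ((fst z, fst y), (snd z, - snd y))"

lemma swap_regroup [simp]: "swap_left (regroup z y) = z" "swap_right (regroup z y) = y"
  by (simp_all add: swap_left_def swap_right_def regroup_def)

lemma wigner_point_tau_point: "wigner_point \<tau> (tau_point \<tau> z y) = regroup z y"
  by (simp add: wigner_point_def tau_point_def regroup_def wigner_lin_inv_def algebra_simps)

lemma wigner_point_diff: "wigner_point \<tau> (v - w) = wigner_point \<tau> v - wigner_point \<tau> w"
  by (simp add: wigner_point_def wigner_lin_inv_def algebra_simps)

lemma tau_point_wigner_point:
  "tau_point \<tau> (swap_left (wigner_point \<tau> w)) (swap_right (wigner_point \<tau> w)) = w"
  by (cases w) (auto simp: wigner_point_def tau_point_def swap_left_def swap_right_def wigner_lin_inv_def algebra_simps)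

lemma norm_tau_point_le:
  assumes "0 < \<tau>" "\<tau> < 1"
  shows "norm (tau_point \<tau> (swap_left \<omega>) (swap_right \<omega>)) \<le> 8 * norm \<omega>"
proof -
  have lin: "norm (s *\<^sub>R x + t *\<^sub>R y) \<le> 2 * norm \<omega>" if "\<bar>s\<bar> \<le> 1" "\<bar>t\<bar> \<le> 1" "norm x \<le> norm \<omega>" "norm y \<le> norm \<omega>" for s t and x y :: 'a
  proof -
    have "norm (s *\<^sub>R x + t *\<^sub>R y) \<le> \<bar>s\<bar> * norm x + \<bar>t\<bar> * norm y" by (rule order_trans[OF norm_triangle_ineq]) simp
    also have "\<dots> \<le> 1 * norm \<omega> + 1 * norm \<omega>" using that by (intro add_mono mult_mono) auto
    finally show ?thesis by simp
  qed
  note c = norm_components_le[of \<omega>]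
  have "norm ((1 - \<tau>) *\<^sub>R fst (fst \<omega>) + \<tau> *\<^sub>R snd (fst \<omega>)) \<le> 2 * norm \<omega>"
    "norm (\<tau> *\<^sub>R fst (snd \<omega>) + (\<tau> - 1) *\<^sub>R snd (snd \<omega>)) \<le> 2 * norm \<omega>"
    "norm (1 *\<^sub>R fst (snd \<omega>) + 1 *\<^sub>R snd (snd \<omega>)) \<le> 2 * norm \<omega>"
    "norm (1 *\<^sub>R snd (fst \<omega>) + (-1) *\<^sub>R fst (fst \<omega>)) \<le> 2 * norm \<omega>"
    using assms c by (intro lin; simp)+
  then have "norm (fst (fst (tau_point \<tau> (swap_left \<omega>) (swap_right \<omega>)))) \<le> 2 * norm \<omega>"
    "norm (snd (fst (tau_point \<tau> (swap_left \<omega>) (swap_right \<omega>)))) \<le> 2 * norm \<omega>"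
    "norm (fst (snd (tau_point \<tau> (swap_left \<omega>) (swap_right \<omega>)))) \<le> 2 * norm \<omega>"
    "norm (snd (snd (tau_point \<tau> (swap_left \<omega>) (swap_right \<omega>)))) \<le> 2 * norm \<omega>"
    by (simp_all add: tau_point_def swap_left_def swap_right_def algebra_simps)
  then have "norm (fst (tau_point \<tau> (swap_left \<omega>) (swap_right \<omega>))) \<le> 2 * (2 * norm \<omega>)"
    "norm (snd (tau_point \<tau> (swap_left \<omega>) (swap_right \<omega>))) \<le> 2 * (2 * norm \<omega>)"
    using norm_Pair_le_2 by (metis prod.collapse)+
  then show ?thesis
    using norm_Pair_le_2[of "fst (tau_point \<tau> (swap_left \<omega>) (swap_right \<omega>))" "2 * (2 * norm \<omega>)" "snd (tau_point \<tau> (swap_left \<omega>) (swap_right \<omega>))"]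
    by simp
qed

text \<open>By covariance the size depends on \<open>regroup z y - wigner_point \<tau> w\<close>,
  which is the image of \<open>tau_point \<tau> z y - w\<close> under the linear map
  \<open>wigner_point \<tau>\<close>. The inverse of that map enlarges norms at most by the factor 8
  for all \<tau> between 0 and 1, so decay in the former is decay in the latter.\<close>

lemma stft_wigner_theta_decay:
  obtains C where "0 < C" "\<And>\<tau> w z y. 0 < \<tau> \<Longrightarrow> \<tau> < 1 \<Longrightarrow>
    norm (dist_of_fun (wigner_theta \<tau> w) (tf_shift gauss (regroup z y)))
      \<le> C * decay2 (tau_point \<tau> z y - w :: ('a::euclidean_space \<times> 'a) \<times> ('a \<times> 'a))"
proof -
  let ?m = "2 * DIM('a \<times> 'a) + 2 * DIM('a \<times> 'a)"
  obtain C where C: "0 \<le> C" "\<And>\<tau> \<omega>. 0 < \<tau> \<Longrightarrow> \<tau> < 1 \<Longrightarrow>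
    (1 + norm \<omega>) ^ ?m * norm (dist_of_fun (gauss_lin \<tau> :: 'a \<times> 'a \<Rightarrow> _) (tf_shift gauss \<omega>)) \<le> C"
    by (rule stft_gauss_lin_bound[where m = ?m]) blast
  show ?thesis
  proof (rule that[of "8 ^ ?m * C + 1"])
    show "0 < 8 ^ ?m * C + 1" using C(1) by (intro add_nonneg_pos mult_nonneg_nonneg) auto
    fix \<tau> :: real and w :: "('a \<times> 'a) \<times> ('a \<times> 'a)" and z y :: "'a \<times> 'a"
    assume \<tau>: "0 < \<tau>" "\<tau> < 1"
    let ?v = "tau_point \<tau> z y - w"
    let ?\<omega> = "wigner_point \<tau> ?v"
    have eq: "?\<omega> = regroup z y - wigner_point \<tau> w" by (simp add: wigner_point_diff wigner_point_tau_point)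
    have "norm ?v \<le> 8 * norm ?\<omega>" using norm_tau_point_le[OF \<tau>, of ?\<omega>] unfolding tau_point_wigner_point .
    then have "(1 + norm ?v) ^ ?m \<le> (8 * (1 + norm ?\<omega>)) ^ ?m" by (intro power_mono) auto
    also have "\<dots> = 8 ^ ?m * (1 + norm ?\<omega>) ^ ?m" by (rule power_mult_distrib)
    finally have le: "(1 + norm ?v) ^ ?m \<le> 8 ^ ?m * (1 + norm ?\<omega>) ^ ?m" .
    let ?x = "norm (dist_of_fun (wigner_theta \<tau> w) (tf_shift gauss (regroup z y)))"
    have x: "?x = norm (dist_of_fun (gauss_lin \<tau>) (tf_shift gauss ?\<omega>))" unfolding norm_stft_wigner_theta eq ..
    have "(1 + norm ?v) ^ ?m * ?x \<le> 8 ^ ?m * (1 + norm ?\<omega>) ^ ?m * ?x" using le by (rule mult_right_mono) simp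
    also have "\<dots> = 8 ^ ?m * ((1 + norm ?\<omega>) ^ ?m * ?x)" by simp
    also have "\<dots> \<le> 8 ^ ?m * C" unfolding x by (intro mult_left_mono C(2) \<tau>) simp
    finally have "?x \<le> 8 ^ ?m * C * decay2 ?v" by (intro le_decay2I) auto
    also have "\<dots> \<le> (8 ^ ?m * C + 1) * decay2 ?v" by (intro mult_right_mono decay2_nonneg) simp
    finally show "?x \<le> (8 ^ ?m * C + 1) * decay2 ?v" .
  qed
qed

definition smear :: "(('a::euclidean_space \<times> 'a) \<times> ('a \<times> 'a) \<Rightarrow> ennreal) \<Rightarrow> ('a \<times> 'a) \<times> ('a \<times> 'a) \<Rightarrow> ennreal" where
  "smear A v = (\<integral>\<^sup>+w. ennreal (decay2 (v - w)) * A w \<partial>lborel)"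

definition tau_majorant ::
    "real \<Rightarrow> (('a::euclidean_space \<times> 'a) \<times> ('a \<times> 'a) \<Rightarrow> ennreal) \<Rightarrow> ('a \<times> 'a \<Rightarrow> ennreal) \<Rightarrow> 'a \<times> 'a \<Rightarrow> ennreal" where
  "tau_majorant \<tau> A F z = (\<integral>\<^sup>+y. smear A (tau_point \<tau> z y) * F y \<partial>lborel)"

lemma borel_ennreal:
  "continuous_on UNIV f \<Longrightarrow> borel_fun (\<lambda>x. ennreal (f x))"
  by (intro measurable_compose[OF borel_measurable_continuous_onI measurable_ennreal])

lemma smear_measurable:
  assumes A: "borel_fun A"
  shows "borel_fun (smear A)"
proof -
  have "borel_fun (\<lambda>v. ennreal (decay2 (fst v - snd v)) * A (snd v))"
    by (intro borel_measurable_times_ennreal borel_compose[OF A] borel_ennreal continuous_intros)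
  from borel_nn_integral[OF this] show ?thesis by (simp add: smear_def[abs_def])
qed

lemma tau_majorant_measurable:
  assumes A: "borel_fun A" and F: "borel_fun F"
  shows "borel_fun (tau_majorant \<tau> A F)"
proof -
  have "borel_fun (\<lambda>v. smear A (tau_point \<tau> (fst v) (snd v)) * F (snd v))" unfolding tau_point_def
    by (intro borel_measurable_times_ennreal borel_compose[OF smear_measurable[OF A]] borel_compose[OF F] continuous_intros)
  from borel_nn_integral[OF this] show ?thesis by (simp add: tau_majorant_def[abs_def])
qed

lemma Lp_norm_zero: "1 \<le> p \<Longrightarrow> Lp_norm p (\<lambda>x::'a::euclidean_space. 0) = 0"
  using Lp_norm_cmult_le[of p "\<lambda>x::'a. 0" 0] by simp

lemma mixed_norm_tau_majorant:
  fixes A :: "('a::euclidean_space \<times> 'a) \<times> ('a \<times> 'a) \<Rightarrow> ennreal" and F :: "'a \<times> 'a \<Rightarrow> ennreal"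
  assumes A: "borel_fun A" and F: "borel_fun F"
    and \<tau>: "0 < \<tau>" "\<tau> < 1" and q: "1 \<le> q" "q \<le> conj_exp p"
    and r1: "1 \<le> r1" "r1 \<le> p" "conj_exp r1 \<le> p" and r2: "1 \<le> r2" "r2 \<le> p" "conj_exp r2 \<le> p"
    and M: "M = max 1 (\<integral>\<^sup>+v. ennreal (decay (v::'a\<times>'a)) \<partial>lborel) * (\<integral>\<^sup>+v. ennreal (decay (v::'a\<times>'a)) \<partial>lborel)"
  shows "mixed_norm r1 r2 (tau_majorant \<tau> A F)
    \<le> ennreal (alpha DIM('a) r1 r2 \<tau>) * (M * Lp_norm q (\<lambda>X. Lp_norm p (\<lambda>\<zeta>. A (X, \<zeta>)))) * mixed_norm r1 r2 F"
proof -
  have m: "(\<lambda>w. ennreal (decay2 (v - w)) * A w) \<in> borel_measurable lborel" for v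
    using A by (intro borel_measurable_times_ennreal) (simp_all add: borel_ennreal continuous_intros)
  \<comment> \<open>The kernel estimate demands a nowhere vanishing kernel. If \<open>A\<close> is 0
    almost everywhere, the majorant is 0; otherwise \<open>smear A\<close> is nonzero everywhere
    because \<open>decay2\<close> is strictly positive.\<close>
  show ?thesis
  proof (cases "AE w in lborel. A w = 0")
  case True
  then have "smear A v = 0" for v
    unfolding smear_def using m[of v] by (subst nn_integral_0_iff_AE) auto
  then have "tau_majorant \<tau> A F = (\<lambda>_. 0)" by (simp add: tau_majorant_def[abs_def])
  then show ?thesis using r1(1) r2(1) by (simp add: mixed_norm_def Lp_norm_zero)
  next
  case False
  have p: "1 \<le> p" using r1 by simp
  have pos: "smear A v \<noteq> 0" for v
  proof
    assume "smear A v = 0"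
    then have "AE w in lborel. ennreal (decay2 (v - w)) * A w = 0"
      using m[of v] unfolding smear_def by (subst (asm) nn_integral_0_iff_AE) auto
    then have "AE w in lborel. A w = 0"
    proof eventually_elim
      case (elim w)
      moreover have "ennreal (decay2 (v - w)) \<noteq> 0" using decay2_pos[of "v - w"] by (simp add: ennreal_eq_0_iff not_le)
      ultimately show ?case by (simp only: mult_eq_0_iff simp_thms)
    qed
    with False show False by simp
  qed
  have k: "borel_fun (\<lambda>x::'a\<times>'a. ennreal (decay x))" by measurable
  have "Lp_norm (conj_exp p) (\<lambda>X. Lp_norm p (\<lambda>\<zeta>. smear A (X, \<zeta>))) \<le> M * Lp_norm q (\<lambda>X. Lp_norm p (\<lambda>\<zeta>. A (X, \<zeta>)))"
  proof -
    have "smear A (X, \<zeta>) = (\<integral>\<^sup>+w. ennreal (decay (X - fst w)) * ennreal (decay (\<zeta> - snd w)) * A w \<partial>lborel)" for X \<zeta>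
      unfolding smear_def decay2_def by (simp add: ennreal_mult' decay_pos less_imp_le)
    then show ?thesis unfolding M
      using Lp_norm_amalgam_convolution[OF A k _ k p q(1) q(2) conj_exp_le_self(2)[OF r1]]
      by (simp add: decay_le_1 ennreal_le_1)
  qed
  then have "ennreal (alpha DIM('a) r1 r2 \<tau>) * Lp_norm (conj_exp p) (\<lambda>X. Lp_norm p (\<lambda>\<zeta>. smear A (X, \<zeta>))) * mixed_norm r1 r2 F
    \<le> ennreal (alpha DIM('a) r1 r2 \<tau>) * (M * Lp_norm q (\<lambda>X. Lp_norm p (\<lambda>\<zeta>. A (X, \<zeta>)))) * mixed_norm r1 r2 F"
    by (intro mult_mono order_refl) auto
  with mixed_norm_tau_kernel[OF smear_measurable[OF A] F pos \<tau> r1 r2] show ?thesis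
    unfolding tau_majorant_def[abs_def] by (rule order_trans)
  qed
qed

section \<open>Change of windows and comparison of norms\<close>

definition stft_abs :: "('a::euclidean_space \<Rightarrow> complex) \<Rightarrow> 'a distribution \<Rightarrow> 'a \<times> 'a \<Rightarrow> ennreal" where
  "stft_abs \<gamma> u z = ennreal (norm (u (tf_shift \<gamma> z)))"

lemma stft_measurable:
  "tempered u \<Longrightarrow> schwartz \<gamma> \<Longrightarrow> borel_fun (\<lambda>z. u (tf_shift \<gamma> z))"
  by (rule poly_bounded_measurable[OF stft_poly_bounded])

lemma stft_abs_measurable:
  "tempered u \<Longrightarrow> schwartz \<gamma> \<Longrightarrow> borel_fun (stft_abs \<gamma> u)"
  unfolding stft_abs_def[abs_def] using stft_measurable[of u \<gamma>] by measurable

lemma modulation_norm_eq: "modulation_norm \<gamma> p q u = mixed_norm p q (stft_abs \<gamma> u)"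
  by (simp add: modulation_norm_def mixed_norm_def stft_abs_def stft_eq)

text \<open>If \<open>f\<close> is not integrable, the left side is 0 by the convention for the
  integral.\<close>

lemma ennreal_norm_integral_le:
  fixes f :: "'a \<Rightarrow> 'b::{banach, second_countable_topology}"
  shows "ennreal (norm (\<integral>x. f x \<partial>M)) \<le> (\<integral>\<^sup>+x. ennreal (norm (f x)) \<partial>M)"
proof (cases "integrable M f")
  case True
  then show ?thesis by (rule integral_norm_bound_ennreal)
qed (simp add: not_integrable_integral_eq)

lemma stft_abs_dist_finite:
  assumes "schwartz \<gamma>" "schwartz \<psi>"
  shows "(\<integral>\<^sup>+v. stft_abs \<gamma> (dist_of_fun \<psi>) v \<partial>lborel) < \<top>"
  using rapidly_decreasing_integrable'[OF stft_rapidly_decreasing[OF assms]]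
  by (simp add: stft_abs_def integrable_iff_bounded)

text \<open>Inversion with window \<gamma> is applied to \<open>tf_shift \<phi> z\<close>; by
  covariance the weight depends on \<open>v - z\<close> only, and a translation gives the
  convolution form.\<close>

lemma stft_change_window:
  fixes \<gamma> \<phi> :: "'a::euclidean_space \<Rightarrow> complex"
  assumes u: "tempered u" and \<gamma>: "schwartz \<gamma>" "\<gamma> \<noteq> (\<lambda>_. 0)" and \<phi>: "schwartz \<phi>"
  defines "c \<equiv> norm (\<integral>s. \<gamma> s * cnj (\<gamma> s) \<partial>lborel)"
  shows "stft_abs \<phi> u z \<le> (\<integral>\<^sup>+v. ennreal (1 / c) * stft_abs \<gamma> (dist_of_fun \<phi>) v * stft_abs \<gamma> u (z + v) \<partial>lborel)"
proof -
  let ?c = "\<integral>s. \<gamma> s * cnj (\<gamma> s) \<partial>lborel"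
  let ?h = "\<lambda>v. ennreal (1 / c) * stft_abs \<gamma> (dist_of_fun \<phi>) v * stft_abs \<gamma> u (z + v)"
  have c: "0 < c" unfolding c_def using schwartz_l2_norm_pos[OF \<gamma>] by simp
  have "u (tf_shift \<phi> z) = (1 / ?c) * (\<integral>v. u (tf_shift \<gamma> v) * cnj (dist_of_fun (tf_shift \<phi> z) (tf_shift \<gamma> v)) \<partial>lborel)"
    using tempered_inversion(1)[OF u \<gamma>(1) schwartz_tf_shift[OF \<phi>, of z]] schwartz_l2_norm_pos[OF \<gamma>]
    by (simp add: field_simps)
  then have "stft_abs \<phi> u z = ennreal (1 / c) * ennreal (norm (\<integral>v. u (tf_shift \<gamma> v) * cnj (dist_of_fun (tf_shift \<phi> z) (tf_shift \<gamma> v)) \<partial>lborel))"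
    using c unfolding stft_abs_def c_def by (simp add: norm_mult norm_divide ennreal_mult'[symmetric])
  also have "\<dots> \<le> ennreal (1 / c) * (\<integral>\<^sup>+v. ennreal (norm (u (tf_shift \<gamma> v) * cnj (dist_of_fun (tf_shift \<phi> z) (tf_shift \<gamma> v)))) \<partial>lborel)"
    by (intro mult_left_mono ennreal_norm_integral_le) simp
  also have "\<dots> = ennreal (1 / c) * (\<integral>\<^sup>+v. stft_abs \<gamma> (dist_of_fun \<phi>) (v - z) * stft_abs \<gamma> u v \<partial>lborel)"
    by (simp add: stft_abs_def norm_mult stft_covariance[OF \<gamma>(1) \<phi>] ennreal_mult' mult.commute)
  also have "\<dots> = ennreal (1 / c) * (\<integral>\<^sup>+v. stft_abs \<gamma> (dist_of_fun \<phi>) v * stft_abs \<gamma> u (z + v) \<partial>lborel)"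
  proof -
    have "borel_fun (\<lambda>v. stft_abs \<gamma> (dist_of_fun \<phi>) (v - z) * stft_abs \<gamma> u v)"
      by (intro borel_measurable_times_ennreal borel_compose[OF stft_abs_measurable[OF tempered_dist_of_fun[OF \<phi>] \<gamma>(1)]]
          stft_abs_measurable u \<gamma>(1) continuous_intros)
    from nn_integral_translate(1)[OF this, of z] show ?thesis by (simp add: add.commute)
  qed
  also have "\<dots> = (\<integral>\<^sup>+v. ?h v \<partial>lborel)"
  proof -
    have "(\<lambda>v. stft_abs \<gamma> (dist_of_fun \<phi>) v * stft_abs \<gamma> u (z + v)) \<in> borel_measurable lborel"
      using stft_abs_measurable[OF tempered_dist_of_fun[OF \<phi>] \<gamma>(1)]
        borel_compose[OF stft_abs_measurable[OF u \<gamma>(1)], of "\<lambda>v. z + v"]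
      by (simp add: continuous_intros)
    from nn_integral_cmult[OF this] show ?thesis by (simp add: mult.assoc)
  qed
  finally show ?thesis .
qed

text \<open>The convolution kernel has finite integral, which bounds the change in every
  translation-invariant mixed norm, for all exponents and all \<open>u\<close> at once. The version
  with exchanged components serves the amalgam norm.\<close>

lemma modulation_norm_change_window:
  fixes \<gamma> \<phi> :: "'a::euclidean_space \<Rightarrow> complex"
  assumes \<gamma>: "schwartz \<gamma>" "\<gamma> \<noteq> (\<lambda>_. 0)" and \<phi>: "schwartz \<phi>"
  obtains C where "0 < C"
    "\<And>u p q. tempered u \<Longrightarrow> 1 \<le> p \<Longrightarrow> 1 \<le> q \<Longrightarrow> mixed_norm p q (stft_abs \<phi> u) \<le> ennreal C * mixed_norm p q (stft_abs \<gamma> u)"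
    "\<And>u p q. tempered u \<Longrightarrow> 1 \<le> p \<Longrightarrow> 1 \<le> q \<Longrightarrow>
      mixed_norm p q (\<lambda>z. stft_abs \<phi> u (snd z, fst z)) \<le> ennreal C * mixed_norm p q (\<lambda>z. stft_abs \<gamma> u (snd z, fst z))"
proof -
  define k where "k v = ennreal (1 / norm (\<integral>s. \<gamma> s * cnj (\<gamma> s) \<partial>lborel)) * stft_abs \<gamma> (dist_of_fun \<phi>) v" for v
  have k: "borel_fun k" unfolding k_def
    using stft_abs_measurable[OF tempered_dist_of_fun[OF \<phi>] \<gamma>(1)] by measurable
  have sw: "continuous_on UNIV (\<lambda>z::'a\<times>'a. (snd z, fst z))" by (intro continuous_intros)
  have ks: "borel_fun (\<lambda>z. k (snd z, fst z))" by (rule borel_compose[OF k sw])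
  define C where "C = enn2real (\<integral>\<^sup>+v. k v \<partial>lborel) + 1"
  have "(\<integral>\<^sup>+v. k v \<partial>lborel) < \<top>"
    unfolding k_def using stft_abs_dist_finite[OF \<gamma>(1) \<phi>] stft_abs_measurable[OF tempered_dist_of_fun[OF \<phi>] \<gamma>(1)]
    by (subst nn_integral_cmult) (auto simp: ennreal_mult_less_top)
  then have "(\<integral>\<^sup>+v. k v \<partial>lborel) = ennreal (enn2real (\<integral>\<^sup>+v. k v \<partial>lborel))" by (simp add: ennreal_enn2real)
  also have "\<dots> \<le> ennreal C" unfolding C_def by (intro ennreal_leI) simp
  finally have kC: "(\<integral>\<^sup>+v. k v \<partial>lborel) \<le> ennreal C" .
  have ksC: "(\<integral>\<^sup>+v. k (snd v, fst v) \<partial>lborel) \<le> ennreal C"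
    using kC nn_integral_lborel_Fubini(1)[OF ks] nn_integral_lborel_Fubini(2)[OF k] by simp
  show ?thesis
  proof (rule that[of C])
    show "0 < C" unfolding C_def by (simp add: add_nonneg_pos)
    fix u :: "'a distribution" and p q :: ennreal
    assume u: "tempered u" and p: "1 \<le> p" and q: "1 \<le> q"
    have le: "stft_abs \<phi> u z \<le> (\<integral>\<^sup>+v. k v * stft_abs \<gamma> u (z + v) \<partial>lborel)" for z
      unfolding k_def by (rule stft_change_window[OF u \<gamma> \<phi>])
    note m = stft_abs_measurable[OF u \<phi>] stft_abs_measurable[OF u \<gamma>(1)]
    have "mixed_norm p q (stft_abs \<phi> u) \<le> mixed_norm p q (\<lambda>z. \<integral>\<^sup>+v. k v * stft_abs \<gamma> u (z + v) \<partial>lborel)"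
      by (rule mixed_norm_mono[OF p q m(1) le])
    also have "\<dots> \<le> (\<integral>\<^sup>+v. k v \<partial>lborel) * mixed_norm p q (stft_abs \<gamma> u)"
      by (rule mixed_norm_convolution[OF m(2) k p q])
    also have "\<dots> \<le> ennreal C * mixed_norm p q (stft_abs \<gamma> u)" by (intro mult_right_mono kC) simp
    finally show "mixed_norm p q (stft_abs \<phi> u) \<le> ennreal C * mixed_norm p q (stft_abs \<gamma> u)" .
    have ms: "borel_fun (\<lambda>z. stft_abs \<phi> u (snd z, fst z))" "borel_fun (\<lambda>z. stft_abs \<gamma> u (snd z, fst z))"
      by (rule borel_compose[OF m(1) sw] borel_compose[OF m(2) sw])+
    have les: "stft_abs \<phi> u (snd z, fst z) \<le> (\<integral>\<^sup>+v. k (snd v, fst v) * stft_abs \<gamma> u (snd (z + v), fst (z + v)) \<partial>lborel)" for z :: "'a \<times> 'a"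
    proof -
      let ?h = "\<lambda>v. k v * stft_abs \<gamma> u ((snd z, fst z) + v)"
      have h: "borel_fun ?h"
        by (intro borel_measurable_times_ennreal k borel_compose[OF m(2)] continuous_intros)
      have hs: "borel_fun (\<lambda>v. ?h (snd v, fst v))" by (rule borel_compose[OF h sw])
      have "(\<integral>\<^sup>+v. ?h v \<partial>lborel) = (\<integral>\<^sup>+v. ?h (snd v, fst v) \<partial>lborel)"
        using nn_integral_lborel_Fubini(1)[OF hs] nn_integral_lborel_Fubini(2)[OF h] by simp
      then show ?thesis using le[of "(snd z, fst z)"] by (simp add: plus_prod_def)
    qed
    have "mixed_norm p q (\<lambda>z. stft_abs \<phi> u (snd z, fst z))
      \<le> mixed_norm p q (\<lambda>z. \<integral>\<^sup>+v. k (snd v, fst v) * stft_abs \<gamma> u (snd (z + v), fst (z + v)) \<partial>lborel)"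
      by (rule mixed_norm_mono[OF p q ms(1) les])
    also have "\<dots> \<le> (\<integral>\<^sup>+v. k (snd v, fst v) \<partial>lborel) * mixed_norm p q (\<lambda>z. stft_abs \<gamma> u (snd z, fst z))"
      by (rule mixed_norm_convolution[OF ms(2) ks p q])
    also have "\<dots> \<le> ennreal C * mixed_norm p q (\<lambda>z. stft_abs \<gamma> u (snd z, fst z))" by (intro mult_right_mono ksC) simp
    finally show "mixed_norm p q (\<lambda>z. stft_abs \<phi> u (snd z, fst z)) \<le> ennreal C * mixed_norm p q (\<lambda>z. stft_abs \<gamma> u (snd z, fst z))" .
  qed
qed

text \<open>Joint measurability in the parameter of \<open>g\<close> and in the phase-space point is
  what Fubini's theorem asks for in \<open>pairing_op\<close>, where \<open>g\<close> runs over
  shifted Gaussians.\<close>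

lemma wigner_dist_measurable:
  fixes f :: "'a::euclidean_space distribution" and g :: "'x::euclidean_space \<Rightarrow> 'a distribution"
  assumes f: "tempered f" and g: "\<And>x. tempered (g x)"
    and gm: "borel_fun (\<lambda>v. g (fst v) (tf_shift gauss (snd v)))"
  shows "borel_fun (\<lambda>v. wigner_dist \<tau> (g (fst v)) f (tf_shift gauss (snd v)))"
proof -
  let ?h = "\<lambda>v :: ('x \<times> ('a \<times> 'a) \<times> ('a \<times> 'a)) \<times> (('a \<times> 'a) \<times> ('a \<times> 'a)).
    cnj (dist_of_fun (wigner_theta \<tau> (snd (fst v))) (tf_shift gauss (snd v)) * f (tf_shift gauss (swap_right (snd v))))
      * g (fst (fst v)) (tf_shift gauss (swap_left (snd v)))"
  have 1: "borel_fun (\<lambda>v :: ('x \<times> ('a \<times> 'a) \<times> ('a \<times> 'a)) \<times> (('a \<times> 'a) \<times> ('a \<times> 'a)).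
      dist_of_fun (wigner_theta \<tau> (snd (fst v))) (tf_shift gauss (snd v)))"
    using borel_compose[OF stft_wigner_theta_measurable[of \<tau>, unfolded split_beta],
      of "\<lambda>v :: ('x \<times> ('a \<times> 'a) \<times> ('a \<times> 'a)) \<times> (('a \<times> 'a) \<times> ('a \<times> 'a)). (snd (fst v), snd v)"]
    by (simp add: continuous_intros)
  have cr: "continuous_on UNIV (\<lambda>v :: ('x \<times> ('a \<times> 'a) \<times> ('a \<times> 'a)) \<times> (('a \<times> 'a) \<times> ('a \<times> 'a)). swap_right (snd v))"
    unfolding swap_right_def by (intro continuous_intros)
  have cl: "continuous_on UNIV (\<lambda>v :: ('x \<times> ('a \<times> 'a) \<times> ('a \<times> 'a)) \<times> (('a \<times> 'a) \<times> ('a \<times> 'a)). (fst (fst v), swap_left (snd v)))"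
    unfolding swap_left_def by (intro continuous_intros)
  have "borel_fun ?h"
    using 1 borel_compose[OF stft_measurable[OF f schwartz_gauss] cr]
      borel_compose[OF gm cl] by (intro borel_measurable_times borel_measurable_cnj) simp_all
  then have "(\<lambda>(x, \<omega>). ?h (x, \<omega>)) \<in> borel_measurable (borel \<Otimes>\<^sub>M lborel)"
    by (simp add: split_beta borel_prod[symmetric] cong: measurable_cong_sets)
  from lborel.borel_measurable_lebesgue_integral[OF this]
  show ?thesis by (simp add: wigner_dist_expansion(1)[OF f g])
qed

lemma wigner_dist_bound:
  fixes f g :: "'a::euclidean_space distribution"
  assumes f: "tempered f" and g: "tempered g" and C0: "0 < C"
    and C: "\<And>(w :: ('a \<times> 'a) \<times> ('a \<times> 'a)) z y. norm (dist_of_fun (wigner_theta \<tau> w) (tf_shift gauss (regroup z y))) \<le> C * decay2 (tau_point \<tau> z y - w)"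
  shows "ennreal (norm (wigner_dist \<tau> g f (tf_shift gauss w)))
    \<le> ennreal C * (\<integral>\<^sup>+v. ennreal (decay2 (tau_point \<tau> (fst v) (snd v) - w)) * (stft_abs gauss f (snd v) * stft_abs gauss g (fst v)) \<partial>lborel)"
proof -
  define h where "h \<omega> = ennreal (norm (dist_of_fun (wigner_theta \<tau> w) (tf_shift gauss \<omega>)))
    * (stft_abs gauss f (swap_right \<omega>) * stft_abs gauss g (swap_left \<omega>))" for \<omega>
  note mf = stft_abs_measurable[OF f schwartz_gauss] and mg = stft_abs_measurable[OF g schwartz_gauss]
  have V: "borel_fun (\<lambda>\<omega>. dist_of_fun (wigner_theta \<tau> w) (tf_shift gauss \<omega>))"
    using borel_slice(1)[OF stft_wigner_theta_measurable[of \<tau>], of w] by simp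
  have h: "borel_fun h" unfolding h_def
    using V borel_compose[OF mf swap_props(2)] borel_compose[OF mg swap_props(1)]
    by measurable
  have "ennreal (norm (wigner_dist \<tau> g f (tf_shift gauss w))) \<le> (\<integral>\<^sup>+\<omega>. h \<omega> \<partial>lborel)"
    unfolding wigner_dist_expansion(1)[OF f g] h_def stft_abs_def
    by (rule order_trans[OF ennreal_norm_integral_le]) (simp add: norm_mult ennreal_mult' mult.assoc)
  also have "\<dots> = (\<integral>\<^sup>+v. h (regroup (fst v) (snd v)) \<partial>lborel)"
    using nn_integral_regroup[OF h] by (simp add: regroup_def)
  also have "\<dots> \<le> (\<integral>\<^sup>+v. ennreal C * (ennreal (decay2 (tau_point \<tau> (fst v) (snd v) - w)) * (stft_abs gauss f (snd v) * stft_abs gauss g (fst v))) \<partial>lborel)"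
  proof (rule nn_integral_mono)
    fix v :: "('a \<times> 'a) \<times> ('a \<times> 'a)"
    have "ennreal (norm (dist_of_fun (wigner_theta \<tau> w) (tf_shift gauss (regroup (fst v) (snd v)))))
        \<le> ennreal C * ennreal (decay2 (tau_point \<tau> (fst v) (snd v) - w))"
      using C[of w "fst v" "snd v"] C0 by (simp add: ennreal_mult'[symmetric] ennreal_leI)
    then show "h (regroup (fst v) (snd v)) \<le> ennreal C * (ennreal (decay2 (tau_point \<tau> (fst v) (snd v) - w)) * (stft_abs gauss f (snd v) * stft_abs gauss g (fst v)))"
      unfolding h_def swap_regroup mult.assoc[symmetric] by (intro mult_right_mono) auto
  qed
  also have "\<dots> = ennreal C * (\<integral>\<^sup>+v. ennreal (decay2 (tau_point \<tau> (fst v) (snd v) - w)) * (stft_abs gauss f (snd v) * stft_abs gauss g (fst v)) \<partial>lborel)"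
  proof (rule nn_integral_cmult)
    have "borel_fun (\<lambda>v. ennreal (decay2 (tau_point \<tau> (fst v) (snd v) - w)) * (stft_abs gauss f (snd v) * stft_abs gauss g (fst v)))"
      unfolding tau_point_def
      by (intro borel_measurable_times_ennreal borel_ennreal borel_compose[OF mf]
        borel_compose[OF mg] continuous_intros)
    then show "(\<lambda>v. ennreal (decay2 (tau_point \<tau> (fst v) (snd v) - w)) * (stft_abs gauss f (snd v) * stft_abs gauss g (fst v))) \<in> borel_measurable lborel"
      by simp
  qed
  finally show ?thesis .
qed

text \<open>Tonelli's theorem: when the integral over \<open>w\<close> is taken first, the weight
  \<open>decay2\<close> smears \<open>A\<close>, and the integral over \<open>y\<close> then builds
  \<open>tau_majorant\<close>.\<close>

lemma wigner_dist_majorant: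
  fixes f g :: "'a::euclidean_space distribution"
  assumes f: "tempered f" and g: "tempered g" and C0: "0 < C" and A: "borel_fun A"
    and C: "\<And>(w :: ('a \<times> 'a) \<times> ('a \<times> 'a)) z y. norm (dist_of_fun (wigner_theta \<tau> w) (tf_shift gauss (regroup z y))) \<le> C * decay2 (tau_point \<tau> z y - w)"
  shows "(\<integral>\<^sup>+w. A w * ennreal (norm (wigner_dist \<tau> g f (tf_shift gauss w))) \<partial>lborel)
    \<le> ennreal C * (\<integral>\<^sup>+z. tau_majorant \<tau> A (stft_abs gauss f) z * stft_abs gauss g z \<partial>lborel)"
proof -
  note mf = stft_abs_measurable[OF f schwartz_gauss] and mg = stft_abs_measurable[OF g schwartz_gauss]
  define e where "e w v = ennreal (decay2 (tau_point \<tau> (fst v) (snd v) - w))" for w :: "('a \<times> 'a) \<times> ('a \<times> 'a)" and v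
  define P where "P v = stft_abs gauss f (snd v) * stft_abs gauss g (fst v)" for v
  have P: "borel_fun P" unfolding P_def
    by (intro borel_measurable_times_ennreal borel_compose[OF mf] borel_compose[OF mg] continuous_intros)
  have e: "borel_fun (\<lambda>x. e (fst x) (snd x))" unfolding e_def tau_point_def
    by (intro borel_ennreal continuous_intros)
  have m: "borel_fun (\<lambda>x. A (fst x) * (e (fst x) (snd x) * P (snd x)))"
    by (intro borel_measurable_times_ennreal e borel_compose[OF A] borel_compose[OF P] continuous_intros)
  have eP: "borel_fun (\<lambda>x. e (fst x) (snd x) * P (snd x))"
    by (intro borel_measurable_times_ennreal e borel_compose[OF P] continuous_intros)
  have eA: "borel_fun (\<lambda>x. e (fst x) (snd x) * A (fst x))"
    by (intro borel_measurable_times_ennreal e borel_compose[OF A] continuous_intros)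
  have "(\<integral>\<^sup>+w. A w * ennreal (norm (wigner_dist \<tau> g f (tf_shift gauss w))) \<partial>lborel)
    \<le> (\<integral>\<^sup>+w. ennreal C * (\<integral>\<^sup>+v. A w * (e w v * P v) \<partial>lborel) \<partial>lborel)"
  proof (rule nn_integral_mono)
    fix w
    have "A w * ennreal (norm (wigner_dist \<tau> g f (tf_shift gauss w))) \<le> A w * (ennreal C * (\<integral>\<^sup>+v. e w v * P v \<partial>lborel))"
      unfolding e_def P_def by (intro mult_left_mono wigner_dist_bound[OF f g C0 C]) simp
    also have "\<dots> = ennreal C * (A w * (\<integral>\<^sup>+v. e w v * P v \<partial>lborel))" by (simp only: mult_ac)
    also have "A w * (\<integral>\<^sup>+v. e w v * P v \<partial>lborel) = (\<integral>\<^sup>+v. A w * (e w v * P v) \<partial>lborel)"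
      by (rule nn_integral_cmult[symmetric]) (use borel_slice(1)[OF eP, of w] in simp)
    finally show "A w * ennreal (norm (wigner_dist \<tau> g f (tf_shift gauss w))) \<le> ennreal C * (\<integral>\<^sup>+v. A w * (e w v * P v) \<partial>lborel)" .
  qed
  also have "\<dots> = ennreal C * (\<integral>\<^sup>+w. \<integral>\<^sup>+v. A w * (e w v * P v) \<partial>lborel \<partial>lborel)"
    by (rule nn_integral_cmult) (use borel_nn_integral[OF m] in simp)
  also have "(\<integral>\<^sup>+w. \<integral>\<^sup>+v. A w * (e w v * P v) \<partial>lborel \<partial>lborel) = (\<integral>\<^sup>+v. \<integral>\<^sup>+w. A w * (e w v * P v) \<partial>lborel \<partial>lborel)"
    using nn_integral_lborel_Fubini[OF m] by simp
  also have "\<dots> = (\<integral>\<^sup>+v. smear A (tau_point \<tau> (fst v) (snd v)) * P v \<partial>lborel)"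
  proof (rule nn_integral_cong)
    fix v
    have "(\<integral>\<^sup>+w. A w * (e w v * P v) \<partial>lborel) = (\<integral>\<^sup>+w. (e w v * A w) * P v \<partial>lborel)" by (simp only: mult_ac)
    also have "\<dots> = smear A (tau_point \<tau> (fst v) (snd v)) * P v"
      unfolding smear_def e_def[symmetric] by (rule nn_integral_multc) (use borel_slice(2)[OF eA, of v] in simp)
    finally show "(\<integral>\<^sup>+w. A w * (e w v * P v) \<partial>lborel) = smear A (tau_point \<tau> (fst v) (snd v)) * P v" .
  qed
  also have "\<dots> = (\<integral>\<^sup>+z. tau_majorant \<tau> A (stft_abs gauss f) z * stft_abs gauss g z \<partial>lborel)"
  proof -
    have SF: "borel_fun (\<lambda>v. smear A (tau_point \<tau> (fst v) (snd v)) * stft_abs gauss f (snd v))" unfolding tau_point_def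
      by (intro borel_measurable_times_ennreal borel_compose[OF smear_measurable[OF A]] borel_compose[OF mf] continuous_intros)
    have mg': "borel_fun (\<lambda>v::('a\<times>'a)\<times>('a\<times>'a). stft_abs gauss g (fst v))"
      by (intro borel_compose[OF mg] continuous_intros)
    have "(\<integral>\<^sup>+v. smear A (tau_point \<tau> (fst v) (snd v)) * P v \<partial>lborel)
      = (\<integral>\<^sup>+z. \<integral>\<^sup>+y. (smear A (tau_point \<tau> z y) * stft_abs gauss f y) * stft_abs gauss g z \<partial>lborel \<partial>lborel)"
      using nn_integral_lborel_Fubini(1)[OF borel_measurable_times_ennreal[OF SF mg']] by (simp add: P_def mult.assoc)
    also have "\<dots> = (\<integral>\<^sup>+z. tau_majorant \<tau> A (stft_abs gauss f) z * stft_abs gauss g z \<partial>lborel)"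
    proof (rule nn_integral_cong)
      fix z
      show "(\<integral>\<^sup>+y. (smear A (tau_point \<tau> z y) * stft_abs gauss f y) * stft_abs gauss g z \<partial>lborel) = tau_majorant \<tau> A (stft_abs gauss f) z * stft_abs gauss g z"
        unfolding tau_majorant_def by (rule nn_integral_multc) (use borel_slice(1)[OF SF, of z] in simp)
    qed
    finally show ?thesis .
  qed
  finally show ?thesis .
qed

subsection \<open>Pseudodifferential operators on modulation spaces\<close>

lemma dist_of_fun_cnj: "dist_of_fun f g = cnj (dist_of_fun g f)"
proof -
  have "cnj (dist_of_fun g f) = (\<integral>t. cnj (g t * cnj (f t)) \<partial>lborel)"
    unfolding dist_of_fun_def by (rule Bochner_Integration.integral_cnj[symmetric])
  then show ?thesis unfolding dist_of_fun_def by (simp add: mult.commute)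
qed

lemma dist_of_fun_add:
  assumes "schwartz \<phi>" "schwartz \<psi>" "schwartz \<eta>"
  shows "dist_of_fun (\<lambda>t. \<phi> t + \<psi> t) \<eta> = dist_of_fun \<phi> \<eta> + dist_of_fun \<psi> \<eta>"
  unfolding dist_of_fun_def distrib_right
  by (rule Bochner_Integration.integral_add[OF schwartz_mult_integrable[OF assms(1,3)] schwartz_mult_integrable[OF assms(2,3)]])

lemma dist_of_fun_scale: "dist_of_fun (\<lambda>t. c * \<phi> t) \<eta> = c * dist_of_fun \<phi> \<eta>"
  unfolding dist_of_fun_def mult.assoc by simp

definition wigner_section ::
    "real \<Rightarrow> 'a::euclidean_space distribution \<Rightarrow> ('a \<times> 'a) \<times> ('a \<times> 'a) \<Rightarrow> 'a \<Rightarrow> complex" where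
  "wigner_section \<tau> f w = (\<lambda>u. f (\<lambda>v. cnj (wigner_kernel \<tau> (tf_shift gauss w) u v)))"

lemma wigner_dist_section: "wigner_dist \<tau> g f (tf_shift gauss w) = g (wigner_section \<tau> f w)"
  by (simp add: wigner_dist_def wigner_section_def)

lemma schwartz_wigner_section: "tempered f \<Longrightarrow> schwartz (wigner_section \<tau> f w)"
  unfolding wigner_section_def by (rule wigner_dist_expansion(3)[OF _ tempered_dist_of_fun[OF schwartz_gauss]])

lemma pairing_eq: "pairing u v = (\<integral>z. u (tf_shift gauss z) * cnj (v (tf_shift gauss z)) \<partial>lborel)"
  and has_pairing_eq: "has_pairing u v \<longleftrightarrow> integrable lborel (\<lambda>z. u (tf_shift gauss z) * cnj (v (tf_shift gauss z)))"
  unfolding pairing_def has_pairing_def stft_eq case_prod_unfold prod.collapse by (rule refl)+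

lemma op_tau_eq:
  "op_tau \<tau> a f \<psi> = (\<integral>w. a (tf_shift gauss w) * cnj (wigner_dist \<tau> (dist_of_fun \<psi>) f (tf_shift gauss w)) \<partial>lborel)"
  by (simp add: op_tau_def pairing_eq)

lemma stft_stft_measurable:
  fixes \<phi> :: "'a::euclidean_space \<Rightarrow> complex"
  assumes "schwartz \<phi>"
  shows "borel_fun (\<lambda>v. dist_of_fun (tf_shift \<phi> (fst v)) (tf_shift gauss (snd v)))"
proof -
  have "continuous_on UNIV (\<lambda>x::(('a \<times> 'a) \<times> ('a \<times> 'a)) \<times> 'a.
      tf_shift \<phi> (fst (fst x)) (snd x) * cnj (tf_shift gauss (snd (fst x)) (snd x)))"
    unfolding tf_shift_def
    by (intro continuous_intros continuous_on_compose2[OF schwartz_continuous[OF assms, of UNIV]]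
      continuous_on_compose2[OF schwartz_continuous[OF schwartz_gauss, of UNIV]]) auto
  then have "borel_fun (\<lambda>x::(('a \<times> 'a) \<times> ('a \<times> 'a)) \<times> 'a.
      tf_shift \<phi> (fst (fst x)) (snd x) * cnj (tf_shift gauss (snd (fst x)) (snd x)))"
    by (rule borel_measurable_continuous_onI)
  then have "(\<lambda>(y :: ('a \<times> 'a) \<times> ('a \<times> 'a), t). tf_shift \<phi> (fst y) t * cnj (tf_shift gauss (snd y) t)) \<in> borel_measurable (borel \<Otimes>\<^sub>M lborel)"
    by (simp add: split_beta borel_prod[symmetric] cong: measurable_cong_sets)
  from lborel.borel_measurable_lebesgue_integral[OF this]
  show ?thesis unfolding dist_of_fun_def by simp
qed

lemma wigner_dist_measurable':
  fixes f g :: "'a::euclidean_space distribution"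
  assumes "tempered f" "tempered g"
  shows "borel_fun (\<lambda>w. wigner_dist \<tau> g f (tf_shift gauss w))"
proof -
  have "borel_fun (\<lambda>v::real \<times> ('a \<times> 'a). g (tf_shift gauss (snd v)))"
    by (rule borel_compose[OF stft_measurable[OF assms(2) schwartz_gauss]]) (intro continuous_intros)
  from wigner_dist_measurable[OF assms(1), of "\<lambda>_. g", OF assms(2) this, of \<tau>]
  have "borel_fun (\<lambda>v::real \<times> _. wigner_dist \<tau> g f (tf_shift gauss (snd v)))" .
  from borel_slice(1)[OF this, of 0] show ?thesis by simp
qed

text \<open>A function \<open>H\<close> of finite mixed norm that dominates the pairing of
  \<open>a\<close> with \<open>wigner_dist \<tau> g f\<close> for all tempered \<open>g\<close>
  carries the rest of the argument: temperedness, the norm bound and duality follow from it without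
  recourse to \<open>p\<close>, \<open>q\<close> or the size of \<tau>.\<close>

locale op_tau_majorant =
  fixes \<tau> :: real and a :: "('a::euclidean_space \<times> 'a) distribution" and f :: "'a distribution"
    and H :: "'a \<times> 'a \<Rightarrow> ennreal" and r1 r2 :: ennreal
  assumes a: "tempered a" and f: "tempered f" and H: "borel_fun H"
    and r: "1 \<le> r1" "1 \<le> r2" and H_finite: "mixed_norm r1 r2 H < \<top>"
    and majorant: "tempered g \<Longrightarrow> (\<integral>\<^sup>+w. stft_abs gauss a w * ennreal (norm (wigner_dist \<tau> g f (tf_shift gauss w))) \<partial>lborel)
      \<le> (\<integral>\<^sup>+z. H z * stft_abs gauss g z \<partial>lborel)"
begin

abbreviation "T \<equiv> op_tau \<tau> a f"

lemma integrand_measurable: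
  "tempered g \<Longrightarrow> borel_fun (\<lambda>w. a (tf_shift gauss w) * cnj (wigner_dist \<tau> g f (tf_shift gauss w)))"
  using stft_measurable[OF a schwartz_gauss] wigner_dist_measurable'[OF f, of g \<tau>]
  by (intro borel_measurable_times borel_measurable_cnj)

lemma integrand_integrable:
  assumes g: "tempered g" and fin: "(\<integral>\<^sup>+z. H z * stft_abs gauss g z \<partial>lborel) < \<top>"
  shows "integrable lborel (\<lambda>w. a (tf_shift gauss w) * cnj (wigner_dist \<tau> g f (tf_shift gauss w)))"
proof -
  have "(\<integral>\<^sup>+w. ennreal (norm (a (tf_shift gauss w) * cnj (wigner_dist \<tau> g f (tf_shift gauss w)))) \<partial>lborel) < \<top>"
    using le_less_trans[OF majorant[OF g] fin] by (simp add: norm_mult ennreal_mult' stft_abs_def)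
  then show ?thesis using integrand_measurable[OF g] by (simp add: integrable_iff_bounded)
qed

lemma norm_op_le:
  assumes "schwartz \<psi>"
  shows "ennreal (norm (T \<psi>)) \<le> (\<integral>\<^sup>+z. H z * stft_abs gauss (dist_of_fun \<psi>) z \<partial>lborel)"
proof -
  have "ennreal (norm (T \<psi>)) \<le> (\<integral>\<^sup>+w. ennreal (norm (a (tf_shift gauss w) * cnj (wigner_dist \<tau> (dist_of_fun \<psi>) f (tf_shift gauss w)))) \<partial>lborel)"
    unfolding op_tau_eq by (rule ennreal_norm_integral_le)
  also have "\<dots> \<le> (\<integral>\<^sup>+z. H z * stft_abs gauss (dist_of_fun \<psi>) z \<partial>lborel)"
    using majorant[OF tempered_dist_of_fun[OF assms]] by (simp add: norm_mult ennreal_mult' stft_abs_def)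
  finally show ?thesis .
qed

text \<open>Hoelder's inequality in mixed norms, with \<open>H\<close> against the weight
  \<open>decay2\<close>, which has finite mixed norm for every pair of exponents; the transform of
  \<open>\<psi>\<close> is bounded by this weight times a sum of Schwartz seminorms.\<close>

lemma majorant_schwartz:
  obtains C N where "0 \<le> C" "\<And>\<psi>. schwartz \<psi> \<Longrightarrow>
    (\<integral>\<^sup>+z. H z * stft_abs gauss (dist_of_fun \<psi>) z \<partial>lborel) \<le> ennreal (C * schwartz_norm N \<psi>)"
proof -
  let ?m = "2 * DIM('a) + 2 * DIM('a)"
  obtain C N where C: "0 \<le> C" "\<And>(\<psi> :: 'a \<Rightarrow> complex) z. schwartz \<psi> \<Longrightarrow>
    (1 + norm z) ^ ?m * norm (dist_of_fun \<psi> (tf_shift gauss z)) \<le> C * schwartz_norm N \<psi>"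
    by (rule stft_schwartz_bound[OF schwartz_gauss, where m = ?m]) blast
  have d: "borel_fun (\<lambda>z :: 'a \<times> 'a. ennreal (decay2 z))"
    by (intro borel_ennreal continuous_intros)
  define D where "D = enn2real (\<integral>\<^sup>+z. H z * ennreal (decay2 z) \<partial>lborel)"
  have "mixed_norm (conj_exp r1) (conj_exp r2) (\<lambda>z :: 'a \<times> 'a. ennreal (decay2 z)) < \<top>"
    unfolding decay2_def by (intro mixed_norm_decay conj_exp_ge_1 r)
  then have "(\<integral>\<^sup>+z. H z * ennreal (decay2 z) \<partial>lborel) < \<top>"
    using H_finite by (intro le_less_trans[OF mixed_norm_holder[OF H d r]]) (simp add: ennreal_mult_less_top)
  then have D: "(\<integral>\<^sup>+z. H z * ennreal (decay2 z) \<partial>lborel) = ennreal D" by (simp add: D_def ennreal_enn2real)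
  show ?thesis
  proof (rule that[of "C * D" N])
    show "0 \<le> C * D" using C(1) by (simp add: D_def)
    fix \<psi> :: "'a \<Rightarrow> complex" assume \<psi>: "schwartz \<psi>"
    let ?c = "C * schwartz_norm N \<psi>"
    have c: "0 \<le> ?c" using C(1) schwartz_norm_nonneg[OF \<psi>] by simp
    have "(\<integral>\<^sup>+z. H z * stft_abs gauss (dist_of_fun \<psi>) z \<partial>lborel) \<le> (\<integral>\<^sup>+z. ennreal ?c * (H z * ennreal (decay2 z)) \<partial>lborel)"
    proof (rule nn_integral_mono)
      fix z :: "'a \<times> 'a"
      have "norm (dist_of_fun \<psi> (tf_shift gauss z)) \<le> ?c * decay2 z" by (intro le_decay2I C(2) \<psi>) simp
      then have "stft_abs gauss (dist_of_fun \<psi>) z \<le> ennreal ?c * ennreal (decay2 z)"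
        unfolding stft_abs_def using c by (simp add: ennreal_mult'[symmetric] ennreal_leI)
      then have "H z * stft_abs gauss (dist_of_fun \<psi>) z \<le> H z * (ennreal ?c * ennreal (decay2 z))"
        by (rule mult_left_mono) simp
      then show "H z * stft_abs gauss (dist_of_fun \<psi>) z \<le> ennreal ?c * (H z * ennreal (decay2 z))"
        by (simp only: mult_ac)
    qed
    also have "\<dots> = ennreal ?c * ennreal D"
      unfolding D[symmetric] using H d by (intro nn_integral_cmult) simp
    also have "\<dots> = ennreal (C * D * schwartz_norm N \<psi>)"
      using ennreal_mult'[OF c, of D] by (simp add: mult_ac)
    finally show "(\<integral>\<^sup>+z. H z * stft_abs gauss (dist_of_fun \<psi>) z \<partial>lborel) \<le> ennreal (C * D * schwartz_norm N \<psi>)" .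
  qed
qed

lemma integrand_integrable_schwartz:
  assumes "schwartz \<psi>"
  shows "integrable lborel (\<lambda>w. a (tf_shift gauss w) * cnj (wigner_dist \<tau> (dist_of_fun \<psi>) f (tf_shift gauss w)))"
proof -
  obtain C N where "\<And>\<psi>. schwartz \<psi> \<Longrightarrow>
    (\<integral>\<^sup>+z. H z * stft_abs gauss (dist_of_fun \<psi>) z \<partial>lborel) \<le> ennreal (C * schwartz_norm N \<psi>)"
    by (rule majorant_schwartz) blast
  from this[OF assms] show ?thesis
    by (intro integrand_integrable[OF tempered_dist_of_fun[OF assms]]) (simp add: le_less_trans)
qed

lemma tempered_op: "tempered T"
  unfolding tempered_def
proof (intro conjI allI impI)
  fix \<phi> \<psi> :: "'a \<Rightarrow> complex" and c
  assume \<phi>: "schwartz \<phi>"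
  show "T (\<lambda>x. c * \<phi> x) = cnj c * T \<phi>"
    by (simp add: op_tau_eq wigner_dist_section dist_of_fun_scale mult.left_commute[of _ "cnj c"])
  assume \<psi>: "schwartz \<psi>"
  show "T (\<lambda>x. \<phi> x + \<psi> x) = T \<phi> + T \<psi>"
    using integrand_integrable_schwartz[OF \<phi>] integrand_integrable_schwartz[OF \<psi>]
    by (simp add: op_tau_eq wigner_dist_section dist_of_fun_add \<phi> \<psi> schwartz_wigner_section f distrib_left)
next
  obtain C N where C: "0 \<le> C" "\<And>\<psi>. schwartz \<psi> \<Longrightarrow>
    (\<integral>\<^sup>+z. H z * stft_abs gauss (dist_of_fun \<psi>) z \<partial>lborel) \<le> ennreal (C * schwartz_norm N \<psi>)"
    by (rule majorant_schwartz) blast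
  have "norm (T \<psi>) \<le> C * schwartz_norm N \<psi>" if \<psi>: "schwartz \<psi>" for \<psi>
    using order_trans[OF norm_op_le[OF \<psi>] C(2)[OF \<psi>]] C(1) schwartz_norm_nonneg[OF \<psi>, of N]
    by (simp add: ennreal_le_iff)
  then show "\<exists>C N. \<forall>\<phi>. schwartz \<phi> \<longrightarrow> norm (T \<phi>) \<le> C * (\<Sum>k\<le>N. \<Sum>bs | set bs \<subseteq> Basis \<and> length bs \<le> N. schwartz_seminorm k bs \<phi>)"
    unfolding schwartz_norm_def by blast
qed

lemma majorant_tf_shift:
  assumes \<gamma>: "schwartz \<gamma>"
  shows "(\<integral>\<^sup>+v. H v * stft_abs gauss (dist_of_fun (tf_shift \<gamma> z)) v \<partial>lborel)
    = (\<integral>\<^sup>+v. stft_abs gauss (dist_of_fun \<gamma>) v * H (z + v) \<partial>lborel)"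
proof -
  note m = stft_abs_measurable[OF tempered_dist_of_fun[OF \<gamma>] schwartz_gauss]
  have "(\<integral>\<^sup>+v. H v * stft_abs gauss (dist_of_fun (tf_shift \<gamma> z)) v \<partial>lborel)
    = (\<integral>\<^sup>+v. stft_abs gauss (dist_of_fun \<gamma>) (v - z) * H v \<partial>lborel)"
    by (simp add: stft_abs_def stft_covariance[OF schwartz_gauss \<gamma>] mult.commute)
  also have "\<dots> = (\<integral>\<^sup>+v. stft_abs gauss (dist_of_fun \<gamma>) v * H (z + v) \<partial>lborel)"
  proof -
    have "borel_fun (\<lambda>v. stft_abs gauss (dist_of_fun \<gamma>) (v - z) * H v)"
      by (intro borel_measurable_times_ennreal borel_compose[OF m] H continuous_intros)
    from nn_integral_translate(1)[OF this, of z] show ?thesis by (simp add: add.commute)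
  qed
  finally show ?thesis .
qed

text \<open>With a shifted window as test function the bound \<open>norm_op_le\<close> becomes a
  convolution of \<open>H\<close> with the transform of the window, which has finite
  integral.\<close>

lemma modulation_norm_op:
  assumes \<gamma>: "schwartz \<gamma>"
  shows "mixed_norm r1 r2 (stft_abs \<gamma> T) \<le> (\<integral>\<^sup>+v. stft_abs gauss (dist_of_fun \<gamma>) v \<partial>lborel) * mixed_norm r1 r2 H"
proof -
  note m = stft_abs_measurable[OF tempered_dist_of_fun[OF \<gamma>] schwartz_gauss]
  have "mixed_norm r1 r2 (stft_abs \<gamma> T) \<le> mixed_norm r1 r2 (\<lambda>z. \<integral>\<^sup>+v. stft_abs gauss (dist_of_fun \<gamma>) v * H (z + v) \<partial>lborel)"
  proof (rule mixed_norm_mono[OF r stft_abs_measurable[OF tempered_op \<gamma>]])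
    fix z
    show "stft_abs \<gamma> T z \<le> (\<integral>\<^sup>+v. stft_abs gauss (dist_of_fun \<gamma>) v * H (z + v) \<partial>lborel)"
      using norm_op_le[OF schwartz_tf_shift[OF \<gamma>, of z]] unfolding majorant_tf_shift[OF \<gamma>] stft_abs_def[of \<gamma> T z] .
  qed
  also have "\<dots> \<le> (\<integral>\<^sup>+v. stft_abs gauss (dist_of_fun \<gamma>) v \<partial>lborel) * mixed_norm r1 r2 H"
    by (rule mixed_norm_convolution[OF H m r])
  finally show ?thesis .
qed

text \<open>Fubini's theorem for \<open>h\<close> on pairs \<open>(z, w)\<close>. Integrating out
  \<open>w\<close> gives the transform of \<open>T\<close> at \<open>z\<close>; integrating out
  \<open>z\<close> gives, by inversion for \<open>g\<close>, the Wigner distribution with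
  \<open>g\<close>. Absolute integrability comes from the majorant for shifted Gaussians and
  Hoelder's inequality.\<close>

lemma pairing_op:
  assumes g: "tempered g" and fin: "mixed_norm (conj_exp r1) (conj_exp r2) (stft_abs gauss g) < \<top>"
  shows "has_pairing T g" "has_pairing a (wigner_dist \<tau> g f)" "pairing T g = pairing a (wigner_dist \<tau> g f)"
proof -
  note mg = stft_abs_measurable[OF g schwartz_gauss]
  have "(\<integral>\<^sup>+z. H z * stft_abs gauss g z \<partial>lborel) < \<top>"
    using H_finite fin by (intro le_less_trans[OF mixed_norm_holder[OF H mg r]]) (simp add: ennreal_mult_less_top)
  then show "has_pairing a (wigner_dist \<tau> g f)"
    unfolding has_pairing_eq by (rule integrand_integrable[OF g])
  define D where "D z w = wigner_dist \<tau> (dist_of_fun (tf_shift gauss z)) f (tf_shift gauss w)" for z :: "'a \<times> 'a" and w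
  define h where "h v = (a (tf_shift gauss (snd v)) * cnj (D (fst v) (snd v))) * cnj (g (tf_shift gauss (fst v)))" for v
  have shift: "tempered (dist_of_fun (tf_shift gauss z))" for z :: "'a \<times> 'a"
    by (intro tempered_dist_of_fun schwartz_tf_shift schwartz_gauss)
  have Dm: "borel_fun (\<lambda>v. D (fst v) (snd v))"
    unfolding D_def by (rule wigner_dist_measurable[OF f shift stft_stft_measurable[OF schwartz_gauss]])
  have hm: "borel_fun h" unfolding h_def
    by (intro borel_measurable_times borel_measurable_cnj Dm borel_compose[OF stft_measurable[OF a schwartz_gauss]]
      borel_compose[OF stft_measurable[OF g schwartz_gauss]] continuous_intros)
  have T_eq: "T (tf_shift gauss z) = (\<integral>w. a (tf_shift gauss w) * cnj (D z w) \<partial>lborel)" for z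
    by (simp add: op_tau_eq D_def)
  let ?E = "\<lambda>z. \<integral>\<^sup>+v. stft_abs gauss (dist_of_fun gauss) v * H (z + v) \<partial>lborel"
  have Em: "borel_fun ?E"
  proof -
    have "borel_fun (\<lambda>x::('a\<times>'a)\<times>('a\<times>'a). stft_abs gauss (dist_of_fun gauss) (snd x) * H (fst x + snd x))"
      by (intro borel_measurable_times_ennreal borel_compose[OF H]
        borel_compose[OF stft_abs_measurable[OF tempered_dist_of_fun[OF schwartz_gauss] schwartz_gauss]] continuous_intros)
    from borel_nn_integral[OF this] show ?thesis by simp
  qed
  have hi: "integrable lborel h"
  proof -
    have hn: "borel_fun (\<lambda>v. ennreal (norm (h v)))" using hm by measurable
    have "(\<integral>\<^sup>+v. ennreal (norm (h v)) \<partial>lborel) = (\<integral>\<^sup>+z. \<integral>\<^sup>+w. ennreal (norm (h (z, w))) \<partial>lborel \<partial>lborel)"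
      by (rule nn_integral_lborel_Fubini(1)[OF hn])
    also have "\<dots> \<le> (\<integral>\<^sup>+z. ?E z * stft_abs gauss g z \<partial>lborel)"
    proof (rule nn_integral_mono)
      fix z
      have m: "(\<lambda>w. stft_abs gauss a w * ennreal (norm (D z w))) \<in> borel_measurable lborel"
        using stft_abs_measurable[OF a schwartz_gauss] borel_slice(1)[OF Dm, of z] by simp
      have "(\<integral>\<^sup>+w. ennreal (norm (h (z, w))) \<partial>lborel) = (\<integral>\<^sup>+w. (stft_abs gauss a w * ennreal (norm (D z w))) * stft_abs gauss g z \<partial>lborel)"
        by (simp add: h_def norm_mult ennreal_mult' stft_abs_def)
      also have "\<dots> = (\<integral>\<^sup>+w. stft_abs gauss a w * ennreal (norm (D z w)) \<partial>lborel) * stft_abs gauss g z"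
        by (rule nn_integral_multc[OF m])
      also have "\<dots> \<le> ?E z * stft_abs gauss g z"
        using majorant[OF shift, of z] unfolding majorant_tf_shift[OF schwartz_gauss] D_def
        by (rule mult_right_mono) simp
      finally show "(\<integral>\<^sup>+w. ennreal (norm (h (z, w))) \<partial>lborel) \<le> ?E z * stft_abs gauss g z" .
    qed
    also have "\<dots> \<le> mixed_norm r1 r2 ?E * mixed_norm (conj_exp r1) (conj_exp r2) (stft_abs gauss g)"
      by (rule mixed_norm_holder[OF Em mg r])
    also have "\<dots> < \<top>"
    proof -
      have "mixed_norm r1 r2 ?E \<le> (\<integral>\<^sup>+v. stft_abs gauss (dist_of_fun (gauss :: 'a \<Rightarrow> complex)) v \<partial>lborel) * mixed_norm r1 r2 H"
        by (rule mixed_norm_convolution[OF H stft_abs_measurable[OF tempered_dist_of_fun[OF schwartz_gauss] schwartz_gauss] r])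
      also have "\<dots> < \<top>" using stft_abs_dist_finite[OF schwartz_gauss schwartz_gauss, where 'a = 'a] H_finite
        by (simp add: ennreal_mult_less_top)
      finally show ?thesis using fin by (simp add: ennreal_mult_less_top)
    qed
    finally show ?thesis using hm by (simp add: integrable_iff_bounded)
  qed
  have inner1: "(\<integral>w. h (z, w) \<partial>lborel) = T (tf_shift gauss z) * cnj (g (tf_shift gauss z))" for z
    by (simp add: h_def T_eq)
  have inner2: "(\<integral>z. h (z, w) \<partial>lborel) = a (tf_shift gauss w) * cnj (wigner_dist \<tau> g f (tf_shift gauss w))" for w
  proof -
    \<comment> \<open>As a function of \<open>z\<close>, \<open>D z w\<close> is the conjugated
      transform of the Schwartz function \<open>?K\<close>, so that \<open>g ?K\<close> is recovered
      by inversion.\<close>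
    let ?K = "wigner_section \<tau> f w"
    have K: "schwartz ?K" by (rule schwartz_wigner_section[OF f])
    have Dz: "cnj (D z w) = dist_of_fun ?K (tf_shift gauss z)" for z
      unfolding D_def wigner_dist_section dist_of_fun_cnj[of ?K] by simp
    have "g ?K = (\<integral>z. g (tf_shift gauss z) * cnj (dist_of_fun ?K (tf_shift gauss z)) \<partial>lborel)"
      using tempered_inversion(1)[OF g schwartz_gauss K] by (simp add: gauss_norm)
    then have "cnj (g ?K) = (\<integral>z. cnj (g (tf_shift gauss z) * cnj (dist_of_fun ?K (tf_shift gauss z))) \<partial>lborel)"
      by (simp only: Bochner_Integration.integral_cnj)
    then show ?thesis
      by (simp add: h_def Dz wigner_dist_section mult.assoc) (simp add: mult.commute)
  qed
  have hi': "integrable (lborel \<Otimes>\<^sub>M lborel) (\<lambda>(z, w). h (z, w))" using hi by (simp add: lborel_prod)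
  show "has_pairing T g"
    unfolding has_pairing_eq using lborel_pair.integrable_fst[OF hi'] by (simp add: inner1)
  show "pairing T g = pairing a (wigner_dist \<tau> g f)"
    unfolding pairing_eq using lborel_Fubini[OF hi] by (simp add: inner1 inner2)
qed

end

text \<open>\<open>f\<close> enters through two conjugations. The section is linear in
  \<open>f\<close>, the distribution of \<open>\<phi>\<close> acts on it antilinearly, and the
  conjugate in the pairing undoes this. Integrability of both integrands lets the integral of the
  sum be split.\<close>

lemma linear_op_tau:
  assumes f: "op_tau_majorant \<tau> a f H r1 r2" and h: "op_tau_majorant \<tau> a h K r1 r2" and \<phi>: "schwartz \<phi>"
  shows "op_tau \<tau> a (\<lambda>\<psi>. f \<psi> + h \<psi>) \<phi> = op_tau \<tau> a f \<phi> + op_tau \<tau> a h \<phi>"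
    and "op_tau \<tau> a (\<lambda>\<psi>. c * f \<psi>) \<phi> = c * op_tau \<tau> a f \<phi>"
proof -
  note f' = op_tau_majorant.f[OF f] and h' = op_tau_majorant.f[OF h]
  have add: "dist_of_fun \<phi> (wigner_section \<tau> (\<lambda>\<psi>. f \<psi> + h \<psi>) w)
      = dist_of_fun \<phi> (wigner_section \<tau> f w) + dist_of_fun \<phi> (wigner_section \<tau> h w)" for w
    using tempered_add[OF tempered_dist_of_fun[OF \<phi>] schwartz_wigner_section[OF f'] schwartz_wigner_section[OF h'], of \<tau> w \<tau> w]
    by (simp add: wigner_section_def)
  show "op_tau \<tau> a (\<lambda>\<psi>. f \<psi> + h \<psi>) \<phi> = op_tau \<tau> a f \<phi> + op_tau \<tau> a h \<phi>"
    using op_tau_majorant.integrand_integrable_schwartz[OF f \<phi>] op_tau_majorant.integrand_integrable_schwartz[OF h \<phi>]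
    by (simp add: op_tau_eq wigner_dist_section add distrib_left)
  have scale: "dist_of_fun \<phi> (wigner_section \<tau> (\<lambda>\<psi>. c * f \<psi>) w) = cnj c * dist_of_fun \<phi> (wigner_section \<tau> f w)" for w
    using tempered_scale[OF tempered_dist_of_fun[OF \<phi>] schwartz_wigner_section[OF f'], of c \<tau> w]
    by (simp add: wigner_section_def)
  show "op_tau \<tau> a (\<lambda>\<psi>. c * f \<psi>) \<phi> = c * op_tau \<tau> a f \<phi>"
    by (simp add: op_tau_eq wigner_dist_section scale mult.left_commute[of _ c])
qed

lemma op_tau_majorant_kernel:
  fixes a :: "('a::euclidean_space \<times> 'a) distribution" and f :: "'a distribution"
  assumes a: "tempered a" and f: "tempered f" and \<tau>: "0 < \<tau>" "\<tau> < 1" and q: "1 \<le> q" "q \<le> conj_exp p"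
    and r1: "1 \<le> r1" "r1 \<le> p" "conj_exp r1 \<le> p" and r2: "1 \<le> r2" "r2 \<le> p" "conj_exp r2 \<le> p"
    and C0: "0 < C"
    and C: "\<And>(w :: ('a \<times> 'a) \<times> ('a \<times> 'a)) z y. norm (dist_of_fun (wigner_theta \<tau> w) (tf_shift gauss (regroup z y)))
      \<le> C * decay2 (tau_point \<tau> z y - w)"
    and M: "M = max 1 (\<integral>\<^sup>+v. ennreal (decay (v::'a\<times>'a)) \<partial>lborel) * (\<integral>\<^sup>+v. ennreal (decay (v::'a\<times>'a)) \<partial>lborel)"
    and fin: "mixed_norm p q (\<lambda>z. stft_abs gauss a (snd z, fst z)) < \<top>" "mixed_norm r1 r2 (stft_abs gauss f) < \<top>"
  defines "H \<equiv> \<lambda>z. ennreal C * tau_majorant \<tau> (stft_abs gauss a) (stft_abs gauss f) z"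
  shows "mixed_norm r1 r2 H \<le> ennreal C * (ennreal (alpha DIM('a) r1 r2 \<tau>) * (M * mixed_norm p q (\<lambda>z. stft_abs gauss a (snd z, fst z))) * mixed_norm r1 r2 (stft_abs gauss f))"
    and "op_tau_majorant \<tau> a f H r1 r2"
proof -
  note ma = stft_abs_measurable[OF a schwartz_gauss] and mf = stft_abs_measurable[OF f schwartz_gauss]
  note mt = tau_majorant_measurable[OF ma mf, of \<tau>]
  have "mixed_norm r1 r2 H \<le> ennreal C * mixed_norm r1 r2 (tau_majorant \<tau> (stft_abs gauss a) (stft_abs gauss f))"
    unfolding H_def by (rule mixed_norm_cmult_le[OF r1(1) r2(1) mt])
  also have "\<dots> \<le> ennreal C * (ennreal (alpha DIM('a) r1 r2 \<tau>) * (M * mixed_norm p q (\<lambda>z. stft_abs gauss a (snd z, fst z))) * mixed_norm r1 r2 (stft_abs gauss f))"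
    unfolding mixed_norm_def[of p q] fst_conv snd_conv
    by (intro mult_left_mono mixed_norm_tau_majorant[OF ma mf \<tau> q r1 r2 M]) simp
  finally show le: "mixed_norm r1 r2 H \<le> ennreal C * (ennreal (alpha DIM('a) r1 r2 \<tau>) * (M * mixed_norm p q (\<lambda>z. stft_abs gauss a (snd z, fst z))) * mixed_norm r1 r2 (stft_abs gauss f))" .
  have "M < \<top>" unfolding M using nn_integral_decay[where 'a = "'a \<times> 'a"]
    by (simp add: ennreal_mult_less_top max_less_iff_conj)
  then have "mixed_norm r1 r2 H < \<top>" using fin by (intro le_less_trans[OF le]) (simp add: ennreal_mult_less_top)
  moreover have "borel_fun H" unfolding H_def using mt by measurable
  moreover have "(\<integral>\<^sup>+w. stft_abs gauss a w * ennreal (norm (wigner_dist \<tau> g f (tf_shift gauss w))) \<partial>lborel)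
      \<le> (\<integral>\<^sup>+z. H z * stft_abs gauss g z \<partial>lborel)" if g: "tempered g" for g
  proof -
    have "(\<integral>\<^sup>+z. H z * stft_abs gauss g z \<partial>lborel)
      = ennreal C * (\<integral>\<^sup>+z. tau_majorant \<tau> (stft_abs gauss a) (stft_abs gauss f) z * stft_abs gauss g z \<partial>lborel)"
      unfolding H_def mult.assoc using mt stft_abs_measurable[OF g schwartz_gauss] by (intro nn_integral_cmult) simp
    then show ?thesis using wigner_dist_majorant[OF f g C0 ma C] by simp
  qed
  ultimately show "op_tau_majorant \<tau> a f H r1 r2"
    using a f r1(1) r2(1) by unfold_locales
qed

theorem theorem1p1:
  fixes p q r1 r2 :: ennreal
    and \<gamma> :: "real ^ 'd \<Rightarrow> complex"
    and \<Gamma> :: "(real ^ 'd) \<times> (real ^ 'd) \<Rightarrow> complex"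
  assumes "1 \<le> p" "1 \<le> q" "1 \<le> r1" "1 \<le> r2"
    and "q \<le> conj_exp p"
    and "Max {r1, r2, conj_exp r1, conj_exp r2} \<le> p"
    and "schwartz \<gamma>" "\<gamma> \<noteq> (\<lambda>_. 0)"
    and "schwartz \<Gamma>" "\<Gamma> \<noteq> (\<lambda>_. 0)"
  shows "\<exists>C::real. C > 0 \<and> (\<forall>\<tau>\<in>{0<..<1}. \<forall>a\<in>amalgam_space \<Gamma> p q.
      \<comment> \<open>\<open>op_tau \<tau> a\<close> extends the operator defined on Schwartz functions\<close>
      (\<forall>f g. schwartz f \<longrightarrow> schwartz g \<longrightarrow> op_tau \<tau> a (dist_of_fun f) g = a (wigner \<tau> g f)) \<and>
      \<comment> \<open>on the modulation space it is given by duality\<close>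
      (\<forall>f\<in>modulation_space \<gamma> r1 r2. \<forall>g\<in>modulation_space \<gamma> (conj_exp r1) (conj_exp r2).
         has_pairing (op_tau \<tau> a f) g \<and> has_pairing a (wigner_dist \<tau> g f) \<and>
         pairing (op_tau \<tau> a f) g = pairing a (wigner_dist \<tau> g f)) \<and>
      \<comment> \<open>it is linear, maps the modulation space into itself, and is bounded\<close>
      (\<forall>f\<in>modulation_space \<gamma> r1 r2. \<forall>h\<in>modulation_space \<gamma> r1 r2. \<forall>\<phi>. schwartz \<phi> \<longrightarrow>
         op_tau \<tau> a (\<lambda>\<psi>. f \<psi> + h \<psi>) \<phi> = op_tau \<tau> a f \<phi> + op_tau \<tau> a h \<phi>) \<and>
      (\<forall>c. \<forall>f\<in>modulation_space \<gamma> r1 r2. \<forall>\<phi>. schwartz \<phi> \<longrightarrow>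
         op_tau \<tau> a (\<lambda>\<psi>. c * f \<psi>) \<phi> = c * op_tau \<tau> a f \<phi>) \<and>
      (\<forall>f\<in>modulation_space \<gamma> r1 r2.
         op_tau \<tau> a f \<in> modulation_space \<gamma> r1 r2 \<and>
         modulation_norm \<gamma> r1 r2 (op_tau \<tau> a f)
           \<le> ennreal (C * alpha CARD('d) r1 r2 \<tau>) * amalgam_norm \<Gamma> p q a * modulation_norm \<gamma> r1 r2 f))"
proof -
  have r1: "1 \<le> r1" "r1 \<le> p" "conj_exp r1 \<le> p" and r2: "1 \<le> r2" "r2 \<le> p" "conj_exp r2 \<le> p"
    using assms by auto
  obtain C0 where C0: "0 < C0" "\<And>\<tau> (w :: ((real ^ 'd) \<times> (real ^ 'd)) \<times> ((real ^ 'd) \<times> (real ^ 'd))) z y. 0 < \<tau> \<Longrightarrow> \<tau> < 1 \<Longrightarrow>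
      norm (dist_of_fun (wigner_theta \<tau> w) (tf_shift gauss (regroup z y))) \<le> C0 * decay2 (tau_point \<tau> z y - w)"
    by (rule stft_wigner_theta_decay) blast
  obtain C1 where C1: "0 < C1" "\<And>u p q. tempered u \<Longrightarrow> 1 \<le> p \<Longrightarrow> 1 \<le> q \<Longrightarrow>
      mixed_norm p q (stft_abs gauss u) \<le> ennreal C1 * mixed_norm p q (stft_abs \<gamma> u)"
    by (rule modulation_norm_change_window[OF assms(7,8) schwartz_gauss]) blast
  obtain C2 where C2: "0 < C2" "\<And>u p q. tempered u \<Longrightarrow> 1 \<le> p \<Longrightarrow> 1 \<le> q \<Longrightarrow>
      mixed_norm p q (\<lambda>z. stft_abs gauss u (snd z, fst z)) \<le> ennreal C2 * mixed_norm p q (\<lambda>z. stft_abs \<Gamma> u (snd z, fst z))"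
    by (rule modulation_norm_change_window[OF assms(9,10) schwartz_gauss]) blast
  define M where "M = max 1 (\<integral>\<^sup>+v. ennreal (decay (v::(real ^ 'd) \<times> (real ^ 'd))) \<partial>lborel) * (\<integral>\<^sup>+v. ennreal (decay (v::(real ^ 'd) \<times> (real ^ 'd))) \<partial>lborel)"
  define S where "S = (\<integral>\<^sup>+v. stft_abs gauss (dist_of_fun \<gamma>) v \<partial>lborel)"
  have S: "S = ennreal (enn2real S)" using stft_abs_dist_finite[OF schwartz_gauss assms(7)]
    by (simp add: S_def ennreal_enn2real)
  have M: "M = ennreal (enn2real M)" using nn_integral_decay[where 'a = "(real ^ 'd) \<times> (real ^ 'd)"]
    by (simp add: M_def ennreal_enn2real ennreal_mult_less_top max_less_iff_conj)
  \<comment> \<open>\<open>C0\<close> and \<open>M\<close> come from the decay of the kernel and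
    from smearing, \<open>C1\<close> and \<open>C2\<close> from passing to Gaussian windows for
    \<open>f\<close> and \<open>a\<close>, and \<open>S\<close> from returning to the window
    \<gamma> for the result. The summand 1 makes \<open>C\<close> positive.\<close>
  define C where "C = enn2real S * (C0 * (enn2real M * (C2 * C1))) + 1"
  have C: "0 < C" unfolding C_def using C0(1) C1(1) C2(1) by (intro add_nonneg_pos mult_nonneg_nonneg) auto
  have amalgam: "amalgam_norm \<Gamma> p q a = mixed_norm p q (\<lambda>z. stft_abs \<Gamma> a (snd z, fst z))" for a
    by (simp add: amalgam_norm_def mixed_norm_def stft_abs_def stft_eq)
  define H where "H \<tau> a f = (\<lambda>z. ennreal C0 * tau_majorant \<tau> (stft_abs gauss a) (stft_abs gauss f) z)"
    for \<tau> and a :: "((real ^ 'd) \<times> (real ^ 'd)) distribution" and f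
  {
    fix \<tau> :: real and a :: "((real ^ 'd) \<times> (real ^ 'd)) distribution"
    assume "\<tau> \<in> {0<..<1}" and a: "a \<in> amalgam_space \<Gamma> p q"
    then have \<tau>: "0 < \<tau>" "\<tau> < 1" by auto
    have ta: "tempered a" and fa: "amalgam_norm \<Gamma> p q a < \<top>" using a by (auto simp: amalgam_space_def)
    have na: "mixed_norm p q (\<lambda>z. stft_abs gauss a (snd z, fst z)) \<le> ennreal C2 * amalgam_norm \<Gamma> p q a"
      unfolding amalgam by (rule C2(2)[OF ta assms(1,2)])
    have na_fin: "mixed_norm p q (\<lambda>z. stft_abs gauss a (snd z, fst z)) < \<top>"
      using fa by (intro le_less_trans[OF na]) (simp add: ennreal_mult_less_top)
    have nf: "tempered f" "mixed_norm s t (stft_abs gauss f) \<le> ennreal C1 * modulation_norm \<gamma> s t f" "mixed_norm s t (stft_abs gauss f) < \<top>"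
      if f: "f \<in> modulation_space \<gamma> s t" and st: "1 \<le> s" "1 \<le> t" for f s t
    proof -
      show tf: "tempered f" using f by (simp add: modulation_space_def)
      show le: "mixed_norm s t (stft_abs gauss f) \<le> ennreal C1 * modulation_norm \<gamma> s t f"
        unfolding modulation_norm_eq by (rule C1(2)[OF tf st])
      show "mixed_norm s t (stft_abs gauss f) < \<top>"
        using f by (intro le_less_trans[OF le]) (simp add: modulation_space_def ennreal_mult_less_top)
    qed
    have maj: "op_tau_majorant \<tau> a f (H \<tau> a f) r1 r2"
      and bound: "modulation_norm \<gamma> r1 r2 (op_tau \<tau> a f)
        \<le> ennreal (C * alpha CARD('d) r1 r2 \<tau>) * amalgam_norm \<Gamma> p q a * modulation_norm \<gamma> r1 r2 f"
      if f: "f \<in> modulation_space \<gamma> r1 r2" for f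
    proof -
      note nf' = nf[OF f r1(1) r2(1)]
      note kernel = op_tau_majorant_kernel[OF ta nf'(1) \<tau> assms(2,5) r1 r2 C0(1) C0(2)[OF \<tau>] M_def na_fin nf'(3), folded H_def]
      show maj: "op_tau_majorant \<tau> a f (H \<tau> a f) r1 r2" by (rule kernel(2))
      let ?\<alpha> = "alpha CARD('d) r1 r2 \<tau>"
      have \<alpha>: "0 \<le> ?\<alpha>" by (simp add: alpha_def)
      have "modulation_norm \<gamma> r1 r2 (op_tau \<tau> a f) \<le> S * mixed_norm r1 r2 (H \<tau> a f)"
        unfolding modulation_norm_eq S_def by (rule op_tau_majorant.modulation_norm_op[OF maj assms(7)])
      also have "\<dots> \<le> S * (ennreal C0 * (ennreal ?\<alpha> * (M * (ennreal C2 * amalgam_norm \<Gamma> p q a)) * (ennreal C1 * modulation_norm \<gamma> r1 r2 f)))"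
      proof (rule mult_left_mono)
        have "mixed_norm r1 r2 (H \<tau> a f) \<le> ennreal C0 * (ennreal ?\<alpha> * (M * mixed_norm p q (\<lambda>z. stft_abs gauss a (snd z, fst z))) * mixed_norm r1 r2 (stft_abs gauss f))"
          using kernel(1) by simp
        also have "\<dots> \<le> ennreal C0 * (ennreal ?\<alpha> * (M * (ennreal C2 * amalgam_norm \<Gamma> p q a)) * (ennreal C1 * modulation_norm \<gamma> r1 r2 f))"
          by (intro mult_mono na nf'(2) order_refl) auto
        finally show "mixed_norm r1 r2 (H \<tau> a f) \<le> \<dots>" .
      qed simp
      also have "\<dots> = (S * (ennreal C0 * (M * (ennreal C2 * ennreal C1)))) * ennreal ?\<alpha> * amalgam_norm \<Gamma> p q a * modulation_norm \<gamma> r1 r2 f"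
        by (simp only: mult_ac)
      also have "S * (ennreal C0 * (M * (ennreal C2 * ennreal C1))) = ennreal (enn2real S * (C0 * (enn2real M * (C2 * C1))))"
        using C0(1) C1(1) C2(1) by (subst S, subst M) (simp add: ennreal_mult'[symmetric])
      also have "\<dots> * ennreal ?\<alpha> * amalgam_norm \<Gamma> p q a * modulation_norm \<gamma> r1 r2 f
          \<le> ennreal C * ennreal ?\<alpha> * amalgam_norm \<Gamma> p q a * modulation_norm \<gamma> r1 r2 f"
        by (intro mult_right_mono ennreal_leI) (auto simp: C_def)
      also have "ennreal C * ennreal ?\<alpha> = ennreal (C * ?\<alpha>)" using C by (simp add: ennreal_mult')
      finally show "modulation_norm \<gamma> r1 r2 (op_tau \<tau> a f)
        \<le> ennreal (C * ?\<alpha>) * amalgam_norm \<Gamma> p q a * modulation_norm \<gamma> r1 r2 f" .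
    qed
    have "op_tau \<tau> a f \<in> modulation_space \<gamma> r1 r2" if f: "f \<in> modulation_space \<gamma> r1 r2" for f
    proof -
      have "modulation_norm \<gamma> r1 r2 (op_tau \<tau> a f) < \<top>"
        using fa f by (intro le_less_trans[OF bound[OF f]]) (simp add: modulation_space_def ennreal_mult_less_top)
      then show ?thesis using op_tau_majorant.tempered_op[OF maj[OF f]] by (simp add: modulation_space_def)
    qed
    note in_space = this
    have pair: "has_pairing (op_tau \<tau> a f) g \<and> has_pairing a (wigner_dist \<tau> g f) \<and> pairing (op_tau \<tau> a f) g = pairing a (wigner_dist \<tau> g f)"
      if f: "f \<in> modulation_space \<gamma> r1 r2" and g: "g \<in> modulation_space \<gamma> (conj_exp r1) (conj_exp r2)" for f g
      using nf[OF g conj_exp_ge_1[OF r1(1)] conj_exp_ge_1[OF r2(1)]] op_tau_majorant.pairing_op[OF maj[OF f], of g] by blast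
    note op_tau_schwartz[OF ta] pair linear_op_tau[OF maj maj] in_space bound
  }
  note main = this
  show ?thesis
    by (intro exI[of _ C] conjI C ballI allI impI main; assumption?)
qed

end
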